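(* Let $\Lambda$ be a pro-species of algebras on a finite acyclic quiver $Q$. Suppose that for each $\mathtt{i}\in Q_0$ the algebra $\Lambda_{\mathtt{i}}\cong\mathbb{k}\tilde Q_{\mathtt{i}}/R_{\mathtt{i}}$ is given by a quiver $\tilde Q_{\mathtt{i}}$ with relations, $R_{\mathtt{i}}$ being an admissible ideal. (a) For each $\alpha\in Q_1$ let $\pi_\alpha\colon\tilde P_\alpha\to\Lambda_\alpha$ be a projective cover of $\Lambda_\alpha$ as a $\Lambda_{t(\alpha)}$-$\Lambda_{s(\alpha)}$-bimodule, and let $R_\alpha=\ker\pi_\alpha$. Let $\tilde Q$ be the quiver obtained from the disjoint union of the quivers $\tilde Q_{\mathtt{i}}$, $\mathtt{i}\in Q_0$, by adding, for each $\alpha\in Q_1$, one arrow $i\to j$ for each direct summand $\Lambda_{t(\alpha)}e_j\otimes_{\mathbb{k}}e_i\Lambda_{s(\alpha)}$ in a decomposition of $\tilde P_\alpha$ into indecomposables, where $i$ is a vertex of $\tilde Q_{s(\alpha)}$ and $j$ a vertex of $\tilde Q_{t(\alpha)}$. Let $R=\langle R_{\mathtt{i}},R_\alpha\mid\mathtt{i}\in Q_0,\alpha\in Q_1\rangle$. Then $T(\Lambda)\cong\mathbb{k}\tilde Q/R$, and this is a description of $T(\Lambda)$ by a quiver with relations (i.e. $R$ is an admissible ideal of $\mathbb{k}\tilde Q$). (b) Suppose in addition that $\Lambda$ is dualisable, and let $\overline Q$, $\overline\Lambda$ and $c$ be as in the definition of the preprojective algebra $\Pi(\Lambda)$. For each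 $\alpha\in\overline Q_1$ let $\pi_\alpha\colon\tilde P_\alpha\to\overline\Lambda_\alpha$ be a projective cover of $\overline\Lambda_\alpha$ as a $\Lambda_{t(\alpha)}$-$\Lambda_{s(\alpha)}$-bimodule, and let $R_\alpha=\ker\pi_\alpha$. Let $\tilde Q$ be the quiver obtained from the disjoint union of the quivers $\tilde Q_{\mathtt{i}}$, $\mathtt{i}\in Q_0$, by adding, for each $\alpha\in\overline Q_1$, one arrow $i\to j$ for each direct summand $\Lambda_{t(\alpha)}e_j\otimes_{\mathbb{k}}e_i\Lambda_{s(\alpha)}$ in a decomposition of $\tilde P_\alpha$ into indecomposables. Let $R=\langle R_{\mathtt{i}},R_\alpha,c\mid\mathtt{i}\in Q_0,\alpha\in\overline Q_1\rangle$. Then $\Pi(\Lambda)\cong\mathbb{k}\tilde Q/R$.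
   Context: $\mathbb{k}$ is a field; modules are left modules; $Q=(Q_0,Q_1,s,t)$ is a finite acyclic quiver. Paths (in $Q$ and in all quivers occurring) are composed right to left; $e_i$ is the trivial path at a vertex $i$. A pro-species of algebras $\Lambda$ on $Q$ consists of a finite dimensional $\mathbb{k}$-algebra $\Lambda_{\mathtt{i}}$ for each $\mathtt{i}\in Q_0$ and, for each arrow $\alpha$, a $\Lambda_{t(\alpha)}$-$\Lambda_{s(\alpha)}$-bimodule $\Lambda_\alpha$ ($\mathbb{k}$ acting centrally), finitely generated projective as a left and as a right module. For a path $p=\alpha_n\cdots\alpha_1$ of length $\ge1$ put $\Lambda_p:=\Lambda_{\alpha_n}\otimes_{\Lambda_{s(\alpha_n)}}\cdots\otimes_{\Lambda_{s(\alpha_2)}}\Lambda_{\alpha_1}$. The tensor algebra is $T(\Lambda)=\prod_{\mathtt{i}}\Lambda_{\mathtt{i}}\oplus\bigoplus_p\Lambda_p$ ($p$ over paths of length $\geq1$), with multiplication given by the products of the $\Lambda_{\mathtt{i}}$, the bimodule actions, and $\lambda_p\cdot\lambda_q=\lambda_p\otimes\lambda_q\in\Lambda_{pq}$ if $t(q)=s(p)$ and $0$ otherwise (the same definition is used for non-acyclic finite quivers). Interpretation of $R_\alpha$ and $c$ as relations: in $\mathbb{k}\tilde Q/\langle R_{\mathtt{i}}\mid \mathtt{i}\in Q_0\rangle$ an element $ae_j\otimes e_ib$ of a summand $\Lambda_{t(\alpha)}e_j\otimes_{\mathbb{k}}e_i\Lambda_{s(\alpha)}$ of $\tilde P_\alpha$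 is identified with the product $a\cdot\gamma\cdot b$, where $\gamma\colon i\to j$ is the new arrow attached to that summand. The ideal generated by $R_{\mathtt{i}}$, $R_\alpha$ (and $c$) means the ideal generated by the $R_{\mathtt{i}}$ and arbitrary lifts to $\mathbb{k}\tilde Q$ of the elements of $R_\alpha$ (and of $c\in T(\overline\Lambda)$). Dualisable: $\operatorname{Hom}_{\Lambda_{\mathtt{i}}^{op}}(\Lambda_\alpha,\Lambda_{\mathtt{i}})\cong\operatorname{Hom}_{\Lambda_{\mathtt{j}}}(\Lambda_\alpha,\Lambda_{\mathtt{j}})$ as $\Lambda_{\mathtt{i}}$-$\Lambda_{\mathtt{j}}$-bimodules for each arrow $\alpha\colon\mathtt{i}\to\mathtt{j}$ in $Q_1$; fix such an isomorphism $\varphi_\alpha$ (from left to right) for each $\alpha$. Preprojective algebra: the double quiver $\overline Q$ has $\overline Q_0=Q_0$ and $\overline Q_1=Q_1\cup\{\alpha^*\colon\mathtt{j}\to\mathtt{i}\mid(\alpha\colon\mathtt{i}\to\mathtt{j})\in Q_1\}$. The pro-species $\overline\Lambda$ on $\overline Q$ has $\overline\Lambda_{\mathtt{i}}=\Lambda_{\mathtt{i}}$, $\overline\Lambda_\alpha=\Lambda_\alpha$ and $\overline\Lambda_{\alpha^*}=\operatorname{Hom}_{\Lambda_{s(\alpha)}^{op}}(\Lambda_\alpha,\Lambda_{s(\alpha)})$ for $\alpha\in Q_1$. For $\alpha\in Q_1$ the Casimir elements are $c_\alpha=\sum_kx_k\otimes f_k\in\Lambda_\alpha\otimes_{\Lambda_{s(\alpha)}}\overline\Lambda_{\alpha^*}$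 with $x=\sum_kx_kf_k(x)$ for all $x\in\Lambda_\alpha$, and $c_{\alpha^*}=\sum_kg_k\otimes y_k\in\overline\Lambda_{\alpha^*}\otimes_{\Lambda_{t(\alpha)}}\Lambda_\alpha$ with $f=\sum_kg_k\cdot\varphi_\alpha(f)(y_k)$ for all $f\in\overline\Lambda_{\alpha^*}$. Put $\operatorname{sgn}(\alpha)=1$ if $\alpha\in Q_1$ and $-1$ otherwise, $c=\sum_{\alpha\in\overline Q_1}\operatorname{sgn}(\alpha)c_\alpha$, and $\Pi(\Lambda)=T(\overline\Lambda)/\langle c\rangle$. *)

theory Defs
  imports "HOL-Algebra.Module" "HOL-Algebra.QuotRing" "HOL-Algebra.Ideal_Product"
    "Graph_Theory.Arc_Walk"
begin

section \<open>Free modules, quotients and associative algebras\<close>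

text \<open>
  Algebras and modules over the ground field \<open>K\<close> are both rendered as records of type
  \<open>module\<close>; for a module the fields \<open>mult\<close> and \<open>one\<close> carry no information.
\<close>

locale assoc_algebra = base: field K + alg: ring A + vec: Module.module K A
  for K :: "'k ring" and A :: "('k, 'a) module" +
  assumes smult_mult_left:
      "\<lbrakk>c \<in> carrier K; x \<in> carrier A; y \<in> carrier A\<rbrakk> \<Longrightarrow>
        (c \<odot>\<^bsub>A\<^esub> x) \<otimes>\<^bsub>A\<^esub> y = c \<odot>\<^bsub>A\<^esub> (x \<otimes>\<^bsub>A\<^esub> y)"
    and smult_mult_right:
      "\<lbrakk>c \<in> carrier K; x \<in> carrier A; y \<in> carrier A\<rbrakk> \<Longrightarrow>
        x \<otimes>\<^bsub>A\<^esub> (c \<odot>\<^bsub>A\<^esub> y) = c \<odot>\<^bsub>A\<^esub> (x \<otimes>\<^bsub>A\<^esub> y)"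

definition alg_iso :: "'k ring \<Rightarrow> ('k, 'a) module \<Rightarrow> ('k, 'b) module \<Rightarrow> ('a \<Rightarrow> 'b) set" where
  "alg_iso K A B = {h \<in> ring_iso A B.
     \<forall>c\<in>carrier K. \<forall>x\<in>carrier A. h (c \<odot>\<^bsub>A\<^esub> x) = c \<odot>\<^bsub>B\<^esub> h x}"

definition alg_isomorphic :: "'k ring \<Rightarrow> ('k, 'a) module \<Rightarrow> ('k, 'b) module \<Rightarrow> bool" where
  "alg_isomorphic K A B \<longleftrightarrow> alg_iso K A B \<noteq> {}"

definition module_span ::
  "'k ring \<Rightarrow> ('k, 'm, 'z) module_scheme \<Rightarrow> 'm set \<Rightarrow> 'm set" where
  "module_span K M S = \<Inter>{H. submodule H K M \<and> S \<subseteq> H}"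

definition finite_dim :: "'k ring \<Rightarrow> ('k, 'm, 'z) module_scheme \<Rightarrow> bool" where
  "finite_dim K M \<longleftrightarrow>
     (\<exists>S. finite S \<and> S \<subseteq> carrier M \<and> module_span K M S = carrier M)"

definition quot :: "('k, 'm, 'z) module_scheme \<Rightarrow> 'm set \<Rightarrow> ('k, 'm set) module" where
  "quot M N = ring.extend (M Quot N)
     (module.fields (\<lambda>c X. \<Union>x\<in>X. N +>\<^bsub>M\<^esub> (c \<odot>\<^bsub>M\<^esub> x)))"

definition single :: "'k ring \<Rightarrow> 's \<Rightarrow> 's \<Rightarrow> 'k" where
  "single K x = (\<lambda>y. if y = x then \<one>\<^bsub>K\<^esub> else \<zero>\<^bsub>K\<^esub>)"

definition free_module :: "'k ring \<Rightarrow> 's set \<Rightarrow> ('k, 's \<Rightarrow> 'k) module" where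
  "free_module K S =
     \<lparr>carrier = {f. (\<forall>x. f x \<in> carrier K) \<and> finite {x. f x \<noteq> \<zero>\<^bsub>K\<^esub>} \<and> {x. f x \<noteq> \<zero>\<^bsub>K\<^esub>} \<subseteq> S},
      mult = undefined, one = undefined,
      zero = (\<lambda>x. \<zero>\<^bsub>K\<^esub>), add = (\<lambda>f g x. f x \<oplus>\<^bsub>K\<^esub> g x),
      smult = (\<lambda>c f x. c \<otimes>\<^bsub>K\<^esub> f x)\<rparr>"

text \<open>The linear extensions of a map and of a partial binary operation on basis elements.\<close>

definition push :: "'k ring \<Rightarrow> ('s \<Rightarrow> 't) \<Rightarrow> ('s \<Rightarrow> 'k) \<Rightarrow> 't \<Rightarrow> 'k" where
  "push K h f = (\<lambda>y. \<Oplus>\<^bsub>K\<^esub>x\<in>{x. f x \<noteq> \<zero>\<^bsub>K\<^esub> \<and> h x = y}. f x)"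

definition convolve ::
  "'k ring \<Rightarrow> ('s \<Rightarrow> 's \<Rightarrow> 's option) \<Rightarrow> ('s \<Rightarrow> 'k) \<Rightarrow> ('s \<Rightarrow> 'k) \<Rightarrow> 's \<Rightarrow> 'k" where
  "convolve K m f g = (\<lambda>z. \<Oplus>\<^bsub>K\<^esub>w\<in>{(x, y). f x \<noteq> \<zero>\<^bsub>K\<^esub> \<and> g y \<noteq> \<zero>\<^bsub>K\<^esub> \<and> m x y = Some z}.
     f (fst w) \<otimes>\<^bsub>K\<^esub> g (snd w))"


section \<open>Quivers, path algebras, admissible ideals\<close>

definition acyclic_quiver :: "('v, 'e) pre_digraph \<Rightarrow> bool" where
  "acyclic_quiver Q \<longleftrightarrow> (\<nexists>p. pre_digraph.cycle Q p)"

text \<open>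
  A path is a triple \<open>(target, arrows, source)\<close> whose arrows are listed as in the product
  \<open>\<alpha>\<^sub>n \<cdots> \<alpha>\<^sub>1\<close>, i.e. in the opposite order of the library's arc walks.
\<close>

type_synonym ('v, 'e) qpath = "'v \<times> 'e list \<times> 'v"

definition qpaths :: "('v, 'e) pre_digraph \<Rightarrow> ('v, 'e) qpath set" where
  "qpaths Q = {(j, p, i). pre_digraph.awalk Q i (rev p) j}"

fun qpath_comp :: "('v, 'e) qpath \<Rightarrow> ('v, 'e) qpath \<Rightarrow> ('v, 'e) qpath option" where
  "qpath_comp (k, p, j) (j', q, i) = (if j = j' then Some (k, p @ q, i) else None)"

definition path_algebra ::
  "'k ring \<Rightarrow> ('v, 'e) pre_digraph \<Rightarrow> ('k, ('v, 'e) qpath \<Rightarrow> 'k) module" where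
  "path_algebra K Q = (free_module K (qpaths Q))
     \<lparr>mult := convolve K qpath_comp,
      one := (\<lambda>x. if x \<in> {(v, [], v) |v. v \<in> verts Q} then \<one>\<^bsub>K\<^esub> else \<zero>\<^bsub>K\<^esub>)\<rparr>"

definition path_vertex :: "'k ring \<Rightarrow> 'v \<Rightarrow> ('v, 'e) qpath \<Rightarrow> 'k" where
  "path_vertex K v = single K (v, [], v)"

definition path_arrow ::
  "'k ring \<Rightarrow> ('v, 'e) pre_digraph \<Rightarrow> 'e \<Rightarrow> ('v, 'e) qpath \<Rightarrow> 'k" where
  "path_arrow K Q \<alpha> = single K (head Q \<alpha>, [\<alpha>], tail Q \<alpha>)"

definition arrow_ideal :: "'k ring \<Rightarrow> ('v, 'e) pre_digraph \<Rightarrow> (('v, 'e) qpath \<Rightarrow> 'k) set" where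
  "arrow_ideal K Q = Idl\<^bsub>path_algebra K Q\<^esub> (path_arrow K Q ` arcs Q)"

definition ideal_power :: "('a, 'z) ring_scheme \<Rightarrow> 'a set \<Rightarrow> nat \<Rightarrow> 'a set" where
  "ideal_power R J m = (ideal_prod R J ^^ m) (carrier R)"

definition admissible ::
  "'k ring \<Rightarrow> ('v, 'e) pre_digraph \<Rightarrow> (('v, 'e) qpath \<Rightarrow> 'k) set \<Rightarrow> bool" where
  "admissible K Q I \<longleftrightarrow> fin_digraph Q \<and> ideal I (path_algebra K Q) \<and>
     I \<subseteq> ideal_power (path_algebra K Q) (arrow_ideal K Q) 2 \<and>
     (\<exists>m\<ge>2. ideal_power (path_algebra K Q) (arrow_ideal K Q) m \<subseteq> I)"

text \<open>
  The linear map on a path algebra, with values in an algebra \<open>B\<close>, that sends the trivial path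
  at \<open>v\<close> to \<open>\<epsilon> v\<close>, an arrow \<open>\<alpha>\<close> to \<open>\<eta> \<alpha>\<close> and a path to the product of these images.
\<close>

definition path_extension ::
  "'k ring \<Rightarrow> ('k, 'b) module \<Rightarrow> ('v \<Rightarrow> 'b) \<Rightarrow> ('e \<Rightarrow> 'b) \<Rightarrow> (('v, 'e) qpath \<Rightarrow> 'k) \<Rightarrow> 'b" where
  "path_extension K B \<epsilon> \<eta> f = (\<Oplus>\<^bsub>B\<^esub>x\<in>{x. f x \<noteq> \<zero>\<^bsub>K\<^esub>}. f x \<odot>\<^bsub>B\<^esub>
     foldr (\<lambda>\<alpha> b. \<eta> \<alpha> \<otimes>\<^bsub>B\<^esub> b) (fst (snd x)) (\<epsilon> (snd (snd x))))"


section \<open>Bimodules\<close>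

record ('a, 'k, 'm) bimodule = "('k, 'm) module" +
  lact :: "'a \<Rightarrow> 'm \<Rightarrow> 'm"
  ract :: "'m \<Rightarrow> 'a \<Rightarrow> 'm"

text \<open>\<open>M\<close> is a \<open>B\<close>-\<open>A\<close>-bimodule on which \<open>K\<close> acts centrally.\<close>

locale bimodule =
  left: assoc_algebra K B + right: assoc_algebra K A + vec: Module.module K M
  for K :: "'k ring" and B A :: "('k, 'a) module" and M :: "('a, 'k, 'm) bimodule" +
  assumes lact_closed: "\<lbrakk>b \<in> carrier B; x \<in> carrier M\<rbrakk> \<Longrightarrow> lact M b x \<in> carrier M"
    and ract_closed: "\<lbrakk>a \<in> carrier A; x \<in> carrier M\<rbrakk> \<Longrightarrow> ract M x a \<in> carrier M"
    and lact_add_left: "\<lbrakk>b \<in> carrier B; b' \<in> carrier B; x \<in> carrier M\<rbrakk> \<Longrightarrow>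
      lact M (b \<oplus>\<^bsub>B\<^esub> b') x = lact M b x \<oplus>\<^bsub>M\<^esub> lact M b' x"
    and lact_add_right: "\<lbrakk>b \<in> carrier B; x \<in> carrier M; y \<in> carrier M\<rbrakk> \<Longrightarrow>
      lact M b (x \<oplus>\<^bsub>M\<^esub> y) = lact M b x \<oplus>\<^bsub>M\<^esub> lact M b y"
    and ract_add_left: "\<lbrakk>a \<in> carrier A; x \<in> carrier M; y \<in> carrier M\<rbrakk> \<Longrightarrow>
      ract M (x \<oplus>\<^bsub>M\<^esub> y) a = ract M x a \<oplus>\<^bsub>M\<^esub> ract M y a"
    and ract_add_right: "\<lbrakk>a \<in> carrier A; a' \<in> carrier A; x \<in> carrier M\<rbrakk> \<Longrightarrow>
      ract M x (a \<oplus>\<^bsub>A\<^esub> a') = ract M x a \<oplus>\<^bsub>M\<^esub> ract M x a'"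
    and lact_mult: "\<lbrakk>b \<in> carrier B; b' \<in> carrier B; x \<in> carrier M\<rbrakk> \<Longrightarrow>
      lact M (b \<otimes>\<^bsub>B\<^esub> b') x = lact M b (lact M b' x)"
    and ract_mult: "\<lbrakk>a \<in> carrier A; a' \<in> carrier A; x \<in> carrier M\<rbrakk> \<Longrightarrow>
      ract M x (a \<otimes>\<^bsub>A\<^esub> a') = ract M (ract M x a) a'"
    and lact_one: "x \<in> carrier M \<Longrightarrow> lact M \<one>\<^bsub>B\<^esub> x = x"
    and ract_one: "x \<in> carrier M \<Longrightarrow> ract M x \<one>\<^bsub>A\<^esub> = x"
    and lact_ract: "\<lbrakk>b \<in> carrier B; a \<in> carrier A; x \<in> carrier M\<rbrakk> \<Longrightarrow>
      ract M (lact M b x) a = lact M b (ract M x a)"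
    and lact_smult: "\<lbrakk>c \<in> carrier K; b \<in> carrier B; x \<in> carrier M\<rbrakk> \<Longrightarrow>
      lact M (c \<odot>\<^bsub>B\<^esub> b) x = c \<odot>\<^bsub>M\<^esub> lact M b x"
    and ract_smult: "\<lbrakk>c \<in> carrier K; a \<in> carrier A; x \<in> carrier M\<rbrakk> \<Longrightarrow>
      ract M x (c \<odot>\<^bsub>A\<^esub> a) = c \<odot>\<^bsub>M\<^esub> ract M x a"

definition left_hom ::
  "('k, 'a) module \<Rightarrow> ('a, 'k, 'm) bimodule \<Rightarrow> ('a, 'k, 'n) bimodule \<Rightarrow> ('m \<Rightarrow> 'n) set" where
  "left_hom B M N = {h \<in> carrier M \<rightarrow> carrier N.
     (\<forall>x\<in>carrier M. \<forall>y\<in>carrier M. h (x \<oplus>\<^bsub>M\<^esub> y) = h x \<oplus>\<^bsub>N\<^esub> h y) \<and>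
     (\<forall>b\<in>carrier B. \<forall>x\<in>carrier M. h (lact M b x) = lact N b (h x))}"

definition right_hom ::
  "('k, 'a) module \<Rightarrow> ('a, 'k, 'm) bimodule \<Rightarrow> ('a, 'k, 'n) bimodule \<Rightarrow> ('m \<Rightarrow> 'n) set" where
  "right_hom A M N = {h \<in> carrier M \<rightarrow> carrier N.
     (\<forall>x\<in>carrier M. \<forall>y\<in>carrier M. h (x \<oplus>\<^bsub>M\<^esub> y) = h x \<oplus>\<^bsub>N\<^esub> h y) \<and>
     (\<forall>a\<in>carrier A. \<forall>x\<in>carrier M. h (ract M x a) = ract N (h x) a)}"

definition bimod_hom ::
  "('k, 'a) module \<Rightarrow> ('k, 'a) module \<Rightarrow> ('a, 'k, 'm) bimodule \<Rightarrow> ('a, 'k, 'n) bimodule \<Rightarrow>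
    ('m \<Rightarrow> 'n) set" where
  "bimod_hom B A M N = left_hom B M N \<inter> right_hom A M N"

definition bimod_iso ::
  "('k, 'a) module \<Rightarrow> ('k, 'a) module \<Rightarrow> ('a, 'k, 'm) bimodule \<Rightarrow> ('a, 'k, 'n) bimodule \<Rightarrow>
    ('m \<Rightarrow> 'n) set" where
  "bimod_iso B A M N = {h \<in> bimod_hom B A M N. bij_betw h (carrier M) (carrier N)}"

definition subbimodule ::
  "'k ring \<Rightarrow> ('k, 'a) module \<Rightarrow> ('k, 'a) module \<Rightarrow> ('a, 'k, 'm) bimodule \<Rightarrow> 'm set \<Rightarrow> bool" where
  "subbimodule K B A M U \<longleftrightarrow> submodule U K M \<and>
     (\<forall>b\<in>carrier B. \<forall>x\<in>U. lact M b x \<in> U) \<and> (\<forall>a\<in>carrier A. \<forall>x\<in>U. ract M x a \<in> U)"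

definition indecomposable_subbimodule ::
  "'k ring \<Rightarrow> ('k, 'a) module \<Rightarrow> ('k, 'a) module \<Rightarrow> ('a, 'k, 'm) bimodule \<Rightarrow> 'm set \<Rightarrow> bool" where
  "indecomposable_subbimodule K B A M X \<longleftrightarrow>
     subbimodule K B A M X \<and> X \<noteq> {\<zero>\<^bsub>M\<^esub>} \<and>
     (\<forall>U V. subbimodule K B A M U \<and> subbimodule K B A M V \<and>
        U \<inter> V = {\<zero>\<^bsub>M\<^esub>} \<and> U <+>\<^bsub>M\<^esub> V = X \<longrightarrow> U = {\<zero>\<^bsub>M\<^esub>} \<or> V = {\<zero>\<^bsub>M\<^esub>})"

definition internal_direct_sum :: "('a, 'k, 'm) bimodule \<Rightarrow> 'g set \<Rightarrow> ('g \<Rightarrow> 'm set) \<Rightarrow> bool" where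
  "internal_direct_sum M S X \<longleftrightarrow> finite S \<and> (\<forall>\<gamma>\<in>S. X \<gamma> \<subseteq> carrier M) \<and>
     (\<forall>x\<in>carrier M. \<exists>!f. f \<in> (\<Pi>\<^sub>E \<gamma>\<in>S. X \<gamma>) \<and> x = (\<Oplus>\<^bsub>M\<^esub>\<gamma>\<in>S. f \<gamma>))"

definition regular_bimodule :: "('k, 'a) module \<Rightarrow> ('a, 'k, 'a) bimodule" where
  "regular_bimodule A = module.extend A (bimodule.fields (mult A) (mult A))"

definition copower :: "('a, 'k, 'm) bimodule \<Rightarrow> 's set \<Rightarrow> ('a, 'k, 's \<Rightarrow> 'm) bimodule" where
  "copower M S =
     \<lparr>carrier = {f \<in> \<Pi>\<^sub>E s\<in>S. carrier M. finite {s \<in> S. f s \<noteq> \<zero>\<^bsub>M\<^esub>}},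
      mult = undefined, one = undefined,
      zero = (\<lambda>s\<in>S. \<zero>\<^bsub>M\<^esub>), add = (\<lambda>f g. \<lambda>s\<in>S. f s \<oplus>\<^bsub>M\<^esub> g s),
      smult = (\<lambda>c f. \<lambda>s\<in>S. c \<odot>\<^bsub>M\<^esub> f s),
      lact = (\<lambda>b f. \<lambda>s\<in>S. lact M b (f s)), ract = (\<lambda>f a. \<lambda>s\<in>S. ract M (f s) a)\<rparr>"

text \<open>Finitely generated projective: a direct summand of a free module of finite rank.\<close>

definition fg_projective_left :: "('k, 'a) module \<Rightarrow> ('a, 'k, 'm) bimodule \<Rightarrow> bool" where
  "fg_projective_left B M \<longleftrightarrow> (\<exists>n::nat.
     \<exists>\<iota>\<in>left_hom B M (copower (regular_bimodule B) {..<n}).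
     \<exists>\<rho>\<in>left_hom B (copower (regular_bimodule B) {..<n}) M.
       \<forall>x\<in>carrier M. \<rho> (\<iota> x) = x)"

definition fg_projective_right :: "('k, 'a) module \<Rightarrow> ('a, 'k, 'm) bimodule \<Rightarrow> bool" where
  "fg_projective_right A M \<longleftrightarrow> (\<exists>n::nat.
     \<exists>\<iota>\<in>right_hom A M (copower (regular_bimodule A) {..<n}).
     \<exists>\<rho>\<in>right_hom A (copower (regular_bimodule A) {..<n}) M.
       \<forall>x\<in>carrier M. \<rho> (\<iota> x) = x)"


section \<open>Tensor products\<close>

text \<open>
  The tensor product of a list of modules: the free module on tuples modulo multilinearity and
  modulo the identification of \<open>xs\<close> with \<open>ys\<close> for all \<open>(xs, ys)\<close> in \<open>E\<close>.  With \<open>E = {}\<close> this is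
  the tensor product over the ground field.
\<close>

definition tuples :: "('k, 'm, 'z) module_scheme list \<Rightarrow> 'm list set" where
  "tuples Vs = {xs. list_all2 (\<lambda>x V. x \<in> carrier V) xs Vs}"

definition tensor_relators ::
  "'k ring \<Rightarrow> ('k, 'm, 'z) module_scheme list \<Rightarrow> ('m list \<times> 'm list) set \<Rightarrow>
    ('m list \<Rightarrow> 'k) set" where
  "tensor_relators K Vs E = (let F = free_module K (tuples Vs) in
     {single K (us @ (x \<oplus>\<^bsub>Vs ! length us\<^esub> y) # vs)
        \<ominus>\<^bsub>F\<^esub> (single K (us @ x # vs) \<oplus>\<^bsub>F\<^esub> single K (us @ y # vs)) |us vs x y.
        us @ x # vs \<in> tuples Vs \<and> us @ y # vs \<in> tuples Vs} \<union>
     {single K (us @ (c \<odot>\<^bsub>Vs ! length us\<^esub> x) # vs)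
        \<ominus>\<^bsub>F\<^esub> (c \<odot>\<^bsub>F\<^esub> single K (us @ x # vs)) |us vs c x.
        us @ x # vs \<in> tuples Vs \<and> c \<in> carrier K} \<union>
     {single K xs \<ominus>\<^bsub>F\<^esub> single K ys |xs ys. (xs, ys) \<in> E})"

definition tensor_kernel ::
  "'k ring \<Rightarrow> ('k, 'm, 'z) module_scheme list \<Rightarrow> ('m list \<times> 'm list) set \<Rightarrow>
    ('m list \<Rightarrow> 'k) set" where
  "tensor_kernel K Vs E = module_span K (free_module K (tuples Vs)) (tensor_relators K Vs E)"

definition tensor ::
  "'k ring \<Rightarrow> ('k, 'm, 'z) module_scheme list \<Rightarrow> ('m list \<times> 'm list) set \<Rightarrow>
    ('k, ('m list \<Rightarrow> 'k) set) module" where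
  "tensor K Vs E = quot (free_module K (tuples Vs)) (tensor_kernel K Vs E)"

definition pure_tensor ::
  "'k ring \<Rightarrow> ('k, 'm, 'z) module_scheme list \<Rightarrow> ('m list \<times> 'm list) set \<Rightarrow> 'm list \<Rightarrow>
    ('m list \<Rightarrow> 'k) set" where
  "pure_tensor K Vs E xs = tensor_kernel K Vs E +>\<^bsub>free_module K (tuples Vs)\<^esub> single K xs"

text \<open>For elements \<open>e\<close> of \<open>B\<close> and \<open>e'\<close> of \<open>A\<close>, the bimodule \<open>B e \<otimes>\<^sub>K e' A\<close>.\<close>

definition elementary_factors ::
  "('k, 'a) module \<Rightarrow> ('k, 'a) module \<Rightarrow> 'a \<Rightarrow> 'a \<Rightarrow> ('k, 'a) module list" where
  "elementary_factors B A e e' =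
     [B\<lparr>carrier := {b \<otimes>\<^bsub>B\<^esub> e |b. b \<in> carrier B}\<rparr>,
      A\<lparr>carrier := {e' \<otimes>\<^bsub>A\<^esub> a |a. a \<in> carrier A}\<rparr>]"

definition elementary_bimodule ::
  "'k ring \<Rightarrow> ('k, 'a) module \<Rightarrow> ('k, 'a) module \<Rightarrow> 'a \<Rightarrow> 'a \<Rightarrow>
    ('a, 'k, ('a list \<Rightarrow> 'k) set) bimodule" where
  "elementary_bimodule K B A e e' =
     (let Vs = elementary_factors B A e e';
          coset = (\<lambda>f. tensor_kernel K Vs {} +>\<^bsub>free_module K (tuples Vs)\<^esub> f)
      in module.extend (tensor K Vs {}) (bimodule.fields
        (\<lambda>b X. \<Union>f\<in>X. coset (push K (\<lambda>xs. [b \<otimes>\<^bsub>B\<^esub> (xs ! 0), xs ! 1]) f))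
        (\<lambda>X a. \<Union>f\<in>X. coset (push K (\<lambda>xs. [xs ! 0, (xs ! 1) \<otimes>\<^bsub>A\<^esub> a]) f))))"

definition elementary_tensor ::
  "'k ring \<Rightarrow> ('k, 'a) module \<Rightarrow> ('k, 'a) module \<Rightarrow> 'a \<Rightarrow> 'a \<Rightarrow> 'a \<Rightarrow> 'a \<Rightarrow>
    ('a list \<Rightarrow> 'k) set" where
  "elementary_tensor K B A e e' x y = pure_tensor K (elementary_factors B A e e') {} [x, y]"

text \<open>
  A bimodule is projective if it is a direct summand of a direct sum of copies of the free bimodule
  \<open>B \<otimes>\<^sub>K A\<close>.  It is no restriction that the copies are indexed by elements of the bimodule:
  a projective bimodule is a summand of the free bimodule on its own elements.
\<close>

definition projective_bimodule ::
  "'k ring \<Rightarrow> ('k, 'a) module \<Rightarrow> ('k, 'a) module \<Rightarrow> ('a, 'k, 'm) bimodule \<Rightarrow> bool" where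
  "projective_bimodule K B A P \<longleftrightarrow> bimodule K B A P \<and>
     (\<exists>S :: 'm set. let F = copower (elementary_bimodule K B A \<one>\<^bsub>B\<^esub> \<one>\<^bsub>A\<^esub>) S in
       \<exists>\<iota>\<in>bimod_hom B A P F. \<exists>\<rho>\<in>bimod_hom B A F P. \<forall>x\<in>carrier P. \<rho> (\<iota> x) = x)"

definition projective_cover ::
  "'k ring \<Rightarrow> ('k, 'a) module \<Rightarrow> ('k, 'a) module \<Rightarrow> ('a, 'k, 'p) bimodule \<Rightarrow>
    ('a, 'k, 'm) bimodule \<Rightarrow> ('p \<Rightarrow> 'm) \<Rightarrow> bool" where
  "projective_cover K B A P M \<pi> \<longleftrightarrow> projective_bimodule K B A P \<and>
     \<pi> \<in> bimod_hom B A P M \<and> \<pi> ` carrier P = carrier M \<and>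
     (\<forall>U. subbimodule K B A P U \<and> U <+>\<^bsub>P\<^esub> a_kernel P M \<pi> = carrier P \<longrightarrow> U = carrier P)"


section \<open>Pro-species of algebras and their tensor algebras\<close>

locale pro_species = base: field K + fin_digraph Q
  for K :: "'k ring" and Q :: "('v, 'e) pre_digraph"
    and A :: "'v \<Rightarrow> ('k, 'a) module" and M :: "'e \<Rightarrow> ('a, 'k, 'm) bimodule" +
  assumes algebras: "i \<in> verts Q \<Longrightarrow> assoc_algebra K (A i)"
    and finite_dimensional: "i \<in> verts Q \<Longrightarrow> finite_dim K (A i)"
    and bimodules: "\<alpha> \<in> arcs Q \<Longrightarrow> bimodule K (A (head Q \<alpha>)) (A (tail Q \<alpha>)) (M \<alpha>)"
    and projective_left: "\<alpha> \<in> arcs Q \<Longrightarrow> fg_projective_left (A (head Q \<alpha>)) (M \<alpha>)"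
    and projective_right: "\<alpha> \<in> arcs Q \<Longrightarrow> fg_projective_right (A (tail Q \<alpha>)) (M \<alpha>)"

text \<open>
  Paths of length at least one are determined by their list of arrows, again written as a product
  \<open>\<alpha>\<^sub>n \<cdots> \<alpha>\<^sub>1\<close>; so \<open>hd\<close> is the last arrow of the path.
\<close>

definition npaths :: "('v, 'e) pre_digraph \<Rightarrow> 'e list set" where
  "npaths Q = {p. p \<noteq> [] \<and> (\<exists>i j. (j, p, i) \<in> qpaths Q)}"

definition balance ::
  "('v, 'e) pre_digraph \<Rightarrow> ('v \<Rightarrow> ('k, 'a) module) \<Rightarrow> ('e \<Rightarrow> ('a, 'k, 'm) bimodule) \<Rightarrow>
    'e list \<Rightarrow> ('m list \<times> 'm list) set" where
  "balance Q A M p = {(us @ ract (M (p ! length us)) x a # y # vs,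
      us @ x # lact (M (p ! Suc (length us))) a y # vs) |us vs x y a.
      us @ x # y # vs \<in> tuples (map M p) \<and> a \<in> carrier (A (tail Q (p ! length us)))}"

definition path_tensor ::
  "'k ring \<Rightarrow> ('v, 'e) pre_digraph \<Rightarrow> ('v \<Rightarrow> ('k, 'a) module) \<Rightarrow>
    ('e \<Rightarrow> ('a, 'k, 'm) bimodule) \<Rightarrow> 'e list \<Rightarrow> ('k, ('m list \<Rightarrow> 'k) set) module" where
  "path_tensor K Q A M p = tensor K (map M p) (balance Q A M p)"

definition path_coset ::
  "'k ring \<Rightarrow> ('v, 'e) pre_digraph \<Rightarrow> ('v \<Rightarrow> ('k, 'a) module) \<Rightarrow>
    ('e \<Rightarrow> ('a, 'k, 'm) bimodule) \<Rightarrow> 'e list \<Rightarrow> ('m list \<Rightarrow> 'k) \<Rightarrow> ('m list \<Rightarrow> 'k) set" where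
  "path_coset K Q A M p f =
     tensor_kernel K (map M p) (balance Q A M p) +>\<^bsub>free_module K (tuples (map M p))\<^esub> f"

definition path_pure ::
  "'k ring \<Rightarrow> ('v, 'e) pre_digraph \<Rightarrow> ('v \<Rightarrow> ('k, 'a) module) \<Rightarrow>
    ('e \<Rightarrow> ('a, 'k, 'm) bimodule) \<Rightarrow> 'e list \<Rightarrow> 'm list \<Rightarrow> ('m list \<Rightarrow> 'k) set" where
  "path_pure K Q A M p xs = pure_tensor K (map M p) (balance Q A M p) xs"

definition path_lact ::
  "'k ring \<Rightarrow> ('v, 'e) pre_digraph \<Rightarrow> ('v \<Rightarrow> ('k, 'a) module) \<Rightarrow>
    ('e \<Rightarrow> ('a, 'k, 'm) bimodule) \<Rightarrow> 'e list \<Rightarrow> 'a \<Rightarrow>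
    ('m list \<Rightarrow> 'k) set \<Rightarrow> ('m list \<Rightarrow> 'k) set" where
  "path_lact K Q A M p a X = (\<Union>f\<in>X. path_coset K Q A M p
     (push K (\<lambda>xs. lact (M (hd p)) a (hd xs) # tl xs) f))"

definition path_ract ::
  "'k ring \<Rightarrow> ('v, 'e) pre_digraph \<Rightarrow> ('v \<Rightarrow> ('k, 'a) module) \<Rightarrow>
    ('e \<Rightarrow> ('a, 'k, 'm) bimodule) \<Rightarrow> 'e list \<Rightarrow>
    ('m list \<Rightarrow> 'k) set \<Rightarrow> 'a \<Rightarrow> ('m list \<Rightarrow> 'k) set" where
  "path_ract K Q A M p X a = (\<Union>f\<in>X. path_coset K Q A M p
     (push K (\<lambda>xs. butlast xs @ [ract (M (last p)) (last xs) a]) f))"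

definition path_mult ::
  "'k ring \<Rightarrow> ('v, 'e) pre_digraph \<Rightarrow> ('v \<Rightarrow> ('k, 'a) module) \<Rightarrow>
    ('e \<Rightarrow> ('a, 'k, 'm) bimodule) \<Rightarrow> 'e list \<Rightarrow> 'e list \<Rightarrow>
    ('m list \<Rightarrow> 'k) set \<Rightarrow> ('m list \<Rightarrow> 'k) set \<Rightarrow> ('m list \<Rightarrow> 'k) set" where
  "path_mult K Q A M p q X Y = (\<Union>f\<in>X. \<Union>g\<in>Y. path_coset K Q A M (p @ q)
     (convolve K (\<lambda>xs ys. Some (xs @ ys)) f g))"

text \<open>
  An element of the tensor algebra is a pair of its components in the algebras at the vertices and
  its components in the tensor products along the paths of positive length.
\<close>

type_synonym ('k, 'v, 'e, 'a, 'm) tensor_elt =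
  "('v \<Rightarrow> 'a) \<times> ('e list \<Rightarrow> ('m list \<Rightarrow> 'k) set)"

definition tensor_algebra ::
  "'k ring \<Rightarrow> ('v, 'e) pre_digraph \<Rightarrow> ('v \<Rightarrow> ('k, 'a) module) \<Rightarrow>
    ('e \<Rightarrow> ('a, 'k, 'm) bimodule) \<Rightarrow> ('k, ('k, 'v, 'e, 'a, 'm) tensor_elt) module" where
  "tensor_algebra K Q A M = (let V = verts Q; N = npaths Q; L = path_tensor K Q A M in
     \<lparr>carrier = {(a, f). a \<in> (\<Pi>\<^sub>E i\<in>V. carrier (A i)) \<and> f \<in> (\<Pi>\<^sub>E p\<in>N. carrier (L p)) \<and>
        finite {p \<in> N. f p \<noteq> \<zero>\<^bsub>L p\<^esub>}},
      mult = (\<lambda>(a, f) (b, g).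
        (\<lambda>i\<in>V. a i \<otimes>\<^bsub>A i\<^esub> b i,
         \<lambda>r\<in>N. path_lact K Q A M r (a (head Q (hd r))) (g r)
           \<oplus>\<^bsub>L r\<^esub> path_ract K Q A M r (f r) (b (tail Q (last r)))
           \<oplus>\<^bsub>L r\<^esub> (\<Oplus>\<^bsub>L r\<^esub>w\<in>{(p, q). p \<noteq> [] \<and> q \<noteq> [] \<and> p @ q = r}.
               path_mult K Q A M (fst w) (snd w) (f (fst w)) (g (snd w))))),
      one = (\<lambda>i\<in>V. \<one>\<^bsub>A i\<^esub>, \<lambda>p\<in>N. \<zero>\<^bsub>L p\<^esub>),
      zero = (\<lambda>i\<in>V. \<zero>\<^bsub>A i\<^esub>, \<lambda>p\<in>N. \<zero>\<^bsub>L p\<^esub>),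
      add = (\<lambda>(a, f) (b, g). (\<lambda>i\<in>V. a i \<oplus>\<^bsub>A i\<^esub> b i, \<lambda>p\<in>N. f p \<oplus>\<^bsub>L p\<^esub> g p)),
      smult = (\<lambda>c (a, f). (\<lambda>i\<in>V. c \<odot>\<^bsub>A i\<^esub> a i, \<lambda>p\<in>N. c \<odot>\<^bsub>L p\<^esub> f p))\<rparr>)"

definition vertex_part ::
  "'k ring \<Rightarrow> ('v, 'e) pre_digraph \<Rightarrow> ('v \<Rightarrow> ('k, 'a) module) \<Rightarrow>
    ('e \<Rightarrow> ('a, 'k, 'm) bimodule) \<Rightarrow> 'v \<Rightarrow> 'a \<Rightarrow> ('k, 'v, 'e, 'a, 'm) tensor_elt" where
  "vertex_part K Q A M i a =
     (\<lambda>j\<in>verts Q. if j = i then a else \<zero>\<^bsub>A j\<^esub>,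
      \<lambda>p\<in>npaths Q. \<zero>\<^bsub>path_tensor K Q A M p\<^esub>)"

definition path_part ::
  "'k ring \<Rightarrow> ('v, 'e) pre_digraph \<Rightarrow> ('v \<Rightarrow> ('k, 'a) module) \<Rightarrow>
    ('e \<Rightarrow> ('a, 'k, 'm) bimodule) \<Rightarrow> 'e list \<Rightarrow> ('m list \<Rightarrow> 'k) set \<Rightarrow>
    ('k, 'v, 'e, 'a, 'm) tensor_elt" where
  "path_part K Q A M p X =
     (\<lambda>j\<in>verts Q. \<zero>\<^bsub>A j\<^esub>,
      \<lambda>q\<in>npaths Q. if q = p then X else \<zero>\<^bsub>path_tensor K Q A M q\<^esub>)"


section \<open>Duals, the double and the preprojective algebra\<close>

text \<open>
  For a \<open>B\<close>-\<open>A\<close>-bimodule \<open>M\<close>, the \<open>A\<close>-\<open>B\<close>-bimodules of right \<open>A\<close>-linear maps \<open>M \<rightarrow> A\<close> and of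
  left \<open>B\<close>-linear maps \<open>M \<rightarrow> B\<close>.
\<close>

definition right_dual :: "('k, 'a) module \<Rightarrow> ('a, 'k, 'm) bimodule \<Rightarrow> ('a, 'k, 'm \<Rightarrow> 'a) bimodule" where
  "right_dual A M =
     \<lparr>carrier = right_hom A M (regular_bimodule A) \<inter> extensional (carrier M),
      mult = undefined, one = undefined,
      zero = (\<lambda>x\<in>carrier M. \<zero>\<^bsub>A\<^esub>), add = (\<lambda>f g. \<lambda>x\<in>carrier M. f x \<oplus>\<^bsub>A\<^esub> g x),
      smult = (\<lambda>c f. \<lambda>x\<in>carrier M. c \<odot>\<^bsub>A\<^esub> f x),
      lact = (\<lambda>a f. \<lambda>x\<in>carrier M. a \<otimes>\<^bsub>A\<^esub> f x),
      ract = (\<lambda>f b. \<lambda>x\<in>carrier M. f (lact M b x))\<rparr>"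

definition left_dual :: "('k, 'a) module \<Rightarrow> ('a, 'k, 'm) bimodule \<Rightarrow> ('a, 'k, 'm \<Rightarrow> 'a) bimodule" where
  "left_dual B M =
     \<lparr>carrier = left_hom B M (regular_bimodule B) \<inter> extensional (carrier M),
      mult = undefined, one = undefined,
      zero = (\<lambda>x\<in>carrier M. \<zero>\<^bsub>B\<^esub>), add = (\<lambda>f g. \<lambda>x\<in>carrier M. f x \<oplus>\<^bsub>B\<^esub> g x),
      smult = (\<lambda>c f. \<lambda>x\<in>carrier M. c \<odot>\<^bsub>B\<^esub> f x),
      lact = (\<lambda>a f. \<lambda>x\<in>carrier M. f (ract M x a)),
      ract = (\<lambda>f b. \<lambda>x\<in>carrier M. f x \<otimes>\<^bsub>B\<^esub> b)\<rparr>"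

definition dualising_isos ::
  "('v, 'e) pre_digraph \<Rightarrow> ('v \<Rightarrow> ('k, 'a) module) \<Rightarrow> ('e \<Rightarrow> ('a, 'k, 'm) bimodule) \<Rightarrow>
    ('e \<Rightarrow> ('m \<Rightarrow> 'a) \<Rightarrow> 'm \<Rightarrow> 'a) \<Rightarrow> bool" where
  "dualising_isos Q A M \<phi> \<longleftrightarrow> (\<forall>\<alpha>\<in>arcs Q. \<phi> \<alpha> \<in> bimod_iso (A (tail Q \<alpha>)) (A (head Q \<alpha>))
     (right_dual (A (tail Q \<alpha>)) (M \<alpha>)) (left_dual (A (head Q \<alpha>)) (M \<alpha>)))"

text \<open>In the double, \<open>Inl \<alpha>\<close> is the arrow \<open>\<alpha>\<close> and \<open>Inr \<alpha>\<close> is the opposite arrow \<open>\<alpha>\<^sup>*\<close>.\<close>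

definition double_quiver :: "('v, 'e) pre_digraph \<Rightarrow> ('v, 'e + 'e) pre_digraph" where
  "double_quiver Q = \<lparr>verts = verts Q, arcs = arcs Q <+> arcs Q,
     tail = case_sum (tail Q) (head Q), head = case_sum (head Q) (tail Q)\<rparr>"

definition transport ::
  "('m \<Rightarrow> 'n) \<Rightarrow> ('n \<Rightarrow> 'm) \<Rightarrow> ('a, 'k, 'm) bimodule \<Rightarrow> ('a, 'k, 'n) bimodule" where
  "transport h h' M =
     \<lparr>carrier = h ` carrier M, mult = undefined, one = undefined,
      zero = h \<zero>\<^bsub>M\<^esub>, add = (\<lambda>x y. h (h' x \<oplus>\<^bsub>M\<^esub> h' y)),
      smult = (\<lambda>c x. h (c \<odot>\<^bsub>M\<^esub> h' x)),
      lact = (\<lambda>b x. h (lact M b (h' x))), ract = (\<lambda>x a. h (ract M (h' x) a))\<rparr>"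

definition double_bimodule ::
  "('v, 'e) pre_digraph \<Rightarrow> ('v \<Rightarrow> ('k, 'a) module) \<Rightarrow> ('e \<Rightarrow> ('a, 'k, 'm) bimodule) \<Rightarrow>
    'e + 'e \<Rightarrow> ('a, 'k, 'm + ('m \<Rightarrow> 'a)) bimodule" where
  "double_bimodule Q A M \<beta> = (case \<beta> of
     Inl \<alpha> \<Rightarrow> transport Inl projl (M \<alpha>)
   | Inr \<alpha> \<Rightarrow> transport Inr projr (right_dual (A (tail Q \<alpha>)) (M \<alpha>)))"

definition double_tensor_algebra ::
  "'k ring \<Rightarrow> ('v, 'e) pre_digraph \<Rightarrow> ('v \<Rightarrow> ('k, 'a) module) \<Rightarrow>
    ('e \<Rightarrow> ('a, 'k, 'm) bimodule) \<Rightarrow>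
    ('k, ('k, 'v, 'e + 'e, 'a, 'm + ('m \<Rightarrow> 'a)) tensor_elt) module" where
  "double_tensor_algebra K Q A M =
     tensor_algebra K (double_quiver Q) A (double_bimodule Q A M)"

text \<open>
  The element \<open>\<Sum>\<^sub>k z\<^sub>k \<otimes> w\<^sub>k\<close> of the component of the tensor algebra of the double at the path
  \<open>\<beta>\<beta>'\<close> of length two.
\<close>

definition double_quadratic ::
  "'k ring \<Rightarrow> ('v, 'e) pre_digraph \<Rightarrow> ('v \<Rightarrow> ('k, 'a) module) \<Rightarrow>
    ('e \<Rightarrow> ('a, 'k, 'm) bimodule) \<Rightarrow> 'e + 'e \<Rightarrow> 'e + 'e \<Rightarrow> nat \<Rightarrow>
    (nat \<Rightarrow> 'm + ('m \<Rightarrow> 'a)) \<Rightarrow> (nat \<Rightarrow> 'm + ('m \<Rightarrow> 'a)) \<Rightarrow>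
    ('k, 'v, 'e + 'e, 'a, 'm + ('m \<Rightarrow> 'a)) tensor_elt" where
  "double_quadratic K Q A M \<beta> \<beta>' n z w =
     (let DQ = double_quiver Q; DM = double_bimodule Q A M in
      path_part K DQ A DM [\<beta>, \<beta>']
        (\<Oplus>\<^bsub>path_tensor K DQ A DM [\<beta>, \<beta>']\<^esub>k\<in>{..<n}. path_pure K DQ A DM [\<beta>, \<beta>'] [z k, w k]))"

definition casimir_elements ::
  "'k ring \<Rightarrow> ('v, 'e) pre_digraph \<Rightarrow> ('v \<Rightarrow> ('k, 'a) module) \<Rightarrow>
    ('e \<Rightarrow> ('a, 'k, 'm) bimodule) \<Rightarrow> ('e \<Rightarrow> ('m \<Rightarrow> 'a) \<Rightarrow> 'm \<Rightarrow> 'a) \<Rightarrow> 'e + 'e \<Rightarrow>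
    ('k, 'v, 'e + 'e, 'a, 'm + ('m \<Rightarrow> 'a)) tensor_elt set" where
  "casimir_elements K Q A M \<phi> \<beta> = (case \<beta> of
     Inl \<alpha> \<Rightarrow> {double_quadratic K Q A M (Inl \<alpha>) (Inr \<alpha>) n (\<lambda>k. Inl (x k)) (\<lambda>k. Inr (f k)) |n x f.
       (\<forall>k<n. x k \<in> carrier (M \<alpha>) \<and> f k \<in> carrier (right_dual (A (tail Q \<alpha>)) (M \<alpha>))) \<and>
       (\<forall>y\<in>carrier (M \<alpha>). y = (\<Oplus>\<^bsub>M \<alpha>\<^esub>k\<in>{..<n}. ract (M \<alpha>) (x k) (f k y)))}
   | Inr \<alpha> \<Rightarrow> {double_quadratic K Q A M (Inr \<alpha>) (Inl \<alpha>) n (\<lambda>k. Inr (g k)) (\<lambda>k. Inl (y k)) |n g y.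
       (\<forall>k<n. y k \<in> carrier (M \<alpha>) \<and> g k \<in> carrier (right_dual (A (tail Q \<alpha>)) (M \<alpha>))) \<and>
       (\<forall>f\<in>carrier (right_dual (A (tail Q \<alpha>)) (M \<alpha>)).
          f = (\<Oplus>\<^bsub>right_dual (A (tail Q \<alpha>)) (M \<alpha>)\<^esub>k\<in>{..<n}.
                ract (right_dual (A (tail Q \<alpha>)) (M \<alpha>)) (g k) (\<phi> \<alpha> f (y k))))})"

definition preprojective_relation ::
  "'k ring \<Rightarrow> ('v, 'e) pre_digraph \<Rightarrow> ('v \<Rightarrow> ('k, 'a) module) \<Rightarrow>
    ('e \<Rightarrow> ('a, 'k, 'm) bimodule) \<Rightarrow>
    ('e + 'e \<Rightarrow> ('k, 'v, 'e + 'e, 'a, 'm + ('m \<Rightarrow> 'a)) tensor_elt) \<Rightarrow>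
    ('k, 'v, 'e + 'e, 'a, 'm + ('m \<Rightarrow> 'a)) tensor_elt" where
  "preprojective_relation K Q A M cas = (let T = double_tensor_algebra K Q A M in
     \<Oplus>\<^bsub>T\<^esub>\<beta>\<in>arcs (double_quiver Q). case \<beta> of Inl \<alpha> \<Rightarrow> cas \<beta> | Inr \<alpha> \<Rightarrow> \<ominus>\<^bsub>T\<^esub> cas \<beta>)"

definition preprojective_algebra ::
  "'k ring \<Rightarrow> ('v, 'e) pre_digraph \<Rightarrow> ('v \<Rightarrow> ('k, 'a) module) \<Rightarrow>
    ('e \<Rightarrow> ('a, 'k, 'm) bimodule) \<Rightarrow>
    ('e + 'e \<Rightarrow> ('k, 'v, 'e + 'e, 'a, 'm + ('m \<Rightarrow> 'a)) tensor_elt) \<Rightarrow>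
    ('k, ('k, 'v, 'e + 'e, 'a, 'm + ('m \<Rightarrow> 'a)) tensor_elt set) module" where
  "preprojective_algebra K Q A M cas = (let T = double_tensor_algebra K Q A M in
     quot T (Idl\<^bsub>T\<^esub> {preprojective_relation K Q A M cas}))"


section \<open>The quiver and the relations of a pro-species\<close>

text \<open>
  The algebras at the vertices are presented by quivers \<open>qt i\<close>, ideals \<open>I i\<close> and isomorphisms
  \<open>\<psi> i\<close> from the quotients of the path algebras to \<open>A i\<close>.
\<close>

definition presents ::
  "'k ring \<Rightarrow> ('k, 'a) module \<Rightarrow> ('w, 'b) pre_digraph \<Rightarrow> (('w, 'b) qpath \<Rightarrow> 'k) set \<Rightarrow>
    ((('w, 'b) qpath \<Rightarrow> 'k) set \<Rightarrow> 'a) \<Rightarrow> bool" where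
  "presents K B q J \<psi> \<longleftrightarrow> admissible K q J \<and> \<psi> \<in> alg_iso K (quot (path_algebra K q) J) B"

definition pres_map ::
  "'k ring \<Rightarrow> ('v \<Rightarrow> ('w, 'b) pre_digraph) \<Rightarrow> ('v \<Rightarrow> (('w, 'b) qpath \<Rightarrow> 'k) set) \<Rightarrow>
    ('v \<Rightarrow> (('w, 'b) qpath \<Rightarrow> 'k) set \<Rightarrow> 'a) \<Rightarrow> 'v \<Rightarrow> (('w, 'b) qpath \<Rightarrow> 'k) \<Rightarrow> 'a" where
  "pres_map K qt I \<psi> i u = \<psi> i (I i +>\<^bsub>path_algebra K (qt i)\<^esub> u)"

definition pres_idem ::
  "'k ring \<Rightarrow> ('v \<Rightarrow> ('w, 'b) pre_digraph) \<Rightarrow> ('v \<Rightarrow> (('w, 'b) qpath \<Rightarrow> 'k) set) \<Rightarrow>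
    ('v \<Rightarrow> (('w, 'b) qpath \<Rightarrow> 'k) set \<Rightarrow> 'a) \<Rightarrow> 'v \<Rightarrow> 'w \<Rightarrow> 'a" where
  "pres_idem K qt I \<psi> i w = pres_map K qt I \<psi> i (path_vertex K w)"

text \<open>
  The data attached to an arrow: a bimodule \<open>cover_bimod\<close>, the map \<open>cover_map\<close> to the bimodule it
  covers, and a decomposition of it; \<open>summand \<gamma>\<close> identifies \<open>\<Lambda>\<^sub>t e\<^sub>j \<otimes>\<^sub>K e\<^sub>i \<Lambda>\<^sub>s\<close> with the summand
  indexed by \<open>\<gamma>\<close>, where \<open>i = new_tail \<gamma>\<close> and \<open>j = new_head \<gamma>\<close>.
\<close>

record ('a, 'k, 'w, 'g, 'p, 'm) cover =
  cover_bimod :: "('a, 'k, 'p) bimodule"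
  cover_map :: "'p \<Rightarrow> 'm"
  new_arcs :: "'g set"
  new_tail :: "'g \<Rightarrow> 'w"
  new_head :: "'g \<Rightarrow> 'w"
  summand :: "'g \<Rightarrow> ('a list \<Rightarrow> 'k) set \<Rightarrow> 'p"

definition decomposed_cover ::
  "'k ring \<Rightarrow> ('v, 'e) pre_digraph \<Rightarrow> ('v \<Rightarrow> ('k, 'a) module) \<Rightarrow>
    ('e \<Rightarrow> ('a, 'k, 'm) bimodule) \<Rightarrow> ('v \<Rightarrow> ('w, 'b) pre_digraph) \<Rightarrow>
    ('v \<Rightarrow> (('w, 'b) qpath \<Rightarrow> 'k) set) \<Rightarrow> ('v \<Rightarrow> (('w, 'b) qpath \<Rightarrow> 'k) set \<Rightarrow> 'a) \<Rightarrow>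
    'e \<Rightarrow> ('a, 'k, 'w, 'g, 'p, 'm) cover \<Rightarrow> bool" where
  "decomposed_cover K Q A M qt I \<psi> \<alpha> C \<longleftrightarrow>
     (let s = tail Q \<alpha>; t = head Q \<alpha>; P = cover_bimod C;
          E = (\<lambda>\<gamma>. elementary_bimodule K (A t) (A s)
                 (pres_idem K qt I \<psi> t (new_head C \<gamma>)) (pres_idem K qt I \<psi> s (new_tail C \<gamma>)));
          X = (\<lambda>\<gamma>. summand C \<gamma> ` carrier (E \<gamma>))
      in projective_cover K (A t) (A s) P (M \<alpha>) (cover_map C) \<and>
         internal_direct_sum P (new_arcs C) X \<and>
         (\<forall>\<gamma>\<in>new_arcs C. new_tail C \<gamma> \<in> verts (qt s) \<and> new_head C \<gamma> \<in> verts (qt t) \<and>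
            summand C \<gamma> \<in> bimod_hom (A t) (A s) (E \<gamma>) P \<and>
            inj_on (summand C \<gamma>) (carrier (E \<gamma>)) \<and>
            indecomposable_subbimodule K (A t) (A s) P (X \<gamma>)))"

definition assembled_quiver ::
  "('v, 'e) pre_digraph \<Rightarrow> ('v \<Rightarrow> ('w, 'b) pre_digraph) \<Rightarrow>
    ('e \<Rightarrow> ('a, 'k, 'w, 'g, 'p, 'm) cover) \<Rightarrow> ('v \<times> 'w, 'v \<times> 'b + 'e \<times> 'g) pre_digraph" where
  "assembled_quiver Q qt C =
     \<lparr>verts = (SIGMA i:verts Q. verts (qt i)),
      arcs = (SIGMA i:verts Q. arcs (qt i)) <+> (SIGMA \<alpha>:arcs Q. new_arcs (C \<alpha>)),
      tail = case_sum (\<lambda>(i, b). (i, tail (qt i) b)) (\<lambda>(\<alpha>, \<gamma>). (tail Q \<alpha>, new_tail (C \<alpha>) \<gamma>)),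
      head = case_sum (\<lambda>(i, b). (i, head (qt i) b)) (\<lambda>(\<alpha>, \<gamma>). (head Q \<alpha>, new_head (C \<alpha>) \<gamma>))\<rparr>"

definition embed ::
  "'k ring \<Rightarrow> 'v \<Rightarrow> (('w, 'b) qpath \<Rightarrow> 'k) \<Rightarrow> ('v \<times> 'w, 'v \<times> 'b + 'e \<times> 'g) qpath \<Rightarrow> 'k" where
  "embed K i = push K (\<lambda>(w', p, w). ((i, w'), map (\<lambda>b. Inl (i, b)) p, (i, w)))"

definition vertex_relations ::
  "'k ring \<Rightarrow> ('v, 'e) pre_digraph \<Rightarrow> ('v \<Rightarrow> (('w, 'b) qpath \<Rightarrow> 'k) set) \<Rightarrow>
    (('v \<times> 'w, 'v \<times> 'b + 'e \<times> 'g) qpath \<Rightarrow> 'k) set" where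
  "vertex_relations K Q I = (\<Union>i\<in>verts Q. embed K i ` I i)"

text \<open>
  \<open>x\<close> lifts the element \<open>r\<close> of the cover at \<open>\<alpha>\<close>: modulo the relations at the vertices, \<open>x\<close> is
  \<open>\<Sum>\<^sub>k u\<^sub>k \<gamma>\<^sub>k v\<^sub>k\<close>, where \<open>r\<close> is the sum of the elements of the summands \<open>\<gamma>\<^sub>k\<close> corresponding to
  \<open>a\<^sub>k e \<otimes> e' b\<^sub>k\<close>, and \<open>u\<^sub>k\<close>, \<open>v\<^sub>k\<close> represent \<open>a\<^sub>k\<close>, \<open>b\<^sub>k\<close> in the path algebras.
\<close>

definition lifts_cover_element ::
  "'k ring \<Rightarrow> ('v, 'e) pre_digraph \<Rightarrow> ('v \<Rightarrow> ('k, 'a) module) \<Rightarrow>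
    ('v \<Rightarrow> ('w, 'b) pre_digraph) \<Rightarrow>
    ('v \<Rightarrow> (('w, 'b) qpath \<Rightarrow> 'k) set) \<Rightarrow> ('v \<Rightarrow> (('w, 'b) qpath \<Rightarrow> 'k) set \<Rightarrow> 'a) \<Rightarrow>
    ('e \<Rightarrow> ('a, 'k, 'w, 'g, 'p, 'm) cover) \<Rightarrow> 'e \<Rightarrow> 'p \<Rightarrow>
    (('v \<times> 'w, 'v \<times> 'b + 'e \<times> 'g) qpath \<Rightarrow> 'k) \<Rightarrow> bool" where
  "lifts_cover_element K Q A qt I \<psi> C \<alpha> r x \<longleftrightarrow>
     (let s = tail Q \<alpha>; t = head Q \<alpha>; AQ = assembled_quiver Q qt C; PA = path_algebra K AQ;
          ej = (\<lambda>\<gamma>. pres_idem K qt I \<psi> t (new_head (C \<alpha>) \<gamma>));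
          ei = (\<lambda>\<gamma>. pres_idem K qt I \<psi> s (new_tail (C \<alpha>) \<gamma>))
      in x \<in> carrier PA \<and>
      (\<exists>(n::nat) \<gamma> u v.
        (\<forall>k<n. \<gamma> k \<in> new_arcs (C \<alpha>) \<and>
           u k \<in> carrier (path_algebra K (qt t)) \<and> v k \<in> carrier (path_algebra K (qt s))) \<and>
        r = (\<Oplus>\<^bsub>cover_bimod (C \<alpha>)\<^esub>k\<in>{..<n}. summand (C \<alpha>) (\<gamma> k)
               (elementary_tensor K (A t) (A s) (ej (\<gamma> k)) (ei (\<gamma> k))
                  (pres_map K qt I \<psi> t (u k) \<otimes>\<^bsub>A t\<^esub> ej (\<gamma> k))
                  (ei (\<gamma> k) \<otimes>\<^bsub>A s\<^esub> pres_map K qt I \<psi> s (v k)))) \<and>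
        x \<ominus>\<^bsub>PA\<^esub> (\<Oplus>\<^bsub>PA\<^esub>k\<in>{..<n}.
               embed K t (u k) \<otimes>\<^bsub>PA\<^esub> path_arrow K AQ (Inr (\<alpha>, \<gamma> k)) \<otimes>\<^bsub>PA\<^esub> embed K s (v k))
          \<in> Idl\<^bsub>PA\<^esub> (vertex_relations K Q I)))"

text \<open>
  One lift \<open>l \<alpha> r\<close> is chosen for every element \<open>r\<close> of a kernel, rather than taking all lifts
  at once, since the set of all lifts would already generate the relations at the vertices.
\<close>

definition kernel_lifts ::
  "'k ring \<Rightarrow> ('v, 'e) pre_digraph \<Rightarrow> ('v \<Rightarrow> ('k, 'a) module) \<Rightarrow>
    ('e \<Rightarrow> ('a, 'k, 'm) bimodule) \<Rightarrow> ('v \<Rightarrow> ('w, 'b) pre_digraph) \<Rightarrow>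
    ('v \<Rightarrow> (('w, 'b) qpath \<Rightarrow> 'k) set) \<Rightarrow> ('v \<Rightarrow> (('w, 'b) qpath \<Rightarrow> 'k) set \<Rightarrow> 'a) \<Rightarrow>
    ('e \<Rightarrow> ('a, 'k, 'w, 'g, 'p, 'm) cover) \<Rightarrow>
    ('e \<Rightarrow> 'p \<Rightarrow> ('v \<times> 'w, 'v \<times> 'b + 'e \<times> 'g) qpath \<Rightarrow> 'k) \<Rightarrow> bool" where
  "kernel_lifts K Q A M qt I \<psi> C l \<longleftrightarrow>
     (\<forall>\<alpha>\<in>arcs Q. \<forall>r\<in>a_kernel (cover_bimod (C \<alpha>)) (M \<alpha>) (cover_map (C \<alpha>)).
        lifts_cover_element K Q A qt I \<psi> C \<alpha> r (l \<alpha> r))"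

definition assembled_relations ::
  "'k ring \<Rightarrow> ('v, 'e) pre_digraph \<Rightarrow> ('e \<Rightarrow> ('a, 'k, 'm) bimodule) \<Rightarrow>
    ('v \<Rightarrow> (('w, 'b) qpath \<Rightarrow> 'k) set) \<Rightarrow> ('e \<Rightarrow> ('a, 'k, 'w, 'g, 'p, 'm) cover) \<Rightarrow>
    ('e \<Rightarrow> 'p \<Rightarrow> ('v \<times> 'w, 'v \<times> 'b + 'e \<times> 'g) qpath \<Rightarrow> 'k) \<Rightarrow>
    (('v \<times> 'w, 'v \<times> 'b + 'e \<times> 'g) qpath \<Rightarrow> 'k) set" where
  "assembled_relations K Q M I C l = vertex_relations K Q I \<union>
     (\<Union>\<alpha>\<in>arcs Q. l \<alpha> ` a_kernel (cover_bimod (C \<alpha>)) (M \<alpha>) (cover_map (C \<alpha>)))"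

text \<open>
  The canonical map from the path algebra of the assembled quiver to the tensor algebra; it sends
  the new arrow \<open>\<gamma>\<close> at \<open>\<alpha>\<close> to the image in the bimodule at \<open>\<alpha>\<close> of \<open>e\<^sub>j \<otimes> e\<^sub>i\<close> in the summand \<open>\<gamma>\<close>.
\<close>

definition canonical_map ::
  "'k ring \<Rightarrow> ('v, 'e) pre_digraph \<Rightarrow> ('v \<Rightarrow> ('k, 'a) module) \<Rightarrow>
    ('e \<Rightarrow> ('a, 'k, 'm) bimodule) \<Rightarrow> ('v \<Rightarrow> ('w, 'b) pre_digraph) \<Rightarrow>
    ('v \<Rightarrow> (('w, 'b) qpath \<Rightarrow> 'k) set) \<Rightarrow> ('v \<Rightarrow> (('w, 'b) qpath \<Rightarrow> 'k) set \<Rightarrow> 'a) \<Rightarrow>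
    ('e \<Rightarrow> ('a, 'k, 'w, 'g, 'p, 'm) cover) \<Rightarrow>
    (('v \<times> 'w, 'v \<times> 'b + 'e \<times> 'g) qpath \<Rightarrow> 'k) \<Rightarrow> ('k, 'v, 'e, 'a, 'm) tensor_elt" where
  "canonical_map K Q A M qt I \<psi> C = path_extension K (tensor_algebra K Q A M)
     (\<lambda>(i, w). vertex_part K Q A M i (pres_idem K qt I \<psi> i w))
     (case_sum
       (\<lambda>(i, b). vertex_part K Q A M i (pres_map K qt I \<psi> i (path_arrow K (qt i) b)))
       (\<lambda>(\<alpha>, \<gamma>). path_part K Q A M [\<alpha>] (path_pure K Q A M [\<alpha>]
          [cover_map (C \<alpha>) (summand (C \<alpha>) \<gamma>
             (let ej = pres_idem K qt I \<psi> (head Q \<alpha>) (new_head (C \<alpha>) \<gamma>);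
                  ei = pres_idem K qt I \<psi> (tail Q \<alpha>) (new_tail (C \<alpha>) \<gamma>)
              in elementary_tensor K (A (head Q \<alpha>)) (A (tail Q \<alpha>)) ej ei ej ei))])))"

end

theory Submission
  imports Defs
begin

text \<open>
  Both isomorphisms come from the canonical map from the path algebra of the assembled quiver to the tensor
  algebra. It is onto: the tensor algebra is generated by the algebras at the vertices and by the bimodules, and each
  bimodule is covered by a sum of bimodules \<open>\<Lambda>\<^sub>t e\<^sub>j \<otimes> e\<^sub>i \<Lambda>\<^sub>s\<close>, each generated by the image of its new arrow
  (\<open>Phi_surj\<close>).  That its kernel is the ideal \<open>R\<close> generated by the relations (\<open>Phi_kernel\<close>) is seen by constructing a
  map back. Since \<open>R\<close> contains the relations at the vertices, elements of the algebras and of the covers have well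
  defined classes modulo \<open>R\<close>. Since \<open>R\<close> contains lifts of the kernels of the covers, these classes only depend on
  the images in the bimodules. By the universal property of the tensor algebra (\<open>tensor_algebra_map\<close>) they define a
  map from it to the quotient by \<open>R\<close>, and composing it with the canonical map gives the quotient map. Now the first
  isomorphism theorem yields part (a). Part (b) is the same argument for the double, which is again a
  species (\<open>species_double\<close>), after dividing by one more element and its lift (\<open>isomorphic_quot_generator\<close>).

  For admissibility, the powers of the arrow ideal are identified with the spans of long paths
  (\<open>ideal_power_eq\<close>). As \<open>Q\<close> is acyclic, the number of new arrows in a path is bounded, so a long path runs for a long
  time inside the quiver at one vertex and hence lies in \<open>R\<close> (\<open>long_paths_in_relations\<close>). That \<open>R\<close> lies in the square
  of the arrow ideal rests on the kernel of a projective cover being superfluous: a relation involving a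
  new arrow linearly would make the summand of that arrow redundant (\<open>cover_kernel_long\<close>).

  Every tensor product here is a quotient of a free module on tuples, and actions and products are defined through
  representatives. Therefore all maps are obtained in the same way, as linear extensions (\<open>lin\<close>) of multilinear maps on
  tuples, followed by passage to cosets (\<open>coset_lift\<close>), and identities between them are checked on pure tensors.
  The axioms of the tensor algebra itself are also proved by reduction to pure tensors (\<open>algebra_T\<close>).
\<close>

section \<open>Linear maps\<close>

text \<open>Linear maps between module records of arbitrary type, so that algebras, bimodules, tensor products and
 quotients all serve as modules over the ground field.\<close>

locale linear_map = M: Module.module K M + N: Module.module K N
 for K :: "'k ring" and M :: "('k, 'm, 'y) module_scheme" and N :: "('k, 'n, 'z) module_scheme" +
 fixes h :: "'m => 'n"
 assumes closed [simp, intro]: "x \<in> carrier M ==> h x \<in> carrier N"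
  and add: "[|x \<in> carrier M; y \<in> carrier M|] ==> h (x \<oplus>\<^bsub>M\<^esub> y) = h x \<oplus>\<^bsub>N\<^esub> h y"
  and smult: "[|c \<in> carrier K; x \<in> carrier M|] ==> h (c \<odot>\<^bsub>M\<^esub> x) = c \<odot>\<^bsub>N\<^esub> h x"
begin

lemma zero: "h \<zero>\<^bsub>M\<^esub> = \<zero>\<^bsub>N\<^esub>"
 using smult[of "\<zero>\<^bsub>K\<^esub>" "\<zero>\<^bsub>M\<^esub>"] by simp

lemma a_inv: "x \<in> carrier M ==> h (\<ominus>\<^bsub>M\<^esub> x) = \<ominus>\<^bsub>N\<^esub> h x"
 using add[of "\<ominus>\<^bsub>M\<^esub> x" x] by (simp add: M.M.l_neg zero N.M.minus_equality)

lemma minus: "[|x \<in> carrier M; y \<in> carrier M|] ==> h (x \<ominus>\<^bsub>M\<^esub> y) = h x \<ominus>\<^bsub>N\<^esub> h y"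
 by (simp add: a_minus_def add a_inv)

lemma finsum: "f \<in> B \<rightarrow> carrier M ==> h (\<Oplus>\<^bsub>M\<^esub>i\<in>B. f i) = (\<Oplus>\<^bsub>N\<^esub>i\<in>B. h (f i))"
proof (induction B rule: infinite_finite_induct)
 case (insert x F)
 then show ?case by (simp add: Pi_def add M.finsum_closed)
qed (simp_all add: zero)

lemma kernel_submodule: "submodule {x \<in> carrier M. h x = \<zero>\<^bsub>N\<^esub>} K M"
 by (rule M.submoduleI) (auto simp: zero a_inv add smult)

lemma image_submodule: "submodule (h ` carrier M) K N"
proof (rule N.submoduleI)
 show "\<zero>\<^bsub>N\<^esub> \<in> h ` carrier M" by (simp add: image_iff) (use zero in force)
qed (auto simp: a_inv[symmetric] add[symmetric] smult[symmetric] simp del: M.M.add.inv_closed)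

end

lemma linear_map_comp:
 "linear_map K M N h ==> linear_map K N L g ==> linear_map K M L (\<lambda>x. g (h x))"
 by (auto simp: linear_map_def linear_map_axioms_def)

lemma (in Module.module) eq_from_minus:
 "[|x \<in> carrier M; y \<in> carrier M; x \<ominus>\<^bsub>M\<^esub> y = \<zero>\<^bsub>M\<^esub>|] ==> x = y"
 using M.minus_unique[of x "\<ominus>\<^bsub>M\<^esub> y" y] by (simp add: a_minus_def M.l_neg)

section \<open>Free modules\<close>

lemma free_module_simps [simp]:
 "zero (free_module K S) = (\<lambda>x. \<zero>\<^bsub>K\<^esub>)"
 "add (free_module K S) = (\<lambda>f g x. f x \<oplus>\<^bsub>K\<^esub> g x)"
 "smult (free_module K S) = (\<lambda>c f x. c \<otimes>\<^bsub>K\<^esub> f x)"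
 by (simp_all add: free_module_def)

lemma free_module_carrier:
 "f \<in> carrier (free_module K S) \<longleftrightarrow>
  (\<forall>x. f x \<in> carrier K) \<and> finite {x. f x \<noteq> \<zero>\<^bsub>K\<^esub>} \<and> {x. f x \<noteq> \<zero>\<^bsub>K\<^esub>} \<subseteq> S"
 by (simp add: free_module_def)

lemma free_module_carrierI:
 assumes "\<And>x. f x \<in> carrier K" "finite B" "\<And>x. x \<notin> B ==> f x = \<zero>\<^bsub>K\<^esub>" "B \<subseteq> S"
 shows "f \<in> carrier (free_module K S)"
 using assms finite_subset[of "{x. f x \<noteq> \<zero>\<^bsub>K\<^esub>}" B] by (auto simp: free_module_carrier)

lemma free_moduleE:
 assumes "f \<in> carrier (free_module K S)"
 obtains B where "finite B" "B \<subseteq> S" "\<And>x. f x \<in> carrier K" "\<And>x. x \<notin> B ==> f x = \<zero>\<^bsub>K\<^esub>"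
proof (rule that[of "{x. f x \<noteq> \<zero>\<^bsub>K\<^esub>}"])
qed (use assms in "simp_all add: free_module_carrier")

lemma module_free_module:
 assumes "cring K" shows "Module.module K (free_module K S)"
proof -
 interpret cring K by fact
 have [simp]: "(\<lambda>x. f x \<oplus>\<^bsub>K\<^esub> g x) \<in> carrier (free_module K S)"
  if f: "f \<in> carrier (free_module K S)" and g: "g \<in> carrier (free_module K S)" for f g
 proof -
  obtain B where "finite B" "B \<subseteq> S" "\<And>x. f x \<in> carrier K" "\<And>x. x \<notin> B ==> f x = \<zero>\<^bsub>K\<^esub>"
   using f by (rule free_moduleE) blast
  moreover obtain C where "finite C" "C \<subseteq> S" "\<And>x. g x \<in> carrier K" "\<And>x. x \<notin> C ==> g x = \<zero>\<^bsub>K\<^esub>"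
   using g by (rule free_moduleE) blast
  ultimately show ?thesis by (intro free_module_carrierI[of _ _ "B \<union> C"]) auto
 qed
 have sm: "(\<lambda>x. c \<otimes>\<^bsub>K\<^esub> f x) \<in> carrier (free_module K S)"
  if f: "f \<in> carrier (free_module K S)" and c: "c \<in> carrier K" for f c
 proof -
  obtain B where "finite B" "B \<subseteq> S" "\<And>x. f x \<in> carrier K" "\<And>x. x \<notin> B ==> f x = \<zero>\<^bsub>K\<^esub>"
   using f by (rule free_moduleE) blast
  then show ?thesis using c by (intro free_module_carrierI[of _ _ "B"]) auto
 qed
 have cK: "\<And>x. f x \<in> carrier K" if "f \<in> carrier (free_module K S)" for f
  using that by (simp add: free_module_carrier)
 show ?thesis
 proof (rule moduleI)
  show "abelian_group (free_module K S)"
  proof (rule abelian_groupI)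
   fix f assume f: "f \<in> carrier (free_module K S)"
   have "(\<lambda>x. \<ominus>\<^bsub>K\<^esub> \<one>\<^bsub>K\<^esub> \<otimes>\<^bsub>K\<^esub> f x) \<in> carrier (free_module K S)" by (rule sm) (auto simp: f)
   moreover have "(\<lambda>x. \<ominus>\<^bsub>K\<^esub> \<one>\<^bsub>K\<^esub> \<otimes>\<^bsub>K\<^esub> f x \<oplus>\<^bsub>K\<^esub> f x) = (\<lambda>x. \<zero>\<^bsub>K\<^esub>)"
    using cK[OF f] by (simp add: l_minus l_neg)
   ultimately show "\<exists>g\<in>carrier (free_module K S). g \<oplus>\<^bsub>free_module K S\<^esub> f = \<zero>\<^bsub>free_module K S\<^esub>"
    by auto
  qed (auto simp: a_ac cK free_module_carrier[of "\<lambda>x. \<zero>\<^bsub>K\<^esub>"])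
 next
  fix a b f assume *: "a \<in> carrier K" "b \<in> carrier K" "f \<in> carrier (free_module K S)"
  show "(a \<oplus>\<^bsub>K\<^esub> b) \<odot>\<^bsub>free_module K S\<^esub> f = a \<odot>\<^bsub>free_module K S\<^esub> f \<oplus>\<^bsub>free_module K S\<^esub> b \<odot>\<^bsub>free_module K S\<^esub> f"
   and "(a \<otimes>\<^bsub>K\<^esub> b) \<odot>\<^bsub>free_module K S\<^esub> f = a \<odot>\<^bsub>free_module K S\<^esub> (b \<odot>\<^bsub>free_module K S\<^esub> f)"
   using *(1,2) cK[OF *(3)] by (simp_all add: l_distr m_assoc)
 next
  fix a f g assume *: "a \<in> carrier K" "f \<in> carrier (free_module K S)" "g \<in> carrier (free_module K S)"
  show "a \<odot>\<^bsub>free_module K S\<^esub> (f \<oplus>\<^bsub>free_module K S\<^esub> g) = a \<odot>\<^bsub>free_module K S\<^esub> f \<oplus>\<^bsub>free_module K S\<^esub> a \<odot>\<^bsub>free_module K S\<^esub> g"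
   using *(1) cK[OF *(2)] cK[OF *(3)] by (simp add: r_distr)
 next
  fix a f assume *: "a \<in> carrier K" "f \<in> carrier (free_module K S)"
  show "a \<odot>\<^bsub>free_module K S\<^esub> f \<in> carrier (free_module K S)" using sm[OF *(2,1)] by simp
 next
  fix f assume *: "f \<in> carrier (free_module K S)"
  show "\<one>\<^bsub>K\<^esub> \<odot>\<^bsub>free_module K S\<^esub> f = f" using cK[OF *] by simp
 qed fact
qed

lemma single_eq [simp]: "single K x x = \<one>\<^bsub>K\<^esub>" by (simp add: single_def)

lemma single_closed:
 assumes "cring K" "x \<in> S" shows "single K x \<in> carrier (free_module K S)"
proof -
 interpret cring K by fact
 show ?thesis using assms(2) by (intro free_module_carrierI[of _ _ "{x}"]) (auto simp: single_def)
qed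

lemma free_module_induct [consumes 2, case_names zero single add smult]:
 assumes K: "cring K" and f: "f \<in> carrier (free_module K S)"
  and zero: "P \<zero>\<^bsub>free_module K S\<^esub>"
  and single: "\<And>x. x \<in> S ==> P (single K x)"
  and add: "\<And>f g. [|f \<in> carrier (free_module K S); g \<in> carrier (free_module K S); P f; P g|]
   ==> P (f \<oplus>\<^bsub>free_module K S\<^esub> g)"
  and smult: "\<And>c f. [|c \<in> carrier K; f \<in> carrier (free_module K S); P f|]
   ==> P (c \<odot>\<^bsub>free_module K S\<^esub> f)"
 shows "P f"
proof -
 interpret cring K by fact
 interpret F: Module.module K "free_module K S" by (rule module_free_module[OF K])
 have "\<And>f. f \<in> carrier (free_module K S) ==> {x. f x \<noteq> \<zero>\<^bsub>K\<^esub>} \<subseteq> B ==> P f" if "finite B" for B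
  using that
 proof (induction B rule: finite_induct)
  case empty
  then have "f = (\<lambda>x. \<zero>\<^bsub>K\<^esub>)" by auto
  then show ?case using zero by simp
 next
  case (insert b B)
  show ?case
  proof (cases "f b = \<zero>\<^bsub>K\<^esub>")
   case True
   then show ?thesis using insert by blast
  next
   case False
   have fK: "\<And>x. f x \<in> carrier K" and fS: "{x. f x \<noteq> \<zero>\<^bsub>K\<^esub>} \<subseteq> S" and ff: "finite {x. f x \<noteq> \<zero>\<^bsub>K\<^esub>}"
    using insert(4) by (auto simp: free_module_carrier)
   let ?g = "f(b := \<zero>\<^bsub>K\<^esub>)" and ?h = "f b \<odot>\<^bsub>free_module K S\<^esub> single K b"
   have b: "b \<in> S" using False fS by auto
   have g: "?g \<in> carrier (free_module K S)"
    using fK fS ff by (intro free_module_carrierI[of _ _ "{x. f x \<noteq> \<zero>\<^bsub>K\<^esub>}"]) (auto split: if_splits)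
   have "P ?g" using insert(5) by (intro insert(3) g) auto
   moreover have "P ?h" by (intro smult single single_closed K b fK)
   moreover have "?h \<in> carrier (free_module K S)" by (intro F.smult_closed single_closed K b fK)
   ultimately have "P (?g \<oplus>\<^bsub>free_module K S\<^esub> ?h)" using g add by blast
   moreover have "?g \<oplus>\<^bsub>free_module K S\<^esub> ?h = f" using fK by (auto simp: single_def fun_eq_iff)
   ultimately show ?thesis by simp
  qed
 qed
 then show ?thesis using f by (auto simp: free_module_carrier)
qed

lemma linear_map_ext:
 assumes "linear_map K (free_module K S) N h" "linear_map K (free_module K S) N h'"
  and "\<And>x. x \<in> S ==> h (single K x) = h' (single K x)" "f \<in> carrier (free_module K S)"
 shows "h f = h' f"
proof -
 interpret h: linear_map K "free_module K S" N h by fact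
 interpret h': linear_map K "free_module K S" N h' by fact
 have K: "cring K" ..
 from K assms(4) show ?thesis
  by (induction rule: free_module_induct)
   (simp_all only: h.zero h'.zero h.add h'.add h.smult h'.smult assms(3))
qed

text \<open>The linear extension of a map on basis elements. The basis is not an argument: only the support of the
 vector enters.\<close>

definition lin :: "'k ring => ('k, 'n, 'z) module_scheme => ('s => 'n) => ('s => 'k) => 'n" where
 "lin K N g f = (\<Oplus>\<^bsub>N\<^esub>x\<in>{x. f x \<noteq> \<zero>\<^bsub>K\<^esub>}. f x \<odot>\<^bsub>N\<^esub> g x)"

lemma lin_superset:
 assumes "Module.module K N" "finite B" "\<And>x. x \<notin> B ==> f x = \<zero>\<^bsub>K\<^esub>" "\<And>x. f x \<in> carrier K"
  "\<And>x. x \<in> B ==> g x \<in> carrier N"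
 shows "lin K N g f = (\<Oplus>\<^bsub>N\<^esub>x\<in>B. f x \<odot>\<^bsub>N\<^esub> g x)"
proof -
 interpret N: Module.module K N by fact
 show ?thesis unfolding lin_def
  by (rule N.M.add.finprod_mono_neutral_cong_left) (use assms in auto)
qed

lemma linear_lin:
 assumes "Module.module K N" "\<And>x. x \<in> S ==> g x \<in> carrier N"
 shows "linear_map K (free_module K S) N (lin K N g)"
proof -
 interpret N: Module.module K N by fact
 interpret F: Module.module K "free_module K S" by (rule module_free_module) (rule N.R.is_cring)
 show ?thesis
 proof
  fix f assume f: "f \<in> carrier (free_module K S)"
  obtain B where B: "finite B" "B \<subseteq> S" "\<And>x. f x \<in> carrier K" "\<And>x. x \<notin> B ==> f x = \<zero>\<^bsub>K\<^esub>"
   using f by (rule free_moduleE) blast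
  have gB: "\<And>x. x \<in> B ==> g x \<in> carrier N" using B assms(2) by auto
  have eq: "lin K N g f = (\<Oplus>\<^bsub>N\<^esub>x\<in>B. f x \<odot>\<^bsub>N\<^esub> g x)" by (rule lin_superset) (use assms B in auto)
  show "lin K N g f \<in> carrier N" unfolding eq by (intro N.M.finsum_closed) (use B gB in auto)
  { fix c assume c: "c \<in> carrier K"
   have "lin K N g (c \<odot>\<^bsub>free_module K S\<^esub> f) = (\<Oplus>\<^bsub>N\<^esub>x\<in>B. (c \<otimes>\<^bsub>K\<^esub> f x) \<odot>\<^bsub>N\<^esub> g x)"
    using c B gB assms by (subst lin_superset[of _ _ B]) auto
   also have "... = (\<Oplus>\<^bsub>N\<^esub>x\<in>B. c \<odot>\<^bsub>N\<^esub> (f x \<odot>\<^bsub>N\<^esub> g x))"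
    by (rule N.M.finsum_cong') (use c B gB in "auto simp: N.smult_assoc1")
   also have "... = c \<odot>\<^bsub>N\<^esub> lin K N g f" unfolding eq
    by (subst N.finsum_smult_ldistr) (use c B gB in auto)
   finally show "lin K N g (c \<odot>\<^bsub>free_module K S\<^esub> f) = c \<odot>\<^bsub>N\<^esub> lin K N g f" . }
  fix f' assume f': "f' \<in> carrier (free_module K S)"
  obtain C where C: "finite C" "C \<subseteq> S" "\<And>x. f' x \<in> carrier K" "\<And>x. x \<notin> C ==> f' x = \<zero>\<^bsub>K\<^esub>"
   using f' by (rule free_moduleE) blast
  have gC: "\<And>x. x \<in> C ==> g x \<in> carrier N" using C assms(2) by auto
  have "lin K N g (f \<oplus>\<^bsub>free_module K S\<^esub> f') = (\<Oplus>\<^bsub>N\<^esub>x\<in>B \<union> C. (f x \<oplus>\<^bsub>K\<^esub> f' x) \<odot>\<^bsub>N\<^esub> g x)"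
   using B C gB gC assms by (subst lin_superset[of _ _ "B \<union> C"]) auto
  also have "... = (\<Oplus>\<^bsub>N\<^esub>x\<in>B \<union> C. f x \<odot>\<^bsub>N\<^esub> g x \<oplus>\<^bsub>N\<^esub> f' x \<odot>\<^bsub>N\<^esub> g x)"
   by (rule N.M.finsum_cong') (use B C gB gC in "auto simp: N.smult_l_distr")
  also have "... = (\<Oplus>\<^bsub>N\<^esub>x\<in>B \<union> C. f x \<odot>\<^bsub>N\<^esub> g x) \<oplus>\<^bsub>N\<^esub> (\<Oplus>\<^bsub>N\<^esub>x\<in>B \<union> C. f' x \<odot>\<^bsub>N\<^esub> g x)"
   by (rule N.M.finsum_addf) (use B C gB gC in auto)
  also have "... = lin K N g f \<oplus>\<^bsub>N\<^esub> lin K N g f'"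
   using B C gB gC assms by (subst (1 2) lin_superset[of _ _ "B \<union> C"]) auto
  finally show "lin K N g (f \<oplus>\<^bsub>free_module K S\<^esub> f') = lin K N g f \<oplus>\<^bsub>N\<^esub> lin K N g f'" .
 qed
qed

lemma lin_single:
 assumes "Module.module K N" "g x \<in> carrier N"
 shows "lin K N g (single K x) = g x"
proof -
 interpret N: Module.module K N by fact
 have "lin K N g (single K x) = (\<Oplus>\<^bsub>N\<^esub>y\<in>{x}. single K x y \<odot>\<^bsub>N\<^esub> g y)"
  by (rule lin_superset) (use assms in "auto simp: single_def")
 also have "... = g x"
  using assms(2) by (simp add: N.M.finsum_insert del: N.M.finsum_closed)
 finally show ?thesis .
qed

lemma push_superset:
 assumes "cring K" "finite B" "\<And>x. x \<notin> B ==> f x = \<zero>\<^bsub>K\<^esub>" "\<And>x. f x \<in> carrier K"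
 shows "push K h f y = (\<Oplus>\<^bsub>K\<^esub>x\<in>{x \<in> B. h x = y}. f x)"
proof -
 interpret cring K by fact
 show ?thesis unfolding push_def
  by (rule add.finprod_mono_neutral_cong_left) (use assms in auto)
qed

lemma linear_push:
 assumes "cring K" "\<And>x. x \<in> S ==> h x \<in> T"
 shows "linear_map K (free_module K S) (free_module K T) (push K h)"
proof -
 interpret cring K by fact
 interpret F: Module.module K "free_module K S" by (rule module_free_module) fact
 interpret G: Module.module K "free_module K T" by (rule module_free_module) fact
 show ?thesis
 proof
  fix f assume f: "f \<in> carrier (free_module K S)"
  obtain B where B: "finite B" "B \<subseteq> S" "\<And>x. f x \<in> carrier K" "\<And>x. x \<notin> B ==> f x = \<zero>\<^bsub>K\<^esub>"
   using f by (rule free_moduleE) blast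
  have eq: "push K h f y = (\<Oplus>\<^bsub>K\<^esub>x\<in>{x \<in> B. h x = y}. f x)" for y
   by (rule push_superset) (use B assms in auto)
  show "push K h f \<in> carrier (free_module K T)"
  proof (rule free_module_carrierI[of _ _ "h ` B"])
   show "push K h f y = \<zero>\<^bsub>K\<^esub>" if "y \<notin> h ` B" for y
   proof -
    have "{x \<in> B. h x = y} = {}" using that by auto
    then show ?thesis unfolding eq by (simp only: finsum_empty)
   qed
  qed (use B assms eq in "auto intro!: finsum_closed")
  { fix c assume c: "c \<in> carrier K"
   show "push K h (c \<odot>\<^bsub>free_module K S\<^esub> f) = c \<odot>\<^bsub>free_module K T\<^esub> push K h f"
   proof
    fix y
    have "push K h (c \<odot>\<^bsub>free_module K S\<^esub> f) y = (\<Oplus>\<^bsub>K\<^esub>x\<in>{x \<in> B. h x = y}. c \<otimes>\<^bsub>K\<^esub> f x)"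
     using c B assms by (subst push_superset[of _ B]) auto
    then show "push K h (c \<odot>\<^bsub>free_module K S\<^esub> f) y = (c \<odot>\<^bsub>free_module K T\<^esub> push K h f) y"
     using c B by (simp add: eq finsum_rdistr Pi_def)
   qed }
  fix f' assume f': "f' \<in> carrier (free_module K S)"
  obtain C where C: "finite C" "C \<subseteq> S" "\<And>x. f' x \<in> carrier K" "\<And>x. x \<notin> C ==> f' x = \<zero>\<^bsub>K\<^esub>"
   using f' by (rule free_moduleE) blast
  show "push K h (f \<oplus>\<^bsub>free_module K S\<^esub> f') = push K h f \<oplus>\<^bsub>free_module K T\<^esub> push K h f'"
  proof
   fix y
   have "push K h (f \<oplus>\<^bsub>free_module K S\<^esub> f') y = (\<Oplus>\<^bsub>K\<^esub>x\<in>{x \<in> B \<union> C. h x = y}. f x \<oplus>\<^bsub>K\<^esub> f' x)"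
    using B C assms by (subst push_superset[of _ "B \<union> C"]) auto
   also have "... = (\<Oplus>\<^bsub>K\<^esub>x\<in>{x \<in> B \<union> C. h x = y}. f x) \<oplus>\<^bsub>K\<^esub> (\<Oplus>\<^bsub>K\<^esub>x\<in>{x \<in> B \<union> C. h x = y}. f' x)"
    by (rule finsum_addf) (use B C in auto)
   also have "... = push K h f y \<oplus>\<^bsub>K\<^esub> push K h f' y"
    using B C assms by (subst (1 2) push_superset[of _ "B \<union> C"]) auto
   finally show "push K h (f \<oplus>\<^bsub>free_module K S\<^esub> f') y = (push K h f \<oplus>\<^bsub>free_module K T\<^esub> push K h f') y"
    by simp
  qed
 qed
qed

lemma push_single:
 assumes "cring K" shows "push K h (single K x) = single K (h x)"
proof
 interpret cring K by fact
 fix y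
 have "push K h (single K x) y = (\<Oplus>\<^bsub>K\<^esub>z\<in>{z \<in> {x}. h z = y}. single K x z)"
  by (rule push_superset) (use assms in "auto simp: single_def")
 also have "{z \<in> {x}. h z = y} = (if h x = y then {x} else {})" by auto
 also have "(\<Oplus>\<^bsub>K\<^esub>z\<in>(if h x = y then {x} else {}). single K x z) = single K (h x) y"
  by (auto simp: single_def finsum_insert)
 finally show "push K h (single K x) y = single K (h x) y" .
qed

section \<open>Partial operations\<close>

text \<open>Sums over different supports cannot be compared term by term; over a common finite superset they can.\<close>

lemma convolve_superset:
 assumes "cring K" "finite B" "finite C" "\<And>x. x \<notin> B ==> f x = \<zero>\<^bsub>K\<^esub>" "\<And>x. f x \<in> carrier K"
  "\<And>x. x \<notin> C ==> g x = \<zero>\<^bsub>K\<^esub>" "\<And>x. g x \<in> carrier K"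
 shows "convolve K m f g z =
  (\<Oplus>\<^bsub>K\<^esub>w\<in>{w \<in> B \<times> C. m (fst w) (snd w) = Some z}. f (fst w) \<otimes>\<^bsub>K\<^esub> g (snd w))"
proof -
 interpret cring K by fact
 show ?thesis unfolding convolve_def
 proof (rule add.finprod_mono_neutral_cong_left)
  fix i assume "i \<in> {w \<in> B \<times> C. m (fst w) (snd w) = Some z} -
   {(x, y). f x \<noteq> \<zero>\<^bsub>K\<^esub> \<and> g y \<noteq> \<zero>\<^bsub>K\<^esub> \<and> m x y = Some z}"
  then have "f (fst i) = \<zero>\<^bsub>K\<^esub> \<or> g (snd i) = \<zero>\<^bsub>K\<^esub>" by auto
  then show "f (fst i) \<otimes>\<^bsub>K\<^esub> g (snd i) = \<zero>\<^bsub>K\<^esub>" using assms by auto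
 qed (use assms in auto)
qed

lemma convolve_swap:
 assumes "cring K" "\<And>x. f x \<in> carrier K" "\<And>x. g x \<in> carrier K"
  "finite {x. f x \<noteq> \<zero>\<^bsub>K\<^esub>}" "finite {x. g x \<noteq> \<zero>\<^bsub>K\<^esub>}"
 shows "convolve K m f g = convolve K (\<lambda>x y. m y x) g f"
proof
 fix z
 interpret cring K by fact
 let ?A = "{(x, y). g x \<noteq> \<zero>\<^bsub>K\<^esub> \<and> f y \<noteq> \<zero>\<^bsub>K\<^esub> \<and> m y x = Some z}"
 have "{(x, y). f x \<noteq> \<zero>\<^bsub>K\<^esub> \<and> g y \<noteq> \<zero>\<^bsub>K\<^esub> \<and> m x y = Some z} = prod.swap ` ?A"
  by force
 then have "convolve K m f g z = (\<Oplus>\<^bsub>K\<^esub>w\<in>prod.swap ` ?A. f (fst w) \<otimes>\<^bsub>K\<^esub> g (snd w))"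
  by (simp add: convolve_def)
 also have "... = (\<Oplus>\<^bsub>K\<^esub>w\<in>?A. f (fst (prod.swap w)) \<otimes>\<^bsub>K\<^esub> g (snd (prod.swap w)))"
  by (rule finsum_reindex) (use assms in "auto simp: inj_on_def")
 also have "... = convolve K (\<lambda>x y. m y x) g f z" unfolding convolve_def
  by (rule finsum_cong') (use assms in "auto simp: m_comm")
 finally show "convolve K m f g z = convolve K (\<lambda>x y. m y x) g f z" .
qed

lemma linear_convolve_left:
 assumes K: "cring K" and m: "\<And>x y z. x \<in> S ==> y \<in> T ==> m x y = Some z ==> z \<in> U"
  and g: "g \<in> carrier (free_module K T)"
 shows "linear_map K (free_module K S) (free_module K U) (\<lambda>f. convolve K m f g)"
proof -
 interpret cring K by fact
 interpret F: Module.module K "free_module K S" by (rule module_free_module) fact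
 interpret G: Module.module K "free_module K U" by (rule module_free_module) fact
 obtain C where C: "finite C" "C \<subseteq> T" "\<And>x. g x \<in> carrier K" "\<And>x. x \<notin> C ==> g x = \<zero>\<^bsub>K\<^esub>"
  using g by (rule free_moduleE) blast
 show ?thesis
 proof
  fix f assume f: "f \<in> carrier (free_module K S)"
  obtain B where B: "finite B" "B \<subseteq> S" "\<And>x. f x \<in> carrier K" "\<And>x. x \<notin> B ==> f x = \<zero>\<^bsub>K\<^esub>"
   using f by (rule free_moduleE) blast
  let ?Z = "\<lambda>B z. {w \<in> B \<times> C. m (fst w) (snd w) = Some z}"
  have eq: "convolve K m f g z = (\<Oplus>\<^bsub>K\<^esub>w\<in>?Z B z. f (fst w) \<otimes>\<^bsub>K\<^esub> g (snd w))" for z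
   by (rule convolve_superset) (use B C K in auto)
  show "convolve K m f g \<in> carrier (free_module K U)"
  proof (rule free_module_carrierI[of _ _ "{z. \<exists>x\<in>B. \<exists>y\<in>C. m x y = Some z}"])
   have "{z. \<exists>x\<in>B. \<exists>y\<in>C. m x y = Some z} \<subseteq> (\<lambda>(x, y). the (m x y)) ` (B \<times> C)" by force
   then show "finite {z. \<exists>x\<in>B. \<exists>y\<in>C. m x y = Some z}" using B C by (meson finite_SigmaI finite_imageI finite_subset)
   show "convolve K m f g z = \<zero>\<^bsub>K\<^esub>" if "z \<notin> {z. \<exists>x\<in>B. \<exists>y\<in>C. m x y = Some z}" for z
   proof -
    have "?Z B z = {}" using that by auto
    then show ?thesis unfolding eq by (simp only: finsum_empty)
   qed
   show "{z. \<exists>x\<in>B. \<exists>y\<in>C. m x y = Some z} \<subseteq> U" using B C m by blast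
  qed (use B C eq in "auto intro!: finsum_closed")
  { fix c assume c: "c \<in> carrier K"
   show "convolve K m (c \<odot>\<^bsub>free_module K S\<^esub> f) g = c \<odot>\<^bsub>free_module K U\<^esub> convolve K m f g"
   proof
    fix z
    have "convolve K m (c \<odot>\<^bsub>free_module K S\<^esub> f) g z = (\<Oplus>\<^bsub>K\<^esub>w\<in>?Z B z. (c \<otimes>\<^bsub>K\<^esub> f (fst w)) \<otimes>\<^bsub>K\<^esub> g (snd w))"
     using c B C K by (subst convolve_superset[of _ B C]) auto
    also have "... = (\<Oplus>\<^bsub>K\<^esub>w\<in>?Z B z. c \<otimes>\<^bsub>K\<^esub> (f (fst w) \<otimes>\<^bsub>K\<^esub> g (snd w)))"
     by (rule finsum_cong') (use c B C in "auto simp: m_assoc")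
    finally show "convolve K m (c \<odot>\<^bsub>free_module K S\<^esub> f) g z = (c \<odot>\<^bsub>free_module K U\<^esub> convolve K m f g) z"
     using c B C by (simp add: eq finsum_rdistr Pi_def)
   qed }
  fix f' assume f': "f' \<in> carrier (free_module K S)"
  obtain B' where B': "finite B'" "B' \<subseteq> S" "\<And>x. f' x \<in> carrier K" "\<And>x. x \<notin> B' ==> f' x = \<zero>\<^bsub>K\<^esub>"
   using f' by (rule free_moduleE) blast
  show "convolve K m (f \<oplus>\<^bsub>free_module K S\<^esub> f') g = convolve K m f g \<oplus>\<^bsub>free_module K U\<^esub> convolve K m f' g"
  proof
   fix z
   let ?Y = "?Z (B \<union> B') z"
   have "convolve K m (f \<oplus>\<^bsub>free_module K S\<^esub> f') g z = (\<Oplus>\<^bsub>K\<^esub>w\<in>?Y. (f (fst w) \<oplus>\<^bsub>K\<^esub> f' (fst w)) \<otimes>\<^bsub>K\<^esub> g (snd w))"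
    using B B' C K by (subst convolve_superset[of _ "B \<union> B'" C]) auto
   also have "... = (\<Oplus>\<^bsub>K\<^esub>w\<in>?Y. f (fst w) \<otimes>\<^bsub>K\<^esub> g (snd w) \<oplus>\<^bsub>K\<^esub> f' (fst w) \<otimes>\<^bsub>K\<^esub> g (snd w))"
    by (rule finsum_cong') (use B B' C in "auto simp: l_distr")
   also have "... = (\<Oplus>\<^bsub>K\<^esub>w\<in>?Y. f (fst w) \<otimes>\<^bsub>K\<^esub> g (snd w)) \<oplus>\<^bsub>K\<^esub> (\<Oplus>\<^bsub>K\<^esub>w\<in>?Y. f' (fst w) \<otimes>\<^bsub>K\<^esub> g (snd w))"
    by (rule finsum_addf) (use B B' C in auto)
   also have "... = convolve K m f g z \<oplus>\<^bsub>K\<^esub> convolve K m f' g z"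
    using B B' C K by (subst (1 2) convolve_superset[of _ "B \<union> B'" C]) auto
   finally show "convolve K m (f \<oplus>\<^bsub>free_module K S\<^esub> f') g z =
    (convolve K m f g \<oplus>\<^bsub>free_module K U\<^esub> convolve K m f' g) z"
    by simp
  qed
 qed
qed

lemma linear_convolve_right:
 assumes K: "cring K" and m: "\<And>x y z. x \<in> S ==> y \<in> T ==> m x y = Some z ==> z \<in> U"
  and f: "f \<in> carrier (free_module K S)"
 shows "linear_map K (free_module K T) (free_module K U) (\<lambda>g. convolve K m f g)"
proof -
 interpret linear_map K "free_module K T" "free_module K U" "\<lambda>g. convolve K (\<lambda>x y. m y x) g f"
  by (rule linear_convolve_left[OF K _ f]) (use m in blast)
 have eq: "convolve K m f g = convolve K (\<lambda>x y. m y x) g f" if "g \<in> carrier (free_module K T)" for g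
  by (rule convolve_swap) (use K f that in "auto simp: free_module_carrier")
 show ?thesis
  by unfold_locales (use closed add smult in "auto simp: eq M.M.a_closed[simplified] M.smult_closed[simplified]")
qed

lemma convolve_single:
 assumes "cring K"
 shows "convolve K m (single K x) (single K y) =
  (case m x y of None => (\<lambda>z. \<zero>\<^bsub>K\<^esub>) | Some z => single K z)"
proof
 interpret cring K by fact
 fix z
 have "convolve K m (single K x) (single K y) z =
  (\<Oplus>\<^bsub>K\<^esub>w\<in>{w \<in> {x} \<times> {y}. m (fst w) (snd w) = Some z}. single K x (fst w) \<otimes>\<^bsub>K\<^esub> single K y (snd w))"
  by (rule convolve_superset) (use assms in "auto simp: single_def")
 also have "{w \<in> {x} \<times> {y}. m (fst w) (snd w) = Some z} = (if m x y = Some z then {(x, y)} else {})"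
  by auto
 also have "(\<Oplus>\<^bsub>K\<^esub>w\<in>(if m x y = Some z then {(x, y)} else {}). single K x (fst w) \<otimes>\<^bsub>K\<^esub> single K y (snd w))
   = (case m x y of None => (\<lambda>z. \<zero>\<^bsub>K\<^esub>) | Some z => single K z) z"
  by (auto simp: finsum_insert single_def split: option.split)
 finally show "convolve K m (single K x) (single K y) z =
  (case m x y of None => (\<lambda>z. \<zero>\<^bsub>K\<^esub>) | Some z => single K z) z" .
qed

section \<open>Quotients\<close>

lemma (in Module.module) abelian_subgroup_submodule:
 assumes "submodule N R M" shows "abelian_subgroup N M"
 by (intro abelian_subgroupI3 additive_subgroup.intro submodule.axioms(1)[OF assms] M.abelian_group_axioms)

lemma quot_simps [simp]:
 "carrier (quot M N) = a_rcosets\<^bsub>M\<^esub> N"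
 "zero (quot M N) = N"
 "add (quot M N) = set_add M"
 "mult (quot M N) = rcoset_mult M N"
 "one (quot M N) = N +>\<^bsub>M\<^esub> \<one>\<^bsub>M\<^esub>"
 "smult (quot M N) = (\<lambda>c X. \<Union>x\<in>X. N +>\<^bsub>M\<^esub> (c \<odot>\<^bsub>M\<^esub> x))"
 by (simp_all add: quot_def ring.extend_def module.fields_def FactRing_def)

lemma UN_const_eq: "X \<noteq> {} ==> (\<And>f. f \<in> X ==> F f = c) ==> (\<Union>f\<in>X. F f) = c"
 by auto

text \<open>The map that \<open>h\<close> induces on a quotient; meaningful if \<open>h\<close> is constant on cosets.\<close>

definition coset_lift :: "('m => 'n) => 'm set => 'n" where
 "coset_lift h X = h (SOME x. x \<in> X)"

locale quotient_module = Module.module K M for K :: "'k ring" and M :: "('k, 'm, 'z) module_scheme" +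
 fixes N assumes sub: "submodule N K M"
begin

sublocale S: abelian_subgroup N M by (rule abelian_subgroup_submodule[OF sub])

lemma coset_eq_iff:
 assumes "x \<in> carrier M" "y \<in> carrier M"
 shows "N +>\<^bsub>M\<^esub> x = N +>\<^bsub>M\<^esub> y \<longleftrightarrow> x \<ominus>\<^bsub>M\<^esub> y \<in> N"
proof -
 have "N +>\<^bsub>M\<^esub> x = N +>\<^bsub>M\<^esub> y \<longleftrightarrow> x \<in> N +>\<^bsub>M\<^esub> y"
  using assms S.a_repr_independence' S.a_rcos_self by metis
 then show ?thesis using S.a_rcos_module[OF assms(2,1)] by (simp add: a_minus_def)
qed

lemma mem_coset_iff:
 assumes "x \<in> carrier M"
 shows "y \<in> N +>\<^bsub>M\<^esub> x \<longleftrightarrow> y \<in> carrier M \<and> y \<ominus>\<^bsub>M\<^esub> x \<in> N"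
 using S.a_rcos_module[OF assms] S.a_elemrcos_carrier[OF assms]
 by (auto simp: a_minus_def)

lemma coset_closed: "x \<in> carrier M ==> N +>\<^bsub>M\<^esub> x \<in> carrier (quot M N)"
 by (simp add: M.a_rcosetsI S.a_subset)

lemma quotE:
 assumes "X \<in> carrier (quot M N)"
 obtains x where "x \<in> carrier M" "X = N +>\<^bsub>M\<^esub> x"
 using assms by (auto simp: A_RCOSETS_def')

lemma coset_add: "[|x \<in> carrier M; y \<in> carrier M|] ==>
  N +>\<^bsub>M\<^esub> (x \<oplus>\<^bsub>M\<^esub> y) = (N +>\<^bsub>M\<^esub> x) \<oplus>\<^bsub>quot M N\<^esub> (N +>\<^bsub>M\<^esub> y)"
 by (simp add: S.a_rcos_sum)

lemma coset_smult:
 assumes c: "c \<in> carrier K" and x: "x \<in> carrier M"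
 shows "N +>\<^bsub>M\<^esub> (c \<odot>\<^bsub>M\<^esub> x) = c \<odot>\<^bsub>quot M N\<^esub> (N +>\<^bsub>M\<^esub> x)"
proof -
 have "N +>\<^bsub>M\<^esub> (c \<odot>\<^bsub>M\<^esub> y) = N +>\<^bsub>M\<^esub> (c \<odot>\<^bsub>M\<^esub> x)" if "y \<in> N +>\<^bsub>M\<^esub> x" for y
 proof -
  have y: "y \<in> carrier M" "y \<ominus>\<^bsub>M\<^esub> x \<in> N" using that x by (auto simp: mem_coset_iff)
  have "c \<odot>\<^bsub>M\<^esub> y \<ominus>\<^bsub>M\<^esub> c \<odot>\<^bsub>M\<^esub> x = c \<odot>\<^bsub>M\<^esub> (y \<ominus>\<^bsub>M\<^esub> x)"
   using c x y by (simp add: a_minus_def smult_r_distr smult_r_minus)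
  then show ?thesis using submodule.smult_closed[OF sub c y(2)] c x y by (simp add: coset_eq_iff)
 qed
 with S.a_rcos_self[OF x] show ?thesis
  unfolding quot_simps by (intro UN_const_eq[symmetric]) blast+
qed

lemma coset_zero: "N +>\<^bsub>M\<^esub> \<zero>\<^bsub>M\<^esub> = \<zero>\<^bsub>quot M N\<^esub>"
 by (simp add: M.a_coset_add_zero S.a_subset)

lemma coset_self: "x \<in> N ==> N +>\<^bsub>M\<^esub> x = \<zero>\<^bsub>quot M N\<^esub>"
 using S.a_rcos_const by simp

lemma coset_zero_iff: "x \<in> carrier M ==> N +>\<^bsub>M\<^esub> x = \<zero>\<^bsub>quot M N\<^esub> \<longleftrightarrow> x \<in> N"
 using coset_self S.a_rcos_self[of x] by auto

lemma module_quot: "Module.module K (quot M N)"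
proof (rule moduleI)
 show "cring K" by (rule R.is_cring)
 show "abelian_group (quot M N)"
 proof (rule abelian_groupI)
  fix X assume "X \<in> carrier (quot M N)"
  then obtain x where x: "x \<in> carrier M" "X = N +>\<^bsub>M\<^esub> x" by (rule quotE)
  then have "(N +>\<^bsub>M\<^esub> (\<ominus>\<^bsub>M\<^esub> x)) \<oplus>\<^bsub>quot M N\<^esub> X = \<zero>\<^bsub>quot M N\<^esub>"
   by (simp only: coset_add[symmetric] M.a_inv_closed M.l_neg coset_zero)
  then show "\<exists>Y\<in>carrier (quot M N). Y \<oplus>\<^bsub>quot M N\<^esub> X = \<zero>\<^bsub>quot M N\<^esub>"
   using coset_closed[OF M.a_inv_closed[OF x(1)]] by blast
 qed (auto elim!: quotE simp del: quot_simps
   simp: coset_closed coset_add[symmetric] coset_zero[symmetric] M.a_ac)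
qed (auto elim!: quotE simp del: quot_simps simp: coset_closed coset_add[symmetric] coset_smult[symmetric]
  smult_l_distr smult_r_distr smult_assoc1)

sublocale Q: Module.module K "quot M N" by (rule module_quot)

lemma linear_coset: "linear_map K M (quot M N) (\<lambda>x. N +>\<^bsub>M\<^esub> x)"
 by unfold_locales (simp_all del: quot_simps add: coset_closed coset_add coset_smult)

lemma coset_UN:
 assumes "X \<in> carrier (quot M N)" "x \<in> X"
 shows "x \<in> carrier M" "X = N +>\<^bsub>M\<^esub> x"
 using quotE[OF assms(1)] assms(2) mem_coset_iff coset_eq_iff by metis+

lemma coset_nonempty: "X \<in> carrier (quot M N) ==> \<exists>x. x \<in> X"
 by (metis quotE S.a_rcos_self)

context
 fixes L :: "('k, 'l, 'y) module_scheme" and h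
 assumes h: "linear_map K M L h" and kill: "\<And>x. x \<in> N ==> h x = \<zero>\<^bsub>L\<^esub>"
begin

interpretation h: linear_map K M L h by (rule h)

lemma const_on_coset: "X \<in> carrier (quot M N) ==> x \<in> X ==> y \<in> X ==> h x = h y"
proof -
 assume X: "X \<in> carrier (quot M N)" "x \<in> X" "y \<in> X"
 then have xy: "x \<in> carrier M" "y \<in> carrier M" "x \<ominus>\<^bsub>M\<^esub> y \<in> N"
  using coset_UN[OF X(1)] coset_eq_iff by metis+
 have "h x \<ominus>\<^bsub>L\<^esub> h y = \<zero>\<^bsub>L\<^esub>" using h.minus[OF xy(1,2)] kill[OF xy(3)] by simp
 then show ?thesis using h.N.eq_from_minus xy by blast
qed

lemma coset_lift_eq: "X \<in> carrier (quot M N) ==> x \<in> X ==> coset_lift h X = h x"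
 unfolding coset_lift_def by (rule const_on_coset) (auto intro: someI)

lemma coset_lift_coset: "x \<in> carrier M ==> coset_lift h (N +>\<^bsub>M\<^esub> x) = h x"
 by (rule coset_lift_eq[OF coset_closed]) (auto intro: S.a_rcos_self)

lemma linear_coset_lift: "linear_map K (quot M N) L (coset_lift h)"
 by unfold_locales
  (auto elim!: quotE simp del: quot_simps simp: coset_lift_coset coset_add[symmetric] coset_smult[symmetric]
   h.add h.smult)

end

end

lemma submodule_module_span:
 assumes "Module.module K M" "S \<subseteq> carrier M"
 shows "submodule (module_span K M S) K M" "S \<subseteq> module_span K M S"
proof -
 interpret Module.module K M by fact
 show "S \<subseteq> module_span K M S" by (auto simp: module_span_def)
 have c: "submodule (carrier M) K M" by (rule carrier_is_submodule)
 show "submodule (module_span K M S) K M"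
  unfolding module_span_def
  by (rule submoduleI) (use c assms submoduleE in \<open>auto simp: submodule.axioms(1) intro: subgroup.one_closed[of _ "add_monoid M", simplified] submodule.axioms(1)\<close>)
qed

lemma module_span_subset: "submodule H K M ==> S \<subseteq> H ==> module_span K M S \<subseteq> H"
 by (auto simp: module_span_def)

section \<open>Tensor products\<close>

lemma tuples_Nil [simp]: "xs \<in> tuples [] \<longleftrightarrow> xs = []"
 by (simp add: tuples_def)

lemma tuples_Cons: "xs \<in> tuples (V # Vs) \<longleftrightarrow> (\<exists>y ys. xs = y # ys \<and> y \<in> carrier V \<and> ys \<in> tuples Vs)"
 by (auto simp: tuples_def list_all2_Cons2)

lemma Cons_tuples [simp]: "x # xs \<in> tuples (V # Vs) \<longleftrightarrow> x \<in> carrier V \<and> xs \<in> tuples Vs"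
 by (auto simp: tuples_def)

lemma tuples_append: "xs \<in> tuples Us ==> ys \<in> tuples Vs ==> xs @ ys \<in> tuples (Us @ Vs)"
 by (auto simp: tuples_def intro: list_all2_appendI)

lemma tuples_length: "xs \<in> tuples Vs ==> length xs = length Vs"
 by (auto simp: tuples_def list_all2_lengthD)

lemma tuples_append_iff: "length xs = length Us ==>
  xs @ ys \<in> tuples (Us @ Vs) \<longleftrightarrow> xs \<in> tuples Us \<and> ys \<in> tuples Vs"
 by (auto simp: tuples_def list_all2_append)

lemma tuples_middleE:
 assumes "us @ x # vs \<in> tuples Vs"
 obtains Us V Ws where "Vs = Us @ V # Ws" "us \<in> tuples Us" "x \<in> carrier V" "vs \<in> tuples Ws"
  "length us = length Us" "Vs ! length us = V"
 using assms
 by (auto simp: tuples_def list_all2_append1 list_all2_Cons1 nth_append dest: list_all2_lengthD)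

definition multilinear ::
 "'k ring => ('k, 'm, 'z) module_scheme list => ('k, 'n, 'y) module_scheme => ('m list => 'n) => bool" where
 "multilinear K Vs L g \<longleftrightarrow> (\<forall>xs\<in>tuples Vs. g xs \<in> carrier L) \<and>
   (\<forall>us vs x y. us @ x # vs \<in> tuples Vs --> us @ y # vs \<in> tuples Vs -->
    g (us @ (x \<oplus>\<^bsub>Vs ! length us\<^esub> y) # vs) = g (us @ x # vs) \<oplus>\<^bsub>L\<^esub> g (us @ y # vs)) \<and>
   (\<forall>us vs c x. us @ x # vs \<in> tuples Vs --> c \<in> carrier K -->
    g (us @ (c \<odot>\<^bsub>Vs ! length us\<^esub> x) # vs) = c \<odot>\<^bsub>L\<^esub> g (us @ x # vs))"

lemma multilinearI:
 assumes "\<And>xs. xs \<in> tuples Vs ==> g xs \<in> carrier L"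
  and "\<And>Us V Ws us vs x y. [|Vs = Us @ V # Ws; us \<in> tuples Us; x \<in> carrier V; y \<in> carrier V; vs \<in> tuples Ws;
    length us = length Us|] ==>
    g (us @ (x \<oplus>\<^bsub>V\<^esub> y) # vs) = g (us @ x # vs) \<oplus>\<^bsub>L\<^esub> g (us @ y # vs)"
  and "\<And>Us V Ws us vs c x. [|Vs = Us @ V # Ws; us \<in> tuples Us; x \<in> carrier V; vs \<in> tuples Ws;
    length us = length Us; c \<in> carrier K|] ==>
    g (us @ (c \<odot>\<^bsub>V\<^esub> x) # vs) = c \<odot>\<^bsub>L\<^esub> g (us @ x # vs)"
 shows "multilinear K Vs L g"
 unfolding multilinear_def
proof (intro conjI allI impI ballI)
 fix us vs x y assume a: "us @ x # vs \<in> tuples Vs" "us @ y # vs \<in> tuples Vs"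
 from a(1) obtain Us V Ws where *: "Vs = Us @ V # Ws" "us \<in> tuples Us" "x \<in> carrier V" "vs \<in> tuples Ws"
  "length us = length Us" "Vs ! length us = V" by (rule tuples_middleE)
 then have "y \<in> carrier V" using a(2) by (simp add: tuples_append_iff)
 with * show "g (us @ (x \<oplus>\<^bsub>Vs ! length us\<^esub> y) # vs) = g (us @ x # vs) \<oplus>\<^bsub>L\<^esub> g (us @ y # vs)"
  using assms(2) by metis
next
 fix us vs c x assume a: "us @ x # vs \<in> tuples Vs" "c \<in> carrier K"
 from a(1) obtain Us V Ws where *: "Vs = Us @ V # Ws" "us \<in> tuples Us" "x \<in> carrier V" "vs \<in> tuples Ws"
  "length us = length Us" "Vs ! length us = V" by (rule tuples_middleE)
 then show "g (us @ (c \<odot>\<^bsub>Vs ! length us\<^esub> x) # vs) = c \<odot>\<^bsub>L\<^esub> g (us @ x # vs)"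
  using assms(3) a(2) by metis
qed (rule assms(1))

lemma multilinearD:
 assumes "multilinear K Vs L g"
 shows "xs \<in> tuples Vs ==> g xs \<in> carrier L"
  and "[|us @ x # vs \<in> tuples Vs; us @ y # vs \<in> tuples Vs; V = Vs ! length us|] ==>
    g (us @ (x \<oplus>\<^bsub>V\<^esub> y) # vs) = g (us @ x # vs) \<oplus>\<^bsub>L\<^esub> g (us @ y # vs)"
  and "[|us @ x # vs \<in> tuples Vs; c \<in> carrier K; V = Vs ! length us|] ==>
    g (us @ (c \<odot>\<^bsub>V\<^esub> x) # vs) = c \<odot>\<^bsub>L\<^esub> g (us @ x # vs)"
 using assms unfolding multilinear_def by auto

locale tensor_product =
 fixes K :: "'k ring" and Vs :: "('k, 'm, 'z) module_scheme list" and E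
 assumes K: "cring K" and modules: "\<And>V. V \<in> set Vs ==> Module.module K V"
  and relation: "E \<subseteq> tuples Vs \<times> tuples Vs"
begin

abbreviation "F == free_module K (tuples Vs)"
abbreviation "T == tensor K Vs E"
abbreviation "ker == tensor_kernel K Vs E"
abbreviation "pure == pure_tensor K Vs E"

sublocale F: Module.module K F by (rule module_free_module[OF K])

lemma single_in: "xs \<in> tuples Vs ==> single K xs \<in> carrier F"
 by (rule single_closed[OF K])

lemma add_in_tuples:
 assumes "us @ x # vs \<in> tuples Vs" "us @ y # vs \<in> tuples Vs"
 shows "us @ (x \<oplus>\<^bsub>Vs ! length us\<^esub> y) # vs \<in> tuples Vs"
proof -
 from assms(1) obtain Us V Ws where *: "Vs = Us @ V # Ws" "us \<in> tuples Us" "x \<in> carrier V" "vs \<in> tuples Ws"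
  "length us = length Us" "Vs ! length us = V" by (rule tuples_middleE)
 interpret V: Module.module K V using modules * by simp
 have "y \<in> carrier V" using assms(2) * by (simp add: tuples_append_iff)
 then show ?thesis using * by (simp add: tuples_append_iff)
qed

lemma smult_in_tuples:
 assumes "us @ x # vs \<in> tuples Vs" "c \<in> carrier K"
 shows "us @ (c \<odot>\<^bsub>Vs ! length us\<^esub> x) # vs \<in> tuples Vs"
proof -
 from assms(1) obtain Us V Ws where *: "Vs = Us @ V # Ws" "us \<in> tuples Us" "x \<in> carrier V" "vs \<in> tuples Ws"
  "length us = length Us" "Vs ! length us = V" by (rule tuples_middleE)
 interpret V: Module.module K V using modules * by simp
 show ?thesis using * assms(2) by (simp add: tuples_append_iff)
qed

lemma relators_closed: "tensor_relators K Vs E \<subseteq> carrier F"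
proof -
 have m: "a \<ominus>\<^bsub>F\<^esub> b \<in> carrier F" if "a \<in> carrier F" "b \<in> carrier F" for a b
  using that by (rule F.M.minus_closed)
 have p: "a \<oplus>\<^bsub>F\<^esub> b \<in> carrier F" if "a \<in> carrier F" "b \<in> carrier F" for a b
  using that by (rule F.M.a_closed)
 show ?thesis unfolding tensor_relators_def Let_def
  using relation
  by (auto simp del: free_module_simps intro!: m p F.smult_closed single_in intro: add_in_tuples smult_in_tuples)
qed

lemma ker_submodule: "submodule ker K F"
 unfolding tensor_kernel_def by (rule submodule_module_span[OF F.module_axioms relators_closed])

sublocale Q: quotient_module K F ker
 by (intro quotient_module.intro F.module_axioms quotient_module_axioms.intro ker_submodule)

lemma T_eq: "T = quot F ker" by (simp add: tensor_def)

lemma module_tensor: "Module.module K T" unfolding T_eq by (rule Q.module_quot)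

lemma pure_eq: "pure xs = ker +>\<^bsub>F\<^esub> single K xs" by (simp add: pure_tensor_def)

lemma coset_relator_eq:
 assumes "a \<in> carrier F" "b \<in> carrier F" "a \<ominus>\<^bsub>F\<^esub> b \<in> tensor_relators K Vs E"
 shows "ker +>\<^bsub>F\<^esub> a = ker +>\<^bsub>F\<^esub> b"
 using assms submodule_module_span(2)[OF F.module_axioms relators_closed] unfolding tensor_kernel_def[symmetric]
 by (subst Q.coset_eq_iff) auto

lemma multilinear_pure: "multilinear K Vs T pure"
 unfolding multilinear_def
proof (intro conjI allI impI ballI)
 show "pure xs \<in> carrier T" if "xs \<in> tuples Vs" for xs
  unfolding pure_eq T_eq by (rule Q.coset_closed[OF single_in[OF that]])
next
 fix us vs x y assume a: "us @ x # vs \<in> tuples Vs" "us @ y # vs \<in> tuples Vs"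
 have "ker +>\<^bsub>F\<^esub> single K (us @ (x \<oplus>\<^bsub>Vs ! length us\<^esub> y) # vs) =
  ker +>\<^bsub>F\<^esub> (single K (us @ x # vs) \<oplus>\<^bsub>F\<^esub> single K (us @ y # vs))"
  by (rule coset_relator_eq[OF single_in[OF add_in_tuples[OF a]] F.M.a_closed[OF single_in[OF a(1)] single_in[OF a(2)]]])
   (use a in "unfold tensor_relators_def Let_def, blast")
 also have "... = pure (us @ x # vs) \<oplus>\<^bsub>T\<^esub> pure (us @ y # vs)" unfolding pure_eq T_eq
  by (rule Q.coset_add) (rule single_in a)+
 finally show "pure (us @ (x \<oplus>\<^bsub>Vs ! length us\<^esub> y) # vs) = pure (us @ x # vs) \<oplus>\<^bsub>T\<^esub> pure (us @ y # vs)"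
  unfolding pure_eq .
next
 fix us vs c x assume a: "us @ x # vs \<in> tuples Vs" "c \<in> carrier K"
 have "ker +>\<^bsub>F\<^esub> single K (us @ (c \<odot>\<^bsub>Vs ! length us\<^esub> x) # vs) = ker +>\<^bsub>F\<^esub> (c \<odot>\<^bsub>F\<^esub> single K (us @ x # vs))"
  by (rule coset_relator_eq[OF single_in[OF smult_in_tuples[OF a]] F.smult_closed[OF a(2) single_in[OF a(1)]]])
   (use a in "unfold tensor_relators_def Let_def, blast")
 also have "... = c \<odot>\<^bsub>T\<^esub> pure (us @ x # vs)" unfolding pure_eq T_eq
  by (rule Q.coset_smult) (rule single_in a)+
 finally show "pure (us @ (c \<odot>\<^bsub>Vs ! length us\<^esub> x) # vs) = c \<odot>\<^bsub>T\<^esub> pure (us @ x # vs)"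
  unfolding pure_eq .
qed

lemmas pure_closed = multilinearD(1)[OF multilinear_pure]
 and pure_add = multilinearD(2)[OF multilinear_pure]
 and pure_smult = multilinearD(3)[OF multilinear_pure]

lemma pure_balanced: "(xs, ys) \<in> E ==> pure xs = pure ys"
 unfolding pure_eq
 by (rule coset_relator_eq) (use relation in "auto simp del: free_module_simps intro: single_in simp: tensor_relators_def Let_def")

lemma tensor_induct_smult [consumes 1, case_names zero pure add smult]:
 assumes X: "X \<in> carrier T" and z: "P \<zero>\<^bsub>T\<^esub>" and p: "\<And>xs. xs \<in> tuples Vs ==> P (pure xs)"
  and a: "\<And>X Y. [|X \<in> carrier T; Y \<in> carrier T; P X; P Y|] ==> P (X \<oplus>\<^bsub>T\<^esub> Y)"
  and s: "\<And>c X. [|c \<in> carrier K; X \<in> carrier T; P X|] ==> P (c \<odot>\<^bsub>T\<^esub> X)"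
 shows "P X"
proof -
 from X obtain f where f: "f \<in> carrier F" and X: "X = ker +>\<^bsub>F\<^esub> f" unfolding T_eq by (rule Q.quotE)
 from K f have "P (ker +>\<^bsub>F\<^esub> f)"
 proof (induction rule: free_module_induct)
  case zero
  then show ?case using z unfolding T_eq Q.coset_zero .
 next
  case (single x)
  then show ?case using p unfolding pure_eq by blast
 next
  case (add f g)
  then show ?case using a[unfolded T_eq, OF Q.coset_closed Q.coset_closed] by (simp only: Q.coset_add)
 next
  case (smult c f)
  then show ?case using s[unfolded T_eq, OF _ Q.coset_closed] by (simp only: Q.coset_smult)
 qed
 then show ?thesis unfolding X .
qed

text \<open>A scalar can be absorbed into the first factor of a pure tensor, so for a nonempty list of modules the
 property need not be closed under scalars.\<close>

lemma tensor_induct [consumes 2, case_names zero pure add]: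
 assumes X: "X \<in> carrier T" and ne: "Vs \<noteq> []" and z: "P \<zero>\<^bsub>T\<^esub>"
  and p: "\<And>xs. xs \<in> tuples Vs ==> P (pure xs)"
  and a: "\<And>X Y. [|X \<in> carrier T; Y \<in> carrier T; P X; P Y|] ==> P (X \<oplus>\<^bsub>T\<^esub> Y)"
 shows "P X"
proof -
 interpret T: Module.module K T by (rule module_tensor)
 from X have "\<forall>c\<in>carrier K. P (c \<odot>\<^bsub>T\<^esub> X)"
 proof (induction rule: tensor_induct_smult)
  case (pure xs)
  show ?case
  proof
   fix c assume c: "c \<in> carrier K"
   obtain x vs where xs: "xs = x # vs" using pure ne by (cases xs; cases Vs) (auto simp: tuples_def)
   have "pure ([] @ (c \<odot>\<^bsub>Vs ! 0\<^esub> x) # vs) = c \<odot>\<^bsub>T\<^esub> pure ([] @ x # vs)"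
    by (rule pure_smult) (use pure xs c in auto)
   moreover have "(c \<odot>\<^bsub>Vs ! 0\<^esub> x) # vs \<in> tuples Vs"
    using smult_in_tuples[of "[]" x vs c] pure xs c by simp
   ultimately show "P (c \<odot>\<^bsub>T\<^esub> pure xs)" using p xs by (metis append_Nil)
  qed
 next
  case (smult c X)
  then show ?case by (metis F.R.m_closed T.smult_assoc1)
 qed (use z a in "auto simp: T.smult_r_distr")
 then show ?thesis using X by (metis F.R.one_closed T.smult_one)
qed

text \<open>Each kind of relator measures the failure of multilinearity or of the identifications \<open>E\<close>, so the linear
 extension of a balanced multilinear map kills them and their span.\<close>

lemma lin_ker:
 assumes L: "Module.module K L" and g: "multilinear K Vs L g" and E: "\<And>xs ys. (xs, ys) \<in> E ==> g xs = g ys"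
  and f: "f \<in> ker"
 shows "lin K L g f = \<zero>\<^bsub>L\<^esub>"
proof -
 interpret lin: linear_map K F L "lin K L g" by (rule linear_lin[OF L]) (rule multilinearD(1)[OF g])
 have gs: "lin K L g (single K xs) = g xs" if "xs \<in> tuples Vs" for xs
  by (rule lin_single[OF L]) (rule multilinearD(1)[OF g that])
 have z: "lin K L g (a \<ominus>\<^bsub>F\<^esub> b) = \<zero>\<^bsub>L\<^esub>" if "a \<in> carrier F" "b \<in> carrier F" "lin K L g a = lin K L g b" for a b
  using lin.minus[OF that(1,2)] that lin.N.M.r_neg by (simp add: a_minus_def del: free_module_simps)
 have "tensor_relators K Vs E \<subseteq> {f \<in> carrier F. lin K L g f = \<zero>\<^bsub>L\<^esub>}"
 proof -
  have 1: "lin K L g (single K (us @ (x \<oplus>\<^bsub>Vs ! length us\<^esub> y) # vs)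
    \<ominus>\<^bsub>F\<^esub> (single K (us @ x # vs) \<oplus>\<^bsub>F\<^esub> single K (us @ y # vs))) = \<zero>\<^bsub>L\<^esub>"
   if a: "us @ x # vs \<in> tuples Vs" "us @ y # vs \<in> tuples Vs" for us vs x y
   by (rule z[OF single_in[OF add_in_tuples[OF a]] F.M.a_closed[OF single_in[OF a(1)] single_in[OF a(2)]]])
    (simp only: lin.add[OF single_in[OF a(1)] single_in[OF a(2)]] gs a add_in_tuples[OF a] multilinearD(2)[OF g a refl])
  have 2: "lin K L g (single K (us @ (c \<odot>\<^bsub>Vs ! length us\<^esub> x) # vs)
    \<ominus>\<^bsub>F\<^esub> (c \<odot>\<^bsub>F\<^esub> single K (us @ x # vs))) = \<zero>\<^bsub>L\<^esub>"
   if a: "us @ x # vs \<in> tuples Vs" "c \<in> carrier K" for us vs c x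
   by (rule z[OF single_in[OF smult_in_tuples[OF a]] F.smult_closed[OF a(2) single_in[OF a(1)]]])
    (simp only: lin.smult[OF a(2) single_in[OF a(1)]] gs a smult_in_tuples[OF a] multilinearD(3)[OF g a refl])
  have 3: "lin K L g (single K xs \<ominus>\<^bsub>F\<^esub> single K ys) = \<zero>\<^bsub>L\<^esub>" if "(xs, ys) \<in> E" for xs ys
  proof -
   have xy: "xs \<in> tuples Vs" "ys \<in> tuples Vs" using that relation by auto
   show ?thesis by (rule z) (simp_all only: single_in gs xy E[OF that])
  qed
  have "lin K L g r = \<zero>\<^bsub>L\<^esub>" if "r \<in> tensor_relators K Vs E" for r
   using that unfolding tensor_relators_def Let_def using 1 2 3 by (elim UnE) blast+
  then show ?thesis using relators_closed by auto
 qed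
 then show ?thesis using module_span_subset[OF lin.kernel_submodule] f unfolding tensor_kernel_def by blast
qed

context
 fixes L :: "('k, 'l, 'y) module_scheme" and g
 assumes L: "Module.module K L" and g: "multilinear K Vs L g"
  and E: "\<And>xs ys. (xs, ys) \<in> E ==> g xs = g ys"
begin

text \<open>The universal property of the tensor product.\<close>

lemma linear_lin_g: "linear_map K F L (lin K L g)"
 by (rule linear_lin[OF L]) (rule multilinearD(1)[OF g])

lemma linear_tensor_lift: "linear_map K T L (coset_lift (lin K L g))"
 unfolding T_eq by (rule Q.linear_coset_lift[OF linear_lin_g lin_ker[OF L g E]])

lemma tensor_lift_pure: "xs \<in> tuples Vs ==> coset_lift (lin K L g) (pure xs) = g xs"
 unfolding pure_eq
 by (subst Q.coset_lift_coset[OF linear_lin_g lin_ker[OF L g E] single_in])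
  (auto intro!: lin_single L multilinearD(1)[OF g])

lemma tensor_lift_eq: "X \<in> carrier T ==> f \<in> X ==> coset_lift (lin K L g) X = lin K L g f"
 unfolding T_eq by (rule Q.coset_lift_eq[OF linear_lin_g lin_ker[OF L g E]])

end

end

section \<open>Homomorphisms and quotients of algebras\<close>

lemma module_cong:
 assumes "Module.module K M" "carrier N = carrier M" "zero N = zero M" "add N = add M" "smult N = smult M"
 shows "Module.module K N"
proof -
 interpret Module.module K M by fact
 show ?thesis
 proof (rule moduleI)
  show "abelian_group N"
   by (rule abelian_groupI) (use assms M.l_neg M.a_inv_closed in "auto simp: M.a_ac intro!: bexI")
 qed (simp_all add: assms smult_l_distr smult_r_distr smult_assoc1 R.is_cring)
qed

lemma assoc_algebraI:
 assumes "field K" "Module.module K A"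
  and "\<And>x y. [|x \<in> carrier A; y \<in> carrier A|] ==> x \<otimes>\<^bsub>A\<^esub> y \<in> carrier A"
  and "\<one>\<^bsub>A\<^esub> \<in> carrier A"
  and "\<And>x y z. [|x \<in> carrier A; y \<in> carrier A; z \<in> carrier A|] ==> (x \<otimes>\<^bsub>A\<^esub> y) \<otimes>\<^bsub>A\<^esub> z = x \<otimes>\<^bsub>A\<^esub> (y \<otimes>\<^bsub>A\<^esub> z)"
  and "\<And>x. x \<in> carrier A ==> \<one>\<^bsub>A\<^esub> \<otimes>\<^bsub>A\<^esub> x = x" "\<And>x. x \<in> carrier A ==> x \<otimes>\<^bsub>A\<^esub> \<one>\<^bsub>A\<^esub> = x"
  and "\<And>x. x \<in> carrier A ==> linear_map K A A (\<lambda>y. x \<otimes>\<^bsub>A\<^esub> y)"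
  and "\<And>y. y \<in> carrier A ==> linear_map K A A (\<lambda>x. x \<otimes>\<^bsub>A\<^esub> y)"
 shows "assoc_algebra K A"
proof -
 interpret field K by fact
 interpret A: Module.module K A by fact
 have "ring A"
  by (intro ringI A.M.abelian_group_axioms monoidI assms)
   (simp_all add: linear_map.add[OF assms(8)] linear_map.add[OF assms(9)])
 then show ?thesis
  by (intro assoc_algebra.intro assoc_algebra_axioms.intro assms)
   (simp_all add: linear_map.smult[OF assms(8)] linear_map.smult[OF assms(9)])
qed

context assoc_algebra
begin

lemma cring_base: "cring K" ..

lemma linear_mult_left: "y \<in> carrier A ==> linear_map K A A (\<lambda>x. x \<otimes>\<^bsub>A\<^esub> y)"
 by unfold_locales (auto simp: alg.l_distr smult_mult_left)

lemma linear_mult_right: "x \<in> carrier A ==> linear_map K A A (\<lambda>y. x \<otimes>\<^bsub>A\<^esub> y)"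
 by unfold_locales (auto simp: alg.r_distr smult_mult_right)

lemma ideal_submodule:
 assumes "ideal N A" shows "submodule N K A"
proof -
 interpret N: ideal N A by fact
 show ?thesis
 proof (rule vec.submoduleI)
  fix c x assume c: "c \<in> carrier K" and x: "x \<in> N"
  have "(c \<odot>\<^bsub>A\<^esub> \<one>\<^bsub>A\<^esub>) \<otimes>\<^bsub>A\<^esub> x = c \<odot>\<^bsub>A\<^esub> x"
   using c x by (simp add: smult_mult_left N.a_Hcarr)
  then show "c \<odot>\<^bsub>A\<^esub> x \<in> N" using N.I_l_closed[OF x, of "c \<odot>\<^bsub>A\<^esub> \<one>\<^bsub>A\<^esub>"] c by simp
 qed (use N.a_subset in auto)
qed

end

locale quotient_algebra = assoc_algebra K A for K and A :: "('k, 'a) module" +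
 fixes N assumes ideal: "ideal N A"
begin

sublocale quotient_module K A N
 by (intro quotient_module.intro vec.module_axioms quotient_module_axioms.intro ideal_submodule ideal)

interpretation I: ideal N A by (rule ideal)

lemma coset_mult: "[|x \<in> carrier A; y \<in> carrier A|] ==>
  N +>\<^bsub>A\<^esub> (x \<otimes>\<^bsub>A\<^esub> y) = (N +>\<^bsub>A\<^esub> x) \<otimes>\<^bsub>quot A N\<^esub> (N +>\<^bsub>A\<^esub> y)"
 by (simp add: I.rcoset_mult_add)

lemma coset_one: "N +>\<^bsub>A\<^esub> \<one>\<^bsub>A\<^esub> = \<one>\<^bsub>quot A N\<^esub>"
 by simp

lemma algebra_quot: "assoc_algebra K (quot A N)"
proof (rule assoc_algebraI)
 show "field K" ..
 show "Module.module K (quot A N)" by (rule module_quot)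
 show "linear_map K (quot A N) (quot A N) (\<lambda>Y. X \<otimes>\<^bsub>quot A N\<^esub> Y)"
  and "linear_map K (quot A N) (quot A N) (\<lambda>Y. Y \<otimes>\<^bsub>quot A N\<^esub> X)" if X: "X \<in> carrier (quot A N)" for X
  using X by (unfold_locales; auto elim!: quotE simp del: quot_simps
    simp: coset_closed coset_add[symmetric] coset_smult[symmetric] coset_mult[symmetric]
     alg.l_distr alg.r_distr smult_mult_left smult_mult_right)+
qed (auto elim!: quotE simp del: quot_simps
   simp: coset_closed coset_one[symmetric] coset_mult[symmetric] alg.m_assoc)

sublocale Q: assoc_algebra K "quot A N" by (rule algebra_quot)

end

locale algebra_hom = A: assoc_algebra K A + B: assoc_algebra K B
 for K and A :: "('k, 'a) module" and B :: "('k, 'b) module" +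
 fixes h
 assumes hom_closed [simp, intro]: "x \<in> carrier A ==> h x \<in> carrier B"
  and hom_add: "[|x \<in> carrier A; y \<in> carrier A|] ==> h (x \<oplus>\<^bsub>A\<^esub> y) = h x \<oplus>\<^bsub>B\<^esub> h y"
  and hom_smult: "[|c \<in> carrier K; x \<in> carrier A|] ==> h (c \<odot>\<^bsub>A\<^esub> x) = c \<odot>\<^bsub>B\<^esub> h x"
  and hom_mult: "[|x \<in> carrier A; y \<in> carrier A|] ==> h (x \<otimes>\<^bsub>A\<^esub> y) = h x \<otimes>\<^bsub>B\<^esub> h y"
  and hom_one: "h \<one>\<^bsub>A\<^esub> = \<one>\<^bsub>B\<^esub>"
begin

sublocale linear_map K A B h
 by unfold_locales (simp_all add: hom_add hom_smult)

lemma kernel_ideal: "ideal {x \<in> carrier A. h x = \<zero>\<^bsub>B\<^esub>} A"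
proof (rule idealI)
 show "subgroup {x \<in> carrier A. h x = \<zero>\<^bsub>B\<^esub>} (add_monoid A)"
  by (rule submodule.axioms(1)[OF kernel_submodule])
qed (auto simp: hom_mult A.alg.ring_axioms)

lemma preimage_ideal:
 assumes "ideal J B" shows "ideal {x \<in> carrier A. h x \<in> J} A"
proof -
 interpret J: ideal J B by fact
 show ?thesis
 proof (rule idealI)
  show "subgroup {x \<in> carrier A. h x \<in> J} (add_monoid A)"
   by (rule submodule.axioms(1), rule A.vec.submoduleI)
    (use zero submodule.smult_closed[OF B.ideal_submodule[OF assms]] in "auto simp: add a_inv smult")
 qed (auto simp: hom_mult A.alg.ring_axioms J.I_l_closed J.I_r_closed)
qed

lemma genideal_kernel:
 assumes "S \<subseteq> carrier A" "\<And>x. x \<in> S ==> h x = \<zero>\<^bsub>B\<^esub>" "x \<in> Idl\<^bsub>A\<^esub> S"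
 shows "h x = \<zero>\<^bsub>B\<^esub>"
 using A.alg.genideal_minimal[OF kernel_ideal, of S] assms by auto

text \<open>The first isomorphism theorem: the induced map takes a coset to the value at a representative, and the kernel
 condition says both that this is well defined and that it is injective.\<close>

lemma isomorphic_quot:
 assumes surj: "h ` carrier A = carrier B" and N: "N = {x \<in> carrier A. h x = \<zero>\<^bsub>B\<^esub>}"
 shows "alg_isomorphic K B (quot A N)"
proof -
 have idl: "ideal N A" unfolding N by (rule kernel_ideal)
 interpret quotient_algebra K A N
  by (intro quotient_algebra.intro quotient_algebra_axioms.intro A.assoc_algebra_axioms idl)
 define s where "s b = (SOME x. x \<in> carrier A \<and> h x = b)" for b
 have s: "s b \<in> carrier A" "h (s b) = b" if "b \<in> carrier B" for b
 proof -
  have "\<exists>x. x \<in> carrier A \<and> h x = b" using that unfolding surj[symmetric] by auto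
  from someI_ex[OF this] show "s b \<in> carrier A" "h (s b) = b" unfolding s_def by simp_all
 qed
 define g where "g b = N +>\<^bsub>A\<^esub> s b" for b
 have gh: "g (h x) = N +>\<^bsub>A\<^esub> x" if x: "x \<in> carrier A" for x
 proof -
  have "s (h x) \<ominus>\<^bsub>A\<^esub> x \<in> N"
   unfolding N using s[of "h x"] x minus[of "s (h x)" x] by (simp add: a_minus_def B.alg.r_neg)
  then show ?thesis unfolding g_def using s[of "h x"] x by (simp add: coset_eq_iff)
 qed
 have ex: "\<exists>x\<in>carrier A. b = h x" if "b \<in> carrier B" for b using that surj by auto
 have "g \<in> ring_hom B (quot A N)"
 proof (rule ring_hom_memI)
  fix b c assume b: "b \<in> carrier B" and c: "c \<in> carrier B"
  obtain x y where xy: "x \<in> carrier A" "b = h x" "y \<in> carrier A" "c = h y"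
   using ex[OF b] ex[OF c] by blast
  show "g (b \<otimes>\<^bsub>B\<^esub> c) = g b \<otimes>\<^bsub>quot A N\<^esub> g c"
   unfolding xy hom_mult[OF xy(1,3), symmetric] gh[OF A.alg.m_closed[OF xy(1,3)]] gh[OF xy(1)] gh[OF xy(3)]
   by (rule coset_mult[OF xy(1,3)])
  show "g (b \<oplus>\<^bsub>B\<^esub> c) = g b \<oplus>\<^bsub>quot A N\<^esub> g c"
   unfolding xy hom_add[OF xy(1,3), symmetric] gh[OF A.alg.a_closed[OF xy(1,3)]] gh[OF xy(1)] gh[OF xy(3)]
   by (rule coset_add[OF xy(1,3)])
 next
  fix b assume "b \<in> carrier B"
  then show "g b \<in> carrier (quot A N)" unfolding g_def by (intro coset_closed s)
 next
  show "g \<one>\<^bsub>B\<^esub> = \<one>\<^bsub>quot A N\<^esub>"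
   unfolding hom_one[symmetric] gh[OF A.alg.one_closed] by (rule coset_one)
 qed
 moreover have "g (c \<odot>\<^bsub>B\<^esub> b) = c \<odot>\<^bsub>quot A N\<^esub> g b" if c: "c \<in> carrier K" and b: "b \<in> carrier B" for c b
 proof -
  obtain x where x: "x \<in> carrier A" "b = h x" using ex[OF b] by blast
  show ?thesis
   unfolding x hom_smult[OF c x(1), symmetric] gh[OF A.vec.smult_closed[OF c x(1)]] gh[OF x(1)]
   by (rule coset_smult[OF c x(1)])
 qed
 moreover have "bij_betw g (carrier B) (carrier (quot A N))"
  proof (rule bij_betwI')
   fix b c assume bc: "b \<in> carrier B" "c \<in> carrier B"
   obtain x y where xy: "x \<in> carrier A" "b = h x" "y \<in> carrier A" "c = h y"
    using ex[OF bc(1)] ex[OF bc(2)] by blast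
   have "g b = g c ==> b = c"
    unfolding xy gh[OF xy(1)] gh[OF xy(3)] coset_eq_iff[OF xy(1,3)] unfolding N
    using minus[OF xy(1,3)] B.vec.eq_from_minus xy by auto
   then show "g b = g c \<longleftrightarrow> b = c" by blast
  next
   fix b assume "b \<in> carrier B"
   then show "g b \<in> carrier (quot A N)" unfolding g_def by (intro coset_closed s)
  next
   fix X assume "X \<in> carrier (quot A N)"
   then obtain x where "x \<in> carrier A" "X = N +>\<^bsub>A\<^esub> x" by (rule quotE)
   then show "\<exists>b\<in>carrier B. X = g b" using gh by blast
  qed
 ultimately have "g \<in> alg_iso K B (quot A N)" unfolding alg_iso_def ring_iso_def by blast
 then show ?thesis by (auto simp: alg_isomorphic_def)
qed

end

lemma (in quotient_algebra) algebra_hom_coset: "algebra_hom K A (quot A N) (\<lambda>x. N +>\<^bsub>A\<^esub> x)"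
 by unfold_locales (simp_all del: quot_simps add: coset_closed coset_add coset_smult coset_mult coset_one)

lemma algebra_hom_comp:
 "algebra_hom K A B g ==> algebra_hom K B C h ==> algebra_hom K A C (\<lambda>x. h (g x))"
 by (auto simp: algebra_hom_def algebra_hom_axioms_def)

text \<open>The image of an ideal under a surjection is an ideal. Hence the preimage of the ideal generated by \<open>h c\<close> is
 generated by \<open>c\<close> and the kernel, and the first isomorphism theorem applies to \<open>h\<close> followed by the quotient map.\<close>

lemma (in algebra_hom) isomorphic_quot_generator:
 assumes surj: "h ` carrier A = carrier B" and S: "S \<subseteq> carrier A"
  and ker: "{x \<in> carrier A. h x = \<zero>\<^bsub>B\<^esub>} = Idl\<^bsub>A\<^esub> S" and c: "c \<in> carrier A"
 shows "alg_isomorphic K (quot B (Idl\<^bsub>B\<^esub> {h c})) (quot A (Idl\<^bsub>A\<^esub> (S \<union> {c})))"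
proof -
 let ?J = "Idl\<^bsub>B\<^esub> {h c}" and ?R = "Idl\<^bsub>A\<^esub> (S \<union> {c})"
 have J: "ideal ?J B" by (rule B.alg.genideal_ideal) (use c in auto)
 have R: "ideal ?R A" by (rule A.alg.genideal_ideal) (use S c in auto)
 interpret Rr: ideal ?R A by (rule R)
 interpret q: quotient_algebra K B ?J
  by (intro quotient_algebra.intro quotient_algebra_axioms.intro B.assoc_algebra_axioms J)
 interpret g: algebra_hom K A "quot B ?J" "\<lambda>x. ?J +>\<^bsub>B\<^esub> h x"
  by (rule algebra_hom_comp[OF algebra_hom_axioms q.algebra_hom_coset])
 show ?thesis
 proof (rule g.isomorphic_quot)
  show "(\<lambda>x. ?J +>\<^bsub>B\<^esub> h x) ` carrier A = carrier (quot B ?J)"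
  proof (intro equalityI subsetI)
   fix X assume "X \<in> carrier (quot B ?J)"
   then obtain b where b: "b \<in> carrier B" "X = ?J +>\<^bsub>B\<^esub> b" by (rule q.quotE)
   from b(1) obtain x where "x \<in> carrier A" "b = h x" unfolding surj[symmetric] by auto
   then show "X \<in> (\<lambda>x. ?J +>\<^bsub>B\<^esub> h x) ` carrier A" using b(2) by blast
  qed (use g.hom_closed in blast)
  have "{x \<in> carrier A. ?J +>\<^bsub>B\<^esub> h x = \<zero>\<^bsub>quot B ?J\<^esub>} = {x \<in> carrier A. h x \<in> ?J}"
   using q.coset_zero_iff by (auto simp del: quot_simps)
  also have "... = ?R"
  proof
   have "S \<union> {c} \<subseteq> {x \<in> carrier A. h x \<in> ?J}"
   proof -
    have "h c \<in> ?J" using B.alg.genideal_self[of "{h c}"] c by auto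
    moreover have "h x \<in> ?J" if "x \<in> S" for x
    proof -
     have "x \<in> Idl\<^bsub>A\<^esub> S" using A.alg.genideal_self[OF S] that by auto
     then have "h x = \<zero>\<^bsub>B\<^esub>" using ker by blast
     then show ?thesis using additive_subgroup.zero_closed[OF ideal.axioms(1)[OF J]] by simp
    qed
    ultimately show ?thesis using S c by auto
   qed
   then show "?R \<subseteq> {x \<in> carrier A. h x \<in> ?J}"
    by (rule A.alg.genideal_minimal[OF preimage_ideal[OF J]])
  next
   have RA: "?R \<subseteq> carrier A" by (rule Rr.a_subset)
   have id: "ideal (h ` ?R) B"
   proof (rule idealI)
    show "subgroup (h ` ?R) (add_monoid B)"
    proof (rule submodule.axioms(1), rule B.vec.submoduleI)
     show "h ` ?R \<subseteq> carrier B" using RA by auto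
     show "\<zero>\<^bsub>B\<^esub> \<in> h ` ?R" using zero Rr.zero_closed by (metis image_eqI)
     fix a assume "a \<in> h ` ?R"
     then obtain x where x: "x \<in> ?R" "a = h x" by auto
     show "\<ominus>\<^bsub>B\<^esub> a \<in> h ` ?R" using x RA a_inv[of x] Rr.a_inv_closed by (metis image_eqI subsetD)
     { fix k assume k: "k \<in> carrier K"
      show "k \<odot>\<^bsub>B\<^esub> a \<in> h ` ?R"
       using x RA smult[OF k, of x] submodule.smult_closed[OF A.ideal_submodule[OF R] k x(1)]
       by (metis image_eqI subsetD) }
     fix b assume "b \<in> h ` ?R"
     then obtain y where y: "y \<in> ?R" "b = h y" by auto
     show "a \<oplus>\<^bsub>B\<^esub> b \<in> h ` ?R" using x y RA add[of x y] Rr.a_closed[of x y] by (metis image_eqI subsetD)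
    qed
   next
    fix a b assume "a \<in> h ` ?R" "b \<in> carrier B"
    then obtain x y where x: "x \<in> ?R" "a = h x" and y: "y \<in> carrier A" "b = h y"
     unfolding surj[symmetric] by blast
    have xA: "x \<in> carrier A" using x RA by auto
    show "b \<otimes>\<^bsub>B\<^esub> a \<in> h ` ?R" using x y hom_mult[OF y(1) xA] Rr.I_l_closed[OF x(1) y(1)] by (metis image_eqI)
    show "a \<otimes>\<^bsub>B\<^esub> b \<in> h ` ?R" using x y hom_mult[OF xA y(1)] Rr.I_r_closed[OF x(1) y(1)] by (metis image_eqI)
   qed (rule B.alg.ring_axioms)
   have "c \<in> ?R" using A.alg.genideal_self[of "S \<union> {c}"] S c by auto
   then have "?J \<subseteq> h ` ?R" by (intro B.alg.genideal_minimal[OF id]) auto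
   then show "{x \<in> carrier A. h x \<in> ?J} \<subseteq> ?R"
   proof safe
    fix x assume x: "x \<in> carrier A" "h x \<in> ?J" and sub: "?J \<subseteq> h ` ?R"
    then obtain y where y: "y \<in> ?R" "h x = h y" by auto
    have yA: "y \<in> carrier A" using y RA by auto
    have "h (x \<ominus>\<^bsub>A\<^esub> y) = \<zero>\<^bsub>B\<^esub>" using minus[OF x(1) yA] y yA by (simp add: a_minus_def B.alg.r_neg)
    then have "x \<ominus>\<^bsub>A\<^esub> y \<in> Idl\<^bsub>A\<^esub> S" using ker x yA by auto
    moreover have "Idl\<^bsub>A\<^esub> S \<subseteq> ?R"
     by (rule A.alg.genideal_minimal[OF R]) (use A.alg.genideal_self[of "S \<union> {c}"] S c in auto)
    ultimately have "(x \<ominus>\<^bsub>A\<^esub> y) \<oplus>\<^bsub>A\<^esub> y \<in> ?R" using y Rr.a_closed by blast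
    then show "x \<in> ?R" using x yA by (simp add: a_minus_def A.alg.a_assoc A.alg.l_neg)
   qed
  qed
  finally show "?R = {x \<in> carrier A. ?J +>\<^bsub>B\<^esub> h x = \<zero>\<^bsub>quot B ?J\<^esub>}" by (rule sym)
 qed
qed

section \<open>Path algebras\<close>

lemma path_algebra_simps [simp]:
 "carrier (path_algebra K Q) = carrier (free_module K (qpaths Q))"
 "zero (path_algebra K Q) = (\<lambda>x. \<zero>\<^bsub>K\<^esub>)"
 "add (path_algebra K Q) = (\<lambda>f g x. f x \<oplus>\<^bsub>K\<^esub> g x)"
 "smult (path_algebra K Q) = (\<lambda>c f x. c \<otimes>\<^bsub>K\<^esub> f x)"
 "mult (path_algebra K Q) = convolve K qpath_comp"
 by (simp_all add: path_algebra_def)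

lemma module_path_algebra: "cring K ==> Module.module K (path_algebra K Q)"
 by (rule module_cong[OF module_free_module]) simp_all

lemma linear_path_algebra_iff:
 "cring K ==> linear_map K (path_algebra K Q) N h \<longleftrightarrow> linear_map K (free_module K (qpaths Q)) N h"
 using module_path_algebra[of K Q] module_free_module[of K "qpaths Q"]
 by (simp add: linear_map_def linear_map_axioms_def)

lemma linear_path_algebra_range_iff:
 "cring K ==> linear_map K N (path_algebra K Q) h \<longleftrightarrow> linear_map K N (free_module K (qpaths Q)) h"
 using module_path_algebra[of K Q] module_free_module[of K "qpaths Q"]
 by (simp add: linear_map_def linear_map_axioms_def)

context wf_digraph
begin

lemma qpaths_Nil [simp]: "(j, [], i) \<in> qpaths G \<longleftrightarrow> j = i \<and> i \<in> verts G"
 by (auto simp: qpaths_def awalk_simps)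

lemma qpaths_Cons [simp]:
 "(j, e # p, i) \<in> qpaths G \<longleftrightarrow> e \<in> arcs G \<and> head G e = j \<and> (tail G e, p, i) \<in> qpaths G"
 by (auto simp: qpaths_def awalk_append_iff awalk_simps)

lemma qpaths_append:
 "(j, p @ q, i) \<in> qpaths G \<longleftrightarrow> (\<exists>k. (j, p, k) \<in> qpaths G \<and> (k, q, i) \<in> qpaths G)"
 by (auto simp: qpaths_def)

lemma qpaths_verts: "(j, p, i) \<in> qpaths G ==> i \<in> verts G \<and> j \<in> verts G"
 by (auto simp: qpaths_def)

lemma qpath_comp_closed: "x \<in> qpaths G ==> y \<in> qpaths G ==> qpath_comp x y = Some z ==> z \<in> qpaths G"
 by (cases x; cases y) (auto simp: qpaths_append split: if_splits)

end

lemma qpath_comp_assoc: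
 "Option.bind (qpath_comp x y) (\<lambda>w. qpath_comp w z) = Option.bind (qpath_comp y z) (\<lambda>w. qpath_comp x w)"
 by (cases x; cases y; cases z) auto

locale finite_quiver = fin_digraph Q + base: field K for K :: "'k ring" and Q :: "('v, 'e) pre_digraph"
begin

abbreviation "kQ == path_algebra K Q"

lemma cring_K: "cring K" ..

lemma single_path: "x \<in> qpaths Q ==> single K x \<in> carrier kQ"
 by (simp add: single_closed[OF cring_K])

lemma linear_path_ext:
 assumes "linear_map K kQ N h" "linear_map K kQ N h'" "\<And>x. x \<in> qpaths Q ==> h (single K x) = h' (single K x)"
  "f \<in> carrier kQ"
 shows "h f = h' f"
 using linear_map_ext[of K "qpaths Q" N h h' f] assms by (simp add: linear_path_algebra_iff[OF cring_K])

lemma mult_paths: "single K x \<otimes>\<^bsub>kQ\<^esub> single K y =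
  (case qpath_comp x y of None => \<zero>\<^bsub>kQ\<^esub> | Some z => single K z)"
 by (cases "qpath_comp x y") (simp_all add: convolve_single[OF cring_K])

lemma linear_mult_path_left: "g \<in> carrier kQ ==> linear_map K kQ kQ (\<lambda>f. f \<otimes>\<^bsub>kQ\<^esub> g)"
 by (simp add: linear_path_algebra_iff linear_path_algebra_range_iff cring_K)
  (rule linear_convolve_left[OF cring_K qpath_comp_closed])

lemma linear_mult_path_right: "f \<in> carrier kQ ==> linear_map K kQ kQ (\<lambda>g. f \<otimes>\<^bsub>kQ\<^esub> g)"
 by (simp add: linear_path_algebra_iff linear_path_algebra_range_iff cring_K)
  (rule linear_convolve_right[OF cring_K qpath_comp_closed])

lemma one_apply: "\<one>\<^bsub>kQ\<^esub> x = (if x \<in> {(v, [], v) |v. v \<in> verts Q} then \<one>\<^bsub>K\<^esub> else \<zero>\<^bsub>K\<^esub>)"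
 by (simp add: path_algebra_def)

lemma one_closed: "\<one>\<^bsub>kQ\<^esub> \<in> carrier kQ"
 unfolding path_algebra_simps
 by (rule free_module_carrierI[of _ _ "(\<lambda>v. (v, [], v)) ` verts Q"]) (auto simp: one_apply)

lemma one_mult_path:
 assumes x: "x \<in> qpaths Q"
 shows "\<one>\<^bsub>kQ\<^esub> \<otimes>\<^bsub>kQ\<^esub> single K x = single K x" "single K x \<otimes>\<^bsub>kQ\<^esub> \<one>\<^bsub>kQ\<^esub> = single K x"
proof -
 obtain k p i where xd: "x = (k, p, i)" by (cases x)
 have v: "k \<in> verts Q" "i \<in> verts Q" using qpaths_verts x xd by auto
 show "\<one>\<^bsub>kQ\<^esub> \<otimes>\<^bsub>kQ\<^esub> single K x = single K x"
 proof
  fix z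
  have "{(a, b). \<one>\<^bsub>kQ\<^esub> a \<noteq> \<zero>\<^bsub>K\<^esub> \<and> single K x b \<noteq> \<zero>\<^bsub>K\<^esub> \<and> qpath_comp a b = Some z}
   = (if z = x then {((k, [], k), x)} else {})"
   using v by (auto simp: one_apply single_def xd split: if_splits)
  then show "(\<one>\<^bsub>kQ\<^esub> \<otimes>\<^bsub>kQ\<^esub> single K x) z = single K x z"
   using v by (simp add: convolve_def base.finsum_insert one_apply) (simp add: single_def)
 qed
 show "single K x \<otimes>\<^bsub>kQ\<^esub> \<one>\<^bsub>kQ\<^esub> = single K x"
 proof
  fix z
  have "{(a, b). single K x a \<noteq> \<zero>\<^bsub>K\<^esub> \<and> \<one>\<^bsub>kQ\<^esub> b \<noteq> \<zero>\<^bsub>K\<^esub> \<and> qpath_comp a b = Some z}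
   = (if z = x then {(x, (i, [], i))} else {})"
   using v by (auto simp: one_apply single_def xd split: if_splits)
  then show "(single K x \<otimes>\<^bsub>kQ\<^esub> \<one>\<^bsub>kQ\<^esub>) z = single K x z"
   using v by (simp add: convolve_def base.finsum_insert one_apply) (simp add: single_def)
 qed
qed

lemma linear_id: "linear_map K kQ kQ (\<lambda>x. x)"
proof -
 interpret Module.module K kQ by (rule module_path_algebra[OF cring_K])
 show ?thesis by unfold_locales auto
qed

lemma mult_paths_assoc:
 "(single K x \<otimes>\<^bsub>kQ\<^esub> single K y) \<otimes>\<^bsub>kQ\<^esub> single K z = single K x \<otimes>\<^bsub>kQ\<^esub> (single K y \<otimes>\<^bsub>kQ\<^esub> single K z)"
proof -
 have z: "convolve K qpath_comp (\<lambda>x. \<zero>\<^bsub>K\<^esub>) f = (\<lambda>x. \<zero>\<^bsub>K\<^esub>)" "convolve K qpath_comp f (\<lambda>x. \<zero>\<^bsub>K\<^esub>) = (\<lambda>x. \<zero>\<^bsub>K\<^esub>)" for f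
  by (simp_all add: convolve_def)
 show ?thesis
  using qpath_comp_assoc[of x y z]
  by (cases "qpath_comp x y"; cases "qpath_comp y z") (simp_all add: convolve_single[OF cring_K] z)
qed

text \<open>Every axiom is linear in each argument, so it suffices to check it on paths, one argument at a time.\<close>

sublocale kQ: assoc_algebra K kQ
proof (rule assoc_algebraI)
 have cl: "f \<otimes>\<^bsub>kQ\<^esub> g \<in> carrier kQ" if "f \<in> carrier kQ" "g \<in> carrier kQ" for f g
  by (rule linear_map.closed[OF linear_mult_path_left[OF that(2)] that(1)])
 show "field K" ..
 show "Module.module K kQ" by (rule module_path_algebra[OF cring_K])
 show "f \<otimes>\<^bsub>kQ\<^esub> g \<in> carrier kQ" if "f \<in> carrier kQ" "g \<in> carrier kQ" for f g
  by (rule cl[OF that])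
 show "\<one>\<^bsub>kQ\<^esub> \<in> carrier kQ" by (rule one_closed)
 show "\<one>\<^bsub>kQ\<^esub> \<otimes>\<^bsub>kQ\<^esub> f = f" if "f \<in> carrier kQ" for f
  by (rule linear_path_ext[OF linear_mult_path_right[OF one_closed] linear_id one_mult_path(1) that])
 show "f \<otimes>\<^bsub>kQ\<^esub> \<one>\<^bsub>kQ\<^esub> = f" if "f \<in> carrier kQ" for f
  by (rule linear_path_ext[OF linear_mult_path_left[OF one_closed] linear_id one_mult_path(2) that])
 show "linear_map K kQ kQ (\<lambda>g. f \<otimes>\<^bsub>kQ\<^esub> g)" "linear_map K kQ kQ (\<lambda>g. g \<otimes>\<^bsub>kQ\<^esub> f)" if "f \<in> carrier kQ" for f
  using that by (rule linear_mult_path_right, rule linear_mult_path_left)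
 fix f g h assume f: "f \<in> carrier kQ" and g: "g \<in> carrier kQ" and h: "h \<in> carrier kQ"
 note L = linear_mult_path_left and R = linear_mult_path_right and C = linear_map_comp and s = single_path
 have 1: "(single K x \<otimes>\<^bsub>kQ\<^esub> single K y) \<otimes>\<^bsub>kQ\<^esub> h = single K x \<otimes>\<^bsub>kQ\<^esub> (single K y \<otimes>\<^bsub>kQ\<^esub> h)"
  if "x \<in> qpaths Q" "y \<in> qpaths Q" for x y
  by (rule linear_path_ext[OF R[OF cl[OF s[OF that(1)] s[OF that(2)]]] C[OF R[OF s[OF that(2)]] R[OF s[OF that(1)]]]
   mult_paths_assoc h])
 have 2: "(single K x \<otimes>\<^bsub>kQ\<^esub> g) \<otimes>\<^bsub>kQ\<^esub> h = single K x \<otimes>\<^bsub>kQ\<^esub> (g \<otimes>\<^bsub>kQ\<^esub> h)" if x: "x \<in> qpaths Q" for x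
  by (rule linear_path_ext[OF C[OF R[OF s[OF x]] L[OF h]] C[OF L[OF h] R[OF s[OF x]]] 1[OF x] g])
 show "(f \<otimes>\<^bsub>kQ\<^esub> g) \<otimes>\<^bsub>kQ\<^esub> h = f \<otimes>\<^bsub>kQ\<^esub> (g \<otimes>\<^bsub>kQ\<^esub> h)"
  by (rule linear_path_ext[OF C[OF L[OF g] L[OF h]] L[OF cl[OF g h]] 2 f])
qed

lemma vertex_closed: "v \<in> verts Q ==> path_vertex K v \<in> carrier kQ"
 unfolding path_vertex_def by (rule single_path) simp

lemma arrow_closed: "e \<in> arcs Q ==> path_arrow K Q e \<in> carrier kQ"
 unfolding path_arrow_def by (rule single_path) simp

lemma single_Cons: "single K (k, e # p, i) = single K (k, [e], j) \<otimes>\<^bsub>kQ\<^esub> single K (j, p, i)"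
 unfolding mult_paths by simp

lemma vertex_mult: "path_vertex K v \<otimes>\<^bsub>kQ\<^esub> path_vertex K w = (if v = w then path_vertex K v else \<zero>\<^bsub>kQ\<^esub>)"
 unfolding path_vertex_def mult_paths by simp

lemma vertex_arrow: "path_vertex K (head Q e) \<otimes>\<^bsub>kQ\<^esub> path_arrow K Q e = path_arrow K Q e"
 "path_arrow K Q e \<otimes>\<^bsub>kQ\<^esub> path_vertex K (tail Q e) = path_arrow K Q e"
 unfolding path_vertex_def path_arrow_def mult_paths by simp_all

lemma finsum_apply: "finite B ==> (\<And>b. b \<in> B ==> f b \<in> carrier kQ) ==>
 (\<Oplus>\<^bsub>kQ\<^esub>b\<in>B. f b) x = (\<Oplus>\<^bsub>K\<^esub>b\<in>B. f b x)"
proof (induction B rule: finite_induct)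
 case (insert b B)
 have "f b x \<in> carrier K" if "f b \<in> carrier kQ" for b x
  using that unfolding path_algebra_simps free_module_carrier by blast
 then have *: "(\<lambda>b. f b x) \<in> insert b B \<rightarrow> carrier K" using insert by auto
 have "(\<Oplus>\<^bsub>kQ\<^esub>b\<in>insert b B. f b) = f b \<oplus>\<^bsub>kQ\<^esub> (\<Oplus>\<^bsub>kQ\<^esub>b\<in>B. f b)"
  using insert by (intro kQ.alg.finsum_insert) auto
 then show ?case using insert * by (simp add: base.finsum_insert)
qed simp

lemma one_eq_sum: "\<one>\<^bsub>kQ\<^esub> = (\<Oplus>\<^bsub>kQ\<^esub>v\<in>verts Q. path_vertex K v)"
proof
 fix x
 have "(\<Oplus>\<^bsub>kQ\<^esub>v\<in>verts Q. path_vertex K v) x = (\<Oplus>\<^bsub>K\<^esub>v\<in>verts Q. path_vertex K v x)"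
  by (rule finsum_apply) (auto simp: vertex_closed simp del: path_algebra_simps)
 also have "... = \<one>\<^bsub>kQ\<^esub> x"
 proof (cases "x \<in> {(v, [], v) |v. v \<in> verts Q}")
  case True
  then obtain v where v: "v \<in> verts Q" "x = (v, [], v)" by auto
  have "(\<Oplus>\<^bsub>K\<^esub>w\<in>verts Q. path_vertex K w x) = (\<Oplus>\<^bsub>K\<^esub>w\<in>verts Q. if v = w then \<one>\<^bsub>K\<^esub> else \<zero>\<^bsub>K\<^esub>)"
   by (rule base.finsum_cong') (auto simp: v path_vertex_def single_def)
  also have "... = \<one>\<^bsub>K\<^esub>" using v by (intro base.finsum_singleton) auto
  finally show ?thesis using True by (simp add: one_apply)
 next
  case False
  then have "(\<Oplus>\<^bsub>K\<^esub>w\<in>verts Q. path_vertex K w x) = (\<Oplus>\<^bsub>K\<^esub>w\<in>verts Q. \<zero>\<^bsub>K\<^esub>)"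
   by (intro base.finsum_cong') (auto simp: path_vertex_def single_def)
  then show ?thesis using False by (simp add: one_apply)
 qed
 finally show "\<one>\<^bsub>kQ\<^esub> x = (\<Oplus>\<^bsub>kQ\<^esub>v\<in>verts Q. path_vertex K v) x" by (rule sym)
qed

end

text \<open>The universal property of the path algebra: orthogonal idempotents with sum one and elements absorbing them on
 either side determine a homomorphism.\<close>

locale path_algebra_map = finite_quiver K Q + B: assoc_algebra K B
 for K :: "'k ring" and Q :: "('v, 'e) pre_digraph" and B :: "('k, 'b) module" +
 fixes \<epsilon> :: "'v => 'b" and \<eta> :: "'e => 'b"
 assumes vertex_image: "v \<in> verts Q ==> \<epsilon> v \<in> carrier B"
  and arrow_image: "e \<in> arcs Q ==> \<eta> e \<in> carrier B"
  and vertex_image_mult: "[|v \<in> verts Q; w \<in> verts Q|] ==> \<epsilon> v \<otimes>\<^bsub>B\<^esub> \<epsilon> w = (if v = w then \<epsilon> v else \<zero>\<^bsub>B\<^esub>)"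
  and vertex_image_sum: "(\<Oplus>\<^bsub>B\<^esub>v\<in>verts Q. \<epsilon> v) = \<one>\<^bsub>B\<^esub>"
  and arrow_head: "e \<in> arcs Q ==> \<epsilon> (head Q e) \<otimes>\<^bsub>B\<^esub> \<eta> e = \<eta> e"
  and arrow_tail: "e \<in> arcs Q ==> \<eta> e \<otimes>\<^bsub>B\<^esub> \<epsilon> (tail Q e) = \<eta> e"
begin

definition path_image :: "('v, 'e) qpath => 'b" where
 "path_image x = foldr (\<lambda>e b. \<eta> e \<otimes>\<^bsub>B\<^esub> b) (fst (snd x)) (\<epsilon> (snd (snd x)))"

lemma path_image_simps [simp]:
 "path_image (j, [], i) = \<epsilon> i"
 "path_image (j, e # p, i) = \<eta> e \<otimes>\<^bsub>B\<^esub> path_image (k, p, i)"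
 by (simp_all add: path_image_def)

lemma path_image_closed: "(j, p, i) \<in> qpaths Q ==> path_image (j, p, i) \<in> carrier B"
 by (induction p arbitrary: j) (auto simp: vertex_image arrow_image path_image_def)

lemma path_image_target: "(j, p, i) \<in> qpaths Q ==> \<epsilon> j \<otimes>\<^bsub>B\<^esub> path_image (j, p, i) = path_image (j, p, i)"
proof (cases p)
 case (Cons e p')
 assume a: "(j, p, i) \<in> qpaths Q"
 with Cons have *: "e \<in> arcs Q" "head Q e = j" "(tail Q e, p', i) \<in> qpaths Q" by auto
 note path_image_simps(2)[where k = "tail Q e", simp]
 show ?thesis using * Cons arrow_head[OF *(1)] head_in_verts[OF *(1)]
  by (simp add: B.alg.m_assoc[symmetric] vertex_image arrow_image path_image_closed del: path_image_simps(2))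
qed (simp add: vertex_image_mult)

lemma path_image_comp:
 assumes "(k, p, j) \<in> qpaths Q" "(j', q, i) \<in> qpaths Q"
 shows "path_image (k, p, j) \<otimes>\<^bsub>B\<^esub> path_image (j', q, i) =
   (if j = j' then path_image (k, p @ q, i) else \<zero>\<^bsub>B\<^esub>)"
 using assms
proof (induction p arbitrary: k)
 case Nil
 have v: "j \<in> verts Q" "j' \<in> verts Q" using Nil qpaths_verts by auto
 have "\<epsilon> j \<otimes>\<^bsub>B\<^esub> path_image (j', q, i) = \<epsilon> j \<otimes>\<^bsub>B\<^esub> (\<epsilon> j' \<otimes>\<^bsub>B\<^esub> path_image (j', q, i))"
  using path_image_target Nil by simp
 also have "... = (\<epsilon> j \<otimes>\<^bsub>B\<^esub> \<epsilon> j') \<otimes>\<^bsub>B\<^esub> path_image (j', q, i)"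
  using v Nil by (simp add: B.alg.m_assoc vertex_image path_image_closed)
 also have "... = (if j = j' then path_image (j', q, i) else \<zero>\<^bsub>B\<^esub>)"
  using v Nil by (simp add: vertex_image_mult path_image_target path_image_closed)
 finally show ?case using Nil by (auto simp: path_image_def)
next
 case (Cons e p)
 then have *: "e \<in> arcs Q" "head Q e = k" "(tail Q e, p, j) \<in> qpaths Q" by auto
 have f: "path_image (k, e # r, l) = \<eta> e \<otimes>\<^bsub>B\<^esub> path_image (tail Q e, r, l)" for r l
  by (rule path_image_simps)
 have "path_image (k, e # p, j) \<otimes>\<^bsub>B\<^esub> path_image (j', q, i) =
   \<eta> e \<otimes>\<^bsub>B\<^esub> (path_image (tail Q e, p, j) \<otimes>\<^bsub>B\<^esub> path_image (j', q, i))"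
  unfolding f using * Cons.prems by (simp add: B.alg.m_assoc arrow_image path_image_closed)
 then show ?case using Cons.IH[OF *(3) Cons.prems(2)] * by (simp add: f arrow_image del: path_image_simps)
qed

abbreviation "ext == path_extension K B \<epsilon> \<eta>"

lemma ext_eq_lin: "ext = lin K B path_image"
 by (simp add: path_extension_def lin_def path_image_def fun_eq_iff)

lemma path_image_closed': "x \<in> qpaths Q ==> path_image x \<in> carrier B"
 using path_image_closed by (cases x) auto

lemma linear_ext: "linear_map K kQ B ext"
 unfolding ext_eq_lin linear_path_algebra_iff[OF cring_K]
 by (rule linear_lin[OF B.vec.module_axioms path_image_closed'])

lemma ext_single: "x \<in> qpaths Q ==> ext (single K x) = path_image x"
 unfolding ext_eq_lin by (rule lin_single[OF B.vec.module_axioms]) (rule path_image_closed')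

lemma ext_vertex: "v \<in> verts Q ==> ext (path_vertex K v) = \<epsilon> v"
 unfolding path_vertex_def by (simp add: ext_single)

lemma ext_arrow: "e \<in> arcs Q ==> ext (path_arrow K Q e) = \<eta> e"
 unfolding path_arrow_def by (simp add: ext_single path_image_def arrow_tail)

sublocale ext: linear_map K kQ B ext by (rule linear_ext)

sublocale hom: algebra_hom K kQ B ext
proof
 fix f g assume f: "f \<in> carrier kQ" and g: "g \<in> carrier kQ"
 have path: "ext (single K x \<otimes>\<^bsub>kQ\<^esub> single K y) = ext (single K x) \<otimes>\<^bsub>B\<^esub> ext (single K y)"
  if x: "x \<in> qpaths Q" and y: "y \<in> qpaths Q" for x y
 proof -
  obtain k p j j' q i where xy: "x = (k, p, j)" "y = (j', q, i)" by (cases x; cases y) auto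
  show ?thesis
  proof (cases "j = j'")
   case True
   then have "(k, p @ q, i) \<in> qpaths Q" using x y xy qpaths_append by auto
   then show ?thesis using x y path_image_comp True unfolding mult_paths xy by (simp add: ext_single)
  next
   case False
   then show ?thesis using x y path_image_comp[of k p j j' q i] ext.zero unfolding mult_paths xy
    by (simp add: ext_single)
  qed
 qed
 have 1: "ext (single K x \<otimes>\<^bsub>kQ\<^esub> g) = ext (single K x) \<otimes>\<^bsub>B\<^esub> ext g" if x: "x \<in> qpaths Q" for x
  by (rule linear_path_ext[OF linear_map_comp[OF kQ.linear_mult_right[OF single_path[OF x]] linear_ext]
    linear_map_comp[OF linear_ext B.linear_mult_right[OF ext.closed[OF single_path[OF x]]]] path[OF x] g])
 show "ext (f \<otimes>\<^bsub>kQ\<^esub> g) = ext f \<otimes>\<^bsub>B\<^esub> ext g"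
  by (rule linear_path_ext[OF linear_map_comp[OF kQ.linear_mult_left[OF g] linear_ext]
    linear_map_comp[OF linear_ext B.linear_mult_left[OF ext.closed[OF g]]] 1 f])
next
 have "ext \<one>\<^bsub>kQ\<^esub> = (\<Oplus>\<^bsub>B\<^esub>v\<in>verts Q. ext (path_vertex K v))"
  unfolding one_eq_sum by (rule ext.finsum) (auto simp: vertex_closed simp del: path_algebra_simps)
 also have "... = (\<Oplus>\<^bsub>B\<^esub>v\<in>verts Q. \<epsilon> v)"
  by (rule B.alg.finsum_cong') (auto simp: ext_vertex vertex_image)
 finally show "ext \<one>\<^bsub>kQ\<^esub> = \<one>\<^bsub>B\<^esub>" using vertex_image_sum by simp
qed (rule ext.closed ext.add ext.smult; assumption)+

end

text \<open>A path is a product of arrows and a trivial path. Units are not required to be preserved, because the embedding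
 of the path algebra at one vertex into that of the assembled quiver does not preserve them.\<close>

lemma (in finite_quiver) multiplicative_map_ext:
 assumes B: "assoc_algebra K B" and h: "linear_map K kQ B h" and h': "linear_map K kQ B h'"
  and mult: "\<And>f g. [|f \<in> carrier kQ; g \<in> carrier kQ|] ==> h (f \<otimes>\<^bsub>kQ\<^esub> g) = h f \<otimes>\<^bsub>B\<^esub> h g"
  and mult': "\<And>f g. [|f \<in> carrier kQ; g \<in> carrier kQ|] ==> h' (f \<otimes>\<^bsub>kQ\<^esub> g) = h' f \<otimes>\<^bsub>B\<^esub> h' g"
  and v: "\<And>v. v \<in> verts Q ==> h (path_vertex K v) = h' (path_vertex K v)"
  and a: "\<And>e. e \<in> arcs Q ==> h (path_arrow K Q e) = h' (path_arrow K Q e)"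
  and f: "f \<in> carrier kQ"
 shows "h f = h' f"
proof (rule linear_path_ext[OF h h' _ f])
 fix x assume x: "x \<in> qpaths Q"
 obtain j p i where xd: "x = (j, p, i)" by (cases x)
 have "(j, p, i) \<in> qpaths Q ==> h (single K (j, p, i)) = h' (single K (j, p, i))"
 proof (induction p arbitrary: j)
  case Nil
  then show ?case using v by (auto simp: path_vertex_def)
 next
  case (Cons e p)
  then have *: "e \<in> arcs Q" "head Q e = j" "(tail Q e, p, i) \<in> qpaths Q" by auto
  have s: "single K (j, e # p, i) = path_arrow K Q e \<otimes>\<^bsub>kQ\<^esub> single K (tail Q e, p, i)"
   unfolding path_arrow_def *(2) by (rule single_Cons)
  show ?case unfolding s
   using mult[OF arrow_closed[OF *(1)] single_path[OF *(3)]] mult'[OF arrow_closed[OF *(1)] single_path[OF *(3)]]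
    a[OF *(1)] Cons.IH[OF *(3)] by simp
 qed
 then show "h (single K x) = h' (single K x)" using x xd by simp
qed

section \<open>Bilinear maps on tensor products\<close>

lemma linear_map_cong:
 assumes "linear_map K N M h" "\<And>x. x \<in> carrier N ==> g x = h x"
 shows "linear_map K N M g"
proof -
 interpret h: linear_map K N M h by fact
 have "g (x \<oplus>\<^bsub>N\<^esub> y) = g x \<oplus>\<^bsub>M\<^esub> g y" if "x \<in> carrier N" "y \<in> carrier N" for x y
  using that by (simp only: assms(2) h.M.M.a_closed h.add)
 moreover have "g (c \<odot>\<^bsub>N\<^esub> x) = c \<odot>\<^bsub>M\<^esub> g x" if "c \<in> carrier K" "x \<in> carrier N" for c x
  using that by (simp only: assms(2) h.M.smult_closed h.smult)
 ultimately show ?thesis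
  using assms(2) h.closed h.M.module_axioms h.N.module_axioms
  by (simp add: linear_map_def linear_map_axioms_def)
qed

lemma linear_sum2:
 assumes "linear_map K N M h" "linear_map K N M g"
 shows "linear_map K N M (\<lambda>x. h x \<oplus>\<^bsub>M\<^esub> g x)"
proof -
 interpret h: linear_map K N M h by fact
 interpret g: linear_map K N M g by fact
 show ?thesis
  by unfold_locales (auto simp: h.add g.add h.smult g.smult h.N.M.a_ac h.N.smult_r_distr)
qed

lemma linear_finsum:
 assumes "Module.module K N" "Module.module K M" "finite B" "\<And>b. b \<in> B ==> linear_map K N M (h b)"
 shows "linear_map K N M (\<lambda>x. \<Oplus>\<^bsub>M\<^esub>b\<in>B. h b x)"
proof -
 interpret N: Module.module K N by fact
 interpret M: Module.module K M by fact
 have c: "h b x \<in> carrier M" if "b \<in> B" "x \<in> carrier N" for b x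
  by (rule linear_map.closed[OF assms(4)[OF that(1)] that(2)])
 show ?thesis
 proof
  fix x assume x: "x \<in> carrier N"
  show "(\<Oplus>\<^bsub>M\<^esub>b\<in>B. h b x) \<in> carrier M" using c x by (intro M.M.finsum_closed) auto
  { fix k assume k: "k \<in> carrier K"
   have "(\<Oplus>\<^bsub>M\<^esub>b\<in>B. h b (k \<odot>\<^bsub>N\<^esub> x)) = (\<Oplus>\<^bsub>M\<^esub>b\<in>B. k \<odot>\<^bsub>M\<^esub> h b x)"
    using c x k by (intro M.M.finsum_cong') (auto simp: linear_map.smult[OF assms(4)])
   then show "(\<Oplus>\<^bsub>M\<^esub>b\<in>B. h b (k \<odot>\<^bsub>N\<^esub> x)) = k \<odot>\<^bsub>M\<^esub> (\<Oplus>\<^bsub>M\<^esub>b\<in>B. h b x)"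
    using c x k assms(3) by (subst M.finsum_smult_ldistr) auto }
  fix y assume y: "y \<in> carrier N"
  have "(\<Oplus>\<^bsub>M\<^esub>b\<in>B. h b (x \<oplus>\<^bsub>N\<^esub> y)) = (\<Oplus>\<^bsub>M\<^esub>b\<in>B. h b x \<oplus>\<^bsub>M\<^esub> h b y)"
   using c x y by (intro M.M.finsum_cong') (auto simp: linear_map.add[OF assms(4)])
  also have "... = (\<Oplus>\<^bsub>M\<^esub>b\<in>B. h b x) \<oplus>\<^bsub>M\<^esub> (\<Oplus>\<^bsub>M\<^esub>b\<in>B. h b y)"
   using c x y by (intro M.M.finsum_addf) auto
  finally show "(\<Oplus>\<^bsub>M\<^esub>b\<in>B. h b (x \<oplus>\<^bsub>N\<^esub> y)) = (\<Oplus>\<^bsub>M\<^esub>b\<in>B. h b x) \<oplus>\<^bsub>M\<^esub> (\<Oplus>\<^bsub>M\<^esub>b\<in>B. h b y)" .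
 qed
qed

lemma linear_zero:
 assumes "Module.module K N" "Module.module K M" shows "linear_map K N M (\<lambda>x. \<zero>\<^bsub>M\<^esub>)"
proof -
 interpret N: Module.module K N by fact
 interpret M: Module.module K M by fact
 show ?thesis by unfold_locales auto
qed

lemma linear_ident: "Module.module K N ==> linear_map K N N (\<lambda>x. x)"
 by (simp add: linear_map_def linear_map_axioms_def)

lemma (in tensor_product) linear_tensor_ext:
 assumes "linear_map K T L h" "linear_map K T L h'" "\<And>xs. xs \<in> tuples Vs ==> h (pure xs) = h' (pure xs)"
  "X \<in> carrier T"
 shows "h X = h' X"
proof -
 interpret h: linear_map K T L h by fact
 interpret h': linear_map K T L h' by fact
 from assms(4) show ?thesis
  by (induction rule: tensor_induct_smult) (simp_all only: h.zero h'.zero h.add h'.add h.smult h'.smult assms(3))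
qed

text \<open>The actions on tensor products are defined as unions of cosets over all representatives; all these cosets agree,
 so the union is the value of an induced map.\<close>

lemma UN_push_coset:
 assumes V: "tensor_product K Vs E" and W: "tensor_product K Ws F"
  and h: "\<And>xs. xs \<in> tuples Vs ==> h xs \<in> tuples Ws"
  and m: "multilinear K Vs (tensor K Ws F) (\<lambda>xs. pure_tensor K Ws F (h xs))"
  and b: "\<And>xs ys. (xs, ys) \<in> E ==> pure_tensor K Ws F (h xs) = pure_tensor K Ws F (h ys)"
  and X: "X \<in> carrier (tensor K Vs E)"
 shows "(\<Union>f\<in>X. tensor_kernel K Ws F +>\<^bsub>free_module K (tuples Ws)\<^esub> push K h f) =
  coset_lift (lin K (tensor K Ws F) (\<lambda>xs. pure_tensor K Ws F (h xs))) X"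
proof -
 interpret V: tensor_product K Vs E by fact
 interpret W: tensor_product K Ws F by fact
 have "X \<noteq> {}" using V.Q.coset_nonempty X unfolding V.T_eq by blast
 then show ?thesis
 proof (rule UN_const_eq)
  fix f assume f: "f \<in> X"
  then have fF: "f \<in> carrier V.F" using V.Q.coset_UN(1) X unfolding V.T_eq by blast
  have "W.ker +>\<^bsub>W.F\<^esub> push K h f = lin K W.T (\<lambda>xs. W.pure (h xs)) f"
  proof (rule linear_map_ext[OF linear_map_comp[OF linear_push[OF V.K h] W.Q.linear_coset]])
   show "linear_map K V.F (quot W.F W.ker) (lin K W.T (\<lambda>xs. W.pure (h xs)))"
    using V.linear_lin_g[OF W.module_tensor m b] unfolding W.T_eq .
   show "W.ker +>\<^bsub>W.F\<^esub> push K h (single K xs) = lin K W.T (\<lambda>xs. W.pure (h xs)) (single K xs)"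
    if "xs \<in> tuples Vs" for xs
    using lin_single[OF W.module_tensor, of "\<lambda>xs. W.pure (h xs)" xs, OF W.pure_closed[OF h[OF that]]]
    by (simp add: push_single[OF V.K] W.pure_eq)
  qed (use fF in auto)
  also have "... = coset_lift (lin K W.T (\<lambda>xs. W.pure (h xs))) X"
   by (rule V.tensor_lift_eq[OF W.module_tensor m b X f, symmetric])
  finally show "W.ker +>\<^bsub>W.F\<^esub> push K h f = coset_lift (lin K W.T (\<lambda>xs. W.pure (h xs))) X" .
 qed
qed

text \<open>Concatenation of tuples induces a pairing of tensor products. It is built one argument at a time:
 \<open>right_part\<close> is the pairing with a pure tensor on the left.\<close>

locale tensor_pairing = V: tensor_product K Vs E + W: tensor_product K Ws F + U: tensor_product K Us G
 for K :: "'k ring" and Vs :: "('k, 'm, 'z) module_scheme list" and E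
  and Ws :: "('k, 'm, 'z) module_scheme list" and F and Us :: "('k, 'm, 'z) module_scheme list" and G +
 assumes append_tuples: "[|xs \<in> tuples Vs; ys \<in> tuples Ws|] ==> xs @ ys \<in> tuples Us"
  and left: "ys \<in> tuples Ws ==> multilinear K Vs U.T (\<lambda>xs. U.pure (xs @ ys))"
  and right: "xs \<in> tuples Vs ==> multilinear K Ws U.T (\<lambda>ys. U.pure (xs @ ys))"
  and left_balanced: "[|ys \<in> tuples Ws; (xs, xs') \<in> E|] ==> U.pure (xs @ ys) = U.pure (xs' @ ys)"
  and right_balanced: "[|xs \<in> tuples Vs; (ys, ys') \<in> F|] ==> U.pure (xs @ ys) = U.pure (xs @ ys')"
begin

definition right_part where "right_part xs = coset_lift (lin K U.T (\<lambda>ys. U.pure (xs @ ys)))"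

lemma linear_right_part: "xs \<in> tuples Vs ==> linear_map K W.T U.T (right_part xs)"
 unfolding right_part_def by (rule W.linear_tensor_lift[OF U.module_tensor right right_balanced])

lemma right_part_pure: "xs \<in> tuples Vs ==> ys \<in> tuples Ws ==> right_part xs (W.pure ys) = U.pure (xs @ ys)"
 unfolding right_part_def by (rule W.tensor_lift_pure[OF U.module_tensor right right_balanced])

lemma multilinear_right_part:
 assumes Y: "Y \<in> carrier W.T" shows "multilinear K Vs U.T (\<lambda>xs. right_part xs Y)"
 unfolding multilinear_def
proof (intro conjI allI impI ballI)
 show "right_part xs Y \<in> carrier U.T" if "xs \<in> tuples Vs" for xs
  by (rule linear_map.closed[OF linear_right_part[OF that] Y])
next
 fix us vs x y assume a: "us @ x # vs \<in> tuples Vs" "us @ y # vs \<in> tuples Vs"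
 show "right_part (us @ (x \<oplus>\<^bsub>Vs ! length us\<^esub> y) # vs) Y =
   right_part (us @ x # vs) Y \<oplus>\<^bsub>U.T\<^esub> right_part (us @ y # vs) Y"
  by (rule W.linear_tensor_ext[OF linear_right_part[OF V.add_in_tuples[OF a]]
    linear_sum2[OF linear_right_part[OF a(1)] linear_right_part[OF a(2)]] _ Y])
   (simp only: right_part_pure a V.add_in_tuples[OF a] multilinearD(2)[OF left a refl])
next
 fix us vs c x assume a: "us @ x # vs \<in> tuples Vs" "c \<in> carrier K"
 have s: "linear_map K U.T U.T (\<lambda>z. c \<odot>\<^bsub>U.T\<^esub> z)"
 proof -
  interpret UT: Module.module K U.T by (rule U.module_tensor)
  show ?thesis using a(2)
   by unfold_locales (auto simp: UT.smult_r_distr UT.smult_assoc1[symmetric] V.F.R.m_comm)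
 qed
 show "right_part (us @ (c \<odot>\<^bsub>Vs ! length us\<^esub> x) # vs) Y = c \<odot>\<^bsub>U.T\<^esub> right_part (us @ x # vs) Y"
  by (rule W.linear_tensor_ext[OF linear_right_part[OF V.smult_in_tuples[OF a]]
    linear_map_comp[OF linear_right_part[OF a(1)] s] _ Y])
   (simp only: right_part_pure a V.smult_in_tuples[OF a] multilinearD(3)[OF left a refl])
qed

lemma right_part_balanced: "Y \<in> carrier W.T ==> (xs, xs') \<in> E ==> right_part xs Y = right_part xs' Y"
 by (rule W.linear_tensor_ext[OF linear_right_part linear_right_part])
  (use V.relation in "auto simp: right_part_pure left_balanced")

definition pairing where "pairing X Y = coset_lift (lin K U.T (\<lambda>xs. right_part xs Y)) X"

lemma linear_pairing_left: "Y \<in> carrier W.T ==> linear_map K V.T U.T (\<lambda>X. pairing X Y)"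
 unfolding pairing_def by (rule V.linear_tensor_lift[OF U.module_tensor multilinear_right_part right_part_balanced])

lemma pairing_pure_left: "Y \<in> carrier W.T ==> xs \<in> tuples Vs ==> pairing (V.pure xs) Y = right_part xs Y"
 unfolding pairing_def by (rule V.tensor_lift_pure[OF U.module_tensor multilinear_right_part right_part_balanced])

lemma pairing_pure: "xs \<in> tuples Vs ==> ys \<in> tuples Ws ==> pairing (V.pure xs) (W.pure ys) = U.pure (xs @ ys)"
 by (simp add: pairing_pure_left W.pure_closed right_part_pure)

lemma linear_pairing_right:
 assumes X: "X \<in> carrier V.T" shows "linear_map K W.T U.T (pairing X)"
proof -
 interpret UT: Module.module K U.T by (rule U.module_tensor)
 interpret WT: Module.module K W.T by (rule W.module_tensor)
 show ?thesis
 proof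
  fix Y assume Y: "Y \<in> carrier W.T"
  show "pairing X Y \<in> carrier U.T" by (rule linear_map.closed[OF linear_pairing_left[OF Y] X])
  { fix c assume c: "c \<in> carrier K"
   have s: "linear_map K U.T U.T (\<lambda>z. c \<odot>\<^bsub>U.T\<^esub> z)"
    using c by unfold_locales (auto simp: UT.smult_r_distr UT.smult_assoc1[symmetric] V.F.R.m_comm)
   show "pairing X (c \<odot>\<^bsub>W.T\<^esub> Y) = c \<odot>\<^bsub>U.T\<^esub> pairing X Y"
    by (rule V.linear_tensor_ext[OF linear_pairing_left[OF WT.smult_closed[OF c Y]]
      linear_map_comp[OF linear_pairing_left[OF Y] s] _ X])
     (simp add: pairing_pure_left Y c WT.smult_closed linear_map.smult[OF linear_right_part]) }
  fix Y' assume Y': "Y' \<in> carrier W.T"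
  show "pairing X (Y \<oplus>\<^bsub>W.T\<^esub> Y') = pairing X Y \<oplus>\<^bsub>U.T\<^esub> pairing X Y'"
   by (rule V.linear_tensor_ext[OF linear_pairing_left[OF WT.a_closed[OF Y Y']]
     linear_sum2[OF linear_pairing_left[OF Y] linear_pairing_left[OF Y']] _ X])
    (simp add: pairing_pure_left Y Y' WT.a_closed linear_map.add[OF linear_right_part])
 qed
qed

text \<open>The multiplication of the tensor algebra is defined through representatives; this identifies it with the pairing.\<close>

lemma UN_convolve_coset:
 assumes X: "X \<in> carrier V.T" and Y: "Y \<in> carrier W.T"
 shows "(\<Union>f\<in>X. \<Union>g\<in>Y. U.ker +>\<^bsub>U.F\<^esub> convolve K (\<lambda>xs ys. Some (xs @ ys)) f g) = pairing X Y"
proof -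
 let ?B = "\<lambda>f g. U.ker +>\<^bsub>U.F\<^esub> convolve K (\<lambda>xs ys. Some (xs @ ys)) f g"
 have ne: "X \<noteq> {}" "Y \<noteq> {}"
  using V.Q.coset_nonempty W.Q.coset_nonempty X Y unfolding V.T_eq W.T_eq by blast+
 have "?B f g = pairing X Y" if f: "f \<in> X" and g: "g \<in> Y" for f g
 proof -
  have fF: "f \<in> carrier V.F" using V.Q.coset_UN(1) X f unfolding V.T_eq by blast
  have gF: "g \<in> carrier W.F" using W.Q.coset_UN(1) Y g unfolding W.T_eq by blast
  have lr: "linear_map K W.F (quot U.F U.ker) (?B f)" if "f \<in> carrier V.F" for f
   by (rule linear_map_comp[OF linear_convolve_right[OF V.K _ that] U.Q.linear_coset])
    (use append_tuples in auto)
  have ll: "linear_map K V.F (quot U.F U.ker) (\<lambda>f. ?B f g)"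
   by (rule linear_map_comp[OF linear_convolve_left[OF V.K _ gF] U.Q.linear_coset])
    (use append_tuples in auto)
  have 1: "?B (single K xs) g = right_part xs Y" if xs: "xs \<in> tuples Vs" for xs
  proof -
   have "?B (single K xs) g = lin K U.T (\<lambda>ys. U.pure (xs @ ys)) g"
   proof (rule linear_map_ext[OF lr[OF V.single_in[OF xs]] _ _ gF])
    show "linear_map K W.F (quot U.F U.ker) (lin K U.T (\<lambda>ys. U.pure (xs @ ys)))"
     using W.linear_lin_g[OF U.module_tensor right[OF xs] right_balanced[OF xs]] unfolding U.T_eq .
    show "?B (single K xs) (single K ys) = lin K U.T (\<lambda>ys. U.pure (xs @ ys)) (single K ys)"
     if "ys \<in> tuples Ws" for ys
     using that xs append_tuples
      lin_single[OF U.module_tensor, of "\<lambda>ys. U.pure (xs @ ys)" ys, OF U.pure_closed[OF append_tuples[OF xs that]]]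
     by (simp add: convolve_single[OF V.K] U.pure_eq)
   qed
   also have "... = right_part xs Y" unfolding right_part_def
    by (rule W.tensor_lift_eq[OF U.module_tensor right[OF xs] right_balanced[OF xs] Y g, symmetric])
   finally show ?thesis .
  qed
  have "?B f g = lin K U.T (\<lambda>xs. right_part xs Y) f"
  proof (rule linear_map_ext[OF ll _ _ fF])
   show "linear_map K V.F (quot U.F U.ker) (lin K U.T (\<lambda>xs. right_part xs Y))"
    using V.linear_lin_g[OF U.module_tensor multilinear_right_part[OF Y] right_part_balanced[OF Y]]
    unfolding U.T_eq .
   show "?B (single K xs) g = lin K U.T (\<lambda>xs. right_part xs Y) (single K xs)" if "xs \<in> tuples Vs" for xs
    using 1[OF that] by (subst lin_single[OF U.module_tensor])
     (auto intro: linear_map.closed[OF linear_right_part[OF that] Y])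
  qed
  also have "... = pairing X Y" unfolding pairing_def
   by (rule V.tensor_lift_eq[OF U.module_tensor multilinear_right_part[OF Y] right_part_balanced[OF Y] X f, symmetric])
  finally show ?thesis .
 qed
 then show ?thesis using ne by (intro UN_const_eq) auto
qed

end

section \<open>The tensor algebra of a species\<close>

context bimodule
begin

lemma lact_scalar: "[|b \<in> carrier B; c \<in> carrier K; x \<in> carrier M|] ==> lact M b (c \<odot>\<^bsub>M\<^esub> x) = c \<odot>\<^bsub>M\<^esub> lact M b x"
proof -
 assume a: "b \<in> carrier B" "c \<in> carrier K" "x \<in> carrier M"
 have "c \<odot>\<^bsub>M\<^esub> x = lact M (c \<odot>\<^bsub>B\<^esub> \<one>\<^bsub>B\<^esub>) x" using a by (simp add: lact_smult lact_one)
 then have "lact M b (c \<odot>\<^bsub>M\<^esub> x) = lact M (b \<otimes>\<^bsub>B\<^esub> (c \<odot>\<^bsub>B\<^esub> \<one>\<^bsub>B\<^esub>)) x" using a by (simp add: lact_mult)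
 then show ?thesis using a by (simp add: left.smult_mult_right lact_smult)
qed

lemma ract_scalar: "[|a \<in> carrier A; c \<in> carrier K; x \<in> carrier M|] ==> ract M (c \<odot>\<^bsub>M\<^esub> x) a = c \<odot>\<^bsub>M\<^esub> ract M x a"
proof -
 assume a: "a \<in> carrier A" "c \<in> carrier K" "x \<in> carrier M"
 have "c \<odot>\<^bsub>M\<^esub> x = ract M x (c \<odot>\<^bsub>A\<^esub> \<one>\<^bsub>A\<^esub>)" using a by (simp add: ract_smult ract_one)
 then have "ract M (c \<odot>\<^bsub>M\<^esub> x) a = ract M x ((c \<odot>\<^bsub>A\<^esub> \<one>\<^bsub>A\<^esub>) \<otimes>\<^bsub>A\<^esub> a)" using a by (simp add: ract_mult)
 then show ?thesis using a by (simp add: right.smult_mult_left ract_smult)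
qed

lemma linear_lact: "b \<in> carrier B ==> linear_map K M M (lact M b)"
 by unfold_locales (simp_all add: lact_closed lact_add_right lact_scalar)

lemma linear_ract: "a \<in> carrier A ==> linear_map K M M (\<lambda>x. ract M x a)"
 by unfold_locales (simp_all add: ract_closed ract_add_left ract_scalar)

end

text \<open>The structure from which a tensor algebra is built, shared by a pro-species and its double.\<close>

locale species = base: field K + fin_digraph Q
 for K :: "'k ring" and Q :: "('v, 'e) pre_digraph"
  and A :: "'v => ('k, 'a) module" and M :: "'e => ('a, 'k, 'm) bimodule" +
 assumes algebra_at: "i \<in> verts Q ==> assoc_algebra K (A i)"
  and bimodule_at: "e \<in> arcs Q ==> bimodule K (A (head Q e)) (A (tail Q e)) (M e)"
begin

abbreviation "N == npaths Q"
abbreviation "L == path_tensor K Q A M"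
abbreviation "pure == path_pure K Q A M"
abbreviation "T == tensor_algebra K Q A M"
abbreviation "plact == path_lact K Q A M"
abbreviation "pract == path_ract K Q A M"
abbreviation "pmult == path_mult K Q A M"

lemma cring_K: "cring K" ..

lemma module_A: "i \<in> verts Q ==> Module.module K (A i)"
 using algebra_at by (simp add: assoc_algebra_def)

lemma module_M: "e \<in> arcs Q ==> Module.module K (M e)"
 using bimodule_at by (simp add: bimodule_def)

lemma npaths_Cons: "e # p \<in> N \<longleftrightarrow> e \<in> arcs Q \<and> (p = [] \<or> p \<in> N \<and> head Q (hd p) = tail Q e)"
 by (cases p) (auto simp: npaths_def)

lemma npaths_Nil [simp]: "[] \<notin> N"
 by (simp add: npaths_def)

lemma npaths_append:
 "p \<noteq> [] ==> q \<noteq> [] ==> p @ q \<in> N \<longleftrightarrow> p \<in> N \<and> q \<in> N \<and> head Q (hd q) = tail Q (last p)"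
 by (induction p) (auto simp: npaths_Cons)

lemma npaths_arcs: "p \<in> N ==> set p \<subseteq> arcs Q"
 by (induction p) (auto simp: npaths_Cons)

lemma npaths_single: "e \<in> arcs Q ==> [e] \<in> N"
 by (simp add: npaths_Cons)

lemma npaths_hd_last: "p \<in> N ==> hd p \<in> arcs Q \<and> last p \<in> arcs Q"
 using npaths_arcs[of p] by (cases "p = []") auto

lemma tuples_map_middleE:
 assumes "us @ x # vs \<in> tuples (map M p)"
 obtains p1 e p2 where "p = p1 @ e # p2" "us \<in> tuples (map M p1)" "x \<in> carrier (M e)" "vs \<in> tuples (map M p2)"
  "length us = length p1"
 using assms by (elim tuples_middleE) (auto simp: map_eq_append_conv map_eq_Cons_conv)

lemma tuples_map_middleI:
 "[|us \<in> tuples (map M p1); x \<in> carrier (M e); vs \<in> tuples (map M p2)|] ==>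
  us @ x # vs \<in> tuples (map M (p1 @ e # p2))"
 by (simp add: tuples_append)

lemma balanceE:
 assumes "(xs, ys) \<in> balance Q A M p"
 obtains us x y vs a p1 e d p2 where "xs = us @ ract (M e) x a # y # vs" "ys = us @ x # lact (M d) a y # vs"
  "p = p1 @ e # d # p2" "us \<in> tuples (map M p1)" "x \<in> carrier (M e)" "y \<in> carrier (M d)"
  "vs \<in> tuples (map M p2)" "a \<in> carrier (A (tail Q e))" "length us = length p1"
proof -
 from assms obtain us x y vs a where *: "xs = us @ ract (M (p ! length us)) x a # y # vs"
  "ys = us @ x # lact (M (p ! Suc (length us))) a y # vs" "us @ x # y # vs \<in> tuples (map M p)"
  "a \<in> carrier (A (tail Q (p ! length us)))" unfolding balance_def by blast
 from *(3) obtain p1 e p2 where 1: "p = p1 @ e # p2" "us \<in> tuples (map M p1)" "x \<in> carrier (M e)"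
  "y # vs \<in> tuples (map M p2)" "length us = length p1" by (rule tuples_map_middleE)
 from 1(4) obtain d p3 where "p2 = d # p3" "y \<in> carrier (M d)" "vs \<in> tuples (map M p3)"
  by (cases p2) auto
 with 1 * show thesis by (intro that[of us e x a y vs d p1 p3]) (auto simp: nth_append)
qed

lemma tensor_product_path:
 assumes p: "p \<in> N" shows "tensor_product K (map M p) (balance Q A M p)"
proof (rule tensor_product.intro)
 show "cring K" by (rule cring_K)
 show "Module.module K V" if "V \<in> set (map M p)" for V
  using that npaths_arcs[OF p] module_M by auto
 show "balance Q A M p \<subseteq> tuples (map M p) \<times> tuples (map M p)"
 proof (rule subrelI)
  fix xs ys assume "(xs, ys) \<in> balance Q A M p"
  then obtain us x y vs a p1 e d p2 where *: "xs = us @ ract (M e) x a # y # vs" "ys = us @ x # lact (M d) a y # vs"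
   "p = p1 @ e # d # p2" "us \<in> tuples (map M p1)" "x \<in> carrier (M e)" "y \<in> carrier (M d)"
   "vs \<in> tuples (map M p2)" "a \<in> carrier (A (tail Q e))" by (rule balanceE)
  have "e \<in> arcs Q" "d \<in> arcs Q" using npaths_arcs[OF p] *(3) by auto
  moreover have "head Q d = tail Q e"
   using p npaths_append[of "p1 @ [e]" "d # p2"] unfolding *(3) by simp
  ultimately show "(xs, ys) \<in> tuples (map M p) \<times> tuples (map M p)"
   using * bimodule.ract_closed[OF bimodule_at[of e]] bimodule.lact_closed[OF bimodule_at[of d]]
   by (auto intro!: tuples_append)
 qed
qed

lemma multilinear_pathI:
 assumes "\<And>xs. xs \<in> tuples (map M p) ==> g xs \<in> carrier C"
  and "\<And>p1 e p2 us vs x y. [|p = p1 @ e # p2; us \<in> tuples (map M p1); x \<in> carrier (M e); y \<in> carrier (M e);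
    vs \<in> tuples (map M p2); length us = length p1|] ==>
    g (us @ (x \<oplus>\<^bsub>M e\<^esub> y) # vs) = g (us @ x # vs) \<oplus>\<^bsub>C\<^esub> g (us @ y # vs)"
  and "\<And>p1 e p2 us vs c x. [|p = p1 @ e # p2; us \<in> tuples (map M p1); x \<in> carrier (M e);
    vs \<in> tuples (map M p2); length us = length p1; c \<in> carrier K|] ==>
    g (us @ (c \<odot>\<^bsub>M e\<^esub> x) # vs) = c \<odot>\<^bsub>C\<^esub> g (us @ x # vs)"
 shows "multilinear K (map M p) C g"
 by (rule multilinearI) (use assms in "auto simp: map_eq_append_conv map_eq_Cons_conv")

context
 fixes p assumes p: "p \<in> N"
begin

interpretation P: tensor_product K "map M p" "balance Q A M p" by (rule tensor_product_path[OF p])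

lemma module_L: "Module.module K (L p)"
 unfolding path_tensor_def by (rule P.module_tensor)

lemma pure_closed: "xs \<in> tuples (map M p) ==> pure p xs \<in> carrier (L p)"
 unfolding path_tensor_def path_pure_def by (rule P.pure_closed)

lemma pure_add: "[|p = p1 @ e # p2; us \<in> tuples (map M p1); x \<in> carrier (M e); y \<in> carrier (M e); vs \<in> tuples (map M p2)|] ==>
  pure p (us @ (x \<oplus>\<^bsub>M e\<^esub> y) # vs) = pure p (us @ x # vs) \<oplus>\<^bsub>L p\<^esub> pure p (us @ y # vs)"
 unfolding path_tensor_def path_pure_def
 by (rule P.pure_add) (use tuples_length[of us "map M p1"] in "auto intro!: tuples_map_middleI simp: nth_append simp del: map_append list.map")

lemma pure_smult: "[|p = p1 @ e # p2; us \<in> tuples (map M p1); x \<in> carrier (M e); vs \<in> tuples (map M p2); c \<in> carrier K|] ==>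
  pure p (us @ (c \<odot>\<^bsub>M e\<^esub> x) # vs) = c \<odot>\<^bsub>L p\<^esub> pure p (us @ x # vs)"
 unfolding path_tensor_def path_pure_def
 by (rule P.pure_smult) (use tuples_length[of us "map M p1"] in "auto intro!: tuples_map_middleI simp: nth_append simp del: map_append list.map")

lemma pure_balance: "[|p = p1 @ e # d # p2; us \<in> tuples (map M p1); x \<in> carrier (M e); y \<in> carrier (M d);
  vs \<in> tuples (map M p2); a \<in> carrier (A (tail Q e))|] ==>
  pure p (us @ ract (M e) x a # y # vs) = pure p (us @ x # lact (M d) a y # vs)"
 unfolding path_pure_def
proof (rule P.pure_balanced)
 assume a: "p = p1 @ e # d # p2" "us \<in> tuples (map M p1)" "x \<in> carrier (M e)" "y \<in> carrier (M d)"
  "vs \<in> tuples (map M p2)" "a \<in> carrier (A (tail Q e))"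
 have "length us = length p1" using tuples_length[OF a(2)] by simp
 then have "p ! length us = e" "p ! Suc (length us) = d" using a(1) by (auto simp: nth_append)
 moreover have "us @ x # y # vs \<in> tuples (map M p)" using a by (simp add: tuples_append)
 ultimately show "(us @ ract (M e) x a # y # vs, us @ x # lact (M d) a y # vs) \<in> balance Q A M p"
  unfolding balance_def using a(6) by blast
qed

lemma path_tensor_induct [consumes 1, case_names zero pure add]:
 assumes "X \<in> carrier (L p)" "P \<zero>\<^bsub>L p\<^esub>" "\<And>xs. xs \<in> tuples (map M p) ==> P (pure p xs)"
  "\<And>X Y. [|X \<in> carrier (L p); Y \<in> carrier (L p); P X; P Y|] ==> P (X \<oplus>\<^bsub>L p\<^esub> Y)"
 shows "P X"
proof (rule P.tensor_induct)
 show "map M p \<noteq> []" using p by auto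
qed (use assms in "simp_all add: path_tensor_def path_pure_def")

lemma linear_path_tensor_ext:
 assumes "linear_map K (L p) C h" "linear_map K (L p) C h'"
  "\<And>xs. xs \<in> tuples (map M p) ==> h (pure p xs) = h' (pure p xs)" "X \<in> carrier (L p)"
 shows "h X = h' X"
 by (rule P.linear_tensor_ext) (use assms in "simp_all add: path_tensor_def path_pure_def")

context
 fixes C :: "('k, 'c, 'z) module_scheme" and g
 assumes C: "Module.module K C" and g: "multilinear K (map M p) C g"
  and b: "\<And>p1 e d p2 us x y vs a. [|p = p1 @ e # d # p2; us \<in> tuples (map M p1); x \<in> carrier (M e);
   y \<in> carrier (M d); vs \<in> tuples (map M p2); a \<in> carrier (A (tail Q e)); length us = length p1|] ==>
   g (us @ ract (M e) x a # y # vs) = g (us @ x # lact (M d) a y # vs)"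
begin

lemma balanced_path: "(xs, ys) \<in> balance Q A M p ==> g xs = g ys"
 by (elim balanceE) (use b in blast)

lemma linear_path_lift: "linear_map K (L p) C (coset_lift (lin K C g))"
 unfolding path_tensor_def by (rule P.linear_tensor_lift[OF C g balanced_path])

lemma path_lift_pure: "xs \<in> tuples (map M p) ==> coset_lift (lin K C g) (pure p xs) = g xs"
 unfolding path_pure_def by (rule P.tensor_lift_pure[OF C g balanced_path])

end

lemma tuples_pathE:
 assumes "xs \<in> tuples (map M p)"
 obtains x ys q where "xs = x # ys" "x \<in> carrier (M (hd p))" "ys \<in> tuples (map M q)" "p = hd p # q"
 using assms p by (cases p) (auto simp: tuples_Cons)

lemma tuples_path_lastE:
 assumes "xs \<in> tuples (map M p)"
 obtains ys x q where "xs = ys @ [x]" "x \<in> carrier (M (last p))" "ys \<in> tuples (map M q)" "p = q @ [last p]"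
  "length ys = length q"
proof -
 obtain q e where q: "p = q @ [e]" using p by (cases p rule: rev_cases) auto
 have "length xs = length p" using tuples_length[OF assms] by simp
 then obtain ys x where ys: "xs = ys @ [x]" using q by (cases xs rule: rev_cases) auto
 have l: "length ys = length q" using \<open>length xs = length p\<close> q ys by simp
 have "ys \<in> tuples (map M q) \<and> [x] \<in> tuples [M e]"
  using assms l unfolding q ys by (simp add: tuples_append_iff)
 then show thesis using that[of ys x q] q ys l by simp
qed

lemma hd_last_arcs: "hd p \<in> arcs Q" "last p \<in> arcs Q"
 using npaths_hd_last[OF p] by auto

text \<open>The action on the first factor respects the balancing relations, since on that factor these concern the right
 action, which commutes with the left one. The right action on the last factor is dealt with in the same way.\<close>

lemma linear_path_lact:
 assumes a: "a \<in> carrier (A (head Q (hd p)))"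
 shows "linear_map K (L p) (L p) (plact p a)"
  and "\<And>x xs. x # xs \<in> tuples (map M p) ==>
   plact p a (pure p (x # xs)) = pure p (lact (M (hd p)) a x # xs)"
proof -
 interpret B: bimodule K "A (head Q (hd p))" "A (tail Q (hd p))" "M (hd p)"
  by (rule bimodule_at[OF hd_last_arcs(1)])
 let ?h = "\<lambda>xs. lact (M (hd p)) a (hd xs) # tl xs"
 have h: "?h xs \<in> tuples (map M p)" if "xs \<in> tuples (map M p)" for xs
  using that
 proof (rule tuples_pathE)
  fix x ys q assume *: "xs = x # ys" "x \<in> carrier (M (hd p))" "ys \<in> tuples (map M q)" "p = hd p # q"
  have "lact (M (hd p)) a x # ys \<in> tuples (map M (hd p # q))"
   using *(2,3) B.lact_closed a by simp
  then show ?thesis using *(1) unfolding *(4)[symmetric] by simp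
 qed
 have m: "multilinear K (map M p) (L p) (\<lambda>xs. pure p (?h xs))"
 proof (rule multilinear_pathI)
  show "pure p (?h xs) \<in> carrier (L p)" if "xs \<in> tuples (map M p)" for xs
   by (rule pure_closed[OF h[OF that]])
 next
  fix p1 e p2 us vs x y assume *: "p = p1 @ e # p2" "us \<in> tuples (map M p1)" "x \<in> carrier (M e)"
   "y \<in> carrier (M e)" "vs \<in> tuples (map M p2)" "length us = length p1"
  show "pure p (?h (us @ (x \<oplus>\<^bsub>M e\<^esub> y) # vs)) = pure p (?h (us @ x # vs)) \<oplus>\<^bsub>L p\<^esub> pure p (?h (us @ y # vs))"
  proof (cases us)
   case Nil
   then show ?thesis using * pure_add[of p1 e p2 "[]" "lact (M e) a x" "lact (M e) a y" vs]
    B.lact_closed B.lact_add_right a by simp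
  next
   case (Cons u us')
   then have "lact (M (hd p)) a u # us' \<in> tuples (map M p1)"
    using * B.lact_closed a by (cases p1) auto
   then show ?thesis using * pure_add[of p1 e p2 "lact (M (hd p)) a u # us'" x y vs] Cons by simp
  qed
 next
  fix p1 e p2 us vs c x assume *: "p = p1 @ e # p2" "us \<in> tuples (map M p1)" "x \<in> carrier (M e)"
   "vs \<in> tuples (map M p2)" "length us = length p1" "c \<in> carrier K"
  show "pure p (?h (us @ (c \<odot>\<^bsub>M e\<^esub> x) # vs)) = c \<odot>\<^bsub>L p\<^esub> pure p (?h (us @ x # vs))"
  proof (cases us)
   case Nil
   then show ?thesis using * pure_smult[of p1 e p2 "[]" "lact (M e) a x" vs c]
    B.lact_closed B.lact_scalar a by simp
  next
   case (Cons u us')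
   then have "lact (M (hd p)) a u # us' \<in> tuples (map M p1)"
    using * B.lact_closed a by (cases p1) auto
   then show ?thesis using * pure_smult[of p1 e p2 "lact (M (hd p)) a u # us'" x vs c] Cons by simp
  qed
 qed
 have b: "pure p (?h (us @ ract (M e) x c # y # vs)) = pure p (?h (us @ x # lact (M d) c y # vs))"
  if *: "p = p1 @ e # d # p2" "us \<in> tuples (map M p1)" "x \<in> carrier (M e)"
   "y \<in> carrier (M d)" "vs \<in> tuples (map M p2)" "c \<in> carrier (A (tail Q e))" for p1 e d p2 us x y vs c
 proof (cases us)
  case Nil
  then have p1: "p1 = []" using *(2) by (auto simp: tuples_def)
  then show ?thesis using * Nil pure_balance[of "[]" e d p2 "[]" "lact (M e) a x" y vs c]
    B.lact_closed B.lact_ract a by simp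
 next
  case (Cons u us')
  then have "lact (M (hd p)) a u # us' \<in> tuples (map M p1)"
   using * B.lact_closed a by (cases p1) (auto simp: tuples_def)
  then show ?thesis using * pure_balance[of p1 e d p2 "lact (M (hd p)) a u # us'" x y vs c] Cons by simp
 qed
 have eq: "path_lact K Q A M p a X = coset_lift (lin K (L p) (\<lambda>xs. pure p (?h xs))) X" if "X \<in> carrier (L p)" for X
  unfolding path_lact_def path_coset_def path_tensor_def path_pure_def
 proof (rule UN_push_coset[OF P.tensor_product_axioms P.tensor_product_axioms h])
  show "multilinear K (map M p) (tensor K (map M p) (balance Q A M p))
   (\<lambda>xs. pure_tensor K (map M p) (balance Q A M p) (?h xs))"
   using m by (simp add: path_tensor_def path_pure_def)
  show "pure_tensor K (map M p) (balance Q A M p) (?h xs) = pure_tensor K (map M p) (balance Q A M p) (?h ys)"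
   if "(xs, ys) \<in> balance Q A M p" for xs ys
   using balanced_path[OF module_L m b that] by (simp add: path_pure_def)
  show "X \<in> carrier (tensor K (map M p) (balance Q A M p))" using that by (simp add: path_tensor_def)
 qed
 interpret l: linear_map K "L p" "L p" "coset_lift (lin K (L p) (\<lambda>xs. pure p (?h xs)))"
  by (rule linear_path_lift[OF module_L m b])
 show "linear_map K (L p) (L p) (plact p a)"
  by unfold_locales (simp_all add: eq l.add l.smult)
 show "path_lact K Q A M p a (pure p (x # xs)) = pure p (lact (M (hd p)) a x # xs)"
  if "x # xs \<in> tuples (map M p)" for x xs
  using path_lift_pure[OF module_L m b that] eq[OF pure_closed[OF that]] by simp
qed

lemma linear_path_ract:
 assumes a: "a \<in> carrier (A (tail Q (last p)))"
 shows "linear_map K (L p) (L p) (\<lambda>X. pract p X a)"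
  and "\<And>x xs. xs @ [x] \<in> tuples (map M p) ==>
   pract p (pure p (xs @ [x])) a = pure p (xs @ [ract (M (last p)) x a])"
proof -
 interpret B: bimodule K "A (head Q (last p))" "A (tail Q (last p))" "M (last p)"
  by (rule bimodule_at[OF hd_last_arcs(2)])
 let ?h = "\<lambda>xs. butlast xs @ [ract (M (last p)) (last xs) a]"
 have h: "?h xs \<in> tuples (map M p)" if "xs \<in> tuples (map M p)" for xs
  using that
 proof (rule tuples_path_lastE)
  fix ys x q assume *: "xs = ys @ [x]" "x \<in> carrier (M (last p))" "ys \<in> tuples (map M q)" "p = q @ [last p]"
  have "ys @ [ract (M (last p)) x a] \<in> tuples (map M (q @ [last p]))"
   using *(2,3) B.ract_closed a by (simp add: tuples_append)
  then show ?thesis using *(1) unfolding *(4)[symmetric] by simp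
 qed
 have lst: "\<exists>vs' v p3. vs = vs' @ [v] \<and> p2 = p3 @ [last p] \<and> vs' \<in> tuples (map M p3) \<and> v \<in> carrier (M (last p))"
  if a: "p = p1 @ e # p2" "vs \<in> tuples (map M p2)" "vs \<noteq> []" for p1 e p2 vs
 proof -
  obtain vs' v where v: "vs = vs' @ [v]" using a(3) by (cases vs rule: rev_cases) auto
  have "p2 \<noteq> []" using a(2,3) by (auto simp: tuples_def)
  then obtain p3 d where p3: "p2 = p3 @ [d]" by (cases p2 rule: rev_cases) auto
  have "length vs' = length p3" using tuples_length[OF a(2)] v p3 by simp
  then show ?thesis using a v p3 by (auto simp: tuples_append_iff)
 qed
 have m: "multilinear K (map M p) (L p) (\<lambda>xs. pure p (?h xs))"
 proof (rule multilinear_pathI)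
  show "pure p (?h xs) \<in> carrier (L p)" if "xs \<in> tuples (map M p)" for xs
   by (rule pure_closed[OF h[OF that]])
 next
  fix p1 e p2 us vs x y assume *: "p = p1 @ e # p2" "us \<in> tuples (map M p1)" "x \<in> carrier (M e)"
   "y \<in> carrier (M e)" "vs \<in> tuples (map M p2)" "length us = length p1"
  show "pure p (?h (us @ (x \<oplus>\<^bsub>M e\<^esub> y) # vs)) = pure p (?h (us @ x # vs)) \<oplus>\<^bsub>L p\<^esub> pure p (?h (us @ y # vs))"
  proof (cases "vs = []")
   case True
   then have "p2 = []" using *(5) by (auto simp: tuples_def)
   then show ?thesis using * True pure_add[of p1 e p2 us "ract (M e) x a" "ract (M e) y a" "[]"]
    B.ract_closed B.ract_add_left a by (simp add: butlast_append)
  next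
   case False
   obtain vs' v p3 where v: "vs = vs' @ [v]" "p2 = p3 @ [last p]" "vs' \<in> tuples (map M p3)" "v \<in> carrier (M (last p))"
    using lst[OF *(1,5) False] by blast
   have "vs' @ [ract (M (last p)) v a] \<in> tuples (map M p2)"
    unfolding v(2) using v B.ract_closed a by (simp add: tuples_append)
   then show ?thesis using * pure_add[of p1 e p2 us x y "vs' @ [ract (M (last p)) v a]"] v(1)
    by (simp add: butlast_append)
  qed
 next
  fix p1 e p2 us vs c x assume *: "p = p1 @ e # p2" "us \<in> tuples (map M p1)" "x \<in> carrier (M e)"
   "vs \<in> tuples (map M p2)" "length us = length p1" "c \<in> carrier K"
  show "pure p (?h (us @ (c \<odot>\<^bsub>M e\<^esub> x) # vs)) = c \<odot>\<^bsub>L p\<^esub> pure p (?h (us @ x # vs))"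
  proof (cases "vs = []")
   case True
   then have "p2 = []" using *(4) by (auto simp: tuples_def)
   then show ?thesis using * True pure_smult[of p1 e p2 us "ract (M e) x a" "[]" c]
    B.ract_closed B.ract_scalar a by (simp add: butlast_append)
  next
   case False
   obtain vs' v p3 where v: "vs = vs' @ [v]" "p2 = p3 @ [last p]" "vs' \<in> tuples (map M p3)" "v \<in> carrier (M (last p))"
    using lst[OF *(1,4) False] by blast
   have "vs' @ [ract (M (last p)) v a] \<in> tuples (map M p2)"
    unfolding v(2) using v B.ract_closed a by (simp add: tuples_append)
   then show ?thesis using * pure_smult[of p1 e p2 us x "vs' @ [ract (M (last p)) v a]" c] v(1)
    by (simp add: butlast_append)
  qed
 qed
 have b: "pure p (?h (us @ ract (M e) x c # y # vs)) = pure p (?h (us @ x # lact (M d) c y # vs))"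
  if *: "p = p1 @ e # d # p2" "us \<in> tuples (map M p1)" "x \<in> carrier (M e)"
   "y \<in> carrier (M d)" "vs \<in> tuples (map M p2)" "c \<in> carrier (A (tail Q e))" for p1 e d p2 us x y vs c
 proof (cases "vs = []")
  case True
  then have p2: "p2 = []" using *(5) by (auto simp: tuples_def)
  have hb: "head Q d = tail Q e"
   using p npaths_append[of "p1 @ [e]" "d # p2"] unfolding *(1) by simp
  have lp: "last p = d" using p2 *(1) by simp
  have "ract (M d) (lact (M d) c y) a = lact (M d) c (ract (M d) y a)"
   using B.lact_ract a * hb unfolding lp by simp
  then show ?thesis using * True p2 pure_balance[of p1 e d "[]" us x "ract (M d) y a" "[]" c]
    B.ract_closed a unfolding lp by (simp add: butlast_append)
 next
  case False
  obtain vs' v p3 where v: "vs = vs' @ [v]" "p2 = p3 @ [last p]" "vs' \<in> tuples (map M p3)" "v \<in> carrier (M (last p))"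
   using lst[of "p1 @ [e]" d p2 vs] * False by auto
  have "vs' @ [ract (M (last p)) v a] \<in> tuples (map M p2)"
   unfolding v(2) using v B.ract_closed a by (simp add: tuples_append)
  then show ?thesis using * pure_balance[of p1 e d p2 us x y "vs' @ [ract (M (last p)) v a]" c] v(1)
   by (simp add: butlast_append)
 qed
 have eq: "path_ract K Q A M p X a = coset_lift (lin K (L p) (\<lambda>xs. pure p (?h xs))) X" if "X \<in> carrier (L p)" for X
  unfolding path_ract_def path_coset_def path_tensor_def path_pure_def
 proof (rule UN_push_coset[OF P.tensor_product_axioms P.tensor_product_axioms h])
  show "multilinear K (map M p) (tensor K (map M p) (balance Q A M p))
   (\<lambda>xs. pure_tensor K (map M p) (balance Q A M p) (?h xs))"
   using m by (simp add: path_tensor_def path_pure_def)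
  show "pure_tensor K (map M p) (balance Q A M p) (?h xs) = pure_tensor K (map M p) (balance Q A M p) (?h ys)"
   if "(xs, ys) \<in> balance Q A M p" for xs ys
   using balanced_path[OF module_L m b that] by (simp add: path_pure_def)
  show "X \<in> carrier (tensor K (map M p) (balance Q A M p))" using that by (simp add: path_tensor_def)
 qed
 interpret l: linear_map K "L p" "L p" "coset_lift (lin K (L p) (\<lambda>xs. pure p (?h xs)))"
  by (rule linear_path_lift[OF module_L m b])
 show "linear_map K (L p) (L p) (\<lambda>X. pract p X a)"
  by unfold_locales (simp_all add: eq l.add l.smult)
 show "path_ract K Q A M p (pure p (xs @ [x])) a = pure p (xs @ [ract (M (last p)) x a])"
  if "xs @ [x] \<in> tuples (map M p)" for x xs
  using path_lift_pure[OF module_L m b that] eq[OF pure_closed[OF that]] by simp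
qed

end

lemma tensor_pairing_path:
 assumes pq: "p @ q \<in> N" "p \<noteq> []" "q \<noteq> []"
 shows "tensor_pairing K (map M p) (balance Q A M p) (map M q) (balance Q A M q) (map M (p @ q)) (balance Q A M (p @ q))"
proof -
 have p: "p \<in> N" and q: "q \<in> N" using npaths_append[OF pq(2,3)] pq(1) by auto
 interpret P: tensor_product K "map M p" "balance Q A M p" by (rule tensor_product_path[OF p])
 interpret R: tensor_product K "map M q" "balance Q A M q" by (rule tensor_product_path[OF q])
 interpret PQ: tensor_product K "map M (p @ q)" "balance Q A M (p @ q)" by (rule tensor_product_path[OF pq(1)])
 note defs = path_tensor_def[symmetric] path_pure_def[symmetric]
 show ?thesis
 proof
  fix xs ys assume xs: "xs \<in> tuples (map M p)" and ys: "ys \<in> tuples (map M q)"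
  show "xs @ ys \<in> tuples (map M (p @ q))" using xs ys by (simp add: tuples_append)
 next
  fix ys assume ys: "ys \<in> tuples (map M q)"
  show "multilinear K (map M p) PQ.T (\<lambda>xs. PQ.pure (xs @ ys))" unfolding defs
  proof (rule multilinear_pathI)
   show "pure (p @ q) (xs @ ys) \<in> carrier (L (p @ q))" if "xs \<in> tuples (map M p)" for xs
    using that ys by (intro pure_closed[OF pq(1)]) (simp add: tuples_append)
   show "pure (p @ q) ((us @ (x \<oplus>\<^bsub>M e\<^esub> y) # vs) @ ys) = pure (p @ q) ((us @ x # vs) @ ys)
    \<oplus>\<^bsub>L (p @ q)\<^esub> pure (p @ q) ((us @ y # vs) @ ys)" if *: "p = p1 @ e # p2" "us \<in> tuples (map M p1)" "x \<in> carrier (M e)" "y \<in> carrier (M e)"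
    "vs \<in> tuples (map M p2)" for p1 e p2 us vs x y
    using pure_add[OF pq(1), of p1 e "p2 @ q" us x y "vs @ ys"] * ys by (simp add: tuples_append)
   show "pure (p @ q) ((us @ (c \<odot>\<^bsub>M e\<^esub> x) # vs) @ ys) = c \<odot>\<^bsub>L (p @ q)\<^esub> pure (p @ q) ((us @ x # vs) @ ys)"
    if *: "p = p1 @ e # p2" "us \<in> tuples (map M p1)" "x \<in> carrier (M e)"
    "vs \<in> tuples (map M p2)" "c \<in> carrier K" for p1 e p2 us vs c x
    using pure_smult[OF pq(1), of p1 e "p2 @ q" us x "vs @ ys" c] * ys by (simp add: tuples_append)
  qed
  fix xs xs' assume "(xs, xs') \<in> balance Q A M p"
  then show "PQ.pure (xs @ ys) = PQ.pure (xs' @ ys)" unfolding defs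
  proof (rule balanceE)
   fix us x y vs a p1 e d p2 assume *: "xs = us @ ract (M e) x a # y # vs" "xs' = us @ x # lact (M d) a y # vs"
    "p = p1 @ e # d # p2" "us \<in> tuples (map M p1)" "x \<in> carrier (M e)" "y \<in> carrier (M d)"
    "vs \<in> tuples (map M p2)" "a \<in> carrier (A (tail Q e))" "length us = length p1"
   show "pure (p @ q) (xs @ ys) = pure (p @ q) (xs' @ ys)"
    using pure_balance[OF pq(1), of p1 e d "p2 @ q" us x y "vs @ ys" a] * ys by (simp add: tuples_append)
  qed
 next
  fix xs assume xs: "xs \<in> tuples (map M p)"
  show "multilinear K (map M q) PQ.T (\<lambda>ys. PQ.pure (xs @ ys))" unfolding defs
  proof (rule multilinear_pathI)
   show "pure (p @ q) (xs @ ys) \<in> carrier (L (p @ q))" if "ys \<in> tuples (map M q)" for ys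
    using that xs by (intro pure_closed[OF pq(1)]) (simp add: tuples_append)
   show "pure (p @ q) (xs @ us @ (x \<oplus>\<^bsub>M e\<^esub> y) # vs) = pure (p @ q) (xs @ us @ x # vs)
    \<oplus>\<^bsub>L (p @ q)\<^esub> pure (p @ q) (xs @ us @ y # vs)" if *: "q = p1 @ e # p2" "us \<in> tuples (map M p1)" "x \<in> carrier (M e)" "y \<in> carrier (M e)"
    "vs \<in> tuples (map M p2)" for p1 e p2 us vs x y
   proof -
    have 1: "p @ q = (p @ p1) @ e # p2" and 2: "xs @ us \<in> tuples (map M (p @ p1))"
     using *(1,2) xs by (simp_all add: tuples_append)
    show ?thesis using pure_add[OF pq(1) 1 2 *(3,4,5)] by simp
   qed
   show "pure (p @ q) (xs @ us @ (c \<odot>\<^bsub>M e\<^esub> x) # vs) = c \<odot>\<^bsub>L (p @ q)\<^esub> pure (p @ q) (xs @ us @ x # vs)"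
    if *: "q = p1 @ e # p2" "us \<in> tuples (map M p1)" "x \<in> carrier (M e)"
    "vs \<in> tuples (map M p2)" "c \<in> carrier K" for p1 e p2 us vs c x
   proof -
    have 1: "p @ q = (p @ p1) @ e # p2" and 2: "xs @ us \<in> tuples (map M (p @ p1))"
     using *(1,2) xs by (simp_all add: tuples_append)
    show ?thesis using pure_smult[OF pq(1) 1 2 *(3,4,5)] by simp
   qed
  qed
  fix ys ys' assume "(ys, ys') \<in> balance Q A M q"
  then show "PQ.pure (xs @ ys) = PQ.pure (xs @ ys')" unfolding defs
  proof (rule balanceE)
   fix us x y vs a p1 e d p2 assume *: "ys = us @ ract (M e) x a # y # vs" "ys' = us @ x # lact (M d) a y # vs"
    "q = p1 @ e # d # p2" "us \<in> tuples (map M p1)" "x \<in> carrier (M e)" "y \<in> carrier (M d)"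
    "vs \<in> tuples (map M p2)" "a \<in> carrier (A (tail Q e))" "length us = length p1"
   show "pure (p @ q) (xs @ ys) = pure (p @ q) (xs @ ys')"
    using pure_balance[OF pq(1), of "p @ p1" e d p2 "xs @ us" x y vs a] * xs by (simp add: tuples_append)
  qed
 qed
qed

lemma path_mult:
 assumes pq: "p @ q \<in> N" "p \<noteq> []" "q \<noteq> []"
 shows "X \<in> carrier (L p) ==> linear_map K (L q) (L (p @ q)) (pmult p q X)"
  and "Y \<in> carrier (L q) ==> linear_map K (L p) (L (p @ q)) (\<lambda>X. pmult p q X Y)"
  and "xs \<in> tuples (map M p) ==> ys \<in> tuples (map M q) ==>
   pmult p q (pure p xs) (pure q ys) = pure (p @ q) (xs @ ys)"
proof -
 interpret R: tensor_pairing K "map M p" "balance Q A M p" "map M q" "balance Q A M q" "map M (p @ q)" "balance Q A M (p @ q)"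
  by (rule tensor_pairing_path[OF pq])
 have eq: "path_mult K Q A M p q X Y = R.pairing X Y" if "X \<in> carrier (L p)" "Y \<in> carrier (L q)" for X Y
  using that unfolding path_mult_def path_coset_def path_tensor_def by (rule R.UN_convolve_coset)
 { assume X: "X \<in> carrier (L p)"
  have "linear_map K (L q) (L (p @ q)) (R.pairing X)"
   unfolding path_tensor_def by (rule R.linear_pairing_right) (use X in "simp add: path_tensor_def")
  then show "linear_map K (L q) (L (p @ q)) (pmult p q X)"
   by (rule linear_map_cong) (rule eq[OF X]) }
 { assume Y: "Y \<in> carrier (L q)"
  have "linear_map K (L p) (L (p @ q)) (\<lambda>X. R.pairing X Y)"
   unfolding path_tensor_def by (rule R.linear_pairing_left) (use Y in "simp add: path_tensor_def")
  then show "linear_map K (L p) (L (p @ q)) (\<lambda>X. pmult p q X Y)"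
   by (rule linear_map_cong) (rule eq[OF _ Y]) }
 assume a: "xs \<in> tuples (map M p)" "ys \<in> tuples (map M q)"
 have "p \<in> N" "q \<in> N" using npaths_append[OF pq(2,3)] pq(1) by auto
 then show "path_mult K Q A M p q (pure p xs) (pure q ys) = pure (p @ q) (xs @ ys)"
  using eq[OF pure_closed[OF _ a(1)] pure_closed[OF _ a(2)]] R.pairing_pure[OF a] by (simp add: path_pure_def)
qed

end

lemma (in Module.module) minus_self: "x \<in> carrier M ==> x \<ominus>\<^bsub>M\<^esub> x = \<zero>\<^bsub>M\<^esub>"
 by (simp add: a_minus_def M.r_neg)

lemma (in Module.module) minus_zero_right: "x \<in> carrier M ==> x \<ominus>\<^bsub>M\<^esub> \<zero>\<^bsub>M\<^esub> = x"
 using M.minus_equality[of "\<zero>\<^bsub>M\<^esub>" "\<zero>\<^bsub>M\<^esub>"] by (simp add: a_minus_def)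

lemma linear_smult_map:
 assumes "Module.module K M" "c \<in> carrier K" shows "linear_map K M M (\<lambda>x. c \<odot>\<^bsub>M\<^esub> x)"
proof -
 interpret Module.module K M by fact
 show ?thesis using assms(2)
  by unfold_locales (auto simp: smult_r_distr smult_assoc1[symmetric] R.m_comm)
qed

context species
begin

text \<open>The identities to be shown are linear in \<open>X\<close>, so pure tensors suffice.\<close>

lemma linear_in_parameter:
 assumes p: "p \<in> N" and B: "Module.module K B" and C: "Module.module K C" and X: "X \<in> carrier (L p)"
  and f: "\<And>b. b \<in> carrier B ==> linear_map K (L p) C (f b)"
  and g: "\<And>xs. xs \<in> tuples (map M p) ==> linear_map K B C (\<lambda>b. f b (pure p xs))"
 shows "linear_map K B C (\<lambda>b. f b X)"
proof -
 interpret B: Module.module K B by fact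
 show ?thesis
 proof (intro linear_map.intro linear_map_axioms.intro B C)
  fix a assume a: "a \<in> carrier B"
  show "f a X \<in> carrier C" by (rule linear_map.closed[OF f[OF a] X])
  show "f (c \<odot>\<^bsub>B\<^esub> a) X = c \<odot>\<^bsub>C\<^esub> f a X" if c: "c \<in> carrier K" for c
   by (rule linear_path_tensor_ext[OF p f[OF B.smult_closed[OF c a]]
     linear_map_comp[OF f[OF a] linear_smult_map[OF C c]] linear_map.smult[OF g c a] X])
  fix b assume b: "b \<in> carrier B"
  show "f (a \<oplus>\<^bsub>B\<^esub> b) X = f a X \<oplus>\<^bsub>C\<^esub> f b X"
   by (rule linear_path_tensor_ext[OF p f[OF B.a_closed[OF a b]] linear_sum2[OF f[OF a] f[OF b]]
     linear_map.add[OF g a b] X])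
 qed
qed

lemma linear_lact_scalar:
 assumes p: "p \<in> N" and X: "X \<in> carrier (L p)"
 shows "linear_map K (A (head Q (hd p))) (L p) (\<lambda>a. plact p a X)"
proof -
 have m: "Module.module K (A (head Q (hd p)))" using hd_last_arcs[OF p] by (auto intro: module_A)
 interpret B: bimodule K "A (head Q (hd p))" "A (tail Q (hd p))" "M (hd p)"
  by (rule bimodule_at[OF hd_last_arcs(1)[OF p]])
 note l = linear_path_lact[OF p]
 show ?thesis
 proof (rule linear_in_parameter[OF p m module_L[OF p] X l(1)])
  fix xs assume t: "xs \<in> tuples (map M p)"
  then obtain x ys q where *: "xs = x # ys" "x \<in> carrier (M (hd p))" "ys \<in> tuples (map M q)" "p = hd p # q"
   by (rule tuples_pathE[OF p])
  have xs: "x # ys \<in> tuples (map M p)" using *(1) t by simp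
  show "linear_map K (A (head Q (hd p))) (L p) (\<lambda>a. plact p a (pure p xs))"
  proof (intro linear_map.intro linear_map_axioms.intro m module_L[OF p])
   fix a assume a: "a \<in> carrier (A (head Q (hd p)))"
   show "path_lact K Q A M p a (pure p xs) \<in> carrier (L p)"
    by (rule linear_map.closed[OF l(1)[OF a] pure_closed[OF p t]])
   show "path_lact K Q A M p (c \<odot>\<^bsub>A (head Q (hd p))\<^esub> a) (pure p xs) = c \<odot>\<^bsub>L p\<^esub> plact p a (pure p xs)"
    if "c \<in> carrier K" for c
    using pure_smult[OF p, of "[]" "hd p" q "[]" "lact (M (hd p)) a x" ys c] *(2-4) that a
    by (simp add: *(1) l(2)[OF _ xs] B.lact_smult B.lact_closed)
   fix b assume b: "b \<in> carrier (A (head Q (hd p)))"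
   show "path_lact K Q A M p (a \<oplus>\<^bsub>A (head Q (hd p))\<^esub> b) (pure p xs) =
     plact p a (pure p xs) \<oplus>\<^bsub>L p\<^esub> plact p b (pure p xs)"
    using pure_add[OF p, of "[]" "hd p" q "[]" "lact (M (hd p)) a x" "lact (M (hd p)) b x" ys] *(2-4) a b
    by (simp add: *(1) l(2)[OF _ xs] B.lact_add_left B.lact_closed)
  qed
 qed
qed

lemma linear_ract_scalar:
 assumes p: "p \<in> N" and X: "X \<in> carrier (L p)"
 shows "linear_map K (A (tail Q (last p))) (L p) (pract p X)"
proof -
 have m: "Module.module K (A (tail Q (last p)))" using hd_last_arcs[OF p] by (auto intro: module_A)
 interpret B: bimodule K "A (head Q (last p))" "A (tail Q (last p))" "M (last p)"
  by (rule bimodule_at[OF hd_last_arcs(2)[OF p]])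
 note l = linear_path_ract[OF p]
 show ?thesis
 proof (rule linear_in_parameter[where f = "\<lambda>a X. pract p X a", OF p m module_L[OF p] X l(1)])
  fix xs assume t: "xs \<in> tuples (map M p)"
  then obtain ys x q where *: "xs = ys @ [x]" "x \<in> carrier (M (last p))" "ys \<in> tuples (map M q)" "p = q @ [last p]"
    "length ys = length q"
   by (rule tuples_path_lastE[OF p])
  have xs: "ys @ [x] \<in> tuples (map M p)" using *(1) t by simp
  show "linear_map K (A (tail Q (last p))) (L p) (\<lambda>a. pract p (pure p xs) a)"
  proof (intro linear_map.intro linear_map_axioms.intro m module_L[OF p])
   fix a assume a: "a \<in> carrier (A (tail Q (last p)))"
   show "path_ract K Q A M p (pure p xs) a \<in> carrier (L p)"
    by (rule linear_map.closed[OF l(1)[OF a] pure_closed[OF p t]])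
   show "path_ract K Q A M p (pure p xs) (c \<odot>\<^bsub>A (tail Q (last p))\<^esub> a) = c \<odot>\<^bsub>L p\<^esub> pract p (pure p xs) a"
    if "c \<in> carrier K" for c
    using pure_smult[OF p, of q "last p" "[]" ys "ract (M (last p)) x a" "[]" c] *(2-4) that a
    by (simp add: *(1) l(2)[OF _ xs] B.ract_smult B.ract_closed)
   fix b assume b: "b \<in> carrier (A (tail Q (last p)))"
   show "path_ract K Q A M p (pure p xs) (a \<oplus>\<^bsub>A (tail Q (last p))\<^esub> b) =
     pract p (pure p xs) a \<oplus>\<^bsub>L p\<^esub> pract p (pure p xs) b"
    using pure_add[OF p, of q "last p" "[]" ys "ract (M (last p)) x a" "ract (M (last p)) x b" "[]"] *(2-4) a b
    by (simp add: *(1) l(2)[OF _ xs] B.ract_add_right B.ract_closed)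
  qed
 qed
qed

abbreviation "vp == vertex_part K Q A M"
abbreviation "pp == path_part K Q A M"

lemma T_carrier: "t \<in> carrier T \<longleftrightarrow> fst t \<in> (\<Pi>\<^sub>E i\<in>verts Q. carrier (A i)) \<and>
  snd t \<in> (\<Pi>\<^sub>E p\<in>N. carrier (L p)) \<and> finite {p \<in> N. snd t p \<noteq> \<zero>\<^bsub>L p\<^esub>}"
 by (cases t) (simp add: tensor_algebra_def Let_def)

lemma fst_in: "t \<in> carrier T ==> i \<in> verts Q ==> fst t i \<in> carrier (A i)"
 and snd_in: "t \<in> carrier T ==> p \<in> N ==> snd t p \<in> carrier (L p)"
 and finite_support: "t \<in> carrier T ==> finite {p \<in> N. snd t p \<noteq> \<zero>\<^bsub>L p\<^esub>}"
 by (auto simp: T_carrier PiE_mem)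

lemma T_eqI:
 assumes "s \<in> carrier T" "t \<in> carrier T" "\<And>i. i \<in> verts Q ==> fst s i = fst t i" "\<And>p. p \<in> N ==> snd s p = snd t p"
 shows "s = t"
proof (rule prod_eqI)
 show "fst s = fst t" by (rule PiE_ext[of _ "verts Q" "\<lambda>i. carrier (A i)"]) (use assms in "auto simp: T_carrier")
 show "snd s = snd t" by (rule PiE_ext[of _ N "\<lambda>p. carrier (L p)"]) (use assms in "auto simp: T_carrier")
qed

lemma T_add_comp:
 "i \<in> verts Q ==> fst (s \<oplus>\<^bsub>T\<^esub> t) i = fst s i \<oplus>\<^bsub>A i\<^esub> fst t i"
 "p \<in> N ==> snd (s \<oplus>\<^bsub>T\<^esub> t) p = snd s p \<oplus>\<^bsub>L p\<^esub> snd t p"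
 by (cases s; cases t; simp add: tensor_algebra_def Let_def)+

lemma T_zero_comp:
 "i \<in> verts Q ==> fst \<zero>\<^bsub>T\<^esub> i = \<zero>\<^bsub>A i\<^esub>"
 "p \<in> N ==> snd \<zero>\<^bsub>T\<^esub> p = \<zero>\<^bsub>L p\<^esub>"
 by (simp_all add: tensor_algebra_def Let_def)

lemma T_one_comp:
 "i \<in> verts Q ==> fst \<one>\<^bsub>T\<^esub> i = \<one>\<^bsub>A i\<^esub>"
 "p \<in> N ==> snd \<one>\<^bsub>T\<^esub> p = \<zero>\<^bsub>L p\<^esub>"
 by (simp_all add: tensor_algebra_def Let_def)

lemma T_smult_comp:
 "i \<in> verts Q ==> fst (c \<odot>\<^bsub>T\<^esub> t) i = c \<odot>\<^bsub>A i\<^esub> fst t i"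
 "p \<in> N ==> snd (c \<odot>\<^bsub>T\<^esub> t) p = c \<odot>\<^bsub>L p\<^esub> snd t p"
 by (cases t; simp add: tensor_algebra_def Let_def)+

lemma T_closed_ext:
 "fst (s \<oplus>\<^bsub>T\<^esub> t) \<in> extensional (verts Q)" "snd (s \<oplus>\<^bsub>T\<^esub> t) \<in> extensional N"
 "fst (s \<otimes>\<^bsub>T\<^esub> t) \<in> extensional (verts Q)" "snd (s \<otimes>\<^bsub>T\<^esub> t) \<in> extensional N"
 "fst (c \<odot>\<^bsub>T\<^esub> t) \<in> extensional (verts Q)" "snd (c \<odot>\<^bsub>T\<^esub> t) \<in> extensional N"
 "fst \<one>\<^bsub>T\<^esub> \<in> extensional (verts Q)" "snd \<one>\<^bsub>T\<^esub> \<in> extensional N"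
 "fst \<zero>\<^bsub>T\<^esub> \<in> extensional (verts Q)" "snd \<zero>\<^bsub>T\<^esub> \<in> extensional N"
 by (cases s; cases t; simp add: tensor_algebra_def Let_def)+

lemma T_carrierI:
 assumes "fst t \<in> extensional (verts Q)" "snd t \<in> extensional N"
  "\<And>i. i \<in> verts Q ==> fst t i \<in> carrier (A i)" "\<And>p. p \<in> N ==> snd t p \<in> carrier (L p)"
  "finite B" "\<And>p. p \<in> N ==> p \<notin> B ==> snd t p = \<zero>\<^bsub>L p\<^esub>"
 shows "t \<in> carrier T"
 unfolding T_carrier using assms finite_subset[of "{p \<in> N. snd t p \<noteq> \<zero>\<^bsub>L p\<^esub>}" B]
 by (auto simp: PiE_def)

lemma A_null:
 assumes "i \<in> verts Q" "x \<in> carrier (A i)"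
 shows "\<zero>\<^bsub>A i\<^esub> \<otimes>\<^bsub>A i\<^esub> x = \<zero>\<^bsub>A i\<^esub>" "x \<otimes>\<^bsub>A i\<^esub> \<zero>\<^bsub>A i\<^esub> = \<zero>\<^bsub>A i\<^esub>"
proof -
 interpret Ai: assoc_algebra K "A i" by (rule algebra_at[OF assms(1)])
 show "\<zero>\<^bsub>A i\<^esub> \<otimes>\<^bsub>A i\<^esub> x = \<zero>\<^bsub>A i\<^esub>" "x \<otimes>\<^bsub>A i\<^esub> \<zero>\<^bsub>A i\<^esub> = \<zero>\<^bsub>A i\<^esub>" using assms by auto
qed

lemma A_one:
 assumes "i \<in> verts Q" "x \<in> carrier (A i)"
 shows "\<one>\<^bsub>A i\<^esub> \<otimes>\<^bsub>A i\<^esub> x = x" "x \<otimes>\<^bsub>A i\<^esub> \<one>\<^bsub>A i\<^esub> = x"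
proof -
 interpret Ai: assoc_algebra K "A i" by (rule algebra_at[OF assms(1)])
 show "\<one>\<^bsub>A i\<^esub> \<otimes>\<^bsub>A i\<^esub> x = x" "x \<otimes>\<^bsub>A i\<^esub> \<one>\<^bsub>A i\<^esub> = x" using assms by auto
qed

lemma A_closed:
 assumes "i \<in> verts Q"
 shows "\<zero>\<^bsub>A i\<^esub> \<in> carrier (A i)" "\<one>\<^bsub>A i\<^esub> \<in> carrier (A i)"
  "x \<in> carrier (A i) ==> y \<in> carrier (A i) ==> x \<otimes>\<^bsub>A i\<^esub> y \<in> carrier (A i)"
  "x \<in> carrier (A i) ==> y \<in> carrier (A i) ==> x \<oplus>\<^bsub>A i\<^esub> y \<in> carrier (A i)"
  "c \<in> carrier K ==> x \<in> carrier (A i) ==> c \<odot>\<^bsub>A i\<^esub> x \<in> carrier (A i)"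
proof -
 interpret Ai: assoc_algebra K "A i" by (rule algebra_at[OF assms(1)])
 show "\<zero>\<^bsub>A i\<^esub> \<in> carrier (A i)" "\<one>\<^bsub>A i\<^esub> \<in> carrier (A i)"
  "x \<in> carrier (A i) ==> y \<in> carrier (A i) ==> x \<otimes>\<^bsub>A i\<^esub> y \<in> carrier (A i)"
  "x \<in> carrier (A i) ==> y \<in> carrier (A i) ==> x \<oplus>\<^bsub>A i\<^esub> y \<in> carrier (A i)"
  "c \<in> carrier K ==> x \<in> carrier (A i) ==> c \<odot>\<^bsub>A i\<^esub> x \<in> carrier (A i)"
  by (auto intro: module.smult_closed[OF module_A[OF assms]])
qed

lemma L_closed:
 assumes "p \<in> N"
 shows "\<zero>\<^bsub>L p\<^esub> \<in> carrier (L p)"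
  "X \<in> carrier (L p) ==> Y \<in> carrier (L p) ==> X \<oplus>\<^bsub>L p\<^esub> Y \<in> carrier (L p)"
  "c \<in> carrier K ==> X \<in> carrier (L p) ==> c \<odot>\<^bsub>L p\<^esub> X \<in> carrier (L p)"
  "\<zero>\<^bsub>L p\<^esub> \<oplus>\<^bsub>L p\<^esub> \<zero>\<^bsub>L p\<^esub> = \<zero>\<^bsub>L p\<^esub>" "c \<in> carrier K ==> c \<odot>\<^bsub>L p\<^esub> \<zero>\<^bsub>L p\<^esub> = \<zero>\<^bsub>L p\<^esub>"
proof -
 interpret L: Module.module K "L p" by (rule module_L[OF assms])
 show "\<zero>\<^bsub>L p\<^esub> \<in> carrier (L p)"
  "X \<in> carrier (L p) ==> Y \<in> carrier (L p) ==> X \<oplus>\<^bsub>L p\<^esub> Y \<in> carrier (L p)"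
  "c \<in> carrier K ==> X \<in> carrier (L p) ==> c \<odot>\<^bsub>L p\<^esub> X \<in> carrier (L p)"
  "\<zero>\<^bsub>L p\<^esub> \<oplus>\<^bsub>L p\<^esub> \<zero>\<^bsub>L p\<^esub> = \<zero>\<^bsub>L p\<^esub>" "c \<in> carrier K ==> c \<odot>\<^bsub>L p\<^esub> \<zero>\<^bsub>L p\<^esub> = \<zero>\<^bsub>L p\<^esub>" by auto
qed

lemma T_zero_closed: "\<zero>\<^bsub>T\<^esub> \<in> carrier T"
 by (rule T_carrierI[of _ "{}"]) (auto simp: T_closed_ext T_zero_comp A_closed L_closed)

lemma T_one_closed: "\<one>\<^bsub>T\<^esub> \<in> carrier T"
 by (rule T_carrierI[of _ "{}"]) (auto simp: T_closed_ext T_one_comp A_closed L_closed)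

lemma T_add_closed: assumes s: "s \<in> carrier T" and t: "t \<in> carrier T" shows "s \<oplus>\<^bsub>T\<^esub> t \<in> carrier T"
 by (rule T_carrierI[of _ "{p \<in> N. snd s p \<noteq> \<zero>\<^bsub>L p\<^esub>} \<union> {p \<in> N. snd t p \<noteq> \<zero>\<^bsub>L p\<^esub>}"])
  (auto simp: T_closed_ext T_add_comp A_closed L_closed fst_in snd_in finite_support s t)

lemma T_smult_closed: assumes c: "c \<in> carrier K" and t: "t \<in> carrier T" shows "c \<odot>\<^bsub>T\<^esub> t \<in> carrier T"
 by (rule T_carrierI[of _ "{p \<in> N. snd t p \<noteq> \<zero>\<^bsub>L p\<^esub>}"])
  (auto simp: T_closed_ext T_smult_comp A_closed L_closed fst_in snd_in finite_support c t)

lemma module_T: "Module.module K T"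
proof -
 note cl = T_add_closed T_smult_closed T_zero_closed and cmp = T_add_comp T_smult_comp T_zero_comp
 have Am: "Module.module K (A i)" if "i \<in> verts Q" for i by (rule module_A[OF that])
 have Lm: "Module.module K (L p)" if "p \<in> N" for p by (rule module_L[OF that])
 have ag: "abelian_group (A i)" if "i \<in> verts Q" for i by (rule Module.module.axioms(2)[OF Am[OF that]])
 have lg: "abelian_group (L p)" if "p \<in> N" for p by (rule Module.module.axioms(2)[OF Lm[OF that]])
 have am: "abelian_monoid (A i)" if "i \<in> verts Q" for i using ag[OF that] by (simp add: abelian_group_def)
 have lm: "abelian_monoid (L p)" if "p \<in> N" for p using lg[OF that] by (simp add: abelian_group_def)
 show ?thesis
 proof (rule moduleI[OF cring_K abelian_groupI])
  fix x y z assume x: "x \<in> carrier T" and y: "y \<in> carrier T" and z: "z \<in> carrier T"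
  show "x \<oplus>\<^bsub>T\<^esub> y \<oplus>\<^bsub>T\<^esub> z = x \<oplus>\<^bsub>T\<^esub> (y \<oplus>\<^bsub>T\<^esub> z)"
   by (rule T_eqI) (simp_all add: cl x y z cmp fst_in snd_in abelian_monoid.a_assoc[OF am] abelian_monoid.a_assoc[OF lm])
 next
  fix x y assume x: "x \<in> carrier T" and y: "y \<in> carrier T"
  show "x \<oplus>\<^bsub>T\<^esub> y = y \<oplus>\<^bsub>T\<^esub> x"
   by (rule T_eqI) (simp_all add: cl x y cmp fst_in snd_in abelian_monoid.a_comm[OF am] abelian_monoid.a_comm[OF lm])
  show "c \<odot>\<^bsub>T\<^esub> (x \<oplus>\<^bsub>T\<^esub> y) = c \<odot>\<^bsub>T\<^esub> x \<oplus>\<^bsub>T\<^esub> c \<odot>\<^bsub>T\<^esub> y" if c: "c \<in> carrier K" for c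
   by (rule T_eqI) (simp_all add: cl x y c cmp fst_in snd_in module.smult_r_distr[OF Am] module.smult_r_distr[OF Lm])
 next
  fix x assume x: "x \<in> carrier T"
  show "\<zero>\<^bsub>T\<^esub> \<oplus>\<^bsub>T\<^esub> x = x"
   by (rule T_eqI) (simp_all add: cl x cmp fst_in snd_in abelian_monoid.l_zero[OF am] abelian_monoid.l_zero[OF lm])
  have m: "\<ominus>\<^bsub>K\<^esub> \<one>\<^bsub>K\<^esub> \<in> carrier K" by simp
  have "(\<ominus>\<^bsub>K\<^esub> \<one>\<^bsub>K\<^esub>) \<odot>\<^bsub>T\<^esub> x \<oplus>\<^bsub>T\<^esub> x = \<zero>\<^bsub>T\<^esub>"
   by (rule T_eqI) (simp_all add: cl x m cmp fst_in snd_in module.smult_l_minus[OF Am] module.smult_l_minus[OF Lm]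
     module.smult_one[OF Am] module.smult_one[OF Lm] abelian_group.l_neg[OF ag] abelian_group.l_neg[OF lg])
  then show "\<exists>y\<in>carrier T. y \<oplus>\<^bsub>T\<^esub> x = \<zero>\<^bsub>T\<^esub>" using T_smult_closed[OF m x] by blast
  show "\<one>\<^bsub>K\<^esub> \<odot>\<^bsub>T\<^esub> x = x"
   by (rule T_eqI) (simp_all add: cl x cmp fst_in snd_in module.smult_one[OF Am] module.smult_one[OF Lm])
  fix a b assume a: "a \<in> carrier K" and b: "b \<in> carrier K"
  show "(a \<oplus>\<^bsub>K\<^esub> b) \<odot>\<^bsub>T\<^esub> x = a \<odot>\<^bsub>T\<^esub> x \<oplus>\<^bsub>T\<^esub> b \<odot>\<^bsub>T\<^esub> x"
   by (rule T_eqI) (simp_all add: cl x a b cmp fst_in snd_in module.smult_l_distr[OF Am] module.smult_l_distr[OF Lm])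
  show "(a \<otimes>\<^bsub>K\<^esub> b) \<odot>\<^bsub>T\<^esub> x = a \<odot>\<^bsub>T\<^esub> (b \<odot>\<^bsub>T\<^esub> x)"
   by (rule T_eqI) (simp_all add: cl x a b cmp fst_in snd_in module.smult_assoc1[OF Am] module.smult_assoc1[OF Lm])
 qed (auto intro: cl)
qed

lemma linear_fst: "i \<in> verts Q ==> linear_map K T (A i) (\<lambda>t. fst t i)"
 using module_T module_A by (simp add: linear_map_def linear_map_axioms_def fst_in T_add_comp T_smult_comp)

lemma linear_snd: "p \<in> N ==> linear_map K T (L p) (\<lambda>t. snd t p)"
 using module_T module_L by (simp add: linear_map_def linear_map_axioms_def snd_in T_add_comp T_smult_comp)

lemma linear_into_T:
 assumes "Module.module K C" "\<And>x. x \<in> carrier C ==> h x \<in> carrier T"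
  "\<And>i. i \<in> verts Q ==> linear_map K C (A i) (\<lambda>x. fst (h x) i)"
  "\<And>p. p \<in> N ==> linear_map K C (L p) (\<lambda>x. snd (h x) p)"
 shows "linear_map K C T h"
proof -
 interpret C: Module.module K C by fact
 interpret T: Module.module K T by (rule module_T)
 show ?thesis
 proof
  fix x assume x: "x \<in> carrier C"
  show "h x \<in> carrier T" by (rule assms(2)[OF x])
  show "h (c \<odot>\<^bsub>C\<^esub> x) = c \<odot>\<^bsub>T\<^esub> h x" if c: "c \<in> carrier K" for c
   by (rule T_eqI) (simp_all add: x c assms(2) T_smult_comp linear_map.smult[OF assms(3)] linear_map.smult[OF assms(4)])
  fix y assume y: "y \<in> carrier C"
  show "h (x \<oplus>\<^bsub>C\<^esub> y) = h x \<oplus>\<^bsub>T\<^esub> h y"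
   by (rule T_eqI) (simp_all add: x y assms(2) T_add_comp linear_map.add[OF assms(3)] linear_map.add[OF assms(4)])
 qed
qed

section \<open>Multiplication in the tensor algebra\<close>

definition splits :: "'e list => ('e list \<times> 'e list) set" where
 "splits r = {(p, q). p \<noteq> [] \<and> q \<noteq> [] \<and> p @ q = r}"

lemma finite_splits: "finite (splits r)"
proof -
 have "splits r \<subseteq> (\<lambda>n. (take n r, drop n r)) ` {..length r}"
 proof
  fix w assume "w \<in> splits r"
  then have "w = (take (length (fst w)) r, drop (length (fst w)) r)" "length (fst w) \<le> length r"
   by (auto simp: splits_def)
  then show "w \<in> (\<lambda>n. (take n r, drop n r)) ` {..length r}" by blast
 qed
 then show ?thesis by (rule finite_subset) simp
qed

lemma splitsD: "r \<in> N ==> w \<in> splits r ==> fst w \<in> N \<and> snd w \<in> N \<and> fst w \<noteq> [] \<and> snd w \<noteq> [] \<and> fst w @ snd w = r"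
 using npaths_append by (auto simp: splits_def)

lemma T_mult_comp:
 "i \<in> verts Q ==> fst (s \<otimes>\<^bsub>T\<^esub> t) i = fst s i \<otimes>\<^bsub>A i\<^esub> fst t i"
 "r \<in> N ==> snd (s \<otimes>\<^bsub>T\<^esub> t) r = plact r (fst s (head Q (hd r))) (snd t r)
      \<oplus>\<^bsub>L r\<^esub> pract r (snd s r) (fst t (tail Q (last r)))
      \<oplus>\<^bsub>L r\<^esub> (\<Oplus>\<^bsub>L r\<^esub>w\<in>splits r. pmult (fst w) (snd w) (snd s (fst w)) (snd t (snd w)))"
 by (cases s; cases t; simp add: tensor_algebra_def Let_def splits_def)+

context
 fixes r assumes r: "r \<in> N"
begin

lemma end_verts: "head Q (hd r) \<in> verts Q" "tail Q (last r) \<in> verts Q"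
 using hd_last_arcs[OF r] by auto

lemma split_mult:
 assumes "w \<in> splits r"
 shows "X \<in> carrier (L (fst w)) ==> linear_map K (L (snd w)) (L r) (pmult (fst w) (snd w) X)"
  and "Y \<in> carrier (L (snd w)) ==> linear_map K (L (fst w)) (L r) (\<lambda>X. pmult (fst w) (snd w) X Y)"
 using path_mult[of "fst w" "snd w"] splitsD[OF r assms] r by auto

lemma split_paths: "w \<in> splits r ==> fst w \<in> N" "w \<in> splits r ==> snd w \<in> N"
 using splitsD[OF r] by auto

lemma linear_mult_comp_right:
 assumes s: "s \<in> carrier T"
 shows "linear_map K T (L r) (\<lambda>t. snd (s \<otimes>\<^bsub>T\<^esub> t) r)"
 unfolding T_mult_comp(2)[OF r]
 by (intro linear_sum2 linear_finsum module_T module_L[OF r] finite_splits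
   linear_map_comp[OF linear_snd[OF r] linear_path_lact(1)[OF r fst_in[OF s end_verts(1)]]]
   linear_map_comp[OF linear_fst[OF end_verts(2)] linear_ract_scalar[OF r snd_in[OF s r]]]
   linear_map_comp[OF linear_snd[OF split_paths(2)] split_mult(1)[OF _ snd_in[OF s split_paths(1)]]])

lemma linear_mult_comp_left:
 assumes t: "t \<in> carrier T"
 shows "linear_map K T (L r) (\<lambda>s. snd (s \<otimes>\<^bsub>T\<^esub> t) r)"
 unfolding T_mult_comp(2)[OF r]
 by (intro linear_sum2 linear_finsum module_T module_L[OF r] finite_splits
   linear_map_comp[OF linear_snd[OF r] linear_path_ract(1)[OF r fst_in[OF t end_verts(2)]]]
   linear_map_comp[OF linear_fst[OF end_verts(1)] linear_lact_scalar[OF r snd_in[OF t r]]]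
   linear_map_comp[OF linear_snd[OF split_paths(1)] split_mult(2)[OF _ snd_in[OF t split_paths(2)]]])

lemma mult_comp_eq_zero:
 assumes s: "s \<in> carrier T" and t: "t \<in> carrier T"
  and "snd s r = \<zero>\<^bsub>L r\<^esub>" "snd t r = \<zero>\<^bsub>L r\<^esub>"
  and "\<And>w. w \<in> splits r ==> snd s (fst w) = \<zero>\<^bsub>L (fst w)\<^esub> \<or> snd t (snd w) = \<zero>\<^bsub>L (snd w)\<^esub>"
 shows "snd (s \<otimes>\<^bsub>T\<^esub> t) r = \<zero>\<^bsub>L r\<^esub>"
proof -
 interpret L: Module.module K "L r" by (rule module_L[OF r])
 have "path_mult K Q A M (fst w) (snd w) (snd s (fst w)) (snd t (snd w)) = \<zero>\<^bsub>L r\<^esub>" if w: "w \<in> splits r" for w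
  using assms(5)[OF w] linear_map.zero[OF split_mult(1)[OF w snd_in[OF s split_paths(1)[OF w]]]]
   linear_map.zero[OF split_mult(2)[OF w snd_in[OF t split_paths(2)[OF w]]]] by auto
 then have "(\<Oplus>\<^bsub>L r\<^esub>w\<in>splits r. pmult (fst w) (snd w) (snd s (fst w)) (snd t (snd w))) = \<zero>\<^bsub>L r\<^esub>"
  by (intro L.M.add.finprod_one_eqI)
 then show ?thesis unfolding T_mult_comp(2)[OF r]
  using linear_map.zero[OF linear_path_lact(1)[OF r fst_in[OF s end_verts(1)]]]
   linear_map.zero[OF linear_path_ract(1)[OF r fst_in[OF t end_verts(2)]]] assms(3,4) by simp
qed

end

lemma T_mult_closed: assumes s: "s \<in> carrier T" and t: "t \<in> carrier T" shows "s \<otimes>\<^bsub>T\<^esub> t \<in> carrier T"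
proof -
 let ?S = "{p \<in> N. snd s p \<noteq> \<zero>\<^bsub>L p\<^esub>}" and ?U = "{p \<in> N. snd t p \<noteq> \<zero>\<^bsub>L p\<^esub>}"
 show ?thesis
 proof (rule T_carrierI[of _ "?S \<union> ?U \<union> (\<lambda>(p, q). p @ q) ` (?S \<times> ?U)"])
  show "fst (s \<otimes>\<^bsub>T\<^esub> t) i \<in> carrier (A i)" if "i \<in> verts Q" for i
  proof -
   interpret A: assoc_algebra K "A i" by (rule algebra_at[OF that])
   show ?thesis using that s t fst_in by (simp add: T_mult_comp)
  qed
  show "snd (s \<otimes>\<^bsub>T\<^esub> t) p \<in> carrier (L p)" if "p \<in> N" for p
   by (rule linear_map.closed[OF linear_mult_comp_right[OF that s] t])
  show "snd (s \<otimes>\<^bsub>T\<^esub> t) r = \<zero>\<^bsub>L r\<^esub>" if r: "r \<in> N" "r \<notin> ?S \<union> ?U \<union> (\<lambda>(p, q). p @ q) ` (?S \<times> ?U)" for r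
  proof (rule mult_comp_eq_zero[OF r(1) s t])
   fix w assume w: "w \<in> splits r"
   show "snd s (fst w) = \<zero>\<^bsub>L (fst w)\<^esub> \<or> snd t (snd w) = \<zero>\<^bsub>L (snd w)\<^esub>"
   proof (rule ccontr)
    assume "\<not> ?thesis"
    then have "w \<in> ?S \<times> ?U" using splitsD[OF r(1) w] by (cases w) auto
    moreover have "r = (\<lambda>(p, q). p @ q) w" using splitsD[OF r(1) w] by (cases w) auto
    ultimately show False using r(2) by blast
   qed
  qed (use r in auto)
 qed (auto simp: T_closed_ext finite_support s t)
qed

lemma linear_T_mult_right: assumes s: "s \<in> carrier T" shows "linear_map K T T (\<lambda>t. s \<otimes>\<^bsub>T\<^esub> t)"
proof (rule linear_into_T[OF module_T T_mult_closed[OF s]])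
 fix i assume i: "i \<in> verts Q"
 interpret A: assoc_algebra K "A i" by (rule algebra_at[OF i])
 show "linear_map K T (A i) (\<lambda>t. fst (s \<otimes>\<^bsub>T\<^esub> t) i)"
  unfolding T_mult_comp(1)[OF i] by (rule linear_map_comp[OF linear_fst[OF i] A.linear_mult_right[OF fst_in[OF s i]]])
qed (simp_all add: linear_mult_comp_right[OF _ s])

lemma linear_T_mult_left: assumes t: "t \<in> carrier T" shows "linear_map K T T (\<lambda>s. s \<otimes>\<^bsub>T\<^esub> t)"
proof (rule linear_into_T[OF module_T T_mult_closed[OF _ t]])
 fix i assume i: "i \<in> verts Q"
 interpret A: assoc_algebra K "A i" by (rule algebra_at[OF i])
 show "linear_map K T (A i) (\<lambda>s. fst (s \<otimes>\<^bsub>T\<^esub> t) i)"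
  unfolding T_mult_comp(1)[OF i] by (rule linear_map_comp[OF linear_fst[OF i] A.linear_mult_left[OF fst_in[OF t i]]])
qed (simp_all add: linear_mult_comp_left[OF _ t])

section \<open>Homogeneous elements\<close>

lemma vp_comp:
 "j \<in> verts Q ==> fst (vp i a) j = (if j = i then a else \<zero>\<^bsub>A j\<^esub>)"
 "p \<in> N ==> snd (vp i a) p = \<zero>\<^bsub>L p\<^esub>"
 by (simp_all add: vertex_part_def)

lemma pp_comp:
 "j \<in> verts Q ==> fst (pp p X) j = \<zero>\<^bsub>A j\<^esub>"
 "q \<in> N ==> snd (pp p X) q = (if q = p then X else \<zero>\<^bsub>L q\<^esub>)"
 by (simp_all add: path_part_def)

lemma vp_closed: assumes i: "i \<in> verts Q" and a: "a \<in> carrier (A i)" shows "vp i a \<in> carrier T"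
 by (rule T_carrierI[of _ "{}"]) (auto simp: vp_comp A_closed L_closed a, simp_all add: vertex_part_def)

lemma pp_closed: assumes p: "p \<in> N" and X: "X \<in> carrier (L p)" shows "pp p X \<in> carrier T"
 by (rule T_carrierI[of _ "{p}"]) (auto simp: pp_comp A_closed L_closed X, simp_all add: path_part_def)

lemma linear_vp: assumes i: "i \<in> verts Q" shows "linear_map K (A i) T (vp i)"
proof (rule linear_into_T[OF module_A[OF i] vp_closed[OF i]])
 show "linear_map K (A i) (A j) (\<lambda>x. fst (vp i x) j)" if "j \<in> verts Q" for j
  unfolding vp_comp(1)[OF that]
  by (cases "j = i") (simp_all add: linear_ident linear_zero module_A i that)
 show "linear_map K (A i) (L p) (\<lambda>x. snd (vp i x) p)" if "p \<in> N" for p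
  unfolding vp_comp(2)[OF that] by (rule linear_zero[OF module_A[OF i] module_L[OF that]])
qed

lemma linear_pp: assumes p: "p \<in> N" shows "linear_map K (L p) T (pp p)"
proof (rule linear_into_T[OF module_L[OF p] pp_closed[OF p]])
 show "linear_map K (L p) (A j) (\<lambda>x. fst (pp p x) j)" if "j \<in> verts Q" for j
  unfolding pp_comp(1)[OF that] by (rule linear_zero[OF module_L[OF p] module_A[OF that]])
 show "linear_map K (L p) (L q) (\<lambda>x. snd (pp p x) q)" if "q \<in> N" for q
  unfolding pp_comp(2)[OF that]
  by (cases "q = p") (simp_all add: linear_ident linear_zero module_L p that)
qed

text \<open>Subtract the homogeneous components of \<open>t\<close> one at a time, first those along the finitely many paths in the
 support, then those at the vertices.\<close>

lemma T_induct_part [consumes 1, case_names zero vertex path add]: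
 assumes t: "t \<in> carrier T" and z: "P \<zero>\<^bsub>T\<^esub>"
  and v: "\<And>i a. [|i \<in> verts Q; a \<in> carrier (A i)|] ==> P (vp i a)"
  and pt: "\<And>p X. [|p \<in> N; X \<in> carrier (L p)|] ==> P (pp p X)"
  and a: "\<And>s t. [|s \<in> carrier T; t \<in> carrier T; P s; P t|] ==> P (s \<oplus>\<^bsub>T\<^esub> t)"
 shows "P t"
proof -
 interpret T: Module.module K T by (rule module_T)
 have restore: "(t \<ominus>\<^bsub>T\<^esub> u) \<oplus>\<^bsub>T\<^esub> u = t" if "t \<in> carrier T" "u \<in> carrier T" for t u
  using that by (simp add: a_minus_def T.M.a_assoc T.M.l_neg)
 have fm: "fst (t \<ominus>\<^bsub>T\<^esub> u) i = fst t i \<ominus>\<^bsub>A i\<^esub> fst u i" if "i \<in> verts Q" "t \<in> carrier T" "u \<in> carrier T" for t u i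
  by (rule linear_map.minus[OF linear_fst[OF that(1)] that(2,3)])
 have sm: "snd (t \<ominus>\<^bsub>T\<^esub> u) p = snd t p \<ominus>\<^bsub>L p\<^esub> snd u p" if "p \<in> N" "t \<in> carrier T" "u \<in> carrier T" for t u p
  by (rule linear_map.minus[OF linear_snd[OF that(1)] that(2,3)])
 have z1: "x \<ominus>\<^bsub>A i\<^esub> x = \<zero>\<^bsub>A i\<^esub>" "x \<ominus>\<^bsub>A i\<^esub> \<zero>\<^bsub>A i\<^esub> = x" if "i \<in> verts Q" "x \<in> carrier (A i)" for i x
  using module.minus_self[OF module_A[OF that(1)] that(2)]
   module.minus_zero_right[OF module_A[OF that(1)] that(2)] by simp_all
 have z2: "x \<ominus>\<^bsub>L p\<^esub> x = \<zero>\<^bsub>L p\<^esub>" "x \<ominus>\<^bsub>L p\<^esub> \<zero>\<^bsub>L p\<^esub> = x" if "p \<in> N" "x \<in> carrier (L p)" for p x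
  using module.minus_self[OF module_L[OF that(1)] that(2)]
   module.minus_zero_right[OF module_L[OF that(1)] that(2)] by simp_all
 note zA = A_closed(1) and zL = L_closed(1)
 have 1: "\<And>t. t \<in> carrier T ==> (\<forall>i\<in>verts Q - C. fst t i = \<zero>\<^bsub>A i\<^esub>) ==> (\<forall>p\<in>N. snd t p = \<zero>\<^bsub>L p\<^esub>) ==> P t"
  if "finite C" "C \<subseteq> verts Q" for C
  using that
 proof (induction C rule: finite_induct)
  case empty
  then have "t = \<zero>\<^bsub>T\<^esub>" by (intro T_eqI T_zero_closed) (auto simp: T_zero_comp)
  then show ?case using z by simp
 next
  case (insert i C)
  let ?u = "vp i (fst t i)"
  have u: "?u \<in> carrier T" and pu: "P ?u" using insert by (auto intro: vp_closed v fst_in)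
  have "P (t \<ominus>\<^bsub>T\<^esub> ?u)"
  proof (rule insert.IH)
   show "t \<ominus>\<^bsub>T\<^esub> ?u \<in> carrier T" using insert u by simp
  qed (use insert u in "auto simp: fm sm vp_comp z1 z2 fst_in zA zL")
  then have "P ((t \<ominus>\<^bsub>T\<^esub> ?u) \<oplus>\<^bsub>T\<^esub> ?u)" using a u pu insert by simp
  then show ?case using restore u insert by simp
 qed
 have 2: "\<And>t. t \<in> carrier T ==> (\<forall>p\<in>N - C. snd t p = \<zero>\<^bsub>L p\<^esub>) ==> P t"
  if "finite C" "C \<subseteq> N" for C
  using that
 proof (induction C rule: finite_induct)
  case empty
  then show ?case using 1[of "verts Q" t] by auto
 next
  case (insert p C)
  let ?u = "pp p (snd t p)"
  have u: "?u \<in> carrier T" and pu: "P ?u" using insert by (auto intro: pp_closed pt snd_in)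
  have "P (t \<ominus>\<^bsub>T\<^esub> ?u)"
  proof (rule insert.IH)
   show "t \<ominus>\<^bsub>T\<^esub> ?u \<in> carrier T" using insert u by simp
  qed (use insert u in "auto simp: sm pp_comp z2 snd_in zL")
  then have "P ((t \<ominus>\<^bsub>T\<^esub> ?u) \<oplus>\<^bsub>T\<^esub> ?u)" using a u pu insert by simp
  then show ?case using restore u insert by simp
 qed
 show ?thesis by (rule 2[OF finite_support[OF t] _ t]) auto
qed

lemma vp_mult_vp:
 assumes "i \<in> verts Q" "a \<in> carrier (A i)" "j \<in> verts Q" "b \<in> carrier (A j)"
 shows "vp i a \<otimes>\<^bsub>T\<^esub> vp j b = (if i = j then vp i (a \<otimes>\<^bsub>A i\<^esub> b) else \<zero>\<^bsub>T\<^esub>)"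
proof -
 have c: "vp i a \<in> carrier T" "vp j b \<in> carrier T" using assms by (auto intro: vp_closed)
 show ?thesis
 proof (rule T_eqI)
  show "vp i a \<otimes>\<^bsub>T\<^esub> vp j b \<in> carrier T" using c by (rule T_mult_closed)
  show "(if i = j then vp i (a \<otimes>\<^bsub>A i\<^esub> b) else \<zero>\<^bsub>T\<^esub>) \<in> carrier T"
   using assms by (auto intro!: vp_closed T_zero_closed A_closed)
  fix k assume k: "k \<in> verts Q"
  show "fst (vp i a \<otimes>\<^bsub>T\<^esub> vp j b) k = fst (if i = j then vp i (a \<otimes>\<^bsub>A i\<^esub> b) else \<zero>\<^bsub>T\<^esub>) k"
   using assms k by (auto simp: T_mult_comp vp_comp T_zero_comp A_null A_closed)
 next
  fix p assume p: "p \<in> N"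
  have "snd (vp i a \<otimes>\<^bsub>T\<^esub> vp j b) p = \<zero>\<^bsub>L p\<^esub>"
   by (rule mult_comp_eq_zero[OF p c]) (auto simp: vp_comp p split_paths[OF p])
  then show "snd (vp i a \<otimes>\<^bsub>T\<^esub> vp j b) p = snd (if i = j then vp i (a \<otimes>\<^bsub>A i\<^esub> b) else \<zero>\<^bsub>T\<^esub>) p"
   using p by (simp add: vp_comp T_zero_comp)
 qed
qed

lemma finsum_zeroI: "Module.module K C ==> (\<And>x. x \<in> B ==> f x = \<zero>\<^bsub>C\<^esub>) ==> (\<Oplus>\<^bsub>C\<^esub>x\<in>B. f x) = \<zero>\<^bsub>C\<^esub>"
proof -
 assume "Module.module K C" "\<And>x. x \<in> B ==> f x = \<zero>\<^bsub>C\<^esub>"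
 interpret C: Module.module K C by fact
 show ?thesis by (rule C.M.add.finprod_one_eqI) fact
qed

lemma finsum_single: "Module.module K C ==> f x \<in> carrier C ==> (\<Oplus>\<^bsub>C\<^esub>y\<in>{x}. f y) = f x"
proof -
 assume "Module.module K C" and f: "f x \<in> carrier C"
 interpret C: Module.module K C by fact
 show ?thesis using C.M.finsum_insert[of "{}" x f] f by simp
qed

lemma path_mult_zero:
 assumes r: "r \<in> N" and w: "w \<in> splits r"
 shows "Y \<in> carrier (L (snd w)) ==> pmult (fst w) (snd w) \<zero>\<^bsub>L (fst w)\<^esub> Y = \<zero>\<^bsub>L r\<^esub>"
  and "X \<in> carrier (L (fst w)) ==> pmult (fst w) (snd w) X \<zero>\<^bsub>L (snd w)\<^esub> = \<zero>\<^bsub>L r\<^esub>"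
 using linear_map.zero[OF split_mult(1)[OF r w]] linear_map.zero[OF split_mult(2)[OF r w]] by auto

lemma vp_mult_pp:
 assumes i: "i \<in> verts Q" and a: "a \<in> carrier (A i)" and p: "p \<in> N" and X: "X \<in> carrier (L p)"
 shows "vp i a \<otimes>\<^bsub>T\<^esub> pp p X = (if head Q (hd p) = i then pp p (plact p a X) else \<zero>\<^bsub>T\<^esub>)"
proof -
 have c: "vp i a \<in> carrier T" "pp p X \<in> carrier T" using assms by (auto intro: vp_closed pp_closed)
 show ?thesis
 proof (rule T_eqI)
  show "vp i a \<otimes>\<^bsub>T\<^esub> pp p X \<in> carrier T" using c by (rule T_mult_closed)
  show "(if head Q (hd p) = i then pp p (plact p a X) else \<zero>\<^bsub>T\<^esub>) \<in> carrier T"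
   using assms linear_map.closed[OF linear_path_lact(1)[OF p] X] by (auto intro: pp_closed T_zero_closed)
  fix k assume k: "k \<in> verts Q"
  interpret Ak: assoc_algebra K "A k" by (rule algebra_at[OF k])
  show "fst (vp i a \<otimes>\<^bsub>T\<^esub> pp p X) k = fst (if head Q (hd p) = i then pp p (plact p a X) else \<zero>\<^bsub>T\<^esub>) k"
   using assms k by (auto simp: T_mult_comp vp_comp pp_comp T_zero_comp)
 next
  fix r assume r: "r \<in> N"
  interpret Lr: Module.module K "L r" by (rule module_L[OF r])
  have 1: "(\<Oplus>\<^bsub>L r\<^esub>w\<in>splits r. pmult (fst w) (snd w) (snd (vp i a) (fst w)) (snd (pp p X) (snd w))) = \<zero>\<^bsub>L r\<^esub>"
   by (rule finsum_zeroI[OF Lr.module_axioms])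
    (simp add: vp_comp split_paths[OF r] path_mult_zero(1)[OF r] snd_in[OF c(2)])
  have 2: "path_ract K Q A M r (snd (vp i a) r) (fst (pp p X) (tail Q (last r))) = \<zero>\<^bsub>L r\<^esub>"
   using linear_map.zero[OF linear_path_ract(1)[OF r A_closed(1)[OF end_verts(2)[OF r]]]] r end_verts[OF r]
   by (simp add: vp_comp pp_comp)
  have 3: "path_lact K Q A M r (fst (vp i a) (head Q (hd r))) (snd (pp p X) r) =
    snd (if head Q (hd p) = i then pp p (plact p a X) else \<zero>\<^bsub>T\<^esub>) r"
   using linear_map.zero[OF linear_path_lact(1)[OF r fst_in[OF c(1) end_verts(1)[OF r]]]]
    linear_map.zero[OF linear_lact_scalar[OF r snd_in[OF c(2) r]]] r end_verts[OF r]
   by (auto simp: vp_comp pp_comp T_zero_comp)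
  have 4: "snd (if head Q (hd p) = i then pp p (plact p a X) else \<zero>\<^bsub>T\<^esub>) r \<in> carrier (L r)"
   unfolding 3[symmetric] by (rule linear_map.closed[OF linear_path_lact(1)[OF r fst_in[OF c(1) end_verts(1)[OF r]]] snd_in[OF c(2) r]])
  show "snd (vp i a \<otimes>\<^bsub>T\<^esub> pp p X) r = snd (if head Q (hd p) = i then pp p (plact p a X) else \<zero>\<^bsub>T\<^esub>) r"
   unfolding T_mult_comp(2)[OF r] 1 2 3 using 4 by simp
 qed
qed

lemma pp_mult_vp:
 assumes i: "i \<in> verts Q" and a: "a \<in> carrier (A i)" and p: "p \<in> N" and X: "X \<in> carrier (L p)"
 shows "pp p X \<otimes>\<^bsub>T\<^esub> vp i a = (if tail Q (last p) = i then pp p (pract p X a) else \<zero>\<^bsub>T\<^esub>)"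
proof -
 have c: "vp i a \<in> carrier T" "pp p X \<in> carrier T" using assms by (auto intro: vp_closed pp_closed)
 show ?thesis
 proof (rule T_eqI)
  show "pp p X \<otimes>\<^bsub>T\<^esub> vp i a \<in> carrier T" using c(2,1) by (rule T_mult_closed)
  show "(if tail Q (last p) = i then pp p (pract p X a) else \<zero>\<^bsub>T\<^esub>) \<in> carrier T"
   using assms linear_map.closed[OF linear_path_ract(1)[OF p] X] by (auto intro: pp_closed T_zero_closed)
  fix k assume k: "k \<in> verts Q"
  interpret Ak: assoc_algebra K "A k" by (rule algebra_at[OF k])
  show "fst (pp p X \<otimes>\<^bsub>T\<^esub> vp i a) k = fst (if tail Q (last p) = i then pp p (pract p X a) else \<zero>\<^bsub>T\<^esub>) k"
   using assms k by (auto simp: T_mult_comp vp_comp pp_comp T_zero_comp)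
 next
  fix r assume r: "r \<in> N"
  interpret Lr: Module.module K "L r" by (rule module_L[OF r])
  have 1: "(\<Oplus>\<^bsub>L r\<^esub>w\<in>splits r. pmult (fst w) (snd w) (snd (pp p X) (fst w)) (snd (vp i a) (snd w))) = \<zero>\<^bsub>L r\<^esub>"
   by (rule finsum_zeroI[OF Lr.module_axioms])
    (simp add: vp_comp split_paths[OF r] path_mult_zero(2)[OF r] snd_in[OF c(2)])
  have 2: "path_lact K Q A M r (fst (pp p X) (head Q (hd r))) (snd (vp i a) r) = \<zero>\<^bsub>L r\<^esub>"
   using linear_map.zero[OF linear_path_lact(1)[OF r A_closed(1)[OF end_verts(1)[OF r]]]] r end_verts[OF r]
   by (simp add: vp_comp pp_comp)
  have 3: "path_ract K Q A M r (snd (pp p X) r) (fst (vp i a) (tail Q (last r))) =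
    snd (if tail Q (last p) = i then pp p (pract p X a) else \<zero>\<^bsub>T\<^esub>) r"
   using linear_map.zero[OF linear_path_ract(1)[OF r fst_in[OF c(1) end_verts(2)[OF r]]]]
    linear_map.zero[OF linear_ract_scalar[OF r snd_in[OF c(2) r]]] r end_verts[OF r]
   by (auto simp: vp_comp pp_comp T_zero_comp)
  have 4: "snd (if tail Q (last p) = i then pp p (pract p X a) else \<zero>\<^bsub>T\<^esub>) r \<in> carrier (L r)"
   unfolding 3[symmetric] by (rule linear_map.closed[OF linear_path_ract(1)[OF r fst_in[OF c(1) end_verts(2)[OF r]]] snd_in[OF c(2) r]])
  show "snd (pp p X \<otimes>\<^bsub>T\<^esub> vp i a) r = snd (if tail Q (last p) = i then pp p (pract p X a) else \<zero>\<^bsub>T\<^esub>) r"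
   unfolding T_mult_comp(2)[OF r] 1 2 3 using 4 by simp
 qed
qed

lemma pp_mult_pp:
 assumes p: "p \<in> N" and X: "X \<in> carrier (L p)" and q: "q \<in> N" and Y: "Y \<in> carrier (L q)"
 shows "pp p X \<otimes>\<^bsub>T\<^esub> pp q Y = (if tail Q (last p) = head Q (hd q) then pp (p @ q) (pmult p q X Y) else \<zero>\<^bsub>T\<^esub>)"
proof -
 have ne: "p \<noteq> []" "q \<noteq> []" using p q by auto
 have pq: "p @ q \<in> N \<longleftrightarrow> tail Q (last p) = head Q (hd q)" using npaths_append[OF ne] p q by auto
 have c: "pp p X \<in> carrier T" "pp q Y \<in> carrier T" using assms by (auto intro: pp_closed)
 have mc: "path_mult K Q A M p q X Y \<in> carrier (L (p @ q))" if "p @ q \<in> N"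
  by (rule linear_map.closed[OF path_mult(1)[OF that ne X] Y])
 show ?thesis
 proof (rule T_eqI)
  show "pp p X \<otimes>\<^bsub>T\<^esub> pp q Y \<in> carrier T" using c by (rule T_mult_closed)
  show "(if tail Q (last p) = head Q (hd q) then pp (p @ q) (pmult p q X Y) else \<zero>\<^bsub>T\<^esub>) \<in> carrier T"
   using mc pq by (auto intro: pp_closed T_zero_closed)
  fix k assume k: "k \<in> verts Q"
  interpret Ak: assoc_algebra K "A k" by (rule algebra_at[OF k])
  show "fst (pp p X \<otimes>\<^bsub>T\<^esub> pp q Y) k = fst (if tail Q (last p) = head Q (hd q) then pp (p @ q) (pmult p q X Y) else \<zero>\<^bsub>T\<^esub>) k"
   using assms k by (auto simp: T_mult_comp pp_comp T_zero_comp)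
 next
  fix r assume r: "r \<in> N"
  interpret Lr: Module.module K "L r" by (rule module_L[OF r])
  have 1: "path_lact K Q A M r (fst (pp p X) (head Q (hd r))) (snd (pp q Y) r) = \<zero>\<^bsub>L r\<^esub>"
   using linear_map.zero[OF linear_lact_scalar[OF r snd_in[OF c(2) r]]] end_verts[OF r] by (simp add: pp_comp)
  have 2: "path_ract K Q A M r (snd (pp p X) r) (fst (pp q Y) (tail Q (last r))) = \<zero>\<^bsub>L r\<^esub>"
   using linear_map.zero[OF linear_ract_scalar[OF r snd_in[OF c(1) r]]] end_verts[OF r] by (simp add: pp_comp)
  let ?f = "\<lambda>w. pmult (fst w) (snd w) (snd (pp p X) (fst w)) (snd (pp q Y) (snd w))"
  have f: "?f w = (if w = (p, q) then pmult p q X Y else \<zero>\<^bsub>L r\<^esub>)" if w: "w \<in> splits r" for w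
   using split_paths[OF r w] path_mult_zero(1)[OF r w snd_in[OF c(2) split_paths(2)[OF r w]]]
    path_mult_zero(2)[OF r w snd_in[OF c(1) split_paths(1)[OF r w]]] by (cases w) (auto simp: pp_comp)
  have 3: "(\<Oplus>\<^bsub>L r\<^esub>w\<in>splits r. ?f w) = (if r = p @ q then pmult p q X Y else \<zero>\<^bsub>L r\<^esub>)"
  proof (cases "r = p @ q")
   case True
   have "(\<Oplus>\<^bsub>L r\<^esub>w\<in>splits r. ?f w) = (\<Oplus>\<^bsub>L r\<^esub>w\<in>{(p, q)}. pmult p q X Y)"
    by (rule Lr.M.add.finprod_mono_neutral_cong_right[OF finite_splits])
     (use f mc r True ne Lr.M.zero_closed in "auto simp: splits_def")
   also have "... = pmult p q X Y"
    using mc r True by (intro finsum_single[OF Lr.module_axioms]) auto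
   finally show ?thesis using True by simp
  next
   case False
   have "?f w = \<zero>\<^bsub>L r\<^esub>" if "w \<in> splits r" for w
    using f[OF that] that False by (auto simp: splits_def)
   then have "(\<Oplus>\<^bsub>L r\<^esub>w\<in>splits r. ?f w) = \<zero>\<^bsub>L r\<^esub>" by (rule finsum_zeroI[OF Lr.module_axioms])
   then show ?thesis using False by simp
  qed
  show "snd (pp p X \<otimes>\<^bsub>T\<^esub> pp q Y) r = snd (if tail Q (last p) = head Q (hd q) then pp (p @ q) (pmult p q X Y) else \<zero>\<^bsub>T\<^esub>) r"
   unfolding T_mult_comp(2)[OF r] 1 2 3 using mc pq r by (auto simp: pp_comp T_zero_comp)
 qed
qed

end

section \<open>Generators and associativity\<close>

text \<open>Elements of the algebras at the vertices and tuples along paths generate the tensor algebra additively. A product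
 of generators is again a generator or zero; this partial operation is \<open>gen_mult\<close> below.\<close>

datatype ('v, 'e, 'a, 'm) tensor_gen = At 'v 'a | Along "'e list" "'m list"

context species
begin

fun gen_valid :: "('v, 'e, 'a, 'm) tensor_gen => bool" where
 "gen_valid (At i a) \<longleftrightarrow> i \<in> verts Q \<and> a \<in> carrier (A i)"
| "gen_valid (Along p xs) \<longleftrightarrow> p \<in> N \<and> xs \<in> tuples (map M p)"

fun gen :: "('v, 'e, 'a, 'm) tensor_gen => ('k, 'v, 'e, 'a, 'm) tensor_elt" where
 "gen (At i a) = vp i a"
| "gen (Along p xs) = pp p (pure p xs)"

definition gen_option :: "('v, 'e, 'a, 'm) tensor_gen option => ('k, 'v, 'e, 'a, 'm) tensor_elt" where
 "gen_option o' = (case o' of None => \<zero>\<^bsub>T\<^esub> | Some g => gen g)"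

lemma gen_option_simps [simp]: "gen_option None = \<zero>\<^bsub>T\<^esub>" "gen_option (Some g) = gen g"
 by (simp_all add: gen_option_def)

fun gen_mult :: "('v, 'e, 'a, 'm) tensor_gen => ('v, 'e, 'a, 'm) tensor_gen => ('v, 'e, 'a, 'm) tensor_gen option" where
 "gen_mult (At i a) (At j b) = (if i = j then Some (At i (a \<otimes>\<^bsub>A i\<^esub> b)) else None)"
| "gen_mult (At i a) (Along p xs) =
  (if head Q (hd p) = i then Some (Along p (lact (M (hd p)) a (hd xs) # tl xs)) else None)"
| "gen_mult (Along p xs) (At i a) =
  (if tail Q (last p) = i then Some (Along p (butlast xs @ [ract (M (last p)) (last xs) a])) else None)"
| "gen_mult (Along p xs) (Along q ys) =
  (if tail Q (last p) = head Q (hd q) then Some (Along (p @ q) (xs @ ys)) else None)"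

lemma gen_closed: "gen_valid g ==> gen g \<in> carrier T"
 by (cases g) (auto intro: vp_closed pp_closed pure_closed)

lemma lact_tuple:
 assumes p: "p \<in> N" and "x # xs \<in> tuples (map M p)" "a \<in> carrier (A (head Q (hd p)))"
 shows "lact (M (hd p)) a x # xs \<in> tuples (map M p)"
proof -
 interpret B: bimodule K "A (head Q (hd p))" "A (tail Q (hd p))" "M (hd p)"
  by (rule bimodule_at[OF hd_last_arcs(1)[OF p]])
 show ?thesis using assms(2,3) B.lact_closed by (cases p) auto
qed

lemma ract_tuple:
 assumes p: "p \<in> N" and xs: "xs @ [x] \<in> tuples (map M p)" and a: "a \<in> carrier (A (tail Q (last p)))"
 shows "xs @ [ract (M (last p)) x a] \<in> tuples (map M p)"
proof -
 interpret B: bimodule K "A (head Q (last p))" "A (tail Q (last p))" "M (last p)"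
  by (rule bimodule_at[OF hd_last_arcs(2)[OF p]])
 from xs show ?thesis
 proof (rule tuples_path_lastE[OF p])
  fix ys y q assume *: "xs @ [x] = ys @ [y]" "y \<in> carrier (M (last p))" "ys \<in> tuples (map M q)" "p = q @ [last p]"
  have "ys @ [ract (M (last p)) y a] \<in> tuples (map M (q @ [last p]))"
   using *(2,3) B.ract_closed a by (simp add: tuples_append)
  then show ?thesis using *(1) unfolding *(4)[symmetric] by simp
 qed
qed

lemma tuple_not_Nil: "p \<in> N ==> xs \<in> tuples (map M p) ==> xs \<noteq> []"
 by (cases p) (auto simp: tuples_Cons)

lemma gen_mult_valid:
 assumes "gen_valid g" "gen_valid h" "gen_mult g h = Some k" shows "gen_valid k"
 using assms
proof (cases g; cases h)
 fix i a p xs assume [simp]: "g = At i a" "h = Along p xs"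
 obtain x ys where xs: "xs = x # ys" using tuple_not_Nil assms by (cases xs) auto
 then show ?thesis using assms lact_tuple[of p x ys a] by (auto split: if_splits)
next
 fix i a p xs assume [simp]: "h = At i a" "g = Along p xs"
 obtain x ys where xs: "xs = ys @ [x]" using tuple_not_Nil assms by (cases xs rule: rev_cases) auto
 then show ?thesis using assms ract_tuple[of p ys x a] by (auto split: if_splits)
next
 fix p xs q ys assume [simp]: "g = Along p xs" "h = Along q ys"
 have "p \<noteq> []" "q \<noteq> []" using assms by auto
 then show ?thesis using assms npaths_append[of p q] by (auto split: if_splits simp: tuples_append)
qed (auto split: if_splits intro: A_closed)

lemma gen_mult:
 assumes "gen_valid g" "gen_valid h"
 shows "gen g \<otimes>\<^bsub>T\<^esub> gen h = gen_option (gen_mult g h)"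
proof (cases g; cases h)
 fix i a j b assume "g = At i a" "h = At j b"
 then show ?thesis using assms by (simp add: vp_mult_vp)
next
 fix i a p xs assume [simp]: "g = At i a" "h = Along p xs"
 obtain x ys where xs: "xs = x # ys" using tuple_not_Nil assms by (cases xs) auto
 show ?thesis using assms xs vp_mult_pp[of i a p "pure p xs"] pure_closed[of p xs] linear_path_lact(2)[of p a x ys] by auto
next
 fix i a p xs assume [simp]: "h = At i a" "g = Along p xs"
 obtain x ys where xs: "xs = ys @ [x]" using tuple_not_Nil assms by (cases xs rule: rev_cases) auto
 show ?thesis using assms xs pp_mult_vp[of i a p "pure p xs"] pure_closed[of p xs] linear_path_ract(2)[of p a ys x] by auto
next
 fix p xs q ys assume [simp]: "g = Along p xs" "h = Along q ys"
 have ne: "p \<noteq> []" "q \<noteq> []" using assms by auto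
 show ?thesis using assms pp_mult_pp[of p "pure p xs" q "pure q ys"] pure_closed[of p xs] pure_closed[of q ys]
  path_mult(3)[of p q xs ys] npaths_append[OF ne] ne by auto
qed

text \<open>Most cases are instances of an associative law, for an algebra, for one of the actions or for lists. Two need more:
 for a single factor between two algebra elements the two actions must commute, and an algebra element between two
 tuples may be moved from one to the other by the balancing relation of the tensor product.\<close>

lemma gen_mult_assoc:
 assumes "gen_valid x" "gen_valid y" "gen_valid z"
 shows "gen_option (Option.bind (gen_mult x y) (\<lambda>w. gen_mult w z)) =
  gen_option (Option.bind (gen_mult y z) (\<lambda>w. gen_mult x w))"
proof -
 have ne: "p \<noteq> []" if "p \<in> N" for p using that by auto
 have Aas: "a \<otimes>\<^bsub>A i\<^esub> b \<otimes>\<^bsub>A i\<^esub> c = a \<otimes>\<^bsub>A i\<^esub> (b \<otimes>\<^bsub>A i\<^esub> c)" if "i \<in> verts Q" "a \<in> carrier (A i)" "b \<in> carrier (A i)" "c \<in> carrier (A i)" for i a b c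
 proof -
  interpret Ai: assoc_algebra K "A i" by (rule algebra_at[OF that(1)])
  show ?thesis using that by (simp add: Ai.alg.m_assoc)
 qed
 have hdx: "hd p \<in> arcs Q \<and> hd xs \<in> carrier (M (hd p))" if "p \<in> N" "xs \<in> tuples (map M p)" for p xs
  using that npaths_hd_last[OF that(1)] by (cases p) (auto simp: tuples_Cons)
 have lastx: "last p \<in> arcs Q \<and> last xs \<in> carrier (M (last p))" if p: "p \<in> N" and xs: "xs \<in> tuples (map M p)" for p xs
  using npaths_hd_last[OF p] tuples_path_lastE[OF p xs] by (metis last_snoc)
 have lm: "lact (M e) (a \<otimes>\<^bsub>A (head Q e)\<^esub> b) x = lact (M e) a (lact (M e) b x)"
  if "e \<in> arcs Q" "a \<in> carrier (A (head Q e))" "b \<in> carrier (A (head Q e))" "x \<in> carrier (M e)" for e a b x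
  using bimodule.lact_mult[OF bimodule_at[OF that(1)]] that by blast
 have rm: "ract (M e) x (a \<otimes>\<^bsub>A (tail Q e)\<^esub> b) = ract (M e) (ract (M e) x a) b"
  if "e \<in> arcs Q" "a \<in> carrier (A (tail Q e))" "b \<in> carrier (A (tail Q e))" "x \<in> carrier (M e)" for e a b x
  using bimodule.ract_mult[OF bimodule_at[OF that(1)]] that by blast
 have lr: "ract (M e) (lact (M e) a x) b = lact (M e) a (ract (M e) x b)"
  if "e \<in> arcs Q" "a \<in> carrier (A (head Q e))" "b \<in> carrier (A (tail Q e))" "x \<in> carrier (M e)" for e a b x
  using bimodule.lact_ract[OF bimodule_at[OF that(1)]] that by blast
 show ?thesis
 proof (cases x)
  case x: (At i a)
  show ?thesis
  proof (cases y)
   case y: (At j b)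
   show ?thesis
   proof (cases z)
    case (At k c) then show ?thesis using x y assms Aas by auto
   next
    case (Along p xs)
    then show ?thesis using x y assms lm[of "hd p" a b "hd xs"] hdx[of p xs] by auto
   qed
  next
   case y: (Along p xs)
   have p: "p \<in> N" "xs \<in> tuples (map M p)" "p \<noteq> []" "xs \<noteq> []" using assms y tuple_not_Nil by auto
   show ?thesis
   proof (cases z)
    case (At k c)
    have "lact (M (hd p)) a (hd (butlast xs @ [ract (M (last p)) (last xs) c])) #
      tl (butlast xs @ [ract (M (last p)) (last xs) c]) =
     butlast (lact (M (hd p)) a (hd xs) # tl xs) @ [ract (M (last p)) (last (lact (M (hd p)) a (hd xs) # tl xs)) c]"
     if "head Q (hd p) = i" "tail Q (last p) = k"
    proof (cases "tl xs = []")
     case True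
     then obtain u where u: "xs = [u]" using p(4) by (cases xs) auto
     have "length p = 1" using tuples_length[OF p(2)] u by simp
     then obtain e where "p = [e]" by (cases p) auto
     then show ?thesis using u lr[of e a c u] assms x At that hdx[OF p(1,2)] by auto
    next
     case False
     then obtain u v vs where "xs = u # vs @ [v]" using p(4) by (cases xs; cases "tl xs" rule: rev_cases) auto
     then show ?thesis by simp
    qed
    then show ?thesis using x y At by auto
   next
    case (Along q ys)
    have "q \<noteq> []" using assms Along by auto
    then show ?thesis using x y Along p by auto
   qed
  qed
 next
  case x: (Along p xs)
  have p: "p \<in> N" "xs \<in> tuples (map M p)" "p \<noteq> []" "xs \<noteq> []" using assms x tuple_not_Nil by auto
  show ?thesis
  proof (cases y)
   case y: (At j b)
   show ?thesis
   proof (cases z)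
    case (At k c)
    then show ?thesis using x y assms rm[of "last p" b c "last xs"] lastx[of p xs] by auto
   next
    case z: (Along q ys)
    have q: "q \<in> N" "ys \<in> tuples (map M q)" "q \<noteq> []" "ys \<noteq> []" using assms z tuple_not_Nil by auto
    show ?thesis
    proof (cases "tail Q (last p) = j \<and> head Q (hd q) = j")
     case False
     then show ?thesis using x y z by auto
    next
     case True
     then have pq: "p @ q \<in> N" using npaths_append p q by auto
     obtain us u where us: "xs = us @ [u]" using p(4) by (cases xs rule: rev_cases) auto
     obtain p1 e where p1: "p = p1 @ [e]" using p(3) by (cases p rule: rev_cases) auto
     obtain v vs where vs: "ys = v # vs" using q(4) by (cases ys) auto
     obtain d q2 where q2: "q = d # q2" using q(3) by (cases q) auto
     have "length us = length p1" using tuples_length[OF p(2)] us p1 by simp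
     then have "us \<in> tuples (map M p1)" "u \<in> carrier (M e)"
      using p(2) unfolding us p1 by (simp_all add: tuples_append_iff)
     moreover have "v \<in> carrier (M d)" "vs \<in> tuples (map M q2)" using q(2) vs q2 by auto
     moreover have "b \<in> carrier (A (tail Q e))" using assms y True p1 by auto
     ultimately have "pure (p @ q) (us @ ract (M e) u b # v # vs) = pure (p @ q) (us @ u # lact (M d) b v # vs)"
      by (intro pure_balance[OF pq]) (simp_all add: p1 q2)
     then show ?thesis using x z True us p1 vs q2 p q y by simp
    qed
   qed
  next
   case y: (Along q ys)
   have q: "q \<in> N" "ys \<in> tuples (map M q)" "q \<noteq> []" "ys \<noteq> []" using assms y tuple_not_Nil by auto
   show ?thesis
   proof (cases z)
    case (At k c)
    then show ?thesis using x y p q by (auto simp: butlast_append)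
   next
    case z: (Along r zs)
    have "r \<noteq> []" using assms z by auto
    then show ?thesis using x y z p q by auto
   qed
  qed
 qed
qed

lemma T_induct [consumes 1, case_names zero gen add]:
 assumes t: "t \<in> carrier T" and z: "P \<zero>\<^bsub>T\<^esub>"
  and g: "\<And>g. gen_valid g ==> P (gen g)"
  and a: "\<And>s t. [|s \<in> carrier T; t \<in> carrier T; P s; P t|] ==> P (s \<oplus>\<^bsub>T\<^esub> t)"
 shows "P t"
 using t
proof (induction rule: T_induct_part)
 case (vertex i a)
 then show ?case using g[of "At i a"] by simp
next
 case (path p X)
 interpret pp: linear_map K "L p" T "pp p" by (rule linear_pp[OF path(1)])
 show ?case
 proof (rule path_tensor_induct[OF path])
  show "P (pp p \<zero>\<^bsub>L p\<^esub>)" using z pp.zero by simp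
  show "P (pp p (pure p xs))" if "xs \<in> tuples (map M p)" for xs
   using g[of "Along p xs"] path(1) that by simp
  show "P (pp p (X \<oplus>\<^bsub>L p\<^esub> Y))" if "X \<in> carrier (L p)" "Y \<in> carrier (L p)" "P (pp p X)" "P (pp p Y)" for X Y
   using that by (simp add: pp.add a)
 qed
qed (use z a in auto)

lemma T_linear_ext:
 assumes "linear_map K T C h" "linear_map K T C h'" "\<And>g. gen_valid g ==> h (gen g) = h' (gen g)" "t \<in> carrier T"
 shows "h t = h' t"
proof -
 interpret h: linear_map K T C h by fact
 interpret h': linear_map K T C h' by fact
 from assms(4) show ?thesis
  by (induction rule: T_induct) (simp_all only: h.zero h'.zero h.add h'.add assms(3))
qed

lemma T_mult_zero: "t \<in> carrier T ==> \<zero>\<^bsub>T\<^esub> \<otimes>\<^bsub>T\<^esub> t = \<zero>\<^bsub>T\<^esub>" "t \<in> carrier T ==> t \<otimes>\<^bsub>T\<^esub> \<zero>\<^bsub>T\<^esub> = \<zero>\<^bsub>T\<^esub>"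
 using linear_map.zero[OF linear_T_mult_left] linear_map.zero[OF linear_T_mult_right] by auto

lemma gen_option_mult:
 assumes "\<And>g. o' = Some g ==> gen_valid g" "gen_valid h"
 shows "gen_option o' \<otimes>\<^bsub>T\<^esub> gen h = gen_option (Option.bind o' (\<lambda>g. gen_mult g h))"
  and "gen h \<otimes>\<^bsub>T\<^esub> gen_option o' = gen_option (Option.bind o' (\<lambda>g. gen_mult h g))"
 using assms by (cases o'; simp add: T_mult_zero gen_closed gen_mult)+

lemma gen_assoc:
 assumes "gen_valid x" "gen_valid y" "gen_valid z"
 shows "gen x \<otimes>\<^bsub>T\<^esub> gen y \<otimes>\<^bsub>T\<^esub> gen z = gen x \<otimes>\<^bsub>T\<^esub> (gen y \<otimes>\<^bsub>T\<^esub> gen z)"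
 unfolding gen_mult[OF assms(1,2)] gen_mult[OF assms(2,3)]
 using gen_option_mult(1)[of "gen_mult x y" z] gen_option_mult(2)[of "gen_mult y z" x]
  gen_mult_valid assms gen_mult_assoc[OF assms] by metis

lemma one_mult:
 assumes t: "t \<in> carrier T"
 shows "\<one>\<^bsub>T\<^esub> \<otimes>\<^bsub>T\<^esub> t = t" "t \<otimes>\<^bsub>T\<^esub> \<one>\<^bsub>T\<^esub> = t"
proof -
 have l1: "path_lact K Q A M r \<one>\<^bsub>A (head Q (hd r))\<^esub> X = X" if r: "r \<in> N" and X: "X \<in> carrier (L r)" for r X
 proof (rule linear_path_tensor_ext[OF r linear_path_lact(1)[OF r A_closed(2)[OF end_verts(1)[OF r]]] linear_ident[OF module_L[OF r]] _ X])
  fix xs assume xs: "xs \<in> tuples (map M r)"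
  then obtain x ys q where *: "xs = x # ys" "x \<in> carrier (M (hd r))" by (rule tuples_pathE[OF r])
  show "path_lact K Q A M r \<one>\<^bsub>A (head Q (hd r))\<^esub> (pure r xs) = pure r xs"
   using linear_path_lact(2)[OF r A_closed(2)[OF end_verts(1)[OF r]], of x ys] xs *
    bimodule.lact_one[OF bimodule_at[OF hd_last_arcs(1)[OF r]]] by simp
 qed
 have r1: "path_ract K Q A M r X \<one>\<^bsub>A (tail Q (last r))\<^esub> = X" if r: "r \<in> N" and X: "X \<in> carrier (L r)" for r X
 proof (rule linear_path_tensor_ext[OF r linear_path_ract(1)[OF r A_closed(2)[OF end_verts(2)[OF r]]] linear_ident[OF module_L[OF r]] _ X])
  fix xs assume xs: "xs \<in> tuples (map M r)"
  then obtain ys x q where *: "xs = ys @ [x]" "x \<in> carrier (M (last r))" by (rule tuples_path_lastE[OF r])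
  show "path_ract K Q A M r (pure r xs) \<one>\<^bsub>A (tail Q (last r))\<^esub> = pure r xs"
   using linear_path_ract(2)[OF r A_closed(2)[OF end_verts(2)[OF r]], of ys x] xs *
    bimodule.ract_one[OF bimodule_at[OF hd_last_arcs(2)[OF r]]] by simp
 qed
 show "\<one>\<^bsub>T\<^esub> \<otimes>\<^bsub>T\<^esub> t = t"
 proof (rule T_eqI[OF T_mult_closed[OF T_one_closed t] t])
  fix i assume i: "i \<in> verts Q"
  interpret Ai: assoc_algebra K "A i" by (rule algebra_at[OF i])
  show "fst (\<one>\<^bsub>T\<^esub> \<otimes>\<^bsub>T\<^esub> t) i = fst t i" using i t by (simp add: T_mult_comp T_one_comp fst_in)
 next
  fix r assume r: "r \<in> N"
  interpret Lr: Module.module K "L r" by (rule module_L[OF r])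
  have 1: "(\<Oplus>\<^bsub>L r\<^esub>w\<in>splits r. pmult (fst w) (snd w) (snd \<one>\<^bsub>T\<^esub> (fst w)) (snd t (snd w))) = \<zero>\<^bsub>L r\<^esub>"
   by (rule finsum_zeroI[OF Lr.module_axioms])
    (simp add: T_one_comp split_paths[OF r] path_mult_zero(1)[OF r] snd_in[OF t])
  show "snd (\<one>\<^bsub>T\<^esub> \<otimes>\<^bsub>T\<^esub> t) r = snd t r"
   unfolding T_mult_comp(2)[OF r] 1 using r t
    linear_map.zero[OF linear_path_ract(1)[OF r fst_in[OF t end_verts(2)[OF r]]]]
   by (simp add: T_one_comp end_verts l1 snd_in)
 qed
 show "t \<otimes>\<^bsub>T\<^esub> \<one>\<^bsub>T\<^esub> = t"
 proof (rule T_eqI[OF T_mult_closed[OF t T_one_closed] t])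
  fix i assume i: "i \<in> verts Q"
  interpret Ai: assoc_algebra K "A i" by (rule algebra_at[OF i])
  show "fst (t \<otimes>\<^bsub>T\<^esub> \<one>\<^bsub>T\<^esub>) i = fst t i" using i t by (simp add: T_mult_comp T_one_comp fst_in)
 next
  fix r assume r: "r \<in> N"
  interpret Lr: Module.module K "L r" by (rule module_L[OF r])
  have 1: "(\<Oplus>\<^bsub>L r\<^esub>w\<in>splits r. pmult (fst w) (snd w) (snd t (fst w)) (snd \<one>\<^bsub>T\<^esub> (snd w))) = \<zero>\<^bsub>L r\<^esub>"
   by (rule finsum_zeroI[OF Lr.module_axioms])
    (simp add: T_one_comp split_paths[OF r] path_mult_zero(2)[OF r] snd_in[OF t])
  show "snd (t \<otimes>\<^bsub>T\<^esub> \<one>\<^bsub>T\<^esub>) r = snd t r"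
   unfolding T_mult_comp(2)[OF r] 1 using r t
    linear_map.zero[OF linear_path_lact(1)[OF r fst_in[OF t end_verts(1)[OF r]]]]
   by (simp add: T_one_comp end_verts r1 snd_in)
 qed
qed

text \<open>Both sides of the associative law are linear in each argument, so the case of generators suffices.\<close>

lemma algebra_T: "assoc_algebra K T"
proof (rule assoc_algebraI)
 show "field K" ..
 show "Module.module K T" by (rule module_T)
 fix f g h assume f: "f \<in> carrier T" and g: "g \<in> carrier T" and h: "h \<in> carrier T"
 note L = linear_T_mult_left and R = linear_T_mult_right and C = linear_map_comp and s = gen_closed and cl = T_mult_closed
 have 1: "gen x \<otimes>\<^bsub>T\<^esub> gen y \<otimes>\<^bsub>T\<^esub> h = gen x \<otimes>\<^bsub>T\<^esub> (gen y \<otimes>\<^bsub>T\<^esub> h)"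
  if "gen_valid x" "gen_valid y" for x y
  by (rule T_linear_ext[OF R[OF cl[OF s[OF that(1)] s[OF that(2)]]] C[OF R[OF s[OF that(2)]] R[OF s[OF that(1)]]]
   gen_assoc[OF that] h])
 have 2: "gen x \<otimes>\<^bsub>T\<^esub> g \<otimes>\<^bsub>T\<^esub> h = gen x \<otimes>\<^bsub>T\<^esub> (g \<otimes>\<^bsub>T\<^esub> h)" if x: "gen_valid x" for x
  by (rule T_linear_ext[OF C[OF R[OF s[OF x]] L[OF h]] C[OF L[OF h] R[OF s[OF x]]] 1[OF x] g])
 show "f \<otimes>\<^bsub>T\<^esub> g \<otimes>\<^bsub>T\<^esub> h = f \<otimes>\<^bsub>T\<^esub> (g \<otimes>\<^bsub>T\<^esub> h)"
  by (rule T_linear_ext[OF C[OF L[OF g] L[OF h]] L[OF cl[OF g h]] 2 f])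
qed (auto intro: T_mult_closed T_one_closed one_mult linear_T_mult_left linear_T_mult_right)

lemma one_eq_vertices: "\<one>\<^bsub>T\<^esub> = (\<Oplus>\<^bsub>T\<^esub>i\<in>verts Q. vp i \<one>\<^bsub>A i\<^esub>)"
proof -
 interpret T: Module.module K T by (rule module_T)
 have c: "(\<lambda>i. vp i \<one>\<^bsub>A i\<^esub>) \<in> verts Q \<rightarrow> carrier T" by (auto intro: vp_closed A_closed)
 show ?thesis
 proof (rule T_eqI[OF T_one_closed])
  show "(\<Oplus>\<^bsub>T\<^esub>i\<in>verts Q. vp i \<one>\<^bsub>A i\<^esub>) \<in> carrier T" using c by (rule T.M.finsum_closed)
  fix j assume j: "j \<in> verts Q"
  interpret Aj: assoc_algebra K "A j" by (rule algebra_at[OF j])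
  have "fst (\<Oplus>\<^bsub>T\<^esub>i\<in>verts Q. vp i \<one>\<^bsub>A i\<^esub>) j = (\<Oplus>\<^bsub>A j\<^esub>i\<in>verts Q. fst (vp i \<one>\<^bsub>A i\<^esub>) j)"
   by (rule linear_map.finsum[OF linear_fst[OF j] c])
  also have "... = (\<Oplus>\<^bsub>A j\<^esub>i\<in>verts Q. if j = i then \<one>\<^bsub>A j\<^esub> else \<zero>\<^bsub>A j\<^esub>)"
   by (rule Aj.alg.finsum_cong') (auto simp: vp_comp j)
  also have "... = \<one>\<^bsub>A j\<^esub>" using j by (intro Aj.alg.finsum_singleton) auto
  finally show "fst \<one>\<^bsub>T\<^esub> j = fst (\<Oplus>\<^bsub>T\<^esub>i\<in>verts Q. vp i \<one>\<^bsub>A i\<^esub>) j" using j by (simp add: T_one_comp)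
 next
  fix p assume p: "p \<in> N"
  have "snd (\<Oplus>\<^bsub>T\<^esub>i\<in>verts Q. vp i \<one>\<^bsub>A i\<^esub>) p = (\<Oplus>\<^bsub>L p\<^esub>i\<in>verts Q. snd (vp i \<one>\<^bsub>A i\<^esub>) p)"
   by (rule linear_map.finsum[OF linear_snd[OF p] c])
  also have "... = \<zero>\<^bsub>L p\<^esub>"
   by (rule finsum_zeroI[OF module_L[OF p]]) (simp add: vp_comp p)
  finally show "snd \<one>\<^bsub>T\<^esub> p = snd (\<Oplus>\<^bsub>T\<^esub>i\<in>verts Q. vp i \<one>\<^bsub>A i\<^esub>) p" using p by (simp add: T_one_comp)
 qed
qed

end

section \<open>Maps from the tensor algebra\<close>

text \<open>The universal property of the tensor algebra: compatible maps on the algebras at the vertices and on the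
 bimodules extend to a linear and multiplicative map \<open>tmap\<close>.\<close>

locale tensor_algebra_map = species K Q A M + B: assoc_algebra K B
 for K :: "'k ring" and Q :: "('v, 'e) pre_digraph"
  and A :: "'v => ('k, 'a) module" and M :: "'e => ('a, 'k, 'm) bimodule" and B :: "('k, 'b) module" +
 fixes \<theta> :: "'v => 'a => 'b" and \<mu> :: "'e => 'm => 'b"
 assumes linear_vertex: "i \<in> verts Q ==> linear_map K (A i) B (\<theta> i)"
  and vertex_mult: "[|i \<in> verts Q; j \<in> verts Q; a \<in> carrier (A i); b \<in> carrier (A j)|] ==>
    \<theta> i a \<otimes>\<^bsub>B\<^esub> \<theta> j b = (if i = j then \<theta> i (a \<otimes>\<^bsub>A i\<^esub> b) else \<zero>\<^bsub>B\<^esub>)"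
  and linear_arrow: "e \<in> arcs Q ==> linear_map K (M e) B (\<mu> e)"
  and arrow_lact: "[|e \<in> arcs Q; x \<in> carrier (M e); a \<in> carrier (A (head Q e))|] ==>
    \<mu> e (lact (M e) a x) = \<theta> (head Q e) a \<otimes>\<^bsub>B\<^esub> \<mu> e x"
  and arrow_ract: "[|e \<in> arcs Q; x \<in> carrier (M e); a \<in> carrier (A (tail Q e))|] ==>
    \<mu> e (ract (M e) x a) = \<mu> e x \<otimes>\<^bsub>B\<^esub> \<theta> (tail Q e) a"
begin

fun word :: "'e list => 'm list => 'b" where
 "word (e # p) (x # xs) = \<mu> e x \<otimes>\<^bsub>B\<^esub> word p xs"
| "word _ _ = \<one>\<^bsub>B\<^esub>"

lemma arrow_closed: "e \<in> arcs Q ==> x \<in> carrier (M e) ==> \<mu> e x \<in> carrier B"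
 by (rule linear_map.closed[OF linear_arrow])

lemma vertex_closed: "i \<in> verts Q ==> a \<in> carrier (A i) ==> \<theta> i a \<in> carrier B"
 by (rule linear_map.closed[OF linear_vertex])

lemma word_closed: "set p \<subseteq> arcs Q ==> xs \<in> tuples (map M p) ==> word p xs \<in> carrier B"
 by (induction p arbitrary: xs) (auto simp: tuples_Cons arrow_closed)

lemma word_append:
 "set p \<subseteq> arcs Q ==> set q \<subseteq> arcs Q ==> xs \<in> tuples (map M p) ==> ys \<in> tuples (map M q) ==>
  word (p @ q) (xs @ ys) = word p xs \<otimes>\<^bsub>B\<^esub> word q ys"
 by (induction p arbitrary: xs) (auto simp: tuples_Cons arrow_closed word_closed B.alg.m_assoc)

lemma word_multilinear:
 assumes p: "p \<in> N" shows "multilinear K (map M p) B (word p)"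
proof (rule multilinear_pathI)
 show "word p xs \<in> carrier B" if "xs \<in> tuples (map M p)" for xs
  using that npaths_arcs[OF p] by (rule word_closed[rotated])
next
 fix p1 e p2 us vs x y assume *: "p = p1 @ e # p2" "us \<in> tuples (map M p1)" "x \<in> carrier (M e)" "y \<in> carrier (M e)"
    "vs \<in> tuples (map M p2)"
 have a: "set p1 \<subseteq> arcs Q" "e \<in> arcs Q" "set p2 \<subseteq> arcs Q" using npaths_arcs[OF p] *(1) by auto
 interpret m: linear_map K "M e" B "\<mu> e" by (rule linear_arrow[OF a(2)])
 have "word p (us @ z # vs) = word p1 us \<otimes>\<^bsub>B\<^esub> (\<mu> e z \<otimes>\<^bsub>B\<^esub> word p2 vs)" if "z \<in> carrier (M e)" for z
  using word_append[of p1 "e # p2" us "z # vs"] * a that by simp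
 then show "word p (us @ (x \<oplus>\<^bsub>M e\<^esub> y) # vs) = word p (us @ x # vs) \<oplus>\<^bsub>B\<^esub> word p (us @ y # vs)"
  using * a by (simp add: m.add B.alg.l_distr B.alg.r_distr word_closed)
next
 fix p1 e p2 us vs c x assume *: "p = p1 @ e # p2" "us \<in> tuples (map M p1)" "x \<in> carrier (M e)"
    "vs \<in> tuples (map M p2)" "length us = length p1" "c \<in> carrier K"
 have a: "set p1 \<subseteq> arcs Q" "e \<in> arcs Q" "set p2 \<subseteq> arcs Q" using npaths_arcs[OF p] *(1) by auto
 interpret m: linear_map K "M e" B "\<mu> e" by (rule linear_arrow[OF a(2)])
 have "word p (us @ z # vs) = word p1 us \<otimes>\<^bsub>B\<^esub> (\<mu> e z \<otimes>\<^bsub>B\<^esub> word p2 vs)" if "z \<in> carrier (M e)" for z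
  using word_append[of p1 "e # p2" us "z # vs"] * a that by simp
 then show "word p (us @ (c \<odot>\<^bsub>M e\<^esub> x) # vs) = c \<odot>\<^bsub>B\<^esub> word p (us @ x # vs)"
  using * a by (simp add: m.smult B.smult_mult_left B.smult_mult_right word_closed)
qed

lemma word_balanced:
 assumes p: "p \<in> N" and *: "p = p1 @ e # d # p2" "us \<in> tuples (map M p1)" "x \<in> carrier (M e)"
   "y \<in> carrier (M d)" "vs \<in> tuples (map M p2)" "a \<in> carrier (A (tail Q e))"
 shows "word p (us @ ract (M e) x a # y # vs) = word p (us @ x # lact (M d) a y # vs)"
proof -
 have a: "set p1 \<subseteq> arcs Q" "e \<in> arcs Q" "d \<in> arcs Q" "set p2 \<subseteq> arcs Q" using npaths_arcs[OF p] *(1) by auto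
 have h: "head Q d = tail Q e" using p npaths_append[of "p1 @ [e]" "d # p2"] unfolding *(1) by simp
 have "ract (M e) x a \<in> carrier (M e)" "lact (M d) a y \<in> carrier (M d)"
  using bimodule.ract_closed[OF bimodule_at[OF a(2)]] bimodule.lact_closed[OF bimodule_at[OF a(3)]] * h by auto
 then show ?thesis
  using word_append[of p1 "e # d # p2" us "ract (M e) x a # y # vs"]
   word_append[of p1 "e # d # p2" us "x # lact (M d) a y # vs"] * a h
  by (simp add: arrow_ract arrow_lact B.alg.m_assoc arrow_closed vertex_closed word_closed)
qed

definition path_map where "path_map p = coset_lift (lin K B (word p))"

lemma linear_path_map: "p \<in> N ==> linear_map K (L p) B (path_map p)"
 unfolding path_map_def by (rule linear_path_lift[OF _ B.vec.module_axioms word_multilinear word_balanced])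

lemma path_map_pure: "p \<in> N ==> xs \<in> tuples (map M p) ==> path_map p (pure p xs) = word p xs"
 unfolding path_map_def by (rule path_lift_pure[OF _ B.vec.module_axioms word_multilinear word_balanced])

definition tmap where
 "tmap t = (\<Oplus>\<^bsub>B\<^esub>i\<in>verts Q. \<theta> i (fst t i)) \<oplus>\<^bsub>B\<^esub> (\<Oplus>\<^bsub>B\<^esub>p\<in>{p \<in> N. snd t p \<noteq> \<zero>\<^bsub>L p\<^esub>}. path_map p (snd t p))"

lemma tmap_superset:
 assumes t: "t \<in> carrier T" and C: "finite C" "C \<subseteq> N" "\<And>p. p \<in> N - C ==> snd t p = \<zero>\<^bsub>L p\<^esub>"
 shows "tmap t = (\<Oplus>\<^bsub>B\<^esub>i\<in>verts Q. \<theta> i (fst t i)) \<oplus>\<^bsub>B\<^esub> (\<Oplus>\<^bsub>B\<^esub>p\<in>C. path_map p (snd t p))"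
proof -
 have "path_map p (snd t p) \<in> carrier B" if "p \<in> N" for p
  by (rule linear_map.closed[OF linear_path_map[OF that] snd_in[OF t that]])
 moreover have "path_map p (snd t p) = \<zero>\<^bsub>B\<^esub>" if "p \<in> N" "snd t p = \<zero>\<^bsub>L p\<^esub>" for p
  using linear_map.zero[OF linear_path_map[OF that(1)]] that by simp
 ultimately have "(\<Oplus>\<^bsub>B\<^esub>p\<in>{p \<in> N. snd t p \<noteq> \<zero>\<^bsub>L p\<^esub>}. path_map p (snd t p)) = (\<Oplus>\<^bsub>B\<^esub>p\<in>C. path_map p (snd t p))"
  by (intro B.alg.add.finprod_mono_neutral_cong_left) (use C in auto)
 then show ?thesis by (simp add: tmap_def)
qed

lemma linear_tmap: "linear_map K T B tmap"
proof -
 interpret T: Module.module K T by (rule module_T)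
 define F where "F C t = (\<Oplus>\<^bsub>B\<^esub>i\<in>verts Q. \<theta> i (fst t i)) \<oplus>\<^bsub>B\<^esub> (\<Oplus>\<^bsub>B\<^esub>p\<in>C. path_map p (snd t p))" for C t
 have F: "linear_map K T B (F C)" if "finite C" "C \<subseteq> N" for C
  unfolding F_def
 proof (intro linear_sum2 linear_finsum module_T B.vec.module_axioms that)
  show "linear_map K T B (\<lambda>x. \<theta> i (fst x i))" if "i \<in> verts Q" for i
   by (rule linear_map_comp[OF linear_fst[OF that] linear_vertex[OF that]])
  show "linear_map K T B (\<lambda>x. path_map p (snd x p))" if "p \<in> C" for p
   using that \<open>C \<subseteq> N\<close> by (intro linear_map_comp[OF linear_snd linear_path_map]) auto
 qed auto
 let ?C = "\<lambda>t. {p \<in> N. snd t p \<noteq> \<zero>\<^bsub>L p\<^esub>}"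
 have eq: "tmap t = F C t" if "t \<in> carrier T" "finite C" "C \<subseteq> N" "?C t \<subseteq> C" for t C
  unfolding F_def by (rule tmap_superset) (use that in auto)
 show ?thesis
 proof
  fix t assume t: "t \<in> carrier T"
  note ft = finite_support[OF t]
  show "tmap t \<in> carrier B" using eq[OF t ft] linear_map.closed[OF F[OF ft] t] by auto
  { fix c assume c: "c \<in> carrier K"
   have "snd (c \<odot>\<^bsub>T\<^esub> t) p = \<zero>\<^bsub>L p\<^esub>" if "p \<in> N" "snd t p = \<zero>\<^bsub>L p\<^esub>" for p
   proof -
    interpret Lp: Module.module K "L p" by (rule module_L[OF that(1)])
    show ?thesis using that c by (simp add: T_smult_comp)
   qed
   then have "?C (c \<odot>\<^bsub>T\<^esub> t) \<subseteq> ?C t" by blast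
   then show "tmap (c \<odot>\<^bsub>T\<^esub> t) = c \<odot>\<^bsub>B\<^esub> tmap t"
    using eq[OF t ft] eq[OF T_smult_closed[OF c t] ft] linear_map.smult[OF F[OF ft] c t] by auto }
  fix s assume s: "s \<in> carrier T"
  let ?D = "?C s \<union> ?C t"
  have fD: "finite ?D" "?D \<subseteq> N" using ft finite_support[OF s] by auto
  have "snd (t \<oplus>\<^bsub>T\<^esub> s) p = \<zero>\<^bsub>L p\<^esub>" if "p \<in> N" "p \<notin> ?D" for p
  proof -
   interpret Lp: Module.module K "L p" by (rule module_L[OF that(1)])
   show ?thesis using that by (simp add: T_add_comp)
  qed
  then have "?C (t \<oplus>\<^bsub>T\<^esub> s) \<subseteq> ?D" by blast
  then show "tmap (t \<oplus>\<^bsub>T\<^esub> s) = tmap t \<oplus>\<^bsub>B\<^esub> tmap s"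
   using eq[OF t fD] eq[OF s fD] eq[OF T_add_closed[OF t s] fD] linear_map.add[OF F[OF fD] t s] by auto
 qed
qed

sublocale tmap: linear_map K T B tmap by (rule linear_tmap)

lemma tmap_vp:
 assumes i: "i \<in> verts Q" and a: "a \<in> carrier (A i)" shows "tmap (vp i a) = \<theta> i a"
proof -
 have z: "\<theta> j \<zero>\<^bsub>A j\<^esub> = \<zero>\<^bsub>B\<^esub>" if "j \<in> verts Q" for j by (rule linear_map.zero[OF linear_vertex[OF that]])
 have "(\<Oplus>\<^bsub>B\<^esub>j\<in>verts Q. \<theta> j (fst (vp i a) j)) = (\<Oplus>\<^bsub>B\<^esub>j\<in>verts Q. if i = j then \<theta> i a else \<zero>\<^bsub>B\<^esub>)"
  by (rule B.alg.finsum_cong') (auto simp: vp_comp z i a vertex_closed)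
 also have "... = \<theta> i a" using i a by (intro B.alg.finsum_singleton) (auto simp: vertex_closed)
 finally show ?thesis
  using tmap_superset[OF vp_closed[OF i a], of "{}"] i a by (simp add: vp_comp vertex_closed)
qed

lemma tmap_pp:
 assumes p: "p \<in> N" and X: "X \<in> carrier (L p)" shows "tmap (pp p X) = path_map p X"
proof -
 have z: "\<theta> j \<zero>\<^bsub>A j\<^esub> = \<zero>\<^bsub>B\<^esub>" if "j \<in> verts Q" for j by (rule linear_map.zero[OF linear_vertex[OF that]])
 have "(\<Oplus>\<^bsub>B\<^esub>j\<in>verts Q. \<theta> j (fst (pp p X) j)) = \<zero>\<^bsub>B\<^esub>"
  by (rule finsum_zeroI[OF B.vec.module_axioms]) (simp add: pp_comp z)
 then show ?thesis
  using tmap_superset[OF pp_closed[OF p X], of "{p}"] p linear_map.closed[OF linear_path_map[OF p] X]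
  by (simp add: pp_comp B.alg.finsum_insert del: B.alg.finsum_closed)
qed

lemma arrow_unit:
 assumes "e \<in> arcs Q" "x \<in> carrier (M e)"
 shows "\<theta> (head Q e) \<one>\<^bsub>A (head Q e)\<^esub> \<otimes>\<^bsub>B\<^esub> \<mu> e x = \<mu> e x" "\<mu> e x \<otimes>\<^bsub>B\<^esub> \<theta> (tail Q e) \<one>\<^bsub>A (tail Q e)\<^esub> = \<mu> e x"
 using arrow_lact[OF assms A_closed(2)] arrow_ract[OF assms A_closed(2)] assms
  bimodule.lact_one[OF bimodule_at[OF assms(1)] assms(2)] bimodule.ract_one[OF bimodule_at[OF assms(1)] assms(2)] by auto

lemma word_unit:
 assumes p: "p \<in> N" and xs: "xs \<in> tuples (map M p)"
 shows "\<theta> (head Q (hd p)) \<one>\<^bsub>A (head Q (hd p))\<^esub> \<otimes>\<^bsub>B\<^esub> word p xs = word p xs"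
  and "word p xs \<otimes>\<^bsub>B\<^esub> \<theta> (tail Q (last p)) \<one>\<^bsub>A (tail Q (last p))\<^esub> = word p xs"
proof -
 have ar: "set p \<subseteq> arcs Q" by (rule npaths_arcs[OF p])
 obtain e p' where p': "p = e # p'" using p by (cases p) auto
 then obtain x ys where x: "xs = x # ys" "x \<in> carrier (M e)" "ys \<in> tuples (map M p')" using xs by (auto simp: tuples_Cons)
 have u: "\<theta> (head Q e) \<one>\<^bsub>A (head Q e)\<^esub> \<in> carrier B" using ar p' by (auto intro!: vertex_closed A_closed)
 show "\<theta> (head Q (hd p)) \<one>\<^bsub>A (head Q (hd p))\<^esub> \<otimes>\<^bsub>B\<^esub> word p xs = word p xs"
  using ar x arrow_unit(1)[of e x] u unfolding p'
  by (simp add: B.alg.m_assoc[symmetric] arrow_closed word_closed)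
 from xs show "word p xs \<otimes>\<^bsub>B\<^esub> \<theta> (tail Q (last p)) \<one>\<^bsub>A (tail Q (last p))\<^esub> = word p xs"
 proof (rule tuples_path_lastE[OF p])
  fix ys y q assume *: "xs = ys @ [y]" "y \<in> carrier (M (last p))" "ys \<in> tuples (map M q)" "p = q @ [last p]"
  define d where "d = last p"
  have q: "p = q @ [d]" using *(4) by (simp add: d_def)
  have b: "set q \<subseteq> arcs Q" "d \<in> arcs Q" "y \<in> carrier (M d)" using ar q *(2) by (auto simp: d_def[symmetric])
  have u: "\<theta> (tail Q d) \<one>\<^bsub>A (tail Q d)\<^esub> \<in> carrier B" using b by (auto intro!: vertex_closed A_closed)
  have "word p xs = word q ys \<otimes>\<^bsub>B\<^esub> \<mu> d y" unfolding q *(1)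
   using word_append[of q "[d]" ys "[y]"] *(3) b by (simp add: arrow_closed)
  then show ?thesis unfolding d_def[symmetric]
   using arrow_unit(2)[OF b(2,3)] u *(3) b by (simp add: B.alg.m_assoc arrow_closed word_closed)
 qed
qed

text \<open>Insert \<open>\<theta> i \<one>\<close> and \<open>\<theta> j \<one>\<close> between \<open>x\<close> and \<open>y\<close>; their product vanishes.\<close>

lemma orthogonal:
 assumes "i \<in> verts Q" "j \<in> verts Q" "i \<noteq> j" "x \<in> carrier B" "y \<in> carrier B"
  "x \<otimes>\<^bsub>B\<^esub> \<theta> i \<one>\<^bsub>A i\<^esub> = x" "\<theta> j \<one>\<^bsub>A j\<^esub> \<otimes>\<^bsub>B\<^esub> y = y"
 shows "x \<otimes>\<^bsub>B\<^esub> y = \<zero>\<^bsub>B\<^esub>"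
proof -
 have c: "\<theta> i \<one>\<^bsub>A i\<^esub> \<in> carrier B" "\<theta> j \<one>\<^bsub>A j\<^esub> \<in> carrier B" using assms by (auto intro!: vertex_closed A_closed)
 have "x \<otimes>\<^bsub>B\<^esub> y = (x \<otimes>\<^bsub>B\<^esub> \<theta> i \<one>\<^bsub>A i\<^esub>) \<otimes>\<^bsub>B\<^esub> (\<theta> j \<one>\<^bsub>A j\<^esub> \<otimes>\<^bsub>B\<^esub> y)" using assms by simp
 also have "... = x \<otimes>\<^bsub>B\<^esub> ((\<theta> i \<one>\<^bsub>A i\<^esub> \<otimes>\<^bsub>B\<^esub> \<theta> j \<one>\<^bsub>A j\<^esub>) \<otimes>\<^bsub>B\<^esub> y)" using assms(4,5) c by (simp add: B.alg.m_assoc)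
 also have "... = \<zero>\<^bsub>B\<^esub>" using assms by (simp add: vertex_mult A_closed)
 finally show ?thesis .
qed

definition gen_image :: "('v, 'e, 'a, 'm) tensor_gen => 'b" where
 "gen_image g = (case g of At i a => \<theta> i a | Along p xs => word p xs)"

lemma tmap_gen: "gen_valid g ==> tmap (gen g) = gen_image g"
 by (cases g) (auto simp: gen_image_def tmap_vp tmap_pp pure_closed path_map_pure)

lemma tmap_gen_mult:
 assumes g: "gen_valid g" and h: "gen_valid h"
 shows "tmap (gen g \<otimes>\<^bsub>T\<^esub> gen h) = tmap (gen g) \<otimes>\<^bsub>B\<^esub> tmap (gen h)"
proof -
 have "tmap (gen_option (gen_mult g h)) = gen_image g \<otimes>\<^bsub>B\<^esub> gen_image h"
 proof (cases g; cases h)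
  fix i a j b assume gh: "g = At i a" "h = At j b"
  then show ?thesis using g h tmap.zero by (auto simp: gen_image_def vertex_mult tmap_vp A_closed)
 next
  fix i a p xs assume gh: "g = At i a" "h = Along p xs"
  then have i: "i \<in> verts Q" "a \<in> carrier (A i)" and p: "p \<in> N" "xs \<in> tuples (map M p)" using g h by auto
  have ar: "set p \<subseteq> arcs Q" by (rule npaths_arcs[OF p(1)])
  obtain e p' where p': "p = e # p'" using p by (cases p) auto
  then obtain x ys where x: "xs = x # ys" "x \<in> carrier (M e)" "ys \<in> tuples (map M p')" using p(2) by (auto simp: tuples_Cons)
  show ?thesis
  proof (cases "head Q e = i")
   case True
   have v: "gen_valid (Along p (lact (M e) a x # ys))" using lact_tuple[OF p(1), of x ys a] p i True x p' by simp
   have "\<mu> e (lact (M e) a x) = \<theta> i a \<otimes>\<^bsub>B\<^esub> \<mu> e x" using arrow_lact[of e x a] ar p' x i True by simp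
   then show ?thesis using tmap_gen[OF v] True ar x i p' unfolding gh
    by (simp add: gen_image_def B.alg.m_assoc arrow_closed vertex_closed word_closed)
  next
   case False
   have "\<theta> i a \<otimes>\<^bsub>B\<^esub> word p xs = \<zero>\<^bsub>B\<^esub>"
   proof (rule orthogonal[of i "head Q e"])
    show "\<theta> i a \<otimes>\<^bsub>B\<^esub> \<theta> i \<one>\<^bsub>A i\<^esub> = \<theta> i a"
     using vertex_mult[OF i(1) i(1) i(2) A_closed(2)[OF i(1)]] A_one(2)[OF i] by simp
    show "\<theta> (head Q e) \<one>\<^bsub>A (head Q e)\<^esub> \<otimes>\<^bsub>B\<^esub> word p xs = word p xs"
     using word_unit(1)[OF p] p' by simp
   qed (use False i p ar p' word_closed[OF ar p(2)] vertex_closed in auto)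
   then show ?thesis using False tmap.zero p' unfolding gh by (simp add: gen_image_def)
  qed
 next
  fix i a p xs assume gh: "h = At i a" "g = Along p xs"
  then have i: "i \<in> verts Q" "a \<in> carrier (A i)" and p: "p \<in> N" "xs \<in> tuples (map M p)" using g h by auto
  have ar: "set p \<subseteq> arcs Q" by (rule npaths_arcs[OF p(1)])
  from p(2) show ?thesis
  proof (rule tuples_path_lastE[OF p(1)])
   fix ys y q assume *: "xs = ys @ [y]" "y \<in> carrier (M (last p))" "ys \<in> tuples (map M q)" "p = q @ [last p]"
   define d where "d = last p"
   have q: "p = q @ [d]" using *(4) by (simp add: d_def)
   have b: "set q \<subseteq> arcs Q" "d \<in> arcs Q" "y \<in> carrier (M d)" using ar q *(2) by (auto simp: d_def[symmetric])
   have w: "word p (ys @ [z]) = word q ys \<otimes>\<^bsub>B\<^esub> \<mu> d z" if "z \<in> carrier (M d)" for z unfolding q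
    using word_append[of q "[d]" ys "[z]"] *(3) b that by (simp add: arrow_closed)
   show ?thesis
   proof (cases "tail Q d = i")
    case True
    have v: "gen_valid (Along p (ys @ [ract (M d) y a]))"
     using ract_tuple[OF p(1), of ys y a] p i True * unfolding d_def by simp
    have rc: "ract (M d) y a \<in> carrier (M d)"
     using bimodule.ract_closed[OF bimodule_at[OF b(2)]] b(3) i True by simp
    have "\<mu> d (ract (M d) y a) = \<mu> d y \<otimes>\<^bsub>B\<^esub> \<theta> i a" using arrow_ract[of d y a] b i True by simp
    then have "gen_image (Along p (ys @ [ract (M d) y a])) = word p xs \<otimes>\<^bsub>B\<^esub> \<theta> i a"
     using w[OF rc] w[OF b(3)] b i *(1,3)
     by (simp add: gen_image_def B.alg.m_assoc arrow_closed vertex_closed word_closed)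
    then show ?thesis using tmap_gen[OF v] True *(1) unfolding gh d_def by (simp add: gen_image_def)
   next
    case False
    have "word p xs \<otimes>\<^bsub>B\<^esub> \<theta> i a = \<zero>\<^bsub>B\<^esub>"
    proof (rule orthogonal[of "tail Q d" i])
     show "\<theta> i \<one>\<^bsub>A i\<^esub> \<otimes>\<^bsub>B\<^esub> \<theta> i a = \<theta> i a"
      using vertex_mult[OF i(1) i(1) A_closed(2)[OF i(1)] i(2)] A_one(1)[OF i] by simp
     show "word p xs \<otimes>\<^bsub>B\<^esub> \<theta> (tail Q d) \<one>\<^bsub>A (tail Q d)\<^esub> = word p xs"
      using word_unit(2)[OF p] by (simp add: d_def)
    qed (use False i b word_closed[OF ar p(2)] vertex_closed in auto)
    then show ?thesis using False tmap.zero unfolding gh d_def by (simp add: gen_image_def)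
   qed
  qed
 next
  fix p xs q ys assume gh: "g = Along p xs" "h = Along q ys"
  then have p: "p \<in> N" "xs \<in> tuples (map M p)" and q: "q \<in> N" "ys \<in> tuples (map M q)" using g h by auto
  have ar: "set p \<subseteq> arcs Q" "set q \<subseteq> arcs Q" using npaths_arcs p q by auto
  have ne: "p \<noteq> []" "q \<noteq> []" using p q by auto
  show ?thesis
  proof (cases "tail Q (last p) = head Q (hd q)")
   case True
   have v: "gen_valid (Along (p @ q) (xs @ ys))" using npaths_append[OF ne] p q True by (simp add: tuples_append)
   then show ?thesis using tmap_gen[OF v] True word_append[OF ar p(2) q(2)] unfolding gh by (simp add: gen_image_def)
  next
   case False
   have "word p xs \<otimes>\<^bsub>B\<^esub> word q ys = \<zero>\<^bsub>B\<^esub>"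
    by (rule orthogonal[of "tail Q (last p)" "head Q (hd q)"])
     (use False p q word_unit(2)[OF p] word_unit(1)[OF q] word_closed[OF ar(1) p(2)] word_closed[OF ar(2) q(2)]
      end_verts in auto)
   then show ?thesis using False tmap.zero unfolding gh by (simp add: gen_image_def)
  qed
 qed
 then show ?thesis unfolding gen_mult[OF g h] tmap_gen[OF g] tmap_gen[OF h] .
qed

lemma tmap_mult:
 assumes s: "s \<in> carrier T" and t: "t \<in> carrier T"
 shows "tmap (s \<otimes>\<^bsub>T\<^esub> t) = tmap s \<otimes>\<^bsub>B\<^esub> tmap t"
proof -
 interpret T: assoc_algebra K T by (rule algebra_T)
 have 1: "tmap (gen g \<otimes>\<^bsub>T\<^esub> t) = tmap (gen g) \<otimes>\<^bsub>B\<^esub> tmap t" if g: "gen_valid g" for g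
  by (rule T_linear_ext[OF linear_map_comp[OF T.linear_mult_right[OF gen_closed[OF g]] linear_tmap]
    linear_map_comp[OF linear_tmap B.linear_mult_right[OF tmap.closed[OF gen_closed[OF g]]]] tmap_gen_mult[OF g] t])
 show ?thesis
  by (rule T_linear_ext[OF linear_map_comp[OF T.linear_mult_left[OF t] linear_tmap]
    linear_map_comp[OF linear_tmap B.linear_mult_left[OF tmap.closed[OF t]]] 1 s])
qed

end

section \<open>Elementary bimodules\<close>

lemma (in assoc_algebra) principal_left_submodule:
 assumes "e \<in> carrier A" shows "submodule {b \<otimes>\<^bsub>A\<^esub> e |b. b \<in> carrier A} K A"
proof -
 have eq: "{b \<otimes>\<^bsub>A\<^esub> e |b. b \<in> carrier A} = (\<lambda>b. b \<otimes>\<^bsub>A\<^esub> e) ` carrier A" by auto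
 show ?thesis unfolding eq by (rule linear_map.image_submodule[OF linear_mult_left[OF assms]])
qed

lemma (in assoc_algebra) principal_right_submodule:
 assumes "e \<in> carrier A" shows "submodule {e \<otimes>\<^bsub>A\<^esub> b |b. b \<in> carrier A} K A"
proof -
 have eq: "{e \<otimes>\<^bsub>A\<^esub> b |b. b \<in> carrier A} = (\<lambda>b. e \<otimes>\<^bsub>A\<^esub> b) ` carrier A" by auto
 show ?thesis unfolding eq by (rule linear_map.image_submodule[OF linear_mult_right[OF assms]])
qed

locale elementary = B: assoc_algebra K B + A: assoc_algebra K A
 for K :: "'k ring" and B A :: "('k, 'a) module" +
 fixes e e' assumes e: "e \<in> carrier B" and e': "e' \<in> carrier A"
begin

definition "Be = {b \<otimes>\<^bsub>B\<^esub> e |b. b \<in> carrier B}"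
definition "eA = {e' \<otimes>\<^bsub>A\<^esub> a |a. a \<in> carrier A}"
abbreviation "Vs == elementary_factors B A e e'"
abbreviation "E == elementary_bimodule K B A e e'"
abbreviation "et == elementary_tensor K B A e e'"

lemma Vs_eq: "Vs = [B\<lparr>carrier := Be\<rparr>, A\<lparr>carrier := eA\<rparr>]"
 by (simp add: elementary_factors_def Be_def eA_def)

lemma tuples_Vs: "xs \<in> tuples Vs \<longleftrightarrow> (\<exists>x\<in>Be. \<exists>y\<in>eA. xs = [x, y])"
 by (auto simp: Vs_eq tuples_Cons)

sublocale V: tensor_product K Vs "{}"
proof (rule tensor_product.intro)
 show "cring K" by (rule A.cring_base)
 show "Module.module K V" if "V \<in> set Vs" for V
  using that submodule.submodule_is_module[OF B.principal_left_submodule[OF e] B.vec.module_axioms]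
   submodule.submodule_is_module[OF A.principal_right_submodule[OF e'] A.vec.module_axioms]
  by (auto simp: Vs_eq Be_def eA_def)
qed auto

lemma Be_subset: "x \<in> Be ==> x \<in> carrier B" using e by (auto simp: Be_def)
lemma eA_subset: "y \<in> eA ==> y \<in> carrier A" using e' by (auto simp: eA_def)

lemma Be_mult: "b \<in> carrier B ==> x \<in> Be ==> b \<otimes>\<^bsub>B\<^esub> x \<in> Be"
 using e unfolding Be_def by (auto simp: B.alg.m_assoc[symmetric])

lemma eA_mult: "a \<in> carrier A ==> y \<in> eA ==> y \<otimes>\<^bsub>A\<^esub> a \<in> eA"
 using e' unfolding eA_def by (auto simp: A.alg.m_assoc)

lemma elementary_simps:
 "carrier E = carrier V.T" "zero E = zero V.T" "add E = add V.T" "smult E = smult V.T"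
 by (simp_all add: elementary_bimodule_def Let_def module.extend_def)

lemma module_E: "Module.module K E"
 by (rule module_cong[OF V.module_tensor]) (simp_all add: elementary_simps)

lemma et_pure: "et x y = V.pure [x, y]"
 by (simp add: elementary_tensor_def)

lemma et_closed: "x \<in> Be ==> y \<in> eA ==> et x y \<in> carrier E"
 unfolding elementary_simps et_pure by (rule V.pure_closed) (simp add: Vs_eq)

lemma multilinear_VsI:
 assumes L: "Module.module K L" and "\<And>x y. x \<in> Be ==> y \<in> eA ==> g [x, y] \<in> carrier L"
  and "\<And>x x' y. x \<in> Be ==> x' \<in> Be ==> y \<in> eA ==> g [x \<oplus>\<^bsub>B\<^esub> x', y] = g [x, y] \<oplus>\<^bsub>L\<^esub> g [x', y]"
  and "\<And>x y y'. x \<in> Be ==> y \<in> eA ==> y' \<in> eA ==> g [x, y \<oplus>\<^bsub>A\<^esub> y'] = g [x, y] \<oplus>\<^bsub>L\<^esub> g [x, y']"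
  and "\<And>c x y. c \<in> carrier K ==> x \<in> Be ==> y \<in> eA ==> g [c \<odot>\<^bsub>B\<^esub> x, y] = c \<odot>\<^bsub>L\<^esub> g [x, y]"
  and "\<And>c x y. c \<in> carrier K ==> x \<in> Be ==> y \<in> eA ==> g [x, c \<odot>\<^bsub>A\<^esub> y] = c \<odot>\<^bsub>L\<^esub> g [x, y]"
 shows "multilinear K Vs L g"
proof (rule multilinearI)
 fix xs assume "xs \<in> tuples Vs" then show "g xs \<in> carrier L" using assms(2) by (auto simp: tuples_Vs)
next
 fix Us V Ws us vs x y
 assume *: "Vs = Us @ V # Ws" "us \<in> tuples Us" "x \<in> carrier V" "y \<in> carrier V" "vs \<in> tuples Ws" "length us = length Us"
 show "g (us @ (x \<oplus>\<^bsub>V\<^esub> y) # vs) = g (us @ x # vs) \<oplus>\<^bsub>L\<^esub> g (us @ y # vs)"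
 proof (cases Us)
  case Nil
  then have "us = []" "V = B\<lparr>carrier := Be\<rparr>" "Ws = [A\<lparr>carrier := eA\<rparr>]" using * by (auto simp: Vs_eq)
  moreover obtain z where "vs = [z]" "z \<in> eA" using * calculation by (auto simp: tuples_Cons)
  ultimately show ?thesis using assms(3)[of x y z] * by simp
 next
  case (Cons U Us')
  then have "Us' = []" "V = A\<lparr>carrier := eA\<rparr>" "Ws = []" "U = B\<lparr>carrier := Be\<rparr>" using *
   by (auto simp: Vs_eq Cons_eq_append_conv)
  moreover obtain z where "us = [z]" "z \<in> Be" using * calculation Cons by (auto simp: tuples_Cons)
  ultimately show ?thesis using assms(4)[of z x y] * by simp
 qed
next
 fix Us V Ws us vs c x
 assume *: "Vs = Us @ V # Ws" "us \<in> tuples Us" "x \<in> carrier V" "vs \<in> tuples Ws" "length us = length Us" "c \<in> carrier K"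
 show "g (us @ (c \<odot>\<^bsub>V\<^esub> x) # vs) = c \<odot>\<^bsub>L\<^esub> g (us @ x # vs)"
 proof (cases Us)
  case Nil
  then have "us = []" "V = B\<lparr>carrier := Be\<rparr>" "Ws = [A\<lparr>carrier := eA\<rparr>]" using * by (auto simp: Vs_eq)
  moreover obtain z where "vs = [z]" "z \<in> eA" using * calculation by (auto simp: tuples_Cons)
  ultimately show ?thesis using assms(5)[of c x z] * by simp
 next
  case (Cons U Us')
  then have "Us' = []" "V = A\<lparr>carrier := eA\<rparr>" "Ws = []" "U = B\<lparr>carrier := Be\<rparr>" using *
   by (auto simp: Vs_eq Cons_eq_append_conv)
  moreover obtain z where "us = [z]" "z \<in> Be" using * calculation Cons by (auto simp: tuples_Cons)
  ultimately show ?thesis using assms(6)[of c z x] * by simp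
 qed
qed

lemma pair_in: "x \<in> Be ==> y \<in> eA ==> [x, y] \<in> tuples Vs"
 by (simp add: Vs_eq)

lemma Vs_nth: "x \<oplus>\<^bsub>Vs ! 0\<^esub> x' = x \<oplus>\<^bsub>B\<^esub> x'" "y \<oplus>\<^bsub>Vs ! Suc 0\<^esub> y' = y \<oplus>\<^bsub>A\<^esub> y'"
  "c \<odot>\<^bsub>Vs ! 0\<^esub> x = c \<odot>\<^bsub>B\<^esub> x" "c \<odot>\<^bsub>Vs ! Suc 0\<^esub> y = c \<odot>\<^bsub>A\<^esub> y"
 by (simp_all add: Vs_eq)

lemma et_add_left: "[|x \<in> Be; x' \<in> Be; y \<in> eA|] ==> V.pure [x \<oplus>\<^bsub>B\<^esub> x', y] = V.pure [x, y] \<oplus>\<^bsub>V.T\<^esub> V.pure [x', y]"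
 using V.pure_add[OF _ _ refl, of "[]" x "[y]" x'] pair_in by (simp only: append_Nil list.size Vs_nth)

lemma et_add_right: "[|x \<in> Be; y \<in> eA; y' \<in> eA|] ==> V.pure [x, y \<oplus>\<^bsub>A\<^esub> y'] = V.pure [x, y] \<oplus>\<^bsub>V.T\<^esub> V.pure [x, y']"
 using V.pure_add[OF _ _ refl, of "[x]" y "[]" y'] pair_in by (simp only: append_Nil append_Cons list.size Vs_nth add_0)

lemma et_smult_left: "[|c \<in> carrier K; x \<in> Be; y \<in> eA|] ==> V.pure [c \<odot>\<^bsub>B\<^esub> x, y] = c \<odot>\<^bsub>V.T\<^esub> V.pure [x, y]"
 using V.pure_smult[OF _ _ refl, of "[]" x "[y]" c] pair_in by (simp only: append_Nil list.size Vs_nth)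

lemma et_smult_right: "[|c \<in> carrier K; x \<in> Be; y \<in> eA|] ==> V.pure [x, c \<odot>\<^bsub>A\<^esub> y] = c \<odot>\<^bsub>V.T\<^esub> V.pure [x, y]"
 using V.pure_smult[OF _ _ refl, of "[x]" y "[]" c] pair_in by (simp only: append_Nil append_Cons list.size Vs_nth add_0)

lemma lact_et:
 assumes b: "b \<in> carrier B" and x: "x \<in> Be" and y: "y \<in> eA"
 shows "lact E b (et x y) = et (b \<otimes>\<^bsub>B\<^esub> x) y"
proof -
 let ?h = "\<lambda>xs. [b \<otimes>\<^bsub>B\<^esub> xs ! 0, xs ! 1]"
 have h: "?h xs \<in> tuples Vs" if "xs \<in> tuples Vs" for xs
  using that Be_mult[OF b] unfolding tuples_Vs by fastforce
 have m: "multilinear K Vs V.T (\<lambda>xs. V.pure (?h xs))"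
 proof (rule multilinear_VsI[OF V.module_tensor])
  show "V.pure (?h [x, y]) \<in> carrier V.T" if "x \<in> Be" "y \<in> eA" for x y
   by (rule V.pure_closed[OF h]) (use that in "simp add: Vs_eq")
  show "V.pure (?h [x \<oplus>\<^bsub>B\<^esub> x', y]) = V.pure (?h [x, y]) \<oplus>\<^bsub>V.T\<^esub> V.pure (?h [x', y])" if "x \<in> Be" "x' \<in> Be" "y \<in> eA" for x x' y
   using et_add_left[OF Be_mult[OF b that(1)] Be_mult[OF b that(2)] that(3)] b Be_subset that by (simp add: B.alg.r_distr)
  show "V.pure (?h [x, y \<oplus>\<^bsub>A\<^esub> y']) = V.pure (?h [x, y]) \<oplus>\<^bsub>V.T\<^esub> V.pure (?h [x, y'])" if "x \<in> Be" "y \<in> eA" "y' \<in> eA" for x y y'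
   using et_add_right[OF Be_mult[OF b that(1)] that(2,3)] by simp
  show "V.pure (?h [c \<odot>\<^bsub>B\<^esub> x, y]) = c \<odot>\<^bsub>V.T\<^esub> V.pure (?h [x, y])" if "c \<in> carrier K" "x \<in> Be" "y \<in> eA" for c x y
   using et_smult_left[OF that(1) Be_mult[OF b that(2)] that(3)] that b Be_subset[OF that(2)] by (simp add: B.smult_mult_right)
  show "V.pure (?h [x, c \<odot>\<^bsub>A\<^esub> y]) = c \<odot>\<^bsub>V.T\<^esub> V.pure (?h [x, y])" if "c \<in> carrier K" "x \<in> Be" "y \<in> eA" for c x y
   using et_smult_right[OF that(1) Be_mult[OF b that(2)] that(3)] by simp
 qed
 have xy: "[x, y] \<in> tuples Vs" using x y by (auto simp: tuples_Vs)
 have "lact E b X = coset_lift (lin K V.T (\<lambda>xs. V.pure (?h xs))) X" if "X \<in> carrier V.T" for X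
  using UN_push_coset[OF V.tensor_product_axioms V.tensor_product_axioms h m _ that]
  by (simp add: elementary_bimodule_def Let_def module.extend_def bimodule.fields_def)
 then show ?thesis
  using V.tensor_lift_pure[OF V.module_tensor m _ xy] V.pure_closed[OF xy] by (simp add: et_pure)
qed

lemma ract_et:
 assumes a: "a \<in> carrier A" and x: "x \<in> Be" and y: "y \<in> eA"
 shows "ract E (et x y) a = et x (y \<otimes>\<^bsub>A\<^esub> a)"
proof -
 let ?h = "\<lambda>xs. [xs ! 0, xs ! 1 \<otimes>\<^bsub>A\<^esub> a]"
 have h: "?h xs \<in> tuples Vs" if "xs \<in> tuples Vs" for xs
  using that eA_mult[OF a] unfolding tuples_Vs by fastforce
 have m: "multilinear K Vs V.T (\<lambda>xs. V.pure (?h xs))"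
 proof (rule multilinear_VsI[OF V.module_tensor])
  show "V.pure (?h [x, y]) \<in> carrier V.T" if "x \<in> Be" "y \<in> eA" for x y
   by (rule V.pure_closed[OF h]) (use that in "simp add: Vs_eq")
  show "V.pure (?h [x \<oplus>\<^bsub>B\<^esub> x', y]) = V.pure (?h [x, y]) \<oplus>\<^bsub>V.T\<^esub> V.pure (?h [x', y])" if "x \<in> Be" "x' \<in> Be" "y \<in> eA" for x x' y
   using et_add_left[OF that(1,2) eA_mult[OF a that(3)]] by simp
  show "V.pure (?h [x, y \<oplus>\<^bsub>A\<^esub> y']) = V.pure (?h [x, y]) \<oplus>\<^bsub>V.T\<^esub> V.pure (?h [x, y'])" if "x \<in> Be" "y \<in> eA" "y' \<in> eA" for x y y'
   using et_add_right[OF that(1) eA_mult[OF a that(2)] eA_mult[OF a that(3)]] a eA_subset that by (simp add: A.alg.l_distr)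
  show "V.pure (?h [c \<odot>\<^bsub>B\<^esub> x, y]) = c \<odot>\<^bsub>V.T\<^esub> V.pure (?h [x, y])" if "c \<in> carrier K" "x \<in> Be" "y \<in> eA" for c x y
   using et_smult_left[OF that(1,2) eA_mult[OF a that(3)]] by simp
  show "V.pure (?h [x, c \<odot>\<^bsub>A\<^esub> y]) = c \<odot>\<^bsub>V.T\<^esub> V.pure (?h [x, y])" if "c \<in> carrier K" "x \<in> Be" "y \<in> eA" for c x y
   using et_smult_right[OF that(1,2) eA_mult[OF a that(3)]] that a eA_subset[OF that(3)] by (simp add: A.smult_mult_left)
 qed
 have xy: "[x, y] \<in> tuples Vs" using x y by (auto simp: tuples_Vs)
 have "ract E X a = coset_lift (lin K V.T (\<lambda>xs. V.pure (?h xs))) X" if "X \<in> carrier V.T" for X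
  using UN_push_coset[OF V.tensor_product_axioms V.tensor_product_axioms h m _ that]
  by (simp add: elementary_bimodule_def Let_def module.extend_def bimodule.fields_def)
 then show ?thesis
  using V.tensor_lift_pure[OF V.module_tensor m _ xy] V.pure_closed[OF xy] by (simp add: et_pure)
qed

lemma elementary_induct [consumes 1, case_names zero et add]:
 assumes "X \<in> carrier E" "P \<zero>\<^bsub>E\<^esub>" "\<And>x y. x \<in> Be ==> y \<in> eA ==> P (et x y)"
  "\<And>X Y. [|X \<in> carrier E; Y \<in> carrier E; P X; P Y|] ==> P (X \<oplus>\<^bsub>E\<^esub> Y)"
 shows "P X"
proof (rule V.tensor_induct)
 show "X \<in> carrier V.T" using assms(1) by (simp add: elementary_simps)
 show "Vs \<noteq> []" by (simp add: Vs_eq)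
 show "P (V.pure xs)" if "xs \<in> tuples Vs" for xs using that assms(3) unfolding tuples_Vs et_pure by blast
qed (use assms in "simp_all add: elementary_simps")

lemma elementary_lift:
 assumes L: "Module.module K L" and g: "multilinear K Vs L g"
 shows "linear_map K E L (coset_lift (lin K L g))"
  and "x \<in> Be ==> y \<in> eA ==> coset_lift (lin K L g) (et x y) = g [x, y]"
proof -
 interpret l: linear_map K V.T L "coset_lift (lin K L g)" by (rule V.linear_tensor_lift[OF L g]) simp
 show "linear_map K E L (coset_lift (lin K L g))"
  using module_E L l.add l.smult l.closed by (simp add: linear_map_def linear_map_axioms_def elementary_simps)
 show "coset_lift (lin K L g) (et x y) = g [x, y]" if "x \<in> Be" "y \<in> eA"
  unfolding et_pure by (rule V.tensor_lift_pure[OF L g]) (use that in "auto simp: tuples_Vs")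
qed

end

section \<open>Decomposed projective covers\<close>

locale decomposed_bimodule = P: bimodule K B A P
 for K :: "'k ring" and B A :: "('k, 'a) module" and P :: "('a, 'k, 'p) bimodule" +
 fixes S :: "'g set" and e e' :: "'g => 'a" and s :: "'g => ('a list => 'k) set => 'p"
 assumes e: "g \<in> S ==> e g \<in> carrier B" and e': "g \<in> S ==> e' g \<in> carrier A"
  and s_hom: "g \<in> S ==> s g \<in> bimod_hom B A (elementary_bimodule K B A (e g) (e' g)) P"
  and s_inj: "g \<in> S ==> inj_on (s g) (carrier (elementary_bimodule K B A (e g) (e' g)))"
  and direct: "internal_direct_sum P S (\<lambda>g. s g ` carrier (elementary_bimodule K B A (e g) (e' g)))"
begin

abbreviation "El g == elementary_bimodule K B A (e g) (e' g)"
abbreviation "tens g == elementary_tensor K B A (e g) (e' g)"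

lemma elementary_at: "g \<in> S ==> elementary K B A (e g) (e' g)"
 by (intro elementary.intro elementary_axioms.intro P.left.assoc_algebra_axioms P.right.assoc_algebra_axioms e e')

lemma finite_S: "finite S"
 using direct by (simp add: internal_direct_sum_def)

lemma s_closed: "g \<in> S ==> x \<in> carrier (El g) ==> s g x \<in> carrier P"
 using s_hom[of g] by (auto simp: bimod_hom_def left_hom_def)

lemma s_add: "g \<in> S ==> x \<in> carrier (El g) ==> y \<in> carrier (El g) ==>
  s g (x \<oplus>\<^bsub>El g\<^esub> y) = s g x \<oplus>\<^bsub>P\<^esub> s g y"
 using s_hom[of g] by (auto simp: bimod_hom_def left_hom_def)

lemma s_lact: "g \<in> S ==> x \<in> carrier (El g) ==> b \<in> carrier B ==> s g (lact (El g) b x) = lact P b (s g x)"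
 using s_hom[of g] by (auto simp: bimod_hom_def left_hom_def)

lemma s_ract: "g \<in> S ==> x \<in> carrier (El g) ==> a \<in> carrier A ==> s g (ract (El g) x a) = ract P (s g x) a"
 using s_hom[of g] by (auto simp: bimod_hom_def right_hom_def)

lemma El_zero: "g \<in> S ==> \<zero>\<^bsub>El g\<^esub> \<in> carrier (El g)" "g \<in> S ==> \<zero>\<^bsub>El g\<^esub> \<oplus>\<^bsub>El g\<^esub> \<zero>\<^bsub>El g\<^esub> = \<zero>\<^bsub>El g\<^esub>"
proof -
 assume g: "g \<in> S"
 interpret E: Module.module K "El g" by (rule elementary.module_E[OF elementary_at[OF g]])
 show "\<zero>\<^bsub>El g\<^esub> \<in> carrier (El g)" "\<zero>\<^bsub>El g\<^esub> \<oplus>\<^bsub>El g\<^esub> \<zero>\<^bsub>El g\<^esub> = \<zero>\<^bsub>El g\<^esub>" by auto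
qed

lemma s_zero: "g \<in> S ==> s g \<zero>\<^bsub>El g\<^esub> = \<zero>\<^bsub>P\<^esub>"
proof -
 assume g: "g \<in> S"
 have "s g \<zero>\<^bsub>El g\<^esub> \<oplus>\<^bsub>P\<^esub> s g \<zero>\<^bsub>El g\<^esub> = s g \<zero>\<^bsub>El g\<^esub>"
  using s_add[OF g El_zero(1)[OF g] El_zero(1)[OF g]] El_zero(2)[OF g] by simp
 then show ?thesis using s_closed[OF g El_zero(1)[OF g]] by (simp add: P.vec.M.add.l_cancel_one)
qed

text \<open>Directness concerns the images of the summands; injectivity of \<open>s\<close> turns it into unique components in the
 elementary bimodules themselves.\<close>

lemma ex1_components:
 assumes p: "p \<in> carrier P"
 shows "\<exists>!t. t \<in> (\<Pi>\<^sub>E g\<in>S. carrier (El g)) \<and> p = (\<Oplus>\<^bsub>P\<^esub>g\<in>S. s g (t g))"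
proof -
 let ?X = "\<lambda>g. s g ` carrier (El g)"
 have ex1: "\<exists>!f. f \<in> (\<Pi>\<^sub>E g\<in>S. ?X g) \<and> p = (\<Oplus>\<^bsub>P\<^esub>g\<in>S. f g)"
  using direct p by (simp add: internal_direct_sum_def)
 then obtain f where f: "f \<in> (\<Pi>\<^sub>E g\<in>S. ?X g)" "p = (\<Oplus>\<^bsub>P\<^esub>g\<in>S. f g)" by blast
 have "\<forall>g\<in>S. \<exists>x\<in>carrier (El g). f g = s g x" using f(1) by blast
 then obtain t where t: "\<And>g. g \<in> S ==> t g \<in> carrier (El g) \<and> f g = s g (t g)" by metis
 have sum: "p = (\<Oplus>\<^bsub>P\<^esub>g\<in>S. s g (restrict t S g))"
  unfolding f(2) by (rule P.vec.M.finsum_cong') (use t s_closed in auto)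
 have uniq: "t1 = t2" if a: "t1 \<in> (\<Pi>\<^sub>E g\<in>S. carrier (El g))" "p = (\<Oplus>\<^bsub>P\<^esub>g\<in>S. s g (t1 g))"
  "t2 \<in> (\<Pi>\<^sub>E g\<in>S. carrier (El g))" "p = (\<Oplus>\<^bsub>P\<^esub>g\<in>S. s g (t2 g))" for t1 t2
 proof (rule PiE_ext[OF a(1,3)])
  fix g assume g: "g \<in> S"
  let ?f = "\<lambda>t. \<lambda>g\<in>S. s g (t g)"
  have "?f u \<in> (\<Pi>\<^sub>E g\<in>S. ?X g) \<and> p = (\<Oplus>\<^bsub>P\<^esub>g\<in>S. ?f u g)"
   if "u \<in> (\<Pi>\<^sub>E g\<in>S. carrier (El g))" "p = (\<Oplus>\<^bsub>P\<^esub>g\<in>S. s g (u g))" for u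
  proof
   show "p = (\<Oplus>\<^bsub>P\<^esub>g\<in>S. ?f u g)"
    unfolding that(2) by (rule P.vec.M.finsum_cong') (use that(1) s_closed in "auto simp: PiE_iff")
  qed (use that in auto)
  then have "?f t1 = ?f t2" using ex1 a by blast
  then have "s g (t1 g) = s g (t2 g)" using g by (metis restrict_apply')
  then show "t1 g = t2 g" using s_inj[OF g] a(1,3) g by (auto simp: inj_on_def PiE_mem)
 qed
 have "restrict t S \<in> (\<Pi>\<^sub>E g\<in>S. carrier (El g))" using t by auto
 with sum uniq show ?thesis by blast
qed

definition comps :: "'p => 'g => ('a list => 'k) set" where
 "comps p = (THE t. t \<in> (\<Pi>\<^sub>E g\<in>S. carrier (El g)) \<and> p = (\<Oplus>\<^bsub>P\<^esub>g\<in>S. s g (t g)))"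

lemma comps: assumes "p \<in> carrier P"
 shows "comps p \<in> (\<Pi>\<^sub>E g\<in>S. carrier (El g))" "p = (\<Oplus>\<^bsub>P\<^esub>g\<in>S. s g (comps p g))"
 using theI'[OF ex1_components[OF assms]] unfolding comps_def by auto

lemma comps_eqI:
 assumes "p \<in> carrier P" "t \<in> (\<Pi>\<^sub>E g\<in>S. carrier (El g))" "p = (\<Oplus>\<^bsub>P\<^esub>g\<in>S. s g (t g))"
 shows "comps p = t"
 using ex1_components[OF assms(1)] comps[OF assms(1)] assms by blast

lemma comps_add:
 assumes p: "p \<in> carrier P" and q: "q \<in> carrier P"
 shows "comps (p \<oplus>\<^bsub>P\<^esub> q) = (\<lambda>g\<in>S. comps p g \<oplus>\<^bsub>El g\<^esub> comps q g)"
proof (rule comps_eqI)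
 have c: "comps p g \<in> carrier (El g)" "comps q g \<in> carrier (El g)" if "g \<in> S" for g
  using comps p q that by (auto simp: PiE_mem)
 have ca: "comps p g \<oplus>\<^bsub>El g\<^esub> comps q g \<in> carrier (El g)" if "g \<in> S" for g
 proof -
  interpret E: Module.module K "El g" by (rule elementary.module_E[OF elementary_at[OF that]])
  show ?thesis using c[OF that] by simp
 qed
 show "p \<oplus>\<^bsub>P\<^esub> q \<in> carrier P" using p q by simp
 show "(\<lambda>g\<in>S. comps p g \<oplus>\<^bsub>El g\<^esub> comps q g) \<in> (\<Pi>\<^sub>E g\<in>S. carrier (El g))" using ca by auto
 have "p \<oplus>\<^bsub>P\<^esub> q = (\<Oplus>\<^bsub>P\<^esub>g\<in>S. s g (comps p g)) \<oplus>\<^bsub>P\<^esub> (\<Oplus>\<^bsub>P\<^esub>g\<in>S. s g (comps q g))"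
  using comps(2)[OF p] comps(2)[OF q] by simp
 also have "... = (\<Oplus>\<^bsub>P\<^esub>g\<in>S. s g (comps p g) \<oplus>\<^bsub>P\<^esub> s g (comps q g))"
  by (rule P.vec.M.finsum_addf[symmetric]) (use c s_closed in auto)
 also have "... = (\<Oplus>\<^bsub>P\<^esub>g\<in>S. s g ((\<lambda>g\<in>S. comps p g \<oplus>\<^bsub>El g\<^esub> comps q g) g))"
  by (rule P.vec.M.finsum_cong') (use c ca s_closed s_add in auto)
 finally show "p \<oplus>\<^bsub>P\<^esub> q = (\<Oplus>\<^bsub>P\<^esub>g\<in>S. s g ((\<lambda>g\<in>S. comps p g \<oplus>\<^bsub>El g\<^esub> comps q g) g))" .
qed

lemma comps_summand:
 assumes g: "g \<in> S" and x: "x \<in> carrier (El g)"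
 shows "comps (s g x) = (\<lambda>\<delta>\<in>S. if g = \<delta> then x else \<zero>\<^bsub>El \<delta>\<^esub>)"
proof (rule comps_eqI[OF s_closed[OF g x]])
 show "(\<lambda>\<delta>\<in>S. if g = \<delta> then x else \<zero>\<^bsub>El \<delta>\<^esub>) \<in> (\<Pi>\<^sub>E \<delta>\<in>S. carrier (El \<delta>))"
  using x El_zero by auto
 have "(\<Oplus>\<^bsub>P\<^esub>\<delta>\<in>S. s \<delta> ((\<lambda>\<delta>\<in>S. if g = \<delta> then x else \<zero>\<^bsub>El \<delta>\<^esub>) \<delta>)) = (\<Oplus>\<^bsub>P\<^esub>\<delta>\<in>S. if g = \<delta> then s g x else \<zero>\<^bsub>P\<^esub>)"
  by (rule P.vec.M.finsum_cong') (use x s_closed[OF g] s_zero in auto)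
 also have "... = s g x" using g finite_S s_closed[OF g x] by (intro P.vec.M.finsum_singleton) auto
 finally show "s g x = (\<Oplus>\<^bsub>P\<^esub>\<delta>\<in>S. s \<delta> ((\<lambda>\<delta>\<in>S. if g = \<delta> then x else \<zero>\<^bsub>El \<delta>\<^esub>) \<delta>))" by simp
qed

lemma decomposed_induct [consumes 1, case_names zero tensor add]:
 assumes p: "p \<in> carrier P" and z: "R \<zero>\<^bsub>P\<^esub>"
  and t: "\<And>g b a. [|g \<in> S; b \<in> carrier B; a \<in> carrier A|] ==> R (s g (tens g (b \<otimes>\<^bsub>B\<^esub> e g) (e' g \<otimes>\<^bsub>A\<^esub> a)))"
  and ad: "\<And>p q. [|p \<in> carrier P; q \<in> carrier P; R p; R q|] ==> R (p \<oplus>\<^bsub>P\<^esub> q)"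
 shows "R p"
proof -
 have 1: "R (s g x)" if g: "g \<in> S" and x: "x \<in> carrier (El g)" for g x
 proof (rule elementary.elementary_induct[OF elementary_at[OF g] x])
  show "R (s g \<zero>\<^bsub>El g\<^esub>)" using s_zero[OF g] z by simp
  show "R (s g (tens g x y))" if "x \<in> elementary.Be B (e g)" "y \<in> elementary.eA A (e' g)" for x y
   using that t[OF g] unfolding elementary.Be_def[OF elementary_at[OF g]] elementary.eA_def[OF elementary_at[OF g]] by auto
  show "R (s g (X \<oplus>\<^bsub>El g\<^esub> Y))" if "X \<in> carrier (El g)" "Y \<in> carrier (El g)" "R (s g X)" "R (s g Y)" for X Y
   using that g by (simp add: s_add ad s_closed)
 qed
 have c: "comps p g \<in> carrier (El g)" if "g \<in> S" for g
  using comps p that by (auto simp: PiE_mem)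
 have fin: "finite C ==> C \<subseteq> S ==> R (\<Oplus>\<^bsub>P\<^esub>g\<in>C. s g (comps p g))" for C
 proof (induction C rule: finite_induct)
  case (insert g C)
  have g: "g \<in> S" and C: "C \<subseteq> S" using insert.prems by auto
  have cl: "s \<delta> (comps p \<delta>) \<in> carrier P" if "\<delta> \<in> S" for \<delta> by (rule s_closed[OF that c[OF that]])
  have eq: "(\<Oplus>\<^bsub>P\<^esub>\<delta>\<in>insert g C. s \<delta> (comps p \<delta>)) = s g (comps p g) \<oplus>\<^bsub>P\<^esub> (\<Oplus>\<^bsub>P\<^esub>\<delta>\<in>C. s \<delta> (comps p \<delta>))"
   by (rule P.vec.M.finsum_insert) (use insert.hyps C g cl in auto)
  show ?case unfolding eq
  proof (rule ad)
   show "(\<Oplus>\<^bsub>P\<^esub>\<delta>\<in>C. s \<delta> (comps p \<delta>)) \<in> carrier P"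
    by (rule P.vec.M.finsum_closed) (use C cl in auto)
  qed (use cl[OF g] 1[OF g c[OF g]] insert.IH[OF C] in auto)
 qed (use z in simp)
 show ?thesis using fin[OF finite_S subset_refl] unfolding comps(2)[OF p, symmetric] .
qed

end

section \<open>The assembled quiver\<close>

lemma path_bilinear_ext:
 assumes Q: "finite_quiver K Q" and Q': "finite_quiver K Q'"
  and "\<And>v. v \<in> carrier (path_algebra K Q') ==> linear_map K (path_algebra K Q) N (\<lambda>u. f u v)"
  and "\<And>v. v \<in> carrier (path_algebra K Q') ==> linear_map K (path_algebra K Q) N (\<lambda>u. g u v)"
  and "\<And>u. u \<in> carrier (path_algebra K Q) ==> linear_map K (path_algebra K Q') N (f u)"
  and "\<And>u. u \<in> carrier (path_algebra K Q) ==> linear_map K (path_algebra K Q') N (g u)"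
  and "\<And>x y. x \<in> qpaths Q ==> y \<in> qpaths Q' ==> f (single K x) (single K y) = g (single K x) (single K y)"
  and u: "u \<in> carrier (path_algebra K Q)" and v: "v \<in> carrier (path_algebra K Q')"
 shows "f u v = g u v"
proof -
 interpret Q: finite_quiver K Q by (rule Q)
 interpret Q': finite_quiver K Q' by (rule Q')
 have 1: "f (single K x) v = g (single K x) v" if x: "x \<in> qpaths Q" for x
  by (rule Q'.linear_path_ext[OF assms(5)[OF Q.single_path[OF x]] assms(6)[OF Q.single_path[OF x]] assms(7)[OF x] v])
 show ?thesis by (rule Q.linear_path_ext[OF assms(3)[OF v] assms(4)[OF v] 1 u])
qed

text \<open>A species with presentations of its algebras and decomposed covers of its bimodules. A pro-species and its double
 are both of this kind.\<close>

locale presented_species = species K Q A M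
 for K :: "'k ring" and Q :: "('v, 'e) pre_digraph"
  and A :: "'v => ('k, 'a) module" and M :: "'e => ('a, 'k, 'm) bimodule" +
 fixes qt :: "'v => ('w, 'b) pre_digraph"
  and I :: "'v => (('w, 'b) qpath => 'k) set"
  and \<psi> :: "'v => (('w, 'b) qpath => 'k) set => 'a"
  and C :: "'e => ('a, 'k, 'w, 'g, 'p, 'm) cover"
 assumes presentation: "i \<in> verts Q ==> presents K (A i) (qt i) (I i) (\<psi> i)"
  and cover: "e \<in> arcs Q ==> decomposed_cover K Q A M qt I \<psi> e (C e)"
begin

abbreviation "kq i == path_algebra K (qt i)"
abbreviation "pr == pres_map K qt I \<psi>"
abbreviation "idem == pres_idem K qt I \<psi>"
abbreviation "AQ == assembled_quiver Q qt C"
abbreviation "PA == path_algebra K AQ"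
abbreviation "emb i == (embed K i :: (('w, 'b) qpath => 'k) => ('v \<times> 'w, 'v \<times> 'b + 'e \<times> 'g) qpath => 'k)"

abbreviation "Cov e == cover_bimod (C e)"
abbreviation "cmap e == cover_map (C e)"
abbreviation "new e == new_arcs (C e)"
abbreviation "nh e == new_head (C e)"
abbreviation "nt e == new_tail (C e)"

lemma idem_eq: "idem i w = pr i (path_vertex K w)"
 by (simp add: pres_idem_def)

context
 fixes i assumes i: "i \<in> verts Q"
begin

lemma qt_finite: "finite_quiver K (qt i)"
proof -
 have "fin_digraph (qt i)" using presentation[OF i] by (simp add: presents_def admissible_def)
 then show ?thesis by (intro finite_quiver.intro base.field_axioms)
qed

lemma I_ideal: "ideal (I i) (kq i)"
 using presentation[OF i] by (simp add: presents_def admissible_def)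

lemma pr_facts:
 shows pr_hom: "algebra_hom K (kq i) (A i) (pr i)"
  and pr_surj: "pr i ` carrier (kq i) = carrier (A i)"
  and pr_kernel: "u \<in> carrier (kq i) ==> pr i u = \<zero>\<^bsub>A i\<^esub> \<longleftrightarrow> u \<in> I i"
proof -
 interpret q: finite_quiver K "qt i" by (rule qt_finite)
 interpret q: quotient_algebra K "kq i" "I i"
  by (intro quotient_algebra.intro quotient_algebra_axioms.intro q.kQ.assoc_algebra_axioms I_ideal)
 interpret Ai: assoc_algebra K "A i" by (rule algebra_at[OF i])
 let ?S = "quot (kq i) (I i)"
 have psi: "\<psi> i \<in> alg_iso K ?S (A i)" using presentation[OF i] by (simp add: presents_def)
 then have h: "\<psi> i \<in> ring_hom ?S (A i)" and bij: "bij_betw (\<psi> i) (carrier ?S) (carrier (A i))"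
  and sm: "\<And>c x. c \<in> carrier K ==> x \<in> carrier ?S ==> \<psi> i (c \<odot>\<^bsub>?S\<^esub> x) = c \<odot>\<^bsub>A i\<^esub> \<psi> i x"
  by (auto simp: alg_iso_def ring_iso_def simp del: quot_simps)
 have 1: "algebra_hom K ?S (A i) (\<psi> i)"
 proof
  show "\<psi> i x \<in> carrier (A i)" if "x \<in> carrier ?S" for x by (rule ring_hom_closed[OF h that])
  show "\<psi> i (x \<oplus>\<^bsub>?S\<^esub> y) = \<psi> i x \<oplus>\<^bsub>A i\<^esub> \<psi> i y" if "x \<in> carrier ?S" "y \<in> carrier ?S" for x y
   by (rule ring_hom_add[OF h that])
  show "\<psi> i (c \<odot>\<^bsub>?S\<^esub> x) = c \<odot>\<^bsub>A i\<^esub> \<psi> i x" if "c \<in> carrier K" "x \<in> carrier ?S" for c x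
   by (rule sm[OF that])
  show "\<psi> i (x \<otimes>\<^bsub>?S\<^esub> y) = \<psi> i x \<otimes>\<^bsub>A i\<^esub> \<psi> i y" if "x \<in> carrier ?S" "y \<in> carrier ?S" for x y
   by (rule ring_hom_mult[OF h that])
  show "\<psi> i \<one>\<^bsub>?S\<^esub> = \<one>\<^bsub>A i\<^esub>" by (rule ring_hom_one[OF h])
 qed
 have pr: "pr i = (\<lambda>u. \<psi> i (I i +>\<^bsub>kq i\<^esub> u))" by (simp add: pres_map_def fun_eq_iff)
 show "algebra_hom K (kq i) (A i) (pr i)"
  unfolding pr by (rule algebra_hom_comp[OF q.algebra_hom_coset 1])
 show "pr i ` carrier (kq i) = carrier (A i)"
 proof
  show "pr i ` carrier (kq i) \<subseteq> carrier (A i)"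
   unfolding pr by (rule image_subsetI) (rule algebra_hom.hom_closed[OF 1 q.coset_closed])
  show "carrier (A i) \<subseteq> pr i ` carrier (kq i)"
  proof
   fix a assume "a \<in> carrier (A i)"
   then have "a \<in> \<psi> i ` carrier ?S" unfolding bij_betw_imp_surj_on[OF bij, symmetric] .
   then obtain X where X: "a = \<psi> i X" "X \<in> carrier ?S" by (rule imageE)
   from X(2) obtain u where u: "u \<in> carrier (kq i)" "X = I i +>\<^bsub>kq i\<^esub> u" by (rule q.quotE)
   show "a \<in> pr i ` carrier (kq i)" unfolding pr X(1) u(2) by (rule imageI[OF u(1)])
  qed
 qed
 show "pr i u = \<zero>\<^bsub>A i\<^esub> \<longleftrightarrow> u \<in> I i" if u: "u \<in> carrier (kq i)"
 proof -
  interpret h: algebra_hom K ?S "A i" "\<psi> i" by (rule 1)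
  have z: "\<psi> i \<zero>\<^bsub>?S\<^esub> = \<zero>\<^bsub>A i\<^esub>" by (rule h.zero)
  have "inj_on (\<psi> i) (carrier ?S)" using bij by (rule bij_betw_imp_inj_on)
  then have "pr i u = \<zero>\<^bsub>A i\<^esub> \<longleftrightarrow> I i +>\<^bsub>kq i\<^esub> u = \<zero>\<^bsub>?S\<^esub>"
   unfolding pr z[symmetric] using q.coset_closed[OF u] q.Q.M.zero_closed by (simp add: inj_on_eq_iff del: quot_simps)
  then show ?thesis using q.coset_zero_iff[OF u] by simp
 qed
qed

lemma I_subset: "u \<in> I i ==> u \<in> carrier (kq i)"
 using additive_subgroup.a_subset[OF ideal.axioms(1)[OF I_ideal]] by blast

lemma prE:
 assumes "a \<in> carrier (A i)" obtains u where "u \<in> carrier (kq i)" "a = pr i u"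
 using assms unfolding pr_surj[symmetric] by auto

lemma pr_closed: "u \<in> carrier (kq i) ==> pr i u \<in> carrier (A i)"
 by (rule algebra_hom.hom_closed[OF pr_hom])

lemma linear_pr: "linear_map K (kq i) (A i) (pr i)"
proof -
 interpret h: algebra_hom K "kq i" "A i" "pr i" by (rule pr_hom)
 show ?thesis by (rule h.linear_map_axioms)
qed

lemma pr_mult: "u \<in> carrier (kq i) ==> v \<in> carrier (kq i) ==> pr i (u \<otimes>\<^bsub>kq i\<^esub> v) = pr i u \<otimes>\<^bsub>A i\<^esub> pr i v"
 by (rule algebra_hom.hom_mult[OF pr_hom])

lemma vertex_in: "w \<in> verts (qt i) ==> path_vertex K w \<in> carrier (kq i)"
 by (rule finite_quiver.vertex_closed[OF qt_finite])

lemma idem_closed: "w \<in> verts (qt i) ==> idem i w \<in> carrier (A i)"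
 unfolding idem_eq by (rule pr_closed[OF vertex_in])

lemma idem_mult: "[|w \<in> verts (qt i); w' \<in> verts (qt i)|] ==>
  idem i w \<otimes>\<^bsub>A i\<^esub> idem i w' = (if w = w' then idem i w else \<zero>\<^bsub>A i\<^esub>)"
 unfolding idem_eq using pr_mult[OF vertex_in vertex_in, of w w'] finite_quiver.vertex_mult[OF qt_finite, of w w']
  linear_map.zero[OF linear_pr] by (auto simp del: path_algebra_simps)

end

context
 fixes e assumes e: "e \<in> arcs Q"
begin

lemma ends: "head Q e \<in> verts Q" "tail Q e \<in> verts Q"
 using e by auto

lemma cover_facts:
 shows cover_projective: "projective_cover K (A (head Q e)) (A (tail Q e)) (Cov e) (M e) (cmap e)"
  and new_ends: "g \<in> new e ==> nt e g \<in> verts (qt (tail Q e))"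
   "g \<in> new e ==> nh e g \<in> verts (qt (head Q e))"
  and decomposed: "decomposed_bimodule K (A (head Q e)) (A (tail Q e)) (Cov e) (new e)
   (\<lambda>g. idem (head Q e) (nh e g)) (\<lambda>g. idem (tail Q e) (nt e g)) (summand (C e))"
proof -
 note D = cover[OF e, unfolded decomposed_cover_def Let_def]
 show pc: "projective_cover K (A (head Q e)) (A (tail Q e)) (Cov e) (M e) (cmap e)"
  using D by blast
 show ne: "g \<in> new e ==> nt e g \<in> verts (qt (tail Q e))"
   "g \<in> new e ==> nh e g \<in> verts (qt (head Q e))" for g
  using D by blast+
 show "decomposed_bimodule K (A (head Q e)) (A (tail Q e)) (Cov e) (new e)
   (\<lambda>g. idem (head Q e) (nh e g)) (\<lambda>g. idem (tail Q e) (nt e g)) (summand (C e))"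
 proof (intro decomposed_bimodule.intro decomposed_bimodule_axioms.intro)
  show "bimodule K (A (head Q e)) (A (tail Q e)) (Cov e)"
   using pc by (simp add: projective_cover_def projective_bimodule_def)
 qed (use D ne idem_closed ends in blast)+
qed

lemma cover_hom:
 shows cover_hom_closed: "p \<in> carrier (Cov e) ==> cmap e p \<in> carrier (M e)"
  and cover_hom_add: "[|p \<in> carrier (Cov e); q \<in> carrier (Cov e)|] ==>
   cmap e (p \<oplus>\<^bsub>Cov e\<^esub> q) = cmap e p \<oplus>\<^bsub>M e\<^esub> cmap e q"
  and cover_hom_lact: "[|p \<in> carrier (Cov e); b \<in> carrier (A (head Q e))|] ==>
   cmap e (lact (Cov e) b p) = lact (M e) b (cmap e p)"
  and cover_hom_ract: "[|p \<in> carrier (Cov e); a \<in> carrier (A (tail Q e))|] ==>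
   cmap e (ract (Cov e) p a) = ract (M e) (cmap e p) a"
  and cover_surj: "cmap e ` carrier (Cov e) = carrier (M e)"
 using cover_projective unfolding projective_cover_def bimod_hom_def left_hom_def right_hom_def by auto

end

lemma AQ_simps:
 "verts AQ = (SIGMA i:verts Q. verts (qt i))"
 "arcs AQ = (SIGMA i:verts Q. arcs (qt i)) <+> (SIGMA e:arcs Q. new e)"
 "tail AQ (Inl (i, b)) = (i, tail (qt i) b)" "head AQ (Inl (i, b)) = (i, head (qt i) b)"
 "tail AQ (Inr (e, g)) = (tail Q e, nt e g)" "head AQ (Inr (e, g)) = (head Q e, nh e g)"
 by (simp_all add: assembled_quiver_def)

lemma AQ_finite: "fin_digraph AQ"
proof (intro fin_digraph.intro wf_digraph.intro fin_digraph_axioms.intro)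
 have fd: "fin_digraph (qt i)" if "i \<in> verts Q" for i
  using finite_quiver.axioms(1)[OF qt_finite[OF that]] .
 show "finite (verts AQ)" unfolding AQ_simps by (intro finite_SigmaI fin_digraph.finite_verts fd) auto
 have "finite (new e)" if "e \<in> arcs Q" for e
  by (rule decomposed_bimodule.finite_S[OF decomposed[OF that]])
 then show "finite (arcs AQ)" unfolding AQ_simps by (intro finite_Plus finite_SigmaI fin_digraph.finite_arcs fd) auto
 fix e assume e: "e \<in> arcs AQ"
 have wf: "wf_digraph (qt i)" if "i \<in> verts Q" for i using fd[OF that] by (rule fin_digraph.axioms(1))
 show "tail AQ e \<in> verts AQ" "head AQ e \<in> verts AQ"
  using e new_ends ends wf_digraph.tail_in_verts[OF wf] wf_digraph.head_in_verts[OF wf]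
  unfolding AQ_simps by (auto simp: AQ_simps)
qed

sublocale AQ: finite_quiver K AQ
 by (intro finite_quiver.intro AQ_finite base.field_axioms)

lemma arcs_Inl: "i \<in> verts Q ==> b \<in> arcs (qt i) ==> Inl (i, b) \<in> arcs AQ"
 and arcs_Inr: "e \<in> arcs Q ==> g \<in> new e ==> Inr (e, g) \<in> arcs AQ"
 by (auto simp: AQ_simps)

definition embed_path :: "'v => ('w, 'b) qpath => ('v \<times> 'w, 'v \<times> 'b + 'e \<times> 'g) qpath" where
 "embed_path i = (\<lambda>(w', p, w). ((i, w'), map (\<lambda>b. Inl (i, b)) p, (i, w)))"

lemma emb_single: "emb i (single K x) = single K (embed_path i x)"
 unfolding embed_def embed_path_def by (rule push_single[OF cring_K])

lemma emb_vertex: "emb i (path_vertex K w) = path_vertex K (i, w)"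
 unfolding path_vertex_def emb_single by (simp add: embed_path_def)

lemma emb_arrow: "emb i (path_arrow K (qt i) b) = path_arrow K AQ (Inl (i, b))"
 unfolding path_arrow_def emb_single by (simp add: embed_path_def AQ_simps)

lemma embed_path_in: assumes i: "i \<in> verts Q" shows "x \<in> qpaths (qt i) ==> embed_path i x \<in> qpaths AQ"
proof -
 interpret q: finite_quiver K "qt i" by (rule qt_finite[OF i])
 have "(w', p, w) \<in> qpaths (qt i) ==> embed_path i (w', p, w) \<in> qpaths AQ" for w' p w
  by (induction p arbitrary: w') (use i in "auto simp: embed_path_def AQ_simps")
 then show "x \<in> qpaths (qt i) ==> embed_path i x \<in> qpaths AQ" by (cases x) auto
qed

lemma linear_emb: "i \<in> verts Q ==> linear_map K (kq i) PA (emb i)"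
 unfolding linear_path_algebra_iff[OF cring_K] linear_path_algebra_range_iff[OF cring_K] embed_def
 by (rule linear_push[OF cring_K]) (use embed_path_in in "auto simp: embed_path_def")

lemma emb_closed: "i \<in> verts Q ==> u \<in> carrier (kq i) ==> emb i u \<in> carrier PA"
 by (rule linear_map.closed[OF linear_emb])

lemma emb_mult:
 assumes i: "i \<in> verts Q" and u: "u \<in> carrier (kq i)" and v: "v \<in> carrier (kq i)"
 shows "emb i (u \<otimes>\<^bsub>kq i\<^esub> v) = emb i u \<otimes>\<^bsub>PA\<^esub> emb i v"
proof -
 interpret q: finite_quiver K "qt i" by (rule qt_finite[OF i])
 note L = q.kQ.linear_mult_left and R = q.kQ.linear_mult_right and C = linear_map_comp and em = linear_emb[OF i]
 show ?thesis
 proof (rule path_bilinear_ext[where f = "\<lambda>u v. emb i (u \<otimes>\<^bsub>kq i\<^esub> v)" and g = "\<lambda>u v. emb i u \<otimes>\<^bsub>PA\<^esub> emb i v",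
    OF q.finite_quiver_axioms q.finite_quiver_axioms C[OF L em] C[OF em AQ.kQ.linear_mult_left[OF emb_closed[OF i]]]
    C[OF R em] C[OF em AQ.kQ.linear_mult_right[OF emb_closed[OF i]]] _ u v])
  fix x y :: "('w, 'b) qpath"
  show "emb i (single K x \<otimes>\<^bsub>kq i\<^esub> single K y) = emb i (single K x) \<otimes>\<^bsub>PA\<^esub> emb i (single K y)"
   unfolding q.mult_paths emb_single AQ.mult_paths
   using linear_map.zero[OF em] by (cases x; cases y) (auto simp: embed_path_def emb_single simp del: path_algebra_simps)
 qed
qed

lemma emb_orthogonal:
 assumes i: "i \<in> verts Q" and j: "j \<in> verts Q" and ij: "i \<noteq> j" and u: "u \<in> carrier (kq i)" and v: "v \<in> carrier (kq j)"
 shows "emb i u \<otimes>\<^bsub>PA\<^esub> emb j v = \<zero>\<^bsub>PA\<^esub>"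
proof -
 interpret q: finite_quiver K "qt i" by (rule qt_finite[OF i])
 interpret q': finite_quiver K "qt j" by (rule qt_finite[OF j])
 note C = linear_map_comp
 show ?thesis
 proof (rule path_bilinear_ext[where f = "\<lambda>u v. emb i u \<otimes>\<^bsub>PA\<^esub> emb j v" and g = "\<lambda>u v. \<zero>\<^bsub>PA\<^esub>",
    OF q.finite_quiver_axioms q'.finite_quiver_axioms C[OF linear_emb[OF i] AQ.kQ.linear_mult_left[OF emb_closed[OF j]]]
    linear_zero[OF q.kQ.vec.module_axioms AQ.kQ.vec.module_axioms]
    C[OF linear_emb[OF j] AQ.kQ.linear_mult_right[OF emb_closed[OF i]]]
    linear_zero[OF q'.kQ.vec.module_axioms AQ.kQ.vec.module_axioms] _ u v])
  fix x y :: "('w, 'b) qpath"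
  show "emb i (single K x) \<otimes>\<^bsub>PA\<^esub> emb j (single K y) = \<zero>\<^bsub>PA\<^esub>"
   unfolding emb_single AQ.mult_paths using ij by (cases x; cases y) (auto simp: embed_path_def)
 qed
qed

lemma emb_arrow_unit:
 assumes a: "e \<in> arcs Q" "g \<in> new e"
 shows "emb (head Q e) (path_vertex K (nh e g)) \<otimes>\<^bsub>PA\<^esub> path_arrow K AQ (Inr (e, g)) = path_arrow K AQ (Inr (e, g))"
  "path_arrow K AQ (Inr (e, g)) \<otimes>\<^bsub>PA\<^esub> emb (tail Q e) (path_vertex K (nt e g)) = path_arrow K AQ (Inr (e, g))"
 using AQ.vertex_arrow[of "Inr (e, g)"] unfolding emb_vertex AQ_simps by auto

lemma new_arrow_closed: "e \<in> arcs Q ==> g \<in> new e ==> path_arrow K AQ (Inr (e, g)) \<in> carrier PA"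
 by (rule AQ.arrow_closed[OF arcs_Inr])

text \<open>The elements of the cover and of the path algebra with \<open>u\<close> and \<open>v\<close> on either side of the new arrow \<open>g\<close>. The
 former generate the cover additively, and the latter lift them.\<close>

definition cover_atom :: "'e => 'g => (('w, 'b) qpath => 'k) => (('w, 'b) qpath => 'k) => 'p" where
 "cover_atom e g u v = summand (C e) g (elementary_tensor K (A (head Q e)) (A (tail Q e))
   (idem (head Q e) (nh e g)) (idem (tail Q e) (nt e g))
   (pr (head Q e) u \<otimes>\<^bsub>A (head Q e)\<^esub> idem (head Q e) (nh e g))
   (idem (tail Q e) (nt e g) \<otimes>\<^bsub>A (tail Q e)\<^esub> pr (tail Q e) v))"

definition path_atom :: "'e => 'g => (('w, 'b) qpath => 'k) => (('w, 'b) qpath => 'k) =>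
  ('v \<times> 'w, 'v \<times> 'b + 'e \<times> 'g) qpath => 'k" where
 "path_atom e g u v = emb (head Q e) u \<otimes>\<^bsub>PA\<^esub> path_arrow K AQ (Inr (e, g)) \<otimes>\<^bsub>PA\<^esub> emb (tail Q e) v"

lemma path_atom_closed: "[|e \<in> arcs Q; g \<in> new e; u \<in> carrier (kq (head Q e)); v \<in> carrier (kq (tail Q e))|] ==>
  path_atom e g u v \<in> carrier PA"
 unfolding path_atom_def by (intro AQ.kQ.alg.m_closed emb_closed new_arrow_closed) auto

context
 fixes e assumes e: "e \<in> arcs Q"
begin

abbreviation "Pe == cover_bimod (C e)"
abbreviation "hde == head Q e"
abbreviation "tle == tail Q e"

interpretation D: decomposed_bimodule K "A hde" "A tle" Pe "new e"
   "\<lambda>g. idem hde (nh e g)" "\<lambda>g. idem tle (nt e g)" "summand (C e)"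
 by (rule decomposed[OF e])

lemma cover_atom_lact:
 assumes g: "g \<in> new e" and u: "u \<in> carrier (kq hde)" and v: "v \<in> carrier (kq tle)" and b: "b \<in> carrier (kq hde)"
 shows "lact Pe (pr hde b) (cover_atom e g u v) = cover_atom e g (b \<otimes>\<^bsub>kq hde\<^esub> u) v"
  and "cover_atom e g u v \<in> carrier Pe"
proof -
 interpret E: elementary K "A hde" "A tle" "idem hde (nh e g)" "idem tle (nt e g)"
  by (rule D.elementary_at[OF g])
 note pc = pr_closed[OF ends(1)[OF e]] pr_closed[OF ends(2)[OF e]]
 have x: "pr hde u \<otimes>\<^bsub>A hde\<^esub> idem hde (nh e g) \<in> E.Be" using pc(1)[OF u] by (auto simp: E.Be_def)
 have y: "idem tle (nt e g) \<otimes>\<^bsub>A tle\<^esub> pr tle v \<in> E.eA" using pc(2)[OF v] by (auto simp: E.eA_def)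
 show "cover_atom e g u v \<in> carrier Pe" unfolding cover_atom_def by (rule D.s_closed[OF g E.et_closed[OF x y]])
 show "lact Pe (pr hde b) (cover_atom e g u v) = cover_atom e g (b \<otimes>\<^bsub>kq hde\<^esub> u) v"
  unfolding cover_atom_def D.s_lact[OF g E.et_closed[OF x y] pc(1)[OF b], symmetric] E.lact_et[OF pc(1)[OF b] x y]
  using pc(1)[OF b] pc(1)[OF u] E.e by (simp add: pr_mult[OF ends(1)[OF e] b u] D.P.left.alg.m_assoc del: path_algebra_simps)
qed

lemma cover_atom_ract:
 assumes g: "g \<in> new e" and u: "u \<in> carrier (kq hde)" and v: "v \<in> carrier (kq tle)" and a: "a \<in> carrier (kq tle)"
 shows "ract Pe (cover_atom e g u v) (pr tle a) = cover_atom e g u (v \<otimes>\<^bsub>kq tle\<^esub> a)"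
proof -
 interpret E: elementary K "A hde" "A tle" "idem hde (nh e g)" "idem tle (nt e g)"
  by (rule D.elementary_at[OF g])
 note pc = pr_closed[OF ends(1)[OF e]] pr_closed[OF ends(2)[OF e]]
 have x: "pr hde u \<otimes>\<^bsub>A hde\<^esub> idem hde (nh e g) \<in> E.Be" using pc(1)[OF u] by (auto simp: E.Be_def)
 have y: "idem tle (nt e g) \<otimes>\<^bsub>A tle\<^esub> pr tle v \<in> E.eA" using pc(2)[OF v] by (auto simp: E.eA_def)
 show "ract Pe (cover_atom e g u v) (pr tle a) = cover_atom e g u (v \<otimes>\<^bsub>kq tle\<^esub> a)"
  unfolding cover_atom_def D.s_ract[OF g E.et_closed[OF x y] pc(2)[OF a], symmetric] E.ract_et[OF pc(2)[OF a] x y]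
  using pc(2)[OF a] pc(2)[OF v] E.e' by (simp add: pr_mult[OF ends(2)[OF e] v a] D.P.right.alg.m_assoc del: path_algebra_simps)
qed

lemma cover_induct [consumes 1, case_names zero atom add]:
 assumes p: "p \<in> carrier Pe" and z: "R \<zero>\<^bsub>Pe\<^esub>"
  and t: "\<And>g u v. [|g \<in> new e; u \<in> carrier (kq hde); v \<in> carrier (kq tle)|] ==> R (cover_atom e g u v)"
  and ad: "\<And>p q. [|p \<in> carrier Pe; q \<in> carrier Pe; R p; R q|] ==> R (p \<oplus>\<^bsub>Pe\<^esub> q)"
 shows "R p"
proof (rule D.decomposed_induct[OF p z _ ad])
 fix g b a assume g: "g \<in> new e" and b: "b \<in> carrier (A hde)" and a: "a \<in> carrier (A tle)"
 obtain u where u: "u \<in> carrier (kq hde)" "b = pr hde u" using b by (rule prE[OF ends(1)[OF e]])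
 obtain v where v: "v \<in> carrier (kq tle)" "a = pr tle v" using a by (rule prE[OF ends(2)[OF e]])
 show "R (summand (C e) g (D.tens g (b \<otimes>\<^bsub>A hde\<^esub> idem hde (nh e g)) (idem tle (nt e g) \<otimes>\<^bsub>A tle\<^esub> a)))"
  using t[OF g u(1) v(1)] unfolding u(2) v(2) cover_atom_def .
qed

text \<open>This is the generator of the summand \<open>g\<close>, to which the canonical map sends the new arrow \<open>g\<close>.\<close>

lemma cover_atom_vertex:
 assumes g: "g \<in> new e"
 shows "summand (C e) g (elementary_tensor K (A hde) (A tle)
   (idem hde (nh e g)) (idem tle (nt e g)) (idem hde (nh e g)) (idem tle (nt e g)))
   = cover_atom e g (path_vertex K (nh e g)) (path_vertex K (nt e g))"
 unfolding cover_atom_def idem_eq[symmetric]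
 using idem_mult[OF ends(1)[OF e] new_ends(2)[OF e g] new_ends(2)[OF e g]]
  idem_mult[OF ends(2)[OF e] new_ends(1)[OF e g] new_ends(1)[OF e g]] by simp

lemma vertex_mult_path_atom:
 assumes g: "g \<in> new e"
 shows "path_atom e g (path_vertex K (nh e g)) (path_vertex K (nt e g)) = path_arrow K AQ (Inr (e, g))"
 unfolding path_atom_def emb_arrow_unit[OF e g] ..

end

end

lemma (in abelian_monoid) additive_finsum:
 assumes "\<And>x. x \<in> B ==> g x \<in> carrier G" "abelian_monoid H"
  and "\<And>x. x \<in> carrier G ==> h x \<in> carrier H" "h \<zero>\<^bsub>G\<^esub> = \<zero>\<^bsub>H\<^esub>"
  and "\<And>x y. x \<in> carrier G ==> y \<in> carrier G ==> h (x \<oplus>\<^bsub>G\<^esub> y) = h x \<oplus>\<^bsub>H\<^esub> h y"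
 shows "h (\<Oplus>\<^bsub>G\<^esub>x\<in>B. g x) = (\<Oplus>\<^bsub>H\<^esub>x\<in>B. h (g x))"
proof -
 interpret H: abelian_monoid H by fact
 show ?thesis using assms(1)
 proof (induction B rule: infinite_finite_induct)
  case (insert x F)
  have "h (\<Oplus>\<^bsub>G\<^esub>y\<in>insert x F. g y) = h (g x \<oplus>\<^bsub>G\<^esub> (\<Oplus>\<^bsub>G\<^esub>y\<in>F. g y))"
   using insert by (subst finsum_insert) auto
  also have "... = h (g x) \<oplus>\<^bsub>H\<^esub> h (\<Oplus>\<^bsub>G\<^esub>y\<in>F. g y)" using insert by (intro assms(5) finsum_closed) auto
  also have "... = (\<Oplus>\<^bsub>H\<^esub>y\<in>insert x F. h (g y))" using insert assms(3) by (subst H.finsum_insert) auto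
  finally show ?case .
 qed (simp_all add: assms(4))
qed

context presented_species
begin

lemma lifts_cover_elementE:
 assumes "lifts_cover_element K Q A qt I \<psi> C e r x"
 obtains n g u v where "x \<in> carrier PA"
  "\<And>k. k < n ==> g k \<in> new e" "\<And>k. k < n ==> u k \<in> carrier (kq (head Q e))" "\<And>k. k < n ==> v k \<in> carrier (kq (tail Q e))"
  "r = (\<Oplus>\<^bsub>Cov e\<^esub>k\<in>{..<n::nat}. cover_atom e (g k) (u k) (v k))"
  "x \<ominus>\<^bsub>PA\<^esub> (\<Oplus>\<^bsub>PA\<^esub>k\<in>{..<n}. path_atom e (g k) (u k) (v k)) \<in> Idl\<^bsub>PA\<^esub> (vertex_relations K Q I)"
 using assms unfolding lifts_cover_element_def Let_def cover_atom_def path_atom_def by blast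

lemma kq_closed:
 assumes i: "i \<in> verts Q" and u: "u \<in> carrier (kq i)"
 shows "v \<in> carrier (kq i) ==> u \<oplus>\<^bsub>kq i\<^esub> v \<in> carrier (kq i)"
  and "v \<in> carrier (kq i) ==> u \<otimes>\<^bsub>kq i\<^esub> v \<in> carrier (kq i)"
  and "c \<in> carrier K ==> c \<odot>\<^bsub>kq i\<^esub> u \<in> carrier (kq i)"
  and "v \<in> carrier (kq i) ==> u \<ominus>\<^bsub>kq i\<^esub> v \<in> carrier (kq i)"
proof -
 interpret q: finite_quiver K "qt i" by (rule qt_finite[OF i])
 interpret m: Module.module K "kq i" by (rule q.kQ.vec.module_axioms)
 show "v \<in> carrier (kq i) ==> u \<oplus>\<^bsub>kq i\<^esub> v \<in> carrier (kq i)"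
  "v \<in> carrier (kq i) ==> u \<otimes>\<^bsub>kq i\<^esub> v \<in> carrier (kq i)"
  "v \<in> carrier (kq i) ==> u \<ominus>\<^bsub>kq i\<^esub> v \<in> carrier (kq i)"
  using u by (simp_all del: path_algebra_simps)
 show "c \<in> carrier K ==> c \<odot>\<^bsub>kq i\<^esub> u \<in> carrier (kq i)"
  using module.smult_closed[OF q.kQ.vec.module_axioms _ u] .
qed

lemma linear_cover_map:
 assumes e: "e \<in> arcs Q"
 shows "linear_map K (Cov e) (M e) (cmap e)"
proof -
 interpret Mb: bimodule K "A (head Q e)" "A (tail Q e)" "M e" by (rule bimodule_at[OF e])
 interpret P: bimodule K "A (head Q e)" "A (tail Q e)" "Cov e"
  by (rule decomposed_bimodule.axioms(1)[OF decomposed[OF e]])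
 have one: "\<one>\<^bsub>A (head Q e)\<^esub> \<in> carrier (A (head Q e))" by (rule A_closed(2)[OF ends(1)[OF e]])
 show ?thesis
 proof (intro linear_map.intro linear_map_axioms.intro P.vec.module_axioms Mb.vec.module_axioms
   cover_hom_closed[OF e] cover_hom_add[OF e])
  fix c p assume c: "c \<in> carrier K" and p: "p \<in> carrier (Cov e)"
  have a: "c \<odot>\<^bsub>A (head Q e)\<^esub> \<one>\<^bsub>A (head Q e)\<^esub> \<in> carrier (A (head Q e))"
   by (rule module.smult_closed[OF module_A[OF ends(1)[OF e]] c one])
  show "cmap e (c \<odot>\<^bsub>Cov e\<^esub> p) = c \<odot>\<^bsub>M e\<^esub> cmap e p"
   using cover_hom_lact[OF e p a]
   unfolding P.lact_smult[OF c one p] P.lact_one[OF p]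
    Mb.lact_smult[OF c one cover_hom_closed[OF e p]] Mb.lact_one[OF cover_hom_closed[OF e p]] .
 qed
qed

section \<open>Classes of lifts modulo an ideal\<close>

text \<open>Modulo an ideal \<open>J\<close> that contains the relations at the vertices, an element of \<open>A i\<close> has a well defined class, that of
 any representative in the path algebra at \<open>i\<close>. The same holds for an element of a cover: the class of a lift depends
 on the element alone.\<close>

context
 fixes J :: "(('v \<times> 'w, 'v \<times> 'b + 'e \<times> 'g) qpath => 'k) set"
 assumes J: "ideal J PA" and above: "vertex_relations K Q I \<subseteq> J"
begin

interpretation JQ: quotient_algebra K PA J
 by (intro quotient_algebra.intro quotient_algebra_axioms.intro AQ.kQ.assoc_algebra_axioms J)

interpretation q: algebra_hom K PA "quot PA J" "\<lambda>x. J +>\<^bsub>PA\<^esub> x"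
 by (rule JQ.algebra_hom_coset)

abbreviation "BJ == quot PA J"
abbreviation "clJ == (\<lambda>x. J +>\<^bsub>PA\<^esub> x)"

definition vertex_class :: "'v => 'a => (('v \<times> 'w, 'v \<times> 'b + 'e \<times> 'g) qpath => 'k) set" where
 "vertex_class i a = clJ (emb i (SOME u. u \<in> carrier (kq i) \<and> pr i u = a))"

lemma vertex_class_pr:
 assumes i: "i \<in> verts Q" and u: "u \<in> carrier (kq i)"
 shows "vertex_class i (pr i u) = clJ (emb i u)"
proof -
 interpret h: algebra_hom K "kq i" "A i" "pr i" by (rule pr_hom[OF i])
 let ?u = "SOME v. v \<in> carrier (kq i) \<and> pr i v = pr i u"
 have v: "?u \<in> carrier (kq i) \<and> pr i ?u = pr i u" by (rule someI[of _ u]) (use u in auto)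
 have u': "?u \<in> carrier (kq i)" and eq: "pr i ?u = pr i u" using v by blast+
 have "pr i (?u \<ominus>\<^bsub>kq i\<^esub> u) = \<zero>\<^bsub>A i\<^esub>"
  unfolding h.minus[OF u' u] eq by (rule module.minus_self[OF module_A[OF i] h.hom_closed[OF u]])
 then have "?u \<ominus>\<^bsub>kq i\<^esub> u \<in> I i" unfolding pr_kernel[OF i kq_closed(4)[OF i u' u]] .
 then have "emb i ?u \<ominus>\<^bsub>PA\<^esub> emb i u \<in> J"
  unfolding linear_map.minus[OF linear_emb[OF i] u' u, symmetric] using above i by (auto simp: vertex_relations_def)
 then show ?thesis unfolding vertex_class_def using v u emb_closed[OF i] by (subst JQ.coset_eq_iff) auto
qed

lemma linear_vertex_class: assumes i: "i \<in> verts Q" shows "linear_map K (A i) BJ (vertex_class i)"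
proof -
 interpret h: algebra_hom K "kq i" "A i" "pr i" by (rule pr_hom[OF i])
 interpret ev: linear_map K "kq i" PA "emb i" by (rule linear_emb[OF i])
 show ?thesis
 proof
  fix a assume "a \<in> carrier (A i)"
  then obtain u where u: "u \<in> carrier (kq i)" "a = pr i u" by (rule prE[OF i])
  show "vertex_class i a \<in> carrier BJ" unfolding u(2) vertex_class_pr[OF i u(1)] by (rule q.hom_closed[OF ev.closed[OF u(1)]])
  show "vertex_class i (c \<odot>\<^bsub>A i\<^esub> a) = c \<odot>\<^bsub>BJ\<^esub> vertex_class i a" if c: "c \<in> carrier K" for c
   unfolding u(2) vertex_class_pr[OF i u(1)] h.hom_smult[OF c u(1), symmetric] vertex_class_pr[OF i kq_closed(3)[OF i u(1) c]]
    ev.smult[OF c u(1)] by (rule q.hom_smult[OF c ev.closed[OF u(1)]])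
  fix b assume "b \<in> carrier (A i)"
  then obtain v where v: "v \<in> carrier (kq i)" "b = pr i v" by (rule prE[OF i])
  show "vertex_class i (a \<oplus>\<^bsub>A i\<^esub> b) = vertex_class i a \<oplus>\<^bsub>BJ\<^esub> vertex_class i b"
   unfolding u(2) v(2) vertex_class_pr[OF i u(1)] vertex_class_pr[OF i v(1)] h.hom_add[OF u(1) v(1), symmetric]
    vertex_class_pr[OF i kq_closed(1)[OF i u(1) v(1)]] ev.add[OF u(1) v(1)] by (rule q.hom_add[OF ev.closed[OF u(1)] ev.closed[OF v(1)]])
 qed
qed

lemma vertex_class_mult:
 assumes i: "i \<in> verts Q" and j: "j \<in> verts Q" and a: "a \<in> carrier (A i)" and b: "b \<in> carrier (A j)"
 shows "vertex_class i a \<otimes>\<^bsub>BJ\<^esub> vertex_class j b = (if i = j then vertex_class i (a \<otimes>\<^bsub>A i\<^esub> b) else \<zero>\<^bsub>BJ\<^esub>)"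
proof -
 obtain u where u: "u \<in> carrier (kq i)" "a = pr i u" using a by (rule prE[OF i])
 obtain v where v: "v \<in> carrier (kq j)" "b = pr j v" using b by (rule prE[OF j])
 have eq: "vertex_class i a \<otimes>\<^bsub>BJ\<^esub> vertex_class j b = clJ (emb i u \<otimes>\<^bsub>PA\<^esub> emb j v)"
  unfolding u(2) v(2) vertex_class_pr[OF i u(1)] vertex_class_pr[OF j v(1)]
  by (rule q.hom_mult[symmetric, OF emb_closed[OF i u(1)] emb_closed[OF j v(1)]])
 show ?thesis
 proof (cases "i = j")
  case True
  interpret h: algebra_hom K "kq i" "A i" "pr i" by (rule pr_hom[OF i])
  have v': "v \<in> carrier (kq i)" "b = pr i v" using v True by auto
  have "vertex_class i (a \<otimes>\<^bsub>A i\<^esub> b) = clJ (emb i u \<otimes>\<^bsub>PA\<^esub> emb i v)"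
   unfolding u(2) v'(2) h.hom_mult[OF u(1) v'(1), symmetric] vertex_class_pr[OF i kq_closed(2)[OF i u(1) v'(1)]]
    emb_mult[OF i u(1) v'(1)] ..
  then show ?thesis using eq True by simp
 next
  case False
  then show ?thesis unfolding eq emb_orthogonal[OF i j False u(1) v(1)] q.zero by simp
 qed
qed

lemma vertex_class_closed: "i \<in> verts Q ==> a \<in> carrier (A i) ==> vertex_class i a \<in> carrier BJ"
 by (rule linear_map.closed[OF linear_vertex_class])

context
 fixes e assumes e: "e \<in> arcs Q"
begin

abbreviation "he == head Q e"
abbreviation "te == tail Q e"

interpretation D: decomposed_bimodule K "A he" "A te" "Cov e" "new e"
   "\<lambda>g. idem he (nh e g)" "\<lambda>g. idem te (nt e g)" "summand (C e)"
 by (rule decomposed[OF e])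

definition cover_class_summand :: "'g => 'a list => (('v \<times> 'w, 'v \<times> 'b + 'e \<times> 'g) qpath => 'k) set" where
 "cover_class_summand g xs = vertex_class he (xs ! 0) \<otimes>\<^bsub>BJ\<^esub> clJ (path_arrow K AQ (Inr (e, g))) \<otimes>\<^bsub>BJ\<^esub> vertex_class te (xs ! 1)"

lemma cover_class_summand_lift:
 assumes g: "g \<in> new e"
 shows "linear_map K (D.El g) BJ (coset_lift (lin K BJ (cover_class_summand g)))"
  and "\<And>u v. u \<in> carrier (kq he) ==> v \<in> carrier (kq te) ==>
   coset_lift (lin K BJ (cover_class_summand g)) (D.tens g (pr he u \<otimes>\<^bsub>A he\<^esub> idem he (nh e g))
    (idem te (nt e g) \<otimes>\<^bsub>A te\<^esub> pr te v)) = clJ (path_atom e g u v)"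
proof -
 interpret E: elementary K "A he" "A te" "idem he (nh e g)" "idem te (nt e g)"
  by (rule D.elementary_at[OF g])
 note ev = ends[OF e]
 interpret th: linear_map K "A he" BJ "vertex_class he" by (rule linear_vertex_class[OF ev(1)])
 interpret tt: linear_map K "A te" BJ "vertex_class te" by (rule linear_vertex_class[OF ev(2)])
 let ?a = "path_arrow K AQ (Inr (e, g))"
 have aP: "?a \<in> carrier PA" by (rule new_arrow_closed[OF e g])
 have ac: "clJ ?a \<in> carrier BJ" by (rule q.hom_closed[OF aP])
 have m: "multilinear K E.Vs BJ (cover_class_summand g)"
  by (rule E.multilinear_VsI[OF JQ.Q.module_axioms])
   (simp_all add: cover_class_summand_def E.Be_subset E.eA_subset ac th.add tt.add th.smult tt.smult
    JQ.Q.alg.l_distr JQ.Q.alg.r_distr JQ.Q.smult_mult_left JQ.Q.smult_mult_right del: quot_simps path_algebra_simps)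
 show "linear_map K (D.El g) BJ (coset_lift (lin K BJ (cover_class_summand g)))"
  by (rule E.elementary_lift(1)[OF JQ.Q.module_axioms m])
 fix u v assume u: "u \<in> carrier (kq he)" and v: "v \<in> carrier (kq te)"
 note pc = pr_closed[OF ev(1) u] pr_closed[OF ev(2) v]
 have x: "pr he u \<otimes>\<^bsub>A he\<^esub> idem he (nh e g) \<in> E.Be" using pc(1) by (auto simp: E.Be_def)
 have y: "idem te (nt e g) \<otimes>\<^bsub>A te\<^esub> pr te v \<in> E.eA" using pc(2) by (auto simp: E.eA_def)
 let ?vh = "path_vertex K (nh e g)" and ?vt = "path_vertex K (nt e g)"
 have vv: "?vh \<in> carrier (kq he)" "?vt \<in> carrier (kq te)"
  by (rule vertex_in[OF ev(1) new_ends(2)[OF e g]], rule vertex_in[OF ev(2) new_ends(1)[OF e g]])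
 note ec = emb_closed[OF ev(1) u] emb_closed[OF ev(2) v] emb_closed[OF ev(1) vv(1)] emb_closed[OF ev(2) vv(2)]
 note P = AQ.kQ.alg.m_closed AQ.kQ.alg.m_assoc
 have th: "vertex_class he (pr he u \<otimes>\<^bsub>A he\<^esub> idem he (nh e g)) = clJ (emb he u \<otimes>\<^bsub>PA\<^esub> emb he ?vh)"
  unfolding idem_eq vertex_class_mult[OF ev(1) ev(1) pc(1) pr_closed[OF ev(1) vv(1)], unfolded simp_thms if_True, symmetric]
   vertex_class_pr[OF ev(1) u] vertex_class_pr[OF ev(1) vv(1)] by (rule q.hom_mult[OF ec(1,3), symmetric])
 have tt: "vertex_class te (idem te (nt e g) \<otimes>\<^bsub>A te\<^esub> pr te v) = clJ (emb te ?vt \<otimes>\<^bsub>PA\<^esub> emb te v)"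
  unfolding idem_eq vertex_class_mult[OF ev(2) ev(2) pr_closed[OF ev(2) vv(2)] pc(2), unfolded simp_thms if_True, symmetric]
   vertex_class_pr[OF ev(2) v] vertex_class_pr[OF ev(2) vv(2)] by (rule q.hom_mult[OF ec(4,2), symmetric])
 have "path_atom e g u v = (emb he u \<otimes>\<^bsub>PA\<^esub> emb he ?vh) \<otimes>\<^bsub>PA\<^esub> ?a \<otimes>\<^bsub>PA\<^esub> (emb te ?vt \<otimes>\<^bsub>PA\<^esub> emb te v)"
 proof -
  have "emb he u \<otimes>\<^bsub>PA\<^esub> (emb he ?vh \<otimes>\<^bsub>PA\<^esub> ?a \<otimes>\<^bsub>PA\<^esub> emb te ?vt) \<otimes>\<^bsub>PA\<^esub> emb te v
   = (emb he u \<otimes>\<^bsub>PA\<^esub> emb he ?vh) \<otimes>\<^bsub>PA\<^esub> ?a \<otimes>\<^bsub>PA\<^esub> (emb te ?vt \<otimes>\<^bsub>PA\<^esub> emb te v)"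
   using ec aP by (simp only: P)
  then show ?thesis unfolding path_atom_def emb_arrow_unit[OF e g] .
 qed
 then have "clJ (path_atom e g u v) = clJ (emb he u \<otimes>\<^bsub>PA\<^esub> emb he ?vh) \<otimes>\<^bsub>BJ\<^esub> clJ ?a \<otimes>\<^bsub>BJ\<^esub> clJ (emb te ?vt \<otimes>\<^bsub>PA\<^esub> emb te v)"
  using ec aP by (simp only: q.hom_mult AQ.kQ.alg.m_closed)
 also have "... = cover_class_summand g [pr he u \<otimes>\<^bsub>A he\<^esub> idem he (nh e g), idem te (nt e g) \<otimes>\<^bsub>A te\<^esub> pr te v]"
  unfolding cover_class_summand_def by (simp add: th tt del: quot_simps path_algebra_simps)
 finally show "coset_lift (lin K BJ (cover_class_summand g)) (D.tens g (pr he u \<otimes>\<^bsub>A he\<^esub> idem he (nh e g))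
    (idem te (nt e g) \<otimes>\<^bsub>A te\<^esub> pr te v)) = clJ (path_atom e g u v)"
  using E.elementary_lift(2)[OF JQ.Q.module_axioms m x y] by simp
qed

text \<open>On the summand \<open>g\<close> the class of \<open>b \<otimes> a\<close> is the product of the classes of \<open>b\<close>, of the arrow \<open>g\<close> and of \<open>a\<close>;
 an element of the cover is the sum of its components.\<close>

definition cover_class :: "'p => (('v \<times> 'w, 'v \<times> 'b + 'e \<times> 'g) qpath => 'k) set" where
 "cover_class p = (\<Oplus>\<^bsub>BJ\<^esub>g\<in>new e. coset_lift (lin K BJ (cover_class_summand g)) (D.comps p g))"

lemma comps_in: "p \<in> carrier (Cov e) ==> g \<in> new e ==> D.comps p g \<in> carrier (D.El g)"
 using D.comps(1) by (auto simp: PiE_mem)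

lemma cover_class_term_closed: "p \<in> carrier (Cov e) ==> g \<in> new e ==>
  coset_lift (lin K BJ (cover_class_summand g)) (D.comps p g) \<in> carrier BJ"
 by (rule linear_map.closed[OF cover_class_summand_lift(1) comps_in])

lemma cover_class_closed: "p \<in> carrier (Cov e) ==> cover_class p \<in> carrier BJ"
 unfolding cover_class_def by (rule JQ.Q.M.finsum_closed) (use cover_class_term_closed in auto)

lemma cover_class_add:
 assumes p: "p \<in> carrier (Cov e)" and r: "r \<in> carrier (Cov e)"
 shows "cover_class (p \<oplus>\<^bsub>Cov e\<^esub> r) = cover_class p \<oplus>\<^bsub>BJ\<^esub> cover_class r"
proof -
 have "cover_class (p \<oplus>\<^bsub>Cov e\<^esub> r) = (\<Oplus>\<^bsub>BJ\<^esub>g\<in>new e. coset_lift (lin K BJ (cover_class_summand g)) (D.comps p g) \<oplus>\<^bsub>BJ\<^esub>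
   coset_lift (lin K BJ (cover_class_summand g)) (D.comps r g))"
  unfolding cover_class_def D.comps_add[OF p r]
  by (rule JQ.Q.M.finsum_cong')
   (use linear_map.add[OF cover_class_summand_lift(1) comps_in[OF p] comps_in[OF r]] cover_class_term_closed[OF p] cover_class_term_closed[OF r] in
    \<open>auto simp del: quot_simps\<close>)
 also have "... = cover_class p \<oplus>\<^bsub>BJ\<^esub> cover_class r" unfolding cover_class_def
  by (rule JQ.Q.M.finsum_addf) (use cover_class_term_closed[OF p] cover_class_term_closed[OF r] in "auto simp del: quot_simps")
 finally show ?thesis .
qed

lemma cover_class_zero: "cover_class \<zero>\<^bsub>Cov e\<^esub> = \<zero>\<^bsub>BJ\<^esub>"
proof -
 have z: "\<zero>\<^bsub>Cov e\<^esub> \<in> carrier (Cov e)" by (rule D.P.vec.M.zero_closed)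
 have "cover_class \<zero>\<^bsub>Cov e\<^esub> \<oplus>\<^bsub>BJ\<^esub> cover_class \<zero>\<^bsub>Cov e\<^esub> = cover_class \<zero>\<^bsub>Cov e\<^esub>"
  using cover_class_add[OF z z] by simp
 then show ?thesis using cover_class_closed[OF z] JQ.Q.M.add.l_cancel_one by (simp del: quot_simps)
qed

lemma cover_class_atom:
 assumes g: "g \<in> new e" and u: "u \<in> carrier (kq he)" and v: "v \<in> carrier (kq te)"
 shows "cover_class (cover_atom e g u v) = clJ (path_atom e g u v)"
proof -
 interpret E: elementary K "A he" "A te" "idem he (nh e g)" "idem te (nt e g)"
  by (rule D.elementary_at[OF g])
 note ev = ends[OF e]
 note pc = pr_closed[OF ev(1) u] pr_closed[OF ev(2) v]
 let ?x = "D.tens g (pr he u \<otimes>\<^bsub>A he\<^esub> idem he (nh e g)) (idem te (nt e g) \<otimes>\<^bsub>A te\<^esub> pr te v)"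
 have x: "?x \<in> carrier (D.El g)"
  by (rule E.et_closed) (use pc in "auto simp: E.Be_def E.eA_def")
 have "cover_class (cover_atom e g u v) = (\<Oplus>\<^bsub>BJ\<^esub>\<delta>\<in>new e. if g = \<delta> then clJ (path_atom e g u v) else \<zero>\<^bsub>BJ\<^esub>)"
  unfolding cover_class_def cover_atom_def D.comps_summand[OF g x]
  by (rule JQ.Q.M.finsum_cong')
   (use cover_class_summand_lift(2)[OF g u v] linear_map.zero[OF cover_class_summand_lift(1)] q.hom_closed[OF path_atom_closed[OF e g u v]] in
    \<open>auto simp del: quot_simps path_algebra_simps\<close>)
 also have "... = clJ (path_atom e g u v)"
  using g D.finite_S q.hom_closed[OF path_atom_closed[OF e g u v]] by (intro JQ.Q.M.finsum_singleton) auto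
 finally show ?thesis .
qed

lemma cover_class_lact:
 assumes p: "p \<in> carrier (Cov e)" and b: "b \<in> carrier (A he)"
 shows "cover_class (lact (Cov e) b p) = vertex_class he b \<otimes>\<^bsub>BJ\<^esub> cover_class p"
proof -
 note ev = ends[OF e]
 obtain w where w: "w \<in> carrier (kq he)" "b = pr he w" using b by (rule prE[OF ev(1)])
 interpret qh: finite_quiver K "qt he" by (rule qt_finite[OF ev(1)])
 have bc: "vertex_class he b \<in> carrier BJ" by (rule vertex_class_closed[OF ev(1) b])
 interpret l: linear_map K "Cov e" "Cov e" "lact (Cov e) b" by (rule D.P.linear_lact[OF b])
 from p show ?thesis
 proof (rule cover_induct[OF e])
  show "cover_class (lact (Cov e) b \<zero>\<^bsub>Cov e\<^esub>) = vertex_class he b \<otimes>\<^bsub>BJ\<^esub> cover_class \<zero>\<^bsub>Cov e\<^esub>"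
   unfolding l.zero cover_class_zero using bc by (simp del: quot_simps)
 next
  fix p r assume pr: "p \<in> carrier (Cov e)" "r \<in> carrier (Cov e)"
   "cover_class (lact (Cov e) b p) = vertex_class he b \<otimes>\<^bsub>BJ\<^esub> cover_class p" "cover_class (lact (Cov e) b r) = vertex_class he b \<otimes>\<^bsub>BJ\<^esub> cover_class r"
  show "cover_class (lact (Cov e) b (p \<oplus>\<^bsub>Cov e\<^esub> r)) = vertex_class he b \<otimes>\<^bsub>BJ\<^esub> cover_class (p \<oplus>\<^bsub>Cov e\<^esub> r)"
   unfolding l.add[OF pr(1,2)] cover_class_add[OF l.closed[OF pr(1)] l.closed[OF pr(2)]] cover_class_add[OF pr(1,2)] pr(3,4)
   by (rule JQ.Q.alg.r_distr[symmetric, OF cover_class_closed[OF pr(1)] cover_class_closed[OF pr(2)] bc])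
 next
  fix g u v assume g: "g \<in> new e" and u: "u \<in> carrier (kq he)" and v: "v \<in> carrier (kq te)"
  have wu: "w \<otimes>\<^bsub>kq he\<^esub> u \<in> carrier (kq he)" by (rule qh.kQ.alg.m_closed[OF w(1) u])
  note ec = emb_closed[OF ev(1) u] emb_closed[OF ev(2) v] emb_closed[OF ev(1) w(1)] new_arrow_closed[OF e g]
  have "path_atom e g (w \<otimes>\<^bsub>kq he\<^esub> u) v = emb he w \<otimes>\<^bsub>PA\<^esub> path_atom e g u v"
   unfolding path_atom_def emb_mult[OF ev(1) w(1) u] using ec by (simp only: AQ.kQ.alg.m_closed AQ.kQ.alg.m_assoc)
  then show "cover_class (lact (Cov e) b (cover_atom e g u v)) = vertex_class he b \<otimes>\<^bsub>BJ\<^esub> cover_class (cover_atom e g u v)"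
   unfolding w(2) cover_atom_lact(1)[OF e g u v w(1)] cover_class_atom[OF g wu v] cover_class_atom[OF g u v] vertex_class_pr[OF ev(1) w(1)]
   using q.hom_mult[OF ec(3) path_atom_closed[OF e g u v]] by simp
 qed
qed

lemma cover_class_ract:
 assumes p: "p \<in> carrier (Cov e)" and b: "b \<in> carrier (A te)"
 shows "cover_class (ract (Cov e) p b) = cover_class p \<otimes>\<^bsub>BJ\<^esub> vertex_class te b"
proof -
 note ev = ends[OF e]
 obtain w where w: "w \<in> carrier (kq te)" "b = pr te w" using b by (rule prE[OF ev(2)])
 interpret qh: finite_quiver K "qt te" by (rule qt_finite[OF ev(2)])
 have bc: "vertex_class te b \<in> carrier BJ" by (rule vertex_class_closed[OF ev(2) b])
 interpret l: linear_map K "Cov e" "Cov e" "\<lambda>x. ract (Cov e) x b" by (rule D.P.linear_ract[OF b])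
 from p show ?thesis
 proof (rule cover_induct[OF e])
  show "cover_class (ract (Cov e) \<zero>\<^bsub>Cov e\<^esub> b) = cover_class \<zero>\<^bsub>Cov e\<^esub> \<otimes>\<^bsub>BJ\<^esub> vertex_class te b"
   unfolding l.zero cover_class_zero using bc by (simp del: quot_simps)
 next
  fix p r assume pr: "p \<in> carrier (Cov e)" "r \<in> carrier (Cov e)"
   "cover_class (ract (Cov e) p b) = cover_class p \<otimes>\<^bsub>BJ\<^esub> vertex_class te b" "cover_class (ract (Cov e) r b) = cover_class r \<otimes>\<^bsub>BJ\<^esub> vertex_class te b"
  show "cover_class (ract (Cov e) (p \<oplus>\<^bsub>Cov e\<^esub> r) b) = cover_class (p \<oplus>\<^bsub>Cov e\<^esub> r) \<otimes>\<^bsub>BJ\<^esub> vertex_class te b"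
   unfolding l.add[OF pr(1,2)] cover_class_add[OF l.closed[OF pr(1)] l.closed[OF pr(2)]] cover_class_add[OF pr(1,2)] pr(3,4)
   by (rule JQ.Q.alg.l_distr[symmetric, OF cover_class_closed[OF pr(1)] cover_class_closed[OF pr(2)] bc])
 next
  fix g u v assume g: "g \<in> new e" and u: "u \<in> carrier (kq he)" and v: "v \<in> carrier (kq te)"
  have wu: "v \<otimes>\<^bsub>kq te\<^esub> w \<in> carrier (kq te)" by (rule qh.kQ.alg.m_closed[OF v w(1)])
  note ec = emb_closed[OF ev(1) u] emb_closed[OF ev(2) v] emb_closed[OF ev(2) w(1)] new_arrow_closed[OF e g]
  have "path_atom e g u (v \<otimes>\<^bsub>kq te\<^esub> w) = path_atom e g u v \<otimes>\<^bsub>PA\<^esub> emb te w"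
   unfolding path_atom_def emb_mult[OF ev(2) v w(1)] using ec by (simp only: AQ.kQ.alg.m_closed AQ.kQ.alg.m_assoc)
  then show "cover_class (ract (Cov e) (cover_atom e g u v) b) = cover_class (cover_atom e g u v) \<otimes>\<^bsub>BJ\<^esub> vertex_class te b"
   unfolding w(2) cover_atom_ract[OF e g u v w(1)] cover_class_atom[OF g u wu] cover_class_atom[OF g u v] vertex_class_pr[OF ev(2) w(1)]
   using q.hom_mult[OF path_atom_closed[OF e g u v] ec(3)] by simp
 qed
qed

lemma linear_cover_class: "linear_map K (Cov e) BJ cover_class"
proof (intro linear_map.intro linear_map_axioms.intro D.P.vec.module_axioms JQ.Q.module_axioms cover_class_closed cover_class_add)
 interpret th: linear_map K "A he" BJ "vertex_class he" by (rule linear_vertex_class[OF ends(1)[OF e]])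
 have one: "\<one>\<^bsub>A he\<^esub> \<in> carrier (A he)" by (rule A_closed(2)[OF ends(1)[OF e]])
 fix c p assume c: "c \<in> carrier K" and p: "p \<in> carrier (Cov e)"
 have a: "c \<odot>\<^bsub>A he\<^esub> \<one>\<^bsub>A he\<^esub> \<in> carrier (A he)"
  by (rule module.smult_closed[OF module_A[OF ends(1)[OF e]] c one])
 have u: "vertex_class he \<one>\<^bsub>A he\<^esub> \<otimes>\<^bsub>BJ\<^esub> cover_class p = cover_class p"
  using cover_class_lact[OF p one] unfolding D.P.lact_one[OF p] by (rule sym)
 show "cover_class (c \<odot>\<^bsub>Cov e\<^esub> p) = c \<odot>\<^bsub>BJ\<^esub> cover_class p"
  using cover_class_lact[OF p a]
  unfolding D.P.lact_smult[OF c one p] D.P.lact_one[OF p] th.smult[OF c one]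
   JQ.Q.smult_mult_left[OF c th.closed[OF one] cover_class_closed[OF p]] u .
qed

lemma vertex_relations_subset: "Idl\<^bsub>PA\<^esub> (vertex_relations K Q I) \<subseteq> J"
 by (rule AQ.kQ.alg.genideal_minimal[OF J above])

text \<open>This is what ties the classes to the lifts chosen for the relations.\<close>

lemma cover_class_lift:
 assumes l: "lifts_cover_element K Q A qt I \<psi> C e r x"
 shows "cover_class r = clJ x"
 using l
proof (rule lifts_cover_elementE)
 fix n :: nat and g u v assume *: "x \<in> carrier PA"
  "\<And>k. k < n ==> g k \<in> new e" "\<And>k. k < n ==> u k \<in> carrier (kq he)" "\<And>k. k < n ==> v k \<in> carrier (kq te)"
  "r = (\<Oplus>\<^bsub>Cov e\<^esub>k\<in>{..<n}. cover_atom e (g k) (u k) (v k))"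
  "x \<ominus>\<^bsub>PA\<^esub> (\<Oplus>\<^bsub>PA\<^esub>k\<in>{..<n}. path_atom e (g k) (u k) (v k)) \<in> Idl\<^bsub>PA\<^esub> (vertex_relations K Q I)"
 let ?y = "\<Oplus>\<^bsub>PA\<^esub>k\<in>{..<n}. path_atom e (g k) (u k) (v k)"
 have pa: "path_atom e (g k) (u k) (v k) \<in> carrier PA" if "k < n" for k by (rule path_atom_closed[OF e *(2-4)]) (use that in auto)
 have ca: "cover_atom e (g k) (u k) (v k) \<in> carrier (Cov e)" if "k < n" for k
  by (rule cover_atom_lact(2)[OF e *(2-4) *(3)]) (use that in auto)
 have y: "?y \<in> carrier PA" by (rule AQ.kQ.alg.finsum_closed) (use pa in auto)
 have "clJ x = clJ ?y" using *(6) vertex_relations_subset by (subst JQ.coset_eq_iff[OF *(1) y]) auto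
 also have "... = (\<Oplus>\<^bsub>BJ\<^esub>k\<in>{..<n}. clJ (path_atom e (g k) (u k) (v k)))"
  by (rule q.finsum) (use pa in auto)
 also have "... = (\<Oplus>\<^bsub>BJ\<^esub>k\<in>{..<n}. cover_class (cover_atom e (g k) (u k) (v k)))"
 proof (rule JQ.Q.M.finsum_cong'[OF refl])
  show "(\<lambda>k. cover_class (cover_atom e (g k) (u k) (v k))) \<in> {..<n} \<rightarrow> carrier BJ" using cover_class_closed[OF ca] by blast
  show "clJ (path_atom e (g k) (u k) (v k)) = cover_class (cover_atom e (g k) (u k) (v k))" if "k \<in> {..<n}" for k
   using cover_class_atom[OF *(2-4)] that by simp
 qed
 also have "... = cover_class r" unfolding *(5)
  by (rule D.P.vec.M.additive_finsum[symmetric])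
   (use ca cover_class_closed cover_class_zero cover_class_add JQ.Q.M.abelian_monoid_axioms in auto)
 finally show "cover_class r = clJ x" by (rule sym)
qed

lemma cover_class_kernel_determines:
 assumes kill: "\<And>r. r \<in> carrier (Cov e) ==> cmap e r = \<zero>\<^bsub>M e\<^esub> ==> cover_class r = \<zero>\<^bsub>BJ\<^esub>"
  and p: "p \<in> carrier (Cov e)" and r: "r \<in> carrier (Cov e)"
  and eq: "cmap e p = cmap e r"
 shows "cover_class p = cover_class r"
proof -
 interpret Mm: Module.module K "M e" by (rule module_M[OF e])
 let ?d = "p \<ominus>\<^bsub>Cov e\<^esub> r"
 have d: "?d \<in> carrier (Cov e)" using p r by simp
 have pd: "p = ?d \<oplus>\<^bsub>Cov e\<^esub> r" using p r by (simp add: a_minus_def D.P.vec.M.a_assoc D.P.vec.M.l_neg)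
 have "cmap e p = cmap e ?d \<oplus>\<^bsub>M e\<^esub> cmap e r"
  using cover_hom_add[OF e d r] pd by simp
 then have "cmap e ?d \<oplus>\<^bsub>M e\<^esub> cmap e r = cmap e r"
  unfolding eq by (rule sym)
 then have "cmap e ?d = \<zero>\<^bsub>M e\<^esub>"
  unfolding Mm.M.add.r_cancel_one[OF cover_hom_closed[OF e r] cover_hom_closed[OF e d]] .
 then have "cover_class ?d = \<zero>\<^bsub>BJ\<^esub>" by (rule kill[OF d])
 then show ?thesis using cover_class_add[OF d r] pd cover_class_closed[OF r] by (simp del: quot_simps)
qed

end

end

end

context presented_species
begin

section \<open>The canonical map and its kernel\<close>

definition arrow_part :: "'e => 'm => ('k, 'v, 'e, 'a, 'm) tensor_elt" where
 "arrow_part e x = pp [e] (pure [e] [x])"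

lemma linear_arrow_part: assumes e: "e \<in> arcs Q" shows "linear_map K (M e) T (arrow_part e)"
proof -
 have p: "[e] \<in> N" by (rule npaths_single[OF e])
 interpret Mm: Module.module K "M e" by (rule module_M[OF e])
 interpret L: Module.module K "L [e]" by (rule module_L[OF p])
 have "linear_map K (M e) (L [e]) (\<lambda>x. pure [e] [x])"
 proof
  show "pure [e] [x] \<in> carrier (L [e])" if "x \<in> carrier (M e)" for x
   by (rule pure_closed[OF p]) (use that in simp)
  show "pure [e] [x \<oplus>\<^bsub>M e\<^esub> y] = pure [e] [x] \<oplus>\<^bsub>L [e]\<^esub> pure [e] [y]"
   if "x \<in> carrier (M e)" "y \<in> carrier (M e)" for x y
   using pure_add[OF p, of "[]" e "[]" "[]" x y "[]"] that by simp
  show "pure [e] [c \<odot>\<^bsub>M e\<^esub> x] = c \<odot>\<^bsub>L [e]\<^esub> pure [e] [x]"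
   if "c \<in> carrier K" "x \<in> carrier (M e)" for c x
   using pure_smult[OF p, of "[]" e "[]" "[]" x "[]" c] that by simp
 qed
 then show ?thesis unfolding arrow_part_def[abs_def] by (rule linear_map_comp) (rule linear_pp[OF p])
qed

lemma arrow_part_closed: "e \<in> arcs Q ==> x \<in> carrier (M e) ==> arrow_part e x \<in> carrier T"
 by (rule linear_map.closed[OF linear_arrow_part])

lemma vp_arrow_part:
 assumes "e \<in> arcs Q" "x \<in> carrier (M e)" "a \<in> carrier (A (head Q e))"
 shows "vp (head Q e) a \<otimes>\<^bsub>T\<^esub> arrow_part e x = arrow_part e (lact (M e) a x)"
 using gen_mult[of "At (head Q e) a" "Along [e] [x]"] assms ends(1)[OF assms(1)]
 by (simp add: arrow_part_def npaths_single)

lemma arrow_part_vp: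
 assumes "e \<in> arcs Q" "x \<in> carrier (M e)" "a \<in> carrier (A (tail Q e))"
 shows "arrow_part e x \<otimes>\<^bsub>T\<^esub> vp (tail Q e) a = arrow_part e (ract (M e) x a)"
 using gen_mult[of "Along [e] [x]" "At (tail Q e) a"] assms ends(2)[OF assms(1)]
 by (simp add: arrow_part_def npaths_single)

interpretation T: assoc_algebra K T by (rule algebra_T)

definition vertex_img :: "'v \<times> 'w => ('k, 'v, 'e, 'a, 'm) tensor_elt" where
 "vertex_img = (\<lambda>(i, w). vp i (idem i w))"

definition arrow_img :: "'v \<times> 'b + 'e \<times> 'g => ('k, 'v, 'e, 'a, 'm) tensor_elt" where
 "arrow_img = case_sum
    (\<lambda>(i, b). vp i (pr i (path_arrow K (qt i) b)))
    (\<lambda>(e, g). pp [e] (pure [e]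
     [cmap e (summand (C e) g
       (let ej = idem (head Q e) (nh e g);
         ei = idem (tail Q e) (nt e g)
       in elementary_tensor K (A (head Q e)) (A (tail Q e)) ej ei ej ei))]))"

abbreviation "Phi == canonical_map K Q A M qt I \<psi> C"

lemma Phi_eq: "Phi = path_extension K T vertex_img arrow_img"
 unfolding canonical_map_def vertex_img_def arrow_img_def ..

abbreviation "vh e g == path_vertex K (nh e g) :: ('w, 'b) qpath => 'k"
abbreviation "vt e g == path_vertex K (nt e g) :: ('w, 'b) qpath => 'k"

lemma arrow_img_Inr:
 assumes "e \<in> arcs Q" "g \<in> new e"
 shows "arrow_img (Inr (e, g)) = arrow_part e (cmap e (cover_atom e g (vh e g) (vt e g)))"
 using cover_atom_vertex[OF assms] by (simp add: arrow_img_def arrow_part_def Let_def)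

lemma new_vertices:
 assumes "e \<in> arcs Q" "g \<in> new e"
 shows "vh e g \<in> carrier (kq (head Q e))" "vt e g \<in> carrier (kq (tail Q e))"
 using vertex_in[OF ends(1) new_ends(2)] vertex_in[OF ends(2) new_ends(1)] assms by auto

lemma cover_atom_absorb:
 assumes e: "e \<in> arcs Q" and g: "g \<in> new e" and u: "u \<in> carrier (kq (head Q e))" and v: "v \<in> carrier (kq (tail Q e))"
 shows "cover_atom e g (u \<otimes>\<^bsub>kq (head Q e)\<^esub> vh e g) v = cover_atom e g u v"
  and "cover_atom e g u (vt e g \<otimes>\<^bsub>kq (tail Q e)\<^esub> v) = cover_atom e g u v"
proof -
 note ev = ends[OF e] and n = new_vertices[OF e g]
 interpret Ah: assoc_algebra K "A (head Q e)" by (rule algebra_at[OF ev(1)])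
 have "pr (head Q e) (u \<otimes>\<^bsub>kq (head Q e)\<^esub> vh e g) \<otimes>\<^bsub>A (head Q e)\<^esub> idem (head Q e) (nh e g)
  = pr (head Q e) u \<otimes>\<^bsub>A (head Q e)\<^esub> idem (head Q e) (nh e g)"
  using pr_closed[OF ev(1) u] idem_closed[OF ev(1) new_ends(2)[OF e g]] idem_mult[OF ev(1) new_ends(2)[OF e g] new_ends(2)[OF e g]]
  unfolding pr_mult[OF ev(1) u n(1)] idem_eq[symmetric] by (simp add: Ah.alg.m_assoc)
 then show "cover_atom e g (u \<otimes>\<^bsub>kq (head Q e)\<^esub> vh e g) v = cover_atom e g u v"
  unfolding cover_atom_def by (simp only:)
next
 note ev = ends[OF e] and n = new_vertices[OF e g]
 interpret Ah: assoc_algebra K "A (tail Q e)" by (rule algebra_at[OF ev(2)])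
 have "idem (tail Q e) (nt e g) \<otimes>\<^bsub>A (tail Q e)\<^esub> pr (tail Q e) (vt e g \<otimes>\<^bsub>kq (tail Q e)\<^esub> v)
  = idem (tail Q e) (nt e g) \<otimes>\<^bsub>A (tail Q e)\<^esub> pr (tail Q e) v"
  using pr_closed[OF ev(2) v] idem_closed[OF ev(2) new_ends(1)[OF e g]] idem_mult[OF ev(2) new_ends(1)[OF e g] new_ends(1)[OF e g]]
  unfolding pr_mult[OF ev(2) n(2) v] idem_eq[symmetric] by (simp add: Ah.alg.m_assoc[symmetric])
 then show "cover_atom e g u (vt e g \<otimes>\<^bsub>kq (tail Q e)\<^esub> v) = cover_atom e g u v"
  unfolding cover_atom_def by (simp only:)
qed

lemma cover_image_atom:
 assumes e: "e \<in> arcs Q" and g: "g \<in> new e" and u: "u \<in> carrier (kq (head Q e))" and v: "v \<in> carrier (kq (tail Q e))"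
 shows "vp (head Q e) (pr (head Q e) u) \<otimes>\<^bsub>T\<^esub> arrow_img (Inr (e, g)) \<otimes>\<^bsub>T\<^esub> vp (tail Q e) (pr (tail Q e) v) =
  arrow_part e (cmap e (cover_atom e g u v))"
proof -
 note ev = ends[OF e] and n = new_vertices[OF e g]
 interpret qh: finite_quiver K "qt (head Q e)" by (rule qt_finite[OF ev(1)])
 interpret qt: finite_quiver K "qt (tail Q e)" by (rule qt_finite[OF ev(2)])
 have uv: "u \<otimes>\<^bsub>kq (head Q e)\<^esub> vh e g \<in> carrier (kq (head Q e))" "vt e g \<otimes>\<^bsub>kq (tail Q e)\<^esub> v \<in> carrier (kq (tail Q e))"
  by (rule qh.kQ.alg.m_closed[OF u n(1)], rule qt.kQ.alg.m_closed[OF n(2) v])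
 have ca: "cover_atom e g a b \<in> carrier (Cov e)" if "a \<in> carrier (kq (head Q e))" "b \<in> carrier (kq (tail Q e))" for a b
  by (rule cover_atom_lact(2)[OF e g that that(1)])
 note cm = cover_hom_closed[OF e ca]
 have 1: "vp (head Q e) (pr (head Q e) u) \<otimes>\<^bsub>T\<^esub> arrow_img (Inr (e, g)) = arrow_part e (cmap e (cover_atom e g u (vt e g)))"
  unfolding arrow_img_Inr[OF e g] vp_arrow_part[OF e cm[OF n] pr_closed[OF ev(1) u]]
   cover_hom_lact[OF e ca[OF n] pr_closed[OF ev(1) u], symmetric] cover_atom_lact(1)[OF e g n u]
   cover_atom_absorb(1)[OF e g u n(2)] ..
 show ?thesis unfolding 1 arrow_part_vp[OF e cm[OF u n(2)] pr_closed[OF ev(2) v]]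
   cover_hom_ract[OF e ca[OF u n(2)] pr_closed[OF ev(2) v], symmetric] cover_atom_ract[OF e g u n(2) v]
   cover_atom_absorb(2)[OF e g u v] ..
qed

lemma finsum_fibres:
 assumes "abelian_monoid G" "finite B" "\<And>i. i \<in> B ==> finite (D i)" "\<And>i w. i \<in> B ==> w \<in> D i ==> f (i, w) \<in> carrier G"
 shows "(\<Oplus>\<^bsub>G\<^esub>z\<in>Sigma B D. f z) = (\<Oplus>\<^bsub>G\<^esub>i\<in>B. \<Oplus>\<^bsub>G\<^esub>w\<in>D i. f (i, w))"
proof -
 interpret G: abelian_monoid G by fact
 have eq: "Sigma B D = (\<Union>i\<in>B. Pair i ` D i)" by auto
 have "(\<Oplus>\<^bsub>G\<^esub>z\<in>Sigma B D. f z) = (\<Oplus>\<^bsub>G\<^esub>i\<in>B. \<Oplus>\<^bsub>G\<^esub>z\<in>Pair i ` D i. f z)"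
  unfolding eq by (rule G.add.finprod_UN_disjoint) (use assms in "auto simp: pairwise_def disjnt_def")
 also have "... = (\<Oplus>\<^bsub>G\<^esub>i\<in>B. \<Oplus>\<^bsub>G\<^esub>w\<in>D i. f (i, w))"
 proof (rule G.finsum_cong'[OF refl])
  show "(\<lambda>i. \<Oplus>\<^bsub>G\<^esub>w\<in>D i. f (i, w)) \<in> B \<rightarrow> carrier G" using assms by (auto intro!: G.finsum_closed)
  show "(\<Oplus>\<^bsub>G\<^esub>z\<in>Pair i ` D i. f z) = (\<Oplus>\<^bsub>G\<^esub>w\<in>D i. f (i, w))" if "i \<in> B" for i
   by (rule G.add.finprod_reindex) (use assms that in "auto simp: inj_on_def")
 qed
 finally show ?thesis .
qed

lemma canonical_path_algebra_map: "path_algebra_map K AQ T vertex_img arrow_img"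
proof (intro path_algebra_map.intro path_algebra_map_axioms.intro AQ.finite_quiver_axioms algebra_T)
 fix x assume x: "x \<in> verts AQ"
 then show "vertex_img x \<in> carrier T" by (auto simp: vertex_img_def AQ_simps intro!: vp_closed idem_closed)
 fix y assume y: "y \<in> verts AQ"
 obtain i w j w' where xy: "x = (i, w)" "y = (j, w')" by (cases x; cases y)
 have *: "i \<in> verts Q" "w \<in> verts (qt i)" "j \<in> verts Q" "w' \<in> verts (qt j)" using x y xy by (auto simp: AQ_simps)
 have "vertex_img x \<otimes>\<^bsub>T\<^esub> vertex_img y = (if i = j then vp i (idem i w \<otimes>\<^bsub>A i\<^esub> idem j w') else \<zero>\<^bsub>T\<^esub>)"
  unfolding xy vertex_img_def using vp_mult_vp[OF *(1) idem_closed[OF *(1,2)] *(3) idem_closed[OF *(3,4)]] by simp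
 also have "... = (if x = y then vertex_img x else \<zero>\<^bsub>T\<^esub>)"
  using * idem_mult[of i w w'] linear_map.zero[OF linear_vp[OF *(1)]] by (auto simp: xy vertex_img_def)
 finally show "vertex_img x \<otimes>\<^bsub>T\<^esub> vertex_img y = (if x = y then vertex_img x else \<zero>\<^bsub>T\<^esub>)" .
next
 fix a assume a: "a \<in> arcs AQ"
 have "arrow_img a \<in> carrier T \<and> vertex_img (head AQ a) \<otimes>\<^bsub>T\<^esub> arrow_img a = arrow_img a \<and> arrow_img a \<otimes>\<^bsub>T\<^esub> vertex_img (tail AQ a) = arrow_img a"
 proof (cases a)
  case (Inl z)
  obtain i b where z: "z = (i, b)" by (cases z)
  have i: "i \<in> verts Q" "b \<in> arcs (qt i)" using a Inl z by (auto simp: AQ_simps)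
  interpret q: finite_quiver K "qt i" by (rule qt_finite[OF i(1)])
  let ?b = "path_arrow K (qt i) b"
  have b: "?b \<in> carrier (kq i)" by (rule q.arrow_closed[OF i(2)])
  have v: "path_vertex K (head (qt i) b) \<in> carrier (kq i)" "path_vertex K (tail (qt i) b) \<in> carrier (kq i)"
   using i by (auto intro!: q.vertex_closed simp del: path_algebra_simps)
  have m: "vp i (pr i u) \<otimes>\<^bsub>T\<^esub> vp i (pr i w) = vp i (pr i (u \<otimes>\<^bsub>kq i\<^esub> w))" if "u \<in> carrier (kq i)" "w \<in> carrier (kq i)" for u w
   unfolding vp_mult_vp[OF i(1) pr_closed[OF i(1) that(1)] i(1) pr_closed[OF i(1) that(2)]] pr_mult[OF i(1) that] by simp
  have "arrow_img a = vp i (pr i ?b)" unfolding Inl z arrow_img_def by simp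
  moreover have "vertex_img (head AQ a) = vp i (pr i (path_vertex K (head (qt i) b)))"
   "vertex_img (tail AQ a) = vp i (pr i (path_vertex K (tail (qt i) b)))"
   unfolding Inl z AQ_simps vertex_img_def idem_eq by simp_all
  ultimately show ?thesis
   using m[OF v(1) b] m[OF b v(2)] q.vertex_arrow[of b] vp_closed[OF i(1) pr_closed[OF i(1) b]] by simp
 next
  case (Inr z)
  obtain e g where z: "z = (e, g)" by (cases z)
  have e: "e \<in> arcs Q" and g: "g \<in> new e" using a Inr z by (auto simp: AQ_simps)
  note ev = ends[OF e] and n = new_vertices[OF e g]
  have c: "cmap e (cover_atom e g (vh e g) (vt e g)) \<in> carrier (M e)"
   by (rule cover_hom_closed[OF e cover_atom_lact(2)[OF e g n n(1)]])
  have et: "arrow_img a = arrow_part e (cmap e (cover_atom e g (vh e g) (vt e g)))" unfolding Inr z by (rule arrow_img_Inr[OF e g])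
  have ep: "vertex_img (head AQ a) = vp (head Q e) (pr (head Q e) (vh e g))" "vertex_img (tail AQ a) = vp (tail Q e) (pr (tail Q e) (vt e g))"
   unfolding Inr z AQ_simps vertex_img_def idem_eq by simp_all
  note ca = cover_atom_lact(2)[OF e g n n(1)]
  have "vp (head Q e) (pr (head Q e) (vh e g)) \<otimes>\<^bsub>T\<^esub> arrow_img a = arrow_img a"
   unfolding et vp_arrow_part[OF e c pr_closed[OF ev(1) n(1)]] cover_hom_lact[OF e ca pr_closed[OF ev(1) n(1)], symmetric]
    cover_atom_lact(1)[OF e g n n(1)] cover_atom_absorb(1)[OF e g n] ..
  moreover have "arrow_img a \<otimes>\<^bsub>T\<^esub> vp (tail Q e) (pr (tail Q e) (vt e g)) = arrow_img a"
   unfolding et arrow_part_vp[OF e c pr_closed[OF ev(2) n(2)]] cover_hom_ract[OF e ca pr_closed[OF ev(2) n(2)], symmetric]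
    cover_atom_ract[OF e g n n(2)] cover_atom_absorb(2)[OF e g n] ..
  ultimately show ?thesis unfolding ep using arrow_part_closed[OF e c] et by simp
 qed
 then show "arrow_img a \<in> carrier T" "vertex_img (head AQ a) \<otimes>\<^bsub>T\<^esub> arrow_img a = arrow_img a" "arrow_img a \<otimes>\<^bsub>T\<^esub> vertex_img (tail AQ a) = arrow_img a" by auto
next
 have c: "vertex_img (i, w) \<in> carrier T" if "i \<in> verts Q" "w \<in> verts (qt i)" for i w
  using that by (auto simp: vertex_img_def intro!: vp_closed idem_closed)
 have "(\<Oplus>\<^bsub>T\<^esub>x\<in>verts AQ. vertex_img x) = (\<Oplus>\<^bsub>T\<^esub>i\<in>verts Q. \<Oplus>\<^bsub>T\<^esub>w\<in>verts (qt i). vertex_img (i, w))"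
  unfolding AQ_simps
  by (rule finsum_fibres[OF T.alg.abelian_monoid_axioms]) (use c fin_digraph.finite_verts[OF finite_quiver.axioms(1)[OF qt_finite]] in auto)
 also have "... = (\<Oplus>\<^bsub>T\<^esub>i\<in>verts Q. vp i \<one>\<^bsub>A i\<^esub>)"
 proof (rule T.alg.finsum_cong'[OF refl])
  show "(\<lambda>i. vp i \<one>\<^bsub>A i\<^esub>) \<in> verts Q \<rightarrow> carrier T" by (auto intro!: vp_closed A_closed)
  fix i assume i: "i \<in> verts Q"
  interpret q: finite_quiver K "qt i" by (rule qt_finite[OF i])
  interpret h: algebra_hom K "kq i" "A i" "pr i" by (rule pr_hom[OF i])
  have "(\<Oplus>\<^bsub>T\<^esub>w\<in>verts (qt i). vertex_img (i, w)) = (\<Oplus>\<^bsub>T\<^esub>w\<in>verts (qt i). vp i (pr i (path_vertex K w)))"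
   by (simp add: vertex_img_def idem_eq)
  also have "... = vp i (pr i (\<Oplus>\<^bsub>kq i\<^esub>w\<in>verts (qt i). path_vertex K w))"
   by (rule linear_map.finsum[OF linear_map_comp[OF linear_pr[OF i] linear_vp[OF i]], symmetric])
    (auto intro: q.vertex_closed simp del: path_algebra_simps)
  also have "... = vp i \<one>\<^bsub>A i\<^esub>" unfolding q.one_eq_sum[symmetric] h.hom_one ..
  finally show "(\<Oplus>\<^bsub>T\<^esub>w\<in>verts (qt i). vertex_img (i, w)) = vp i \<one>\<^bsub>A i\<^esub>" .
 qed
 also have "... = \<one>\<^bsub>T\<^esub>" by (rule one_eq_vertices[symmetric])
 finally show "(\<Oplus>\<^bsub>T\<^esub>x\<in>verts AQ. vertex_img x) = \<one>\<^bsub>T\<^esub>" .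
qed

interpretation Phi: path_algebra_map K AQ T vertex_img arrow_img by (rule canonical_path_algebra_map)

lemma Phi_hom: "algebra_hom K PA T Phi"
 unfolding Phi_eq by (rule Phi.hom.algebra_hom_axioms)

interpretation Ph: algebra_hom K PA T Phi by (rule Phi_hom)

lemma Phi_emb:
 assumes i: "i \<in> verts Q" and u: "u \<in> carrier (kq i)"
 shows "Phi (emb i u) = vp i (pr i u)"
proof -
 interpret q: finite_quiver K "qt i" by (rule qt_finite[OF i])
 show ?thesis
 proof (rule q.multiplicative_map_ext[where h = "\<lambda>u. Phi (emb i u)" and h' = "\<lambda>u. vp i (pr i u)", OF algebra_T
    linear_map_comp[OF linear_emb[OF i] Ph.linear_map_axioms] linear_map_comp[OF linear_pr[OF i] linear_vp[OF i]] _ _ _ _ u])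
  fix f g assume f: "f \<in> carrier (kq i)" and g: "g \<in> carrier (kq i)"
  show "Phi (emb i (f \<otimes>\<^bsub>kq i\<^esub> g)) = Phi (emb i f) \<otimes>\<^bsub>T\<^esub> Phi (emb i g)"
   unfolding emb_mult[OF i f g] by (rule Ph.hom_mult[OF emb_closed[OF i f] emb_closed[OF i g]])
  show "vp i (pr i (f \<otimes>\<^bsub>kq i\<^esub> g)) = vp i (pr i f) \<otimes>\<^bsub>T\<^esub> vp i (pr i g)"
   unfolding pr_mult[OF i f g] vp_mult_vp[OF i pr_closed[OF i f] i pr_closed[OF i g]] by simp
 next
  fix w assume w: "w \<in> verts (qt i)"
  then have "(i, w) \<in> verts AQ" using i by (simp add: AQ_simps)
  then show "Phi (emb i (path_vertex K w)) = vp i (pr i (path_vertex K w))"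
   unfolding emb_vertex Phi_eq by (subst Phi.ext_vertex) (simp_all add: vertex_img_def idem_eq)
 next
  fix b assume b: "b \<in> arcs (qt i)"
  show "Phi (emb i (path_arrow K (qt i) b)) = vp i (pr i (path_arrow K (qt i) b))"
   unfolding emb_arrow Phi_eq Phi.ext_arrow[OF arcs_Inl[OF i b]] by (simp add: arrow_img_def)
 qed
qed

lemma Phi_arrow:
 assumes "e \<in> arcs Q" "g \<in> new e"
 shows "Phi (path_arrow K AQ (Inr (e, g))) = arrow_img (Inr (e, g))"
 unfolding Phi_eq by (rule Phi.ext_arrow[OF arcs_Inr[OF assms]])

lemma Phi_atom:
 assumes e: "e \<in> arcs Q" and g: "g \<in> new e" and u: "u \<in> carrier (kq (head Q e))" and v: "v \<in> carrier (kq (tail Q e))"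
 shows "Phi (path_atom e g u v) = arrow_part e (cmap e (cover_atom e g u v))"
proof -
 note ev = ends[OF e]
 note ec = emb_closed[OF ev(1) u] emb_closed[OF ev(2) v] new_arrow_closed[OF e g]
 show ?thesis
  unfolding path_atom_def Ph.hom_mult[OF AQ.kQ.alg.m_closed[OF ec(1,3)] ec(2)] Ph.hom_mult[OF ec(1,3)]
   Phi_emb[OF ev(1) u] Phi_emb[OF ev(2) v] Phi_arrow[OF e g]
  by (rule cover_image_atom[OF e g u v])
qed

lemma Phi_vertex_relations:
 assumes "x \<in> Idl\<^bsub>PA\<^esub> (vertex_relations K Q I)" shows "Phi x = \<zero>\<^bsub>T\<^esub>"
proof (rule Ph.genideal_kernel[OF _ _ assms])
 show "vertex_relations K Q I \<subseteq> carrier PA"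
  by (auto simp: vertex_relations_def simp del: path_algebra_simps intro!: emb_closed I_subset)
 fix y :: "('v \<times> 'w, 'v \<times> 'b + 'e \<times> 'g) qpath => 'k" assume "y \<in> vertex_relations K Q I"
 then obtain i u where i: "i \<in> verts Q" "u \<in> I i" "y = emb i u" by (auto simp: vertex_relations_def)
 have "pr i u = \<zero>\<^bsub>A i\<^esub>" using pr_kernel[OF i(1) I_subset[OF i(1,2)]] i(2) by simp
 then show "Phi y = \<zero>\<^bsub>T\<^esub>" unfolding i(3) Phi_emb[OF i(1) I_subset[OF i(1,2)]]
  using linear_map.zero[OF linear_vp[OF i(1)]] by simp
qed

lemma Phi_lift:
 assumes e: "e \<in> arcs Q" and l: "lifts_cover_element K Q A qt I \<psi> C e r x"
 shows "Phi x = arrow_part e (cmap e r)" "x \<in> carrier PA"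
proof -
 interpret P: bimodule K "A (head Q e)" "A (tail Q e)" "Cov e"
  by (rule decomposed_bimodule.axioms(1)[OF decomposed[OF e]])
 interpret Mm: Module.module K "M e" by (rule module_M[OF e])
 interpret io: linear_map K "M e" T "arrow_part e" by (rule linear_arrow_part[OF e])
 have "Phi x = arrow_part e (cmap e r) \<and> x \<in> carrier PA"
  using l
 proof (rule lifts_cover_elementE)
  fix n :: nat and g u v assume *: "x \<in> carrier PA"
   "\<And>k. k < n ==> g k \<in> new e" "\<And>k. k < n ==> u k \<in> carrier (kq (head Q e))" "\<And>k. k < n ==> v k \<in> carrier (kq (tail Q e))"
   "r = (\<Oplus>\<^bsub>Cov e\<^esub>k\<in>{..<n}. cover_atom e (g k) (u k) (v k))"
   "x \<ominus>\<^bsub>PA\<^esub> (\<Oplus>\<^bsub>PA\<^esub>k\<in>{..<n}. path_atom e (g k) (u k) (v k)) \<in> Idl\<^bsub>PA\<^esub> (vertex_relations K Q I)"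
  let ?y = "\<Oplus>\<^bsub>PA\<^esub>k\<in>{..<n}. path_atom e (g k) (u k) (v k)"
  have pa: "path_atom e (g k) (u k) (v k) \<in> carrier PA" if "k < n" for k by (rule path_atom_closed[OF e *(2-4)]) (use that in auto)
  have ca: "cover_atom e (g k) (u k) (v k) \<in> carrier (Cov e)" if "k < n" for k
   by (rule cover_atom_lact(2)[OF e *(2-4) *(3)]) (use that in auto)
  note cm = cover_hom_closed[OF e ca]
  have y: "?y \<in> carrier PA" by (rule AQ.kQ.alg.finsum_closed) (use pa in auto)
  have "Phi x \<ominus>\<^bsub>T\<^esub> Phi ?y = \<zero>\<^bsub>T\<^esub>" using Phi_vertex_relations[OF *(6)] Ph.minus[OF *(1) y] by simp
  then have "Phi x = Phi ?y" using T.vec.eq_from_minus[OF Ph.hom_closed[OF *(1)] Ph.hom_closed[OF y]] by blast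
  also have "... = (\<Oplus>\<^bsub>T\<^esub>k\<in>{..<n}. Phi (path_atom e (g k) (u k) (v k)))"
   by (rule Ph.finsum) (use pa in auto)
  also have "... = (\<Oplus>\<^bsub>T\<^esub>k\<in>{..<n}. arrow_part e (cmap e (cover_atom e (g k) (u k) (v k))))"
  proof (rule T.alg.finsum_cong'[OF refl])
   show "(\<lambda>k. arrow_part e (cmap e (cover_atom e (g k) (u k) (v k)))) \<in> {..<n} \<rightarrow> carrier T"
    using io.closed[OF cm] by blast
   show "Phi (path_atom e (g k) (u k) (v k)) = arrow_part e (cmap e (cover_atom e (g k) (u k) (v k)))" if "k \<in> {..<n}" for k
    using Phi_atom[OF e *(2-4)] that by simp
  qed
  also have "... = arrow_part e (\<Oplus>\<^bsub>M e\<^esub>k\<in>{..<n}. cmap e (cover_atom e (g k) (u k) (v k)))"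
   by (rule io.finsum[symmetric]) (use cm in auto)
  also have "(\<Oplus>\<^bsub>M e\<^esub>k\<in>{..<n}. cmap e (cover_atom e (g k) (u k) (v k))) = cmap e r"
  proof -
   have z: "cmap e \<zero>\<^bsub>Cov e\<^esub> = \<zero>\<^bsub>M e\<^esub>"
    using cover_hom_add[OF e P.vec.M.zero_closed P.vec.M.zero_closed] cover_hom_closed[OF e P.vec.M.zero_closed]
    by (simp add: Mm.M.add.l_cancel_one)
   show ?thesis unfolding *(5)
    by (rule P.vec.M.additive_finsum[symmetric])
     (use ca z cover_hom_add[OF e] cover_hom_closed[OF e] Mm.M.abelian_monoid_axioms in auto)
  qed
  finally show "Phi x = arrow_part e (cmap e r) \<and> x \<in> carrier PA" using *(1) by blast
 qed
 then show "Phi x = arrow_part e (cmap e r)" "x \<in> carrier PA" by auto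
qed

text \<open>A bimodule element is the image of an element of the cover, which is a sum of atoms, and atoms are images of elements
 of the path algebra. Pure tensors along a path are products of bimodule elements.\<close>

lemma Phi_surj: "Phi ` carrier PA = carrier T"
proof
 show "Phi ` carrier PA \<subseteq> carrier T" by (rule image_subsetI) (rule Ph.hom_closed)
 have img: "t \<in> Phi ` carrier PA" if "x \<in> carrier PA" "Phi x = t" for t x
  using that(1) unfolding that(2)[symmetric] by (rule imageI)
 have img_add: "s \<oplus>\<^bsub>T\<^esub> t \<in> Phi ` carrier PA" if s: "s \<in> Phi ` carrier PA" and t: "t \<in> Phi ` carrier PA" for s t
 proof -
  obtain x where x: "s = Phi x" "x \<in> carrier PA" using s by (rule imageE)
  obtain y where y: "t = Phi y" "y \<in> carrier PA" using t by (rule imageE)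
  show ?thesis unfolding x(1) y(1) by (rule img[OF AQ.kQ.alg.a_closed[OF x(2) y(2)] Ph.hom_add[OF x(2) y(2)]])
 qed
 have img_mult: "s \<otimes>\<^bsub>T\<^esub> t \<in> Phi ` carrier PA" if s: "s \<in> Phi ` carrier PA" and t: "t \<in> Phi ` carrier PA" for s t
 proof -
  obtain x where x: "s = Phi x" "x \<in> carrier PA" using s by (rule imageE)
  obtain y where y: "t = Phi y" "y \<in> carrier PA" using t by (rule imageE)
  show ?thesis unfolding x(1) y(1) by (rule img[OF AQ.kQ.alg.m_closed[OF x(2) y(2)] Ph.hom_mult[OF x(2) y(2)]])
 qed
 have img_zero: "\<zero>\<^bsub>T\<^esub> \<in> Phi ` carrier PA"
  by (rule img[OF AQ.kQ.alg.zero_closed Ph.zero])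
 have img_arrow_part: "arrow_part e x \<in> Phi ` carrier PA" if e: "e \<in> arcs Q" and x: "x \<in> carrier (M e)" for e x
 proof -
  interpret P: bimodule K "A (head Q e)" "A (tail Q e)" "Cov e"
   by (rule decomposed_bimodule.axioms(1)[OF decomposed[OF e]])
  interpret Mm: Module.module K "M e" by (rule module_M[OF e])
  interpret io: linear_map K "M e" T "arrow_part e" by (rule linear_arrow_part[OF e])
  obtain p where p: "p \<in> carrier (Cov e)" "x = cmap e p"
   using x unfolding cover_surj[OF e, symmetric] by auto
  have z: "cmap e \<zero>\<^bsub>Cov e\<^esub> = \<zero>\<^bsub>M e\<^esub>"
   using cover_hom_add[OF e P.vec.M.zero_closed P.vec.M.zero_closed] cover_hom_closed[OF e P.vec.M.zero_closed]
   by (simp add: Mm.M.add.l_cancel_one)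
  from p(1) have "arrow_part e (cmap e p) \<in> Phi ` carrier PA"
  proof (rule cover_induct[OF e])
   show "arrow_part e (cmap e \<zero>\<^bsub>Cov e\<^esub>) \<in> Phi ` carrier PA" unfolding z io.zero by (rule img_zero)
   show "arrow_part e (cmap e (cover_atom e g u v)) \<in> Phi ` carrier PA"
    if "g \<in> new e" "u \<in> carrier (kq (head Q e))" "v \<in> carrier (kq (tail Q e))" for g u v
    by (rule img[OF path_atom_closed[OF e that] Phi_atom[OF e that]])
   show "arrow_part e (cmap e (p \<oplus>\<^bsub>Cov e\<^esub> r)) \<in> Phi ` carrier PA"
    if "p \<in> carrier (Cov e)" "r \<in> carrier (Cov e)" "arrow_part e (cmap e p) \<in> Phi ` carrier PA"
     "arrow_part e (cmap e r) \<in> Phi ` carrier PA" for p r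
    unfolding cover_hom_add[OF e that(1,2)] io.add[OF cover_hom_closed[OF e that(1)] cover_hom_closed[OF e that(2)]]
    by (rule img_add[OF that(3,4)])
  qed
  then show ?thesis using p(2) by simp
 qed
 have img_along: "pp p (pure p xs) \<in> Phi ` carrier PA" if "p \<in> N" "xs \<in> tuples (map M p)" for p xs
  using that
 proof (induction p arbitrary: xs)
  case (Cons e p)
  then obtain x ys where xs: "xs = x # ys" "x \<in> carrier (M e)" "ys \<in> tuples (map M p)" by (auto simp: tuples_Cons)
  have e: "e \<in> arcs Q" using Cons.prems(1) by (simp add: npaths_Cons)
  show ?case
  proof (cases "p = []")
   case True
   then show ?thesis using img_arrow_part[OF e xs(2)] xs by (simp add: arrow_part_def)
  next
   case False
   then have p: "p \<in> N" "head Q (hd p) = tail Q e" using Cons.prems(1) by (auto simp: npaths_Cons)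
   have "arrow_part e x \<otimes>\<^bsub>T\<^esub> pp p (pure p ys) = pp (e # p) (pure (e # p) (x # ys))"
    using gen_mult[of "Along [e] [x]" "Along p ys"] p xs npaths_single[OF e] by (simp add: arrow_part_def)
   then show ?thesis using img_mult[OF img_arrow_part[OF e xs(2)] Cons.IH[OF p(1) xs(3)]] xs(1) by simp
  qed
 qed simp
 show "carrier T \<subseteq> Phi ` carrier PA"
 proof
  fix t assume "t \<in> carrier T"
  then show "t \<in> Phi ` carrier PA"
  proof (induction rule: T_induct)
   case (gen g)
   show ?case
   proof (cases g)
    case (At i a)
    then have i: "i \<in> verts Q" "a \<in> carrier (A i)" using gen by auto
    obtain u where u: "u \<in> carrier (kq i)" "a = pr i u" using i(2) by (rule prE[OF i(1)])
    show ?thesis unfolding At gen.simps u(2)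
     by (rule img[OF emb_closed[OF i(1) u(1)] Phi_emb[OF i(1) u(1)]])
   next
    case (Along p xs)
    then show ?thesis using gen img_along by simp
   qed
  qed (use img_zero img_add in auto)
 qed
qed

context
 fixes l :: "'e => 'p => ('v \<times> 'w, 'v \<times> 'b + 'e \<times> 'g) qpath => 'k"
 assumes lifts: "kernel_lifts K Q A M qt I \<psi> C l"
begin

lemma lift_kernel: "e \<in> arcs Q ==> r \<in> carrier (Cov e) ==> cmap e r = \<zero>\<^bsub>M e\<^esub> ==>
  lifts_cover_element K Q A qt I \<psi> C e r (l e r)"
 using lifts by (simp add: kernel_lifts_def a_kernel_def')

abbreviation "Rels == assembled_relations K Q M I C l"

lemma Rels_cases:
 assumes "x \<in> Rels"
 obtains i u where "i \<in> verts Q" "u \<in> I i" "x = emb i u"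
 | e r where "e \<in> arcs Q" "r \<in> carrier (Cov e)" "cmap e r = \<zero>\<^bsub>M e\<^esub>" "x = l e r"
 using assms by (auto simp: assembled_relations_def vertex_relations_def a_kernel_def')

lemma Rels_subset: "Rels \<subseteq> carrier PA"
proof
 fix x assume "x \<in> Rels"
 then show "x \<in> carrier PA"
  by (rule Rels_cases) (use emb_closed I_subset Phi_lift(2) lift_kernel in blast)+
qed

text \<open>Let \<open>J\<close> be the ideal generated by the relations. The classes modulo \<open>J\<close> of elements of the algebras and of the covers
 are compatible with all actions, and those of kernel elements vanish because \<open>J\<close> contains lifts of them. So they
 define maps on the algebras and bimodules, which extend to the tensor algebra by its universal property. Following
 the canonical map by this extension gives the quotient map modulo \<open>J\<close>, as one sees on trivial paths and arrows.\<close>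

lemma Phi_kernel: "{x \<in> carrier PA. Phi x = \<zero>\<^bsub>T\<^esub>} = Idl\<^bsub>PA\<^esub> Rels"
proof
 let ?J = "Idl\<^bsub>PA\<^esub> Rels"
 have "Phi x = \<zero>\<^bsub>T\<^esub>" if "x \<in> Rels" for x
  using that
 proof (rule Rels_cases)
  fix i u assume "i \<in> verts Q" "u \<in> I i" "x = emb i u"
  then have "x \<in> Idl\<^bsub>PA\<^esub> (vertex_relations K Q I)"
   by (intro subsetD[OF AQ.kQ.alg.genideal_self]) (auto simp: vertex_relations_def simp del: path_algebra_simps intro!: emb_closed I_subset)
  then show "Phi x = \<zero>\<^bsub>T\<^esub>" by (rule Phi_vertex_relations)
 next
  fix e r assume *: "e \<in> arcs Q" "r \<in> carrier (Cov e)" "cmap e r = \<zero>\<^bsub>M e\<^esub>" "x = l e r"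
  show "Phi x = \<zero>\<^bsub>T\<^esub>" unfolding *(4) Phi_lift(1)[OF *(1) lift_kernel[OF *(1-3)]] *(3) by (rule linear_map.zero[OF linear_arrow_part[OF *(1)]])
 qed
 then show "?J \<subseteq> {x \<in> carrier PA. Phi x = \<zero>\<^bsub>T\<^esub>}"
  by (intro AQ.kQ.alg.genideal_minimal[OF Ph.kernel_ideal]) (use Rels_subset in auto)
 have J: "ideal ?J PA" by (rule AQ.kQ.alg.genideal_ideal[OF Rels_subset])
 have self: "x \<in> ?J" if "x \<in> Rels" for x using AQ.kQ.alg.genideal_self[OF Rels_subset] that by auto
 have above: "vertex_relations K Q I \<subseteq> ?J"
  using self by (auto simp: assembled_relations_def)
 interpret JQ: quotient_algebra K PA ?J
  by (intro quotient_algebra.intro quotient_algebra_axioms.intro AQ.kQ.assoc_algebra_axioms J)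
 interpret q: algebra_hom K PA "quot PA ?J" "\<lambda>x. ?J +>\<^bsub>PA\<^esub> x"
  by (rule JQ.algebra_hom_coset)
 let ?B = "quot PA ?J" and ?th = "vertex_class ?J" and ?cover_class = "cover_class ?J"
 note ctx = J above
 have kill: "?cover_class e r = \<zero>\<^bsub>?B\<^esub>" if "e \<in> arcs Q" "r \<in> carrier (Cov e)" "cmap e r = \<zero>\<^bsub>M e\<^esub>" for e r
 proof -
  have "l e r \<in> ?J" by (rule self) (use that in "auto simp: assembled_relations_def a_kernel_def'")
  then show ?thesis using cover_class_lift[OF ctx that(1) lift_kernel[OF that]] JQ.coset_self by simp
 qed
 \<comment> \<open>The class of an element of a bimodule is that of any preimage in the cover.\<close>
 define mu where "mu e x = ?cover_class e (SOME p. p \<in> carrier (Cov e) \<and> cmap e p = x)" for e x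
 have mu: "mu e (cmap e p) = ?cover_class e p" if e: "e \<in> arcs Q" and p: "p \<in> carrier (Cov e)" for e p
 proof -
  let ?p = "SOME r. r \<in> carrier (Cov e) \<and> cmap e r = cmap e p"
  have "?p \<in> carrier (Cov e) \<and> cmap e ?p = cmap e p"
   by (rule someI[of _ p]) (use p in auto)
  then show ?thesis unfolding mu_def by (intro cover_class_kernel_determines[OF ctx e kill[OF e]] p) auto
 qed
 have surj: "\<exists>p\<in>carrier (Cov e). x = cmap e p" if "e \<in> arcs Q" "x \<in> carrier (M e)" for e x
  using that(2) unfolding cover_surj[OF that(1), symmetric] by auto
 have mu_lact: "mu e (lact (M e) a x) = ?th (head Q e) a \<otimes>\<^bsub>?B\<^esub> mu e x"
  if e: "e \<in> arcs Q" and x: "x \<in> carrier (M e)" and a: "a \<in> carrier (A (head Q e))" for e x a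
 proof -
  interpret P: bimodule K "A (head Q e)" "A (tail Q e)" "Cov e"
   by (rule decomposed_bimodule.axioms(1)[OF decomposed[OF e]])
  obtain p where p: "p \<in> carrier (Cov e)" "x = cmap e p" using surj[OF e x] by blast
  show ?thesis unfolding p(2) cover_hom_lact[OF e p(1) a, symmetric] mu[OF e P.lact_closed[OF a p(1)]] mu[OF e p(1)]
   by (rule cover_class_lact[OF ctx e p(1) a])
 qed
 have mu_ract: "mu e (ract (M e) x a) = mu e x \<otimes>\<^bsub>?B\<^esub> ?th (tail Q e) a"
  if e: "e \<in> arcs Q" and x: "x \<in> carrier (M e)" and a: "a \<in> carrier (A (tail Q e))" for e x a
 proof -
  interpret P: bimodule K "A (head Q e)" "A (tail Q e)" "Cov e"
   by (rule decomposed_bimodule.axioms(1)[OF decomposed[OF e]])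
  obtain p where p: "p \<in> carrier (Cov e)" "x = cmap e p" using surj[OF e x] by blast
  show ?thesis unfolding p(2) cover_hom_ract[OF e p(1) a, symmetric] mu[OF e P.ract_closed[OF a p(1)]] mu[OF e p(1)]
   by (rule cover_class_ract[OF ctx e p(1) a])
 qed
 have linear_mu: "linear_map K (M e) ?B (mu e)" if e: "e \<in> arcs Q" for e
 proof -
  interpret ta: linear_map K "Cov e" ?B "?cover_class e" by (rule linear_cover_class[OF ctx e])
  interpret cm: linear_map K "Cov e" "M e" "cmap e" by (rule linear_cover_map[OF e])
  show ?thesis
  proof (intro linear_map.intro linear_map_axioms.intro module_M[OF e] JQ.Q.module_axioms)
   fix x assume "x \<in> carrier (M e)"
   then obtain p where p: "p \<in> carrier (Cov e)" "x = cmap e p" using surj[OF e] by blast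
   show "mu e x \<in> carrier ?B" unfolding p(2) mu[OF e p(1)] by (rule ta.closed[OF p(1)])
   show "mu e (c \<odot>\<^bsub>M e\<^esub> x) = c \<odot>\<^bsub>?B\<^esub> mu e x" if c: "c \<in> carrier K" for c
    unfolding p(2) cm.smult[OF c p(1), symmetric]
     mu[OF e module.smult_closed[OF linear_map.axioms(1)[OF linear_cover_map[OF e]] c p(1)]] mu[OF e p(1)] by (rule ta.smult[OF c p(1)])
   fix y assume "y \<in> carrier (M e)"
   then obtain r where r: "r \<in> carrier (Cov e)" "y = cmap e r" using surj[OF e] by blast
   have pr_sum: "p \<oplus>\<^bsub>Cov e\<^esub> r \<in> carrier (Cov e)" using p(1) r(1) by simp
   show "mu e (x \<oplus>\<^bsub>M e\<^esub> y) = mu e x \<oplus>\<^bsub>?B\<^esub> mu e y"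
    unfolding p(2) r(2) cm.add[OF p(1) r(1), symmetric] mu[OF e pr_sum]
     mu[OF e p(1)] mu[OF e r(1)] by (rule ta.add[OF p(1) r(1)])
  qed
 qed
 interpret t: tensor_algebra_map K Q A M ?B ?th mu
  by (intro tensor_algebra_map.intro tensor_algebra_map_axioms.intro species_axioms JQ.algebra_quot
    linear_vertex_class[OF ctx] vertex_class_mult[OF ctx] linear_mu mu_lact mu_ract)
 have tPhi: "t.tmap (Phi x) = ?J +>\<^bsub>PA\<^esub> x" if x: "x \<in> carrier PA" for x
 proof (rule AQ.multiplicative_map_ext[where h = "\<lambda>x. t.tmap (Phi x)" and h' = "\<lambda>x. ?J +>\<^bsub>PA\<^esub> x", OF JQ.algebra_quot
    linear_map_comp[OF Ph.linear_map_axioms t.linear_tmap] JQ.linear_coset _ JQ.coset_mult _ _ x])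
  fix f g assume f: "f \<in> carrier PA" and g: "g \<in> carrier PA"
  show "t.tmap (Phi (f \<otimes>\<^bsub>PA\<^esub> g)) = t.tmap (Phi f) \<otimes>\<^bsub>?B\<^esub> t.tmap (Phi g)"
   unfolding Ph.hom_mult[OF f g] by (rule t.tmap_mult[OF Ph.hom_closed[OF f] Ph.hom_closed[OF g]])
 next
  fix z assume z: "z \<in> verts AQ"
  obtain i w where iw: "z = (i, w)" by (cases z)
  have i: "i \<in> verts Q" "w \<in> verts (qt i)" using z iw by (auto simp: AQ_simps)
  have v: "path_vertex K w \<in> carrier (kq i)" by (rule vertex_in[OF i])
  have "t.tmap (Phi (path_vertex K z)) = ?th i (pr i (path_vertex K w))"
   unfolding iw emb_vertex[symmetric] Phi_emb[OF i(1) v] by (rule t.tmap_vp[OF i(1) pr_closed[OF i(1) v]])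
  also have "... = ?J +>\<^bsub>PA\<^esub> path_vertex K z"
   unfolding iw emb_vertex[symmetric] by (rule vertex_class_pr[OF ctx i(1) v])
  finally show "t.tmap (Phi (path_vertex K z)) = ?J +>\<^bsub>PA\<^esub> path_vertex K z" .
 next
  fix a assume a: "a \<in> arcs AQ"
  show "t.tmap (Phi (path_arrow K AQ a)) = ?J +>\<^bsub>PA\<^esub> path_arrow K AQ a"
  proof (cases a)
   case (Inl z)
   obtain i b where z: "z = (i, b)" by (cases z)
   have i: "i \<in> verts Q" "b \<in> arcs (qt i)" using a Inl z by (auto simp: AQ_simps)
   have v: "path_arrow K (qt i) b \<in> carrier (kq i)" by (rule finite_quiver.arrow_closed[OF qt_finite[OF i(1)] i(2)])
   have "t.tmap (Phi (path_arrow K AQ a)) = ?th i (pr i (path_arrow K (qt i) b))"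
    unfolding Inl z emb_arrow[symmetric] Phi_emb[OF i(1) v] by (rule t.tmap_vp[OF i(1) pr_closed[OF i(1) v]])
   also have "... = ?J +>\<^bsub>PA\<^esub> path_arrow K AQ a"
    unfolding Inl z emb_arrow[symmetric] by (rule vertex_class_pr[OF ctx i(1) v])
   finally show ?thesis .
  next
   case (Inr z)
   obtain e g where z: "z = (e, g)" by (cases z)
   have e: "e \<in> arcs Q" and g: "g \<in> new e" using a Inr z by (auto simp: AQ_simps)
   note n = new_vertices[OF e g]
   note ca = cover_atom_lact(2)[OF e g n n(1)]
   note cm = cover_hom_closed[OF e ca]
   have xs: "[cmap e (cover_atom e g (vh e g) (vt e g))] \<in> tuples (map M [e])" using cm by simp
   have p: "[e] \<in> N" by (rule npaths_single[OF e])
   have "t.tmap (arrow_img a) = mu e (cmap e (cover_atom e g (vh e g) (vt e g)))"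
    unfolding Inr z arrow_img_Inr[OF e g] arrow_part_def t.tmap_pp[OF p pure_closed[OF p xs]] t.path_map_pure[OF p xs]
    using t.arrow_closed[OF e cm] by (simp del: quot_simps)
   also have "... = ?cover_class e (cover_atom e g (vh e g) (vt e g))" by (rule mu[OF e ca])
   also have "... = ?J +>\<^bsub>PA\<^esub> path_arrow K AQ (Inr (e, g))"
    unfolding vertex_mult_path_atom[OF e g, symmetric] by (rule cover_class_atom[OF ctx e g n])
   finally show ?thesis unfolding Inr z Phi_arrow[OF e g] .
  qed
 qed
 show "{x \<in> carrier PA. Phi x = \<zero>\<^bsub>T\<^esub>} \<subseteq> ?J"
 proof safe
  fix x assume x: "x \<in> carrier PA" "Phi x = \<zero>\<^bsub>T\<^esub>"
  have "?J +>\<^bsub>PA\<^esub> x = \<zero>\<^bsub>?B\<^esub>" using tPhi[OF x(1)] x(2) t.tmap.zero by simp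
  then show "x \<in> ?J" using JQ.coset_zero_iff[OF x(1)] by simp
 qed
qed

theorem tensor_algebra_presentation: "alg_isomorphic K T (quot PA (Idl\<^bsub>PA\<^esub> Rels))"
 by (rule Ph.isomorphic_quot[OF Phi_surj Phi_kernel[symmetric]])

theorem tensor_quotient_presentation:
 assumes "c \<in> carrier PA"
 shows "alg_isomorphic K (quot T (Idl\<^bsub>T\<^esub> {Phi c})) (quot PA (Idl\<^bsub>PA\<^esub> (Rels \<union> {c})))"
 by (rule Ph.isomorphic_quot_generator[OF Phi_surj Rels_subset Phi_kernel assms])

end

end

section \<open>Powers of the arrow ideal\<close>

context finite_quiver
begin

text \<open>The span of the paths of length at least \<open>n\<close>, which turns out to be the \<open>n\<close>th power of the arrow ideal.\<close>

definition long_part :: "nat => (('v, 'e) qpath => 'k) set" where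
 "long_part n = {f \<in> carrier kQ. \<forall>x. f x \<noteq> \<zero>\<^bsub>K\<^esub> --> n \<le> length (fst (snd x))}"

lemma long_part_0: "long_part 0 = carrier kQ"
 by (auto simp: long_part_def)

lemma long_part_closed: "f \<in> long_part n ==> f \<in> carrier kQ"
 by (simp add: long_part_def)

lemma long_part_mono: "m \<le> n ==> long_part n \<subseteq> long_part m"
 unfolding long_part_def by (blast intro: order_trans)

lemma support_path: "f \<in> carrier kQ ==> f x \<noteq> \<zero>\<^bsub>K\<^esub> ==> x \<in> qpaths Q"
 by (auto simp: free_module_carrier)

lemma coefficient_closed: "f \<in> carrier kQ ==> f x \<in> carrier K"
 unfolding path_algebra_simps free_module_carrier by blast

lemma mult_nonzeroE:
 assumes "(f \<otimes>\<^bsub>kQ\<^esub> g) z \<noteq> \<zero>\<^bsub>K\<^esub>"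
 obtains k p j q i where "z = (k, p @ q, i)" "f (k, p, j) \<noteq> \<zero>\<^bsub>K\<^esub>" "g (j, q, i) \<noteq> \<zero>\<^bsub>K\<^esub>"
proof -
 have "{(x, y). f x \<noteq> \<zero>\<^bsub>K\<^esub> \<and> g y \<noteq> \<zero>\<^bsub>K\<^esub> \<and> qpath_comp x y = Some z} \<noteq> {}"
 proof
  assume ev: "{(x, y). f x \<noteq> \<zero>\<^bsub>K\<^esub> \<and> g y \<noteq> \<zero>\<^bsub>K\<^esub> \<and> qpath_comp x y = Some z} = {}"
  have "(f \<otimes>\<^bsub>kQ\<^esub> g) z = \<zero>\<^bsub>K\<^esub>" unfolding path_algebra_simps convolve_def ev by simp
  then show False using assms by blast
 qed
 then obtain k p j j' q i where *: "f (k, p, j) \<noteq> \<zero>\<^bsub>K\<^esub>" "g (j', q, i) \<noteq> \<zero>\<^bsub>K\<^esub>"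
   "qpath_comp (k, p, j) (j', q, i) = Some z"
  by auto
 then have "j' = j" "z = (k, p @ q, i)" by (auto split: if_splits)
 with * that show thesis by blast
qed

lemma long_part_mult: "f \<in> long_part m ==> g \<in> long_part n ==> f \<otimes>\<^bsub>kQ\<^esub> g \<in> long_part (m + n)"
 unfolding long_part_def
proof (intro CollectI conjI allI impI)
 assume f: "f \<in> {f \<in> carrier kQ. \<forall>x. f x \<noteq> \<zero>\<^bsub>K\<^esub> --> m \<le> length (fst (snd x))}"
  and g: "g \<in> {f \<in> carrier kQ. \<forall>x. f x \<noteq> \<zero>\<^bsub>K\<^esub> --> n \<le> length (fst (snd x))}"
 show "f \<otimes>\<^bsub>kQ\<^esub> g \<in> carrier kQ" by (rule kQ.alg.m_closed) (use f g in blast)+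
 fix z assume "(f \<otimes>\<^bsub>kQ\<^esub> g) z \<noteq> \<zero>\<^bsub>K\<^esub>"
 then obtain k p j q i where *: "z = (k, p @ q, i)" "f (k, p, j) \<noteq> \<zero>\<^bsub>K\<^esub>" "g (j, q, i) \<noteq> \<zero>\<^bsub>K\<^esub>"
  by (rule mult_nonzeroE)
 have "m \<le> length p" "n \<le> length q" using f g *(2,3) by fastforce+
 then show "m + n \<le> length (fst (snd z))" using *(1) by simp
qed

lemma long_part_submodule: "submodule (long_part n) K kQ"
proof (rule kQ.vec.submoduleI)
 show "long_part n \<subseteq> carrier kQ" by (auto simp: long_part_def)
 show "\<zero>\<^bsub>kQ\<^esub> \<in> long_part n" using kQ.alg.zero_closed by (simp add: long_part_def)
 have sm: "c \<odot>\<^bsub>kQ\<^esub> f \<in> long_part n" if c: "c \<in> carrier K" and f: "f \<in> long_part n" for c f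
 proof -
  have "f x \<noteq> \<zero>\<^bsub>K\<^esub>" if "(c \<odot>\<^bsub>kQ\<^esub> f) x \<noteq> \<zero>\<^bsub>K\<^esub>" for x using that c by auto
  then show ?thesis using f kQ.vec.smult_closed[OF c long_part_closed[OF f]] unfolding long_part_def by blast
 qed
 show "c \<odot>\<^bsub>kQ\<^esub> f \<in> long_part n" if "c \<in> carrier K" "f \<in> long_part n" for c f by (rule sm[OF that])
 fix f assume f: "f \<in> long_part n"
 have "\<ominus>\<^bsub>kQ\<^esub> f = (\<ominus>\<^bsub>K\<^esub> \<one>\<^bsub>K\<^esub>) \<odot>\<^bsub>kQ\<^esub> f"
  using kQ.vec.smult_l_minus[OF base.one_closed long_part_closed[OF f]] kQ.vec.smult_one[OF long_part_closed[OF f]]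
  by (simp del: path_algebra_simps)
 then show "\<ominus>\<^bsub>kQ\<^esub> f \<in> long_part n" using sm[OF _ f] by simp
 fix g assume g: "g \<in> long_part n"
 have "f x \<noteq> \<zero>\<^bsub>K\<^esub> \<or> g x \<noteq> \<zero>\<^bsub>K\<^esub>" if "(f \<oplus>\<^bsub>kQ\<^esub> g) x \<noteq> \<zero>\<^bsub>K\<^esub>" for x using that by auto
 then show "f \<oplus>\<^bsub>kQ\<^esub> g \<in> long_part n"
  using f g kQ.alg.a_closed[OF long_part_closed[OF f] long_part_closed[OF g]] unfolding long_part_def by blast
qed

lemma long_part_ideal: "ideal (long_part n) kQ"
proof (rule idealI)
 show "subgroup (long_part n) (add_monoid kQ)"
  by (rule submodule.axioms(1)[OF long_part_submodule])
 fix f g assume f: "f \<in> long_part n" and g: "g \<in> carrier kQ"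
 then have g0: "g \<in> long_part 0" unfolding long_part_0 by blast
 show "g \<otimes>\<^bsub>kQ\<^esub> f \<in> long_part n" using long_part_mult[OF g0 f] by simp
 show "f \<otimes>\<^bsub>kQ\<^esub> g \<in> long_part n" using long_part_mult[OF f g0] by simp
qed (rule kQ.alg.ring_axioms)

lemma single_long: "x \<in> qpaths Q ==> n \<le> length (fst (snd x)) ==> single K x \<in> long_part n"
 using single_path[of x] unfolding long_part_def by (auto simp: single_def simp del: path_algebra_simps)

lemma long_part_subset:
 assumes H: "submodule H K kQ" and s: "\<And>x. x \<in> qpaths Q ==> n \<le> length (fst (snd x)) ==> single K x \<in> H"
 shows "long_part n \<subseteq> H"
proof
 let ?S = "{x \<in> qpaths Q. n \<le> length (fst (snd x))}"
 fix f assume "f \<in> long_part n"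
 then have "f \<in> carrier (free_module K ?S)" unfolding long_part_def path_algebra_simps free_module_carrier by blast
 with cring_K show "f \<in> H"
 proof (induction rule: free_module_induct)
  case zero
  then show ?case using subgroup.one_closed[OF submodule.axioms(1)[OF H]] by simp
 next
  case (add f g)
  then show ?case using subgroup.m_closed[OF submodule.axioms(1)[OF H], of f g] by simp
 next
  case (smult c f)
  then show ?case using submodule.smult_closed[OF H, of c f] by simp
 qed (use s in auto)
qed

lemma long_path_factor:
 assumes "x \<in> qpaths Q" "Suc n \<le> length (fst (snd x))"
 obtains e y where "e \<in> arcs Q" "y \<in> qpaths Q" "n \<le> length (fst (snd y))"
  "single K x = path_arrow K Q e \<otimes>\<^bsub>kQ\<^esub> single K y"
proof -
 obtain k p i where x: "x = (k, p, i)" by (cases x)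
 obtain e q where p: "p = e # q" using assms x by (cases p) auto
 show thesis
 proof (rule that[of e "(tail Q e, q, i)"])
  have "head Q e = k" using assms x p by auto
  then show "single K x = path_arrow K Q e \<otimes>\<^bsub>kQ\<^esub> single K (tail Q e, q, i)"
   unfolding x p path_arrow_def by (simp only:) (rule single_Cons)
 qed (use assms x p in auto)
qed

lemma arrow_ideal_eq: "arrow_ideal K Q = long_part 1"
proof
 have arr: "path_arrow K Q ` arcs Q \<subseteq> carrier kQ" using arrow_closed by blast
 show "arrow_ideal K Q \<subseteq> long_part 1" unfolding arrow_ideal_def
 proof (rule kQ.alg.genideal_minimal[OF long_part_ideal])
  show "path_arrow K Q ` arcs Q \<subseteq> long_part 1"
   unfolding path_arrow_def by (rule image_subsetI) (rule single_long, auto)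
 qed
 interpret A: ideal "arrow_ideal K Q" kQ
  unfolding arrow_ideal_def by (rule kQ.alg.genideal_ideal[OF arr])
 show "long_part 1 \<subseteq> arrow_ideal K Q"
 proof (rule long_part_subset[OF kQ.ideal_submodule[OF A.ideal_axioms]])
  fix x assume "x \<in> qpaths Q" "1 \<le> length (fst (snd x))"
  then obtain e y where *: "e \<in> arcs Q" "y \<in> qpaths Q" "single K x = path_arrow K Q e \<otimes>\<^bsub>kQ\<^esub> single K y"
   using long_path_factor[of x 0] by (metis One_nat_def)
  have "path_arrow K Q e \<in> arrow_ideal K Q" unfolding arrow_ideal_def
   by (rule subsetD[OF kQ.alg.genideal_self[OF arr] imageI[OF *(1)]])
  then show "single K x \<in> arrow_ideal K Q" unfolding *(3) by (rule A.I_r_closed[OF _ single_path[OF *(2)]])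
 qed
qed

lemma ideal_power_eq: "ideal_power kQ (arrow_ideal K Q) n = long_part n"
proof (induction n)
 case 0
 show ?case unfolding ideal_power_def long_part_0 by (simp del: path_algebra_simps)
next
 case (Suc n)
 have eq: "ideal_power kQ (arrow_ideal K Q) (Suc n) = ideal_prod kQ (long_part 1) (long_part n)"
  using Suc unfolding ideal_power_def arrow_ideal_eq by simp
 show ?case unfolding eq
 proof
  show "ideal_prod kQ (long_part 1) (long_part n) \<subseteq> long_part (Suc n)"
  proof
   fix f assume "f \<in> ideal_prod kQ (long_part 1) (long_part n)"
   then show "f \<in> long_part (Suc n)"
   proof (induction rule: ideal_prod.induct)
    case (prod f g)
    show ?case using long_part_mult[OF prod] by simp
   next
    case (sum f g)
    show ?case by (rule additive_subgroup.a_closed[OF ideal.axioms(1)[OF long_part_ideal] sum.IH])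
   qed
  qed
  show "long_part (Suc n) \<subseteq> ideal_prod kQ (long_part 1) (long_part n)"
  proof (rule long_part_subset[OF kQ.ideal_submodule[OF kQ.alg.ideal_prod_is_ideal[OF long_part_ideal long_part_ideal]]])
   fix x assume "x \<in> qpaths Q" "Suc n \<le> length (fst (snd x))"
   then obtain e y where *: "e \<in> arcs Q" "y \<in> qpaths Q" "n \<le> length (fst (snd y))"
     "single K x = path_arrow K Q e \<otimes>\<^bsub>kQ\<^esub> single K y"
    by (rule long_path_factor)
   have "path_arrow K Q e \<in> long_part 1" unfolding path_arrow_def by (rule single_long) (use *(1) in auto)
   then show "single K x \<in> ideal_prod kQ (long_part 1) (long_part n)"
    unfolding *(4) by (rule ideal_prod.prod[OF _ single_long[OF *(2,3)]])
  qed
 qed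
qed

lemma admissible_iff: "admissible K Q J \<longleftrightarrow>
  ideal J kQ \<and> J \<subseteq> long_part 2 \<and> (\<exists>m\<ge>2. long_part m \<subseteq> J)"
 unfolding admissible_def ideal_power_eq using fin_digraph_axioms by blast

text \<open>A path as short as the shortest ones in \<open>g\<close> can only arise from a product with a trivial path.\<close>

lemma bottom_coefficient_left:
 assumes f: "f \<in> carrier kQ" and g: "g \<in> long_part n" and y: "length (fst (snd y)) = n" "g y = \<zero>\<^bsub>K\<^esub>"
 shows "(f \<otimes>\<^bsub>kQ\<^esub> g) y = \<zero>\<^bsub>K\<^esub>"
proof (rule ccontr)
 assume "(f \<otimes>\<^bsub>kQ\<^esub> g) y \<noteq> \<zero>\<^bsub>K\<^esub>"
 then obtain k p j q i where *: "y = (k, p @ q, i)" "f (k, p, j) \<noteq> \<zero>\<^bsub>K\<^esub>" "g (j, q, i) \<noteq> \<zero>\<^bsub>K\<^esub>"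
  by (rule mult_nonzeroE)
 have "n \<le> length q" using g *(3) by (fastforce simp: long_part_def)
 moreover have "length p + length q = n" using y(1) *(1) by simp
 ultimately have "length p = 0" by linarith
 then have "p = []" by simp
 then have "k = j" using support_path[OF f *(2)] by simp
 then show False using *(1,3) y(2) \<open>p = []\<close> by simp
qed

lemma bottom_coefficient_right:
 assumes f: "f \<in> carrier kQ" and g: "g \<in> long_part n" and y: "length (fst (snd y)) = n" "g y = \<zero>\<^bsub>K\<^esub>"
 shows "(g \<otimes>\<^bsub>kQ\<^esub> f) y = \<zero>\<^bsub>K\<^esub>"
proof (rule ccontr)
 assume "(g \<otimes>\<^bsub>kQ\<^esub> f) y \<noteq> \<zero>\<^bsub>K\<^esub>"
 then obtain k p j q i where *: "y = (k, p @ q, i)" "g (k, p, j) \<noteq> \<zero>\<^bsub>K\<^esub>" "f (j, q, i) \<noteq> \<zero>\<^bsub>K\<^esub>"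
  by (rule mult_nonzeroE)
 have "n \<le> length p" using g *(2) by (fastforce simp: long_part_def)
 moreover have "length p + length q = n" using y(1) *(1) by simp
 ultimately have "length q = 0" by linarith
 then have "q = []" by simp
 then have "j = i" using support_path[OF f *(3)] by simp
 then show False using *(1,2) y(2) \<open>q = []\<close> by simp
qed

lemma single_append:
 assumes "(k, p @ q, i) \<in> qpaths Q"
 obtains j where "(k, p, j) \<in> qpaths Q" "(j, q, i) \<in> qpaths Q"
  "single K (k, p @ q, i) = single K (k, p, j) \<otimes>\<^bsub>kQ\<^esub> single K (j, q, i)"
proof -
 obtain j where *: "(k, p, j) \<in> qpaths Q" "(j, q, i) \<in> qpaths Q" using assms by (auto simp: qpaths_append)
 show thesis by (rule that[OF *]) (unfold mult_paths, simp)
qed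

end

text \<open>If there are \<open>k\<close> exceptions, they cut the list into \<open>k + 1\<close> blocks without exceptions, and not all of these can
 be shorter than \<open>m\<close>.\<close>

lemma infix_of_few_exceptions:
 assumes "(length (filter (\<lambda>x. \<not> P x) p) + 1) * m \<le> length p" "0 < m"
 obtains us vs ws where "p = us @ vs @ ws" "length vs = m" "list_all P vs"
proof -
 have "\<exists>us vs ws. p = us @ vs @ ws \<and> length vs = m \<and> list_all P vs"
  using assms(1)
 proof (induction "length p" arbitrary: p rule: less_induct)
  case less
  show ?case
  proof (cases "m \<le> length (takeWhile P p)")
   case True
   have "p = [] @ take m (takeWhile P p) @ (drop m (takeWhile P p) @ dropWhile P p)"
    by (simp only: append_Nil append_assoc[symmetric] append_take_drop_id takeWhile_dropWhile_id)
   moreover have "list_all P (take m (takeWhile P p))"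
    by (auto simp: list_all_iff dest!: in_set_takeD dest: set_takeWhileD)
   ultimately show ?thesis using True by (metis length_take min.absorb2)
  next
   case False
   have "m \<le> length p" using less.prems by (simp add: algebra_simps)
   then have "dropWhile P p \<noteq> []" using False by (metis append_Nil2 takeWhile_dropWhile_id)
   then obtain x q where xq: "dropWhile P p = x # q" by (cases "dropWhile P p") auto
   then have x: "\<not> P x" by (metis hd_dropWhile list.sel(1) list.simps(3))
   have p: "p = takeWhile P p @ x # q" using xq by (metis takeWhile_dropWhile_id)
   have "filter (\<lambda>x. \<not> P x) (takeWhile P p) = []" by (auto simp: filter_empty_conv dest: set_takeWhileD)
   then have f: "length (filter (\<lambda>x. \<not> P x) p) = Suc (length (filter (\<lambda>x. \<not> P x) q))"
    using x by (subst p) simp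
   have l: "length p = length (takeWhile P p) + Suc (length q)" by (subst p) simp
   have "(length (filter (\<lambda>x. \<not> P x) q) + 1) * m \<le> length q"
    using less.prems f l False by simp
   then obtain us vs ws where "q = us @ vs @ ws" "length vs = m" "list_all P vs"
    using less.hyps[of q] l by auto
   then show ?thesis using p by (metis append.assoc append_Cons)
  qed
 qed
 then show thesis using that by blast
qed

text \<open>A repeated vertex would yield a closed walk and hence a cycle.\<close>

lemma (in fin_digraph) acyclic_qpath_length:
 assumes "acyclic_quiver G" "(j, p, i) \<in> qpaths G"
 shows "length p < card (verts G)"
proof -
 have w: "awalk i (rev p) j" using assms(2) by (simp add: qpaths_def)
 have "distinct (awalk_verts i (rev p))"
 proof (rule ccontr)
  assume "\<not> distinct (awalk_verts i (rev p))"
  from awalk_not_distinct_decomp[OF w this] obtain r u where "0 < length r" "awalk u r u" by blast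
  then have "closed_w r" by (auto simp: closed_w_def)
  then obtain c where "cycle c" using closed_w_imp_cycle by blast
  then show False using assms(1) by (auto simp: acyclic_quiver_def)
 qed
 then have "apath i (rev p) j" using w by (simp add: apath_def)
 then show ?thesis using length_apath_less by fastforce
qed

section \<open>Admissibility of the assembled relations\<close>

context presented_species
begin

abbreviation "Long == AQ.long_part"
abbreviation "cover_class2 == cover_class (Long 2)"
abbreviation "cl2 x == Long 2 +>\<^bsub>PA\<^esub> x"

lemma emb_coefficient: "emb i u y \<noteq> \<zero>\<^bsub>K\<^esub> ==> \<exists>x. u x \<noteq> \<zero>\<^bsub>K\<^esub> \<and> embed_path i x = y"
proof (rule ccontr)
 assume y: "emb i u y \<noteq> \<zero>\<^bsub>K\<^esub>" and "\<not> (\<exists>x. u x \<noteq> \<zero>\<^bsub>K\<^esub> \<and> embed_path i x = y)"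
 then have ev: "{x. u x \<noteq> \<zero>\<^bsub>K\<^esub> \<and> embed_path i x = y} = {}" by blast
 have "emb i u y = (\<Oplus>\<^bsub>K\<^esub>x\<in>{x. u x \<noteq> \<zero>\<^bsub>K\<^esub> \<and> embed_path i x = y}. u x)"
  unfolding embed_def push_def embed_path_def ..
 then show False using y unfolding ev by simp
qed

lemma emb_long:
 assumes i: "i \<in> verts Q" and u: "u \<in> finite_quiver.long_part K (qt i) n"
 shows "emb i u \<in> Long n"
proof -
 interpret q: finite_quiver K "qt i" by (rule qt_finite[OF i])
 have "n \<le> length (fst (snd y))" if ne: "emb i u y \<noteq> \<zero>\<^bsub>K\<^esub>" for y
 proof -
  obtain x where x: "u x \<noteq> \<zero>\<^bsub>K\<^esub>" "embed_path i x = y" using emb_coefficient[OF ne] by blast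
  have "length (fst (snd y)) = length (fst (snd x))" unfolding x(2)[symmetric] by (cases x) (simp add: embed_path_def)
  moreover have "n \<le> length (fst (snd x))" using u x(1) unfolding q.long_part_def by blast
  ultimately show ?thesis by simp
 qed
 then show ?thesis using emb_closed[OF i q.long_part_closed[OF u]] unfolding AQ.long_part_def by blast
qed

lemma vertex_relations_long: "vertex_relations K Q I \<subseteq> Long 2"
proof
 fix x :: "('v \<times> 'w, 'v \<times> 'b + 'e \<times> 'g) qpath => 'k" assume "x \<in> vertex_relations K Q I"
 then obtain i u where i: "i \<in> verts Q" and u: "u \<in> I i" "x = emb i u" by (auto simp: vertex_relations_def)
 interpret q: finite_quiver K "qt i" by (rule qt_finite[OF i])
 have "u \<in> q.long_part 2"
  using presentation[OF i] u(1) unfolding presents_def q.admissible_iff by blast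
 then show "x \<in> Long 2" unfolding u(2) by (rule emb_long[OF i])
qed

lemma path_atom_long:
 assumes "e \<in> arcs Q" "g \<in> new e" "u \<in> carrier (kq (head Q e))" "v \<in> carrier (kq (tail Q e))"
 shows "path_atom e g u v \<in> Long 1"
  and "length (fst (snd y)) = 1 ==> fst (snd y) \<noteq> [Inr (e, g)] ==> path_atom e g u v y = \<zero>\<^bsub>K\<^esub>"
proof -
 let ?a = "path_arrow K AQ (Inr (e, g))"
 have a: "?a \<in> Long 1"
  unfolding path_arrow_def by (rule AQ.single_long) (use arcs_Inr[OF assms(1,2)] in auto)
 have uv: "emb (head Q e) u \<in> carrier PA" "emb (tail Q e) v \<in> carrier PA"
  by (rule emb_closed[OF ends(1)[OF assms(1)] assms(3)], rule emb_closed[OF ends(2)[OF assms(1)] assms(4)])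
 note L = ideal.I_l_closed[OF AQ.long_part_ideal a uv(1)]
 show "path_atom e g u v \<in> Long 1"
  unfolding path_atom_def by (rule ideal.I_r_closed[OF AQ.long_part_ideal L uv(2)])
 assume y: "length (fst (snd y)) = 1" "fst (snd y) \<noteq> [Inr (e, g)]"
 have "?a y = \<zero>\<^bsub>K\<^esub>" using y(2) by (auto simp: path_arrow_def single_def)
 then show "path_atom e g u v y = \<zero>\<^bsub>K\<^esub>"
  unfolding path_atom_def
  by (rule AQ.bottom_coefficient_right[OF uv(2) L y(1) AQ.bottom_coefficient_left[OF uv(1) a y(1)]])
qed

text \<open>Modulo paths of length two, the coefficients at arrows are well defined.\<close>

lemma long_part_coset:
 assumes w: "w \<in> Long 1" and x: "x \<in> carrier PA"
  and eq: "cl2 x = cl2 w"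
 shows "x \<in> Long 1" and "length (fst (snd y)) = 1 ==> x y = w y"
proof -
 interpret JQ: quotient_algebra K PA "Long 2"
  by (intro quotient_algebra.intro quotient_algebra_axioms.intro AQ.kQ.assoc_algebra_axioms AQ.long_part_ideal)
 interpret L: additive_subgroup "Long 1" PA by (rule ideal.axioms(1)[OF AQ.long_part_ideal])
 have wc: "w \<in> carrier PA" by (rule AQ.long_part_closed[OF w])
 let ?d = "x \<ominus>\<^bsub>PA\<^esub> w"
 have d: "?d \<in> Long 2" using eq unfolding JQ.coset_eq_iff[OF x wc] .
 then have d1: "?d \<in> Long 1" using AQ.long_part_mono[of 1 2] by auto
 have xd: "x = ?d \<oplus>\<^bsub>PA\<^esub> w"
  using x wc by (simp add: a_minus_def AQ.kQ.alg.a_assoc AQ.kQ.alg.l_neg del: path_algebra_simps)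
 show "x \<in> Long 1" by (subst xd) (rule L.a_closed[OF d1 w])
 assume y: "length (fst (snd y)) = 1"
 have "?d y = \<zero>\<^bsub>K\<^esub>"
 proof (rule ccontr)
  assume "?d y \<noteq> \<zero>\<^bsub>K\<^esub>"
  then have "2 \<le> length (fst (snd y))" using d unfolding AQ.long_part_def by blast
  then show False using y by simp
 qed
 moreover have "x y = ?d y \<oplus>\<^bsub>K\<^esub> w y" by (subst xd) simp
 ultimately show "x y = w y" using AQ.coefficient_closed[OF wc] by simp
qed

lemmas cover_class_context = AQ.long_part_ideal[of 2] vertex_relations_long

context
 fixes e assumes e: "e \<in> arcs Q"
begin

interpretation D: decomposed_bimodule K "A (head Q e)" "A (tail Q e)" "Cov e" "new e"
   "\<lambda>g. idem (head Q e) (nh e g)" "\<lambda>g. idem (tail Q e) (nt e g)" "summand (C e)"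
 by (rule decomposed[OF e])

interpretation JQ: quotient_algebra K PA "Long 2"
 by (intro quotient_algebra.intro quotient_algebra_axioms.intro AQ.kQ.assoc_algebra_axioms AQ.long_part_ideal)

interpretation q: algebra_hom K PA "quot PA (Long 2)" "\<lambda>x. cl2 x"
 by (rule JQ.algebra_hom_coset)

interpretation L: submodule "Long 1" K PA by (rule AQ.long_part_submodule)

interpretation L: ideal "Long 1" PA by (rule AQ.long_part_ideal)

interpretation ta: linear_map K "Cov e" "quot PA (Long 2)" "cover_class2 e"
 by (rule linear_cover_class[OF cover_class_context e])

text \<open>The elements of the cover whose class modulo paths of length two has coefficient zero at the path \<open>y\<close>. For a path of
 length one this is a subbimodule, because multiplying by an element of an algebra affects that coefficient only by a
 scalar factor.\<close>

definition vanishing :: "('v \<times> 'w, 'v \<times> 'b + 'e \<times> 'g) qpath => 'p set" where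
 "vanishing y = {p \<in> carrier (Cov e). \<exists>w\<in>Long 1.
   cover_class2 e p = cl2 w \<and> w y = \<zero>\<^bsub>K\<^esub>}"

lemma vanishingI: "[|p \<in> carrier (Cov e); w \<in> Long 1;
  cover_class2 e p = Long 2 +>\<^bsub>PA\<^esub> w; w y = \<zero>\<^bsub>K\<^esub>|] ==> p \<in> vanishing y"
 unfolding vanishing_def by blast

lemma vanishingE:
 assumes "p \<in> vanishing y"
 obtains w where "p \<in> carrier (Cov e)" "w \<in> Long 1" "w \<in> carrier PA"
  "cover_class2 e p = cl2 w" "w y = \<zero>\<^bsub>K\<^esub>"
 using assms AQ.long_part_closed unfolding vanishing_def by blast

lemma vanishing_zero: "\<zero>\<^bsub>Cov e\<^esub> \<in> vanishing y"
proof (rule vanishingI[OF D.P.vec.M.zero_closed L.zero_closed])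
 show "cover_class2 e \<zero>\<^bsub>Cov e\<^esub> = Long 2 +>\<^bsub>PA\<^esub> \<zero>\<^bsub>PA\<^esub>"
  unfolding ta.zero q.zero ..
qed simp

lemma vanishing_add:
 assumes "p \<in> vanishing y" "p' \<in> vanishing y" shows "p \<oplus>\<^bsub>Cov e\<^esub> p' \<in> vanishing y"
proof -
 obtain w where w: "p \<in> carrier (Cov e)" "w \<in> Long 1" "w \<in> carrier PA"
  "cover_class2 e p = cl2 w" "w y = \<zero>\<^bsub>K\<^esub>" using assms(1) by (rule vanishingE)
 obtain w' where w': "p' \<in> carrier (Cov e)" "w' \<in> Long 1" "w' \<in> carrier PA"
  "cover_class2 e p' = cl2 w'" "w' y = \<zero>\<^bsub>K\<^esub>" using assms(2) by (rule vanishingE)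
 show ?thesis
 proof (rule vanishingI[of _ "w \<oplus>\<^bsub>PA\<^esub> w'"])
  show "cover_class2 e (p \<oplus>\<^bsub>Cov e\<^esub> p') = cl2 (w \<oplus>\<^bsub>PA\<^esub> w')"
   unfolding ta.add[OF w(1) w'(1)] w(4) w'(4) by (rule q.hom_add[OF w(3) w'(3), symmetric])
  show "(w \<oplus>\<^bsub>PA\<^esub> w') y = \<zero>\<^bsub>K\<^esub>" using w(5) w'(5) by simp
 qed (rule D.P.vec.M.a_closed[OF w(1) w'(1)], rule L.a_closed[OF w(2) w'(2)])
qed

lemma vanishing_lact:
 assumes p: "p \<in> vanishing y" and b: "b \<in> carrier (A (head Q e))" and y: "length (fst (snd y)) = 1"
 shows "lact (Cov e) b p \<in> vanishing y"
proof -
 note ev = ends[OF e]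
 obtain w where w: "p \<in> carrier (Cov e)" "w \<in> Long 1" "w \<in> carrier PA"
  "cover_class2 e p = cl2 w" "w y = \<zero>\<^bsub>K\<^esub>" using p by (rule vanishingE)
 obtain u where u: "u \<in> carrier (kq (head Q e))" "b = pr (head Q e) u" using b by (rule prE[OF ev(1)])
 have eu: "emb (head Q e) u \<in> carrier PA" by (rule emb_closed[OF ev(1) u(1)])
 show ?thesis
 proof (rule vanishingI[of _ "emb (head Q e) u \<otimes>\<^bsub>PA\<^esub> w"])
  show "cover_class2 e (lact (Cov e) b p) = cl2 (emb (head Q e) u \<otimes>\<^bsub>PA\<^esub> w)"
   unfolding cover_class_lact[OF cover_class_context e w(1) b] w(4) unfolding u(2) vertex_class_pr[OF cover_class_context ev(1) u(1)]
   by (rule q.hom_mult[OF eu w(3), symmetric])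
  show "(emb (head Q e) u \<otimes>\<^bsub>PA\<^esub> w) y = \<zero>\<^bsub>K\<^esub>" by (rule AQ.bottom_coefficient_left[OF eu w(2) y w(5)])
 qed (rule D.P.lact_closed[OF b w(1)], rule L.I_l_closed[OF w(2) eu])
qed

lemma vanishing_ract:
 assumes p: "p \<in> vanishing y" and b: "b \<in> carrier (A (tail Q e))" and y: "length (fst (snd y)) = 1"
 shows "ract (Cov e) p b \<in> vanishing y"
proof -
 note ev = ends[OF e]
 obtain w where w: "p \<in> carrier (Cov e)" "w \<in> Long 1" "w \<in> carrier PA"
  "cover_class2 e p = cl2 w" "w y = \<zero>\<^bsub>K\<^esub>" using p by (rule vanishingE)
 obtain u where u: "u \<in> carrier (kq (tail Q e))" "b = pr (tail Q e) u" using b by (rule prE[OF ev(2)])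
 have eu: "emb (tail Q e) u \<in> carrier PA" by (rule emb_closed[OF ev(2) u(1)])
 show ?thesis
 proof (rule vanishingI[of _ "w \<otimes>\<^bsub>PA\<^esub> emb (tail Q e) u"])
  show "cover_class2 e (ract (Cov e) p b) = cl2 (w \<otimes>\<^bsub>PA\<^esub> emb (tail Q e) u)"
   unfolding cover_class_ract[OF cover_class_context e w(1) b] w(4) unfolding u(2) vertex_class_pr[OF cover_class_context ev(2) u(1)]
   by (rule q.hom_mult[OF w(3) eu, symmetric])
  show "(w \<otimes>\<^bsub>PA\<^esub> emb (tail Q e) u) y = \<zero>\<^bsub>K\<^esub>" by (rule AQ.bottom_coefficient_right[OF eu w(2) y w(5)])
 qed (rule D.P.ract_closed[OF b w(1)], rule L.I_r_closed[OF w(2) eu])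
qed

lemma vanishing_subbimodule:
 assumes y: "length (fst (snd y)) = 1"
 shows "subbimodule K (A (head Q e)) (A (tail Q e)) (Cov e) (vanishing y)"
 unfolding subbimodule_def
proof (intro conjI ballI)
 have sm: "c \<odot>\<^bsub>Cov e\<^esub> p \<in> vanishing y" if c: "c \<in> carrier K" and p: "p \<in> vanishing y" for c p
 proof -
  have one: "\<one>\<^bsub>A (head Q e)\<^esub> \<in> carrier (A (head Q e))" by (rule A_closed(2)[OF ends(1)[OF e]])
  have pc: "p \<in> carrier (Cov e)" using p by (rule vanishingE)
  have a: "c \<odot>\<^bsub>A (head Q e)\<^esub> \<one>\<^bsub>A (head Q e)\<^esub> \<in> carrier (A (head Q e))"
   by (rule module.smult_closed[OF module_A[OF ends(1)[OF e]] c one])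
  show ?thesis using vanishing_lact[OF p a y] unfolding D.P.lact_smult[OF c one pc] D.P.lact_one[OF pc] .
 qed
 show "submodule (vanishing y) K (Cov e)"
 proof (rule D.P.vec.submoduleI)
  fix p assume p: "p \<in> vanishing y"
  have pc: "p \<in> carrier (Cov e)" using p by (rule vanishingE)
  have "\<ominus>\<^bsub>Cov e\<^esub> p = (\<ominus>\<^bsub>K\<^esub> \<one>\<^bsub>K\<^esub>) \<odot>\<^bsub>Cov e\<^esub> p"
   using module.smult_l_minus[OF D.P.vec.module_axioms base.one_closed pc] module.smult_one[OF D.P.vec.module_axioms pc]
   by simp
  then show "\<ominus>\<^bsub>Cov e\<^esub> p \<in> vanishing y" using sm[OF _ p] by simp
 qed (use vanishing_zero vanishing_add sm in "auto simp: vanishing_def")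
qed (use vanishing_lact vanishing_ract y in blast)+

lemma long_representative:
 assumes "p \<in> carrier (Cov e)"
 shows "\<exists>w\<in>Long 1. cover_class2 e p = cl2 w \<and>
  (\<forall>y. length (fst (snd y)) = 1 --> (\<forall>g\<in>new e. fst (snd y) \<noteq> [Inr (e, g)]) --> w y = \<zero>\<^bsub>K\<^esub>)"
 using assms
proof (rule cover_induct[OF e])
 show "\<exists>w\<in>Long 1. cover_class2 e \<zero>\<^bsub>Cov e\<^esub> = cl2 w \<and>
  (\<forall>y. length (fst (snd y)) = 1 --> (\<forall>g\<in>new e. fst (snd y) \<noteq> [Inr (e, g)]) --> w y = \<zero>\<^bsub>K\<^esub>)"
 proof (intro bexI[OF _ L.zero_closed] conjI allI impI)
  show "cover_class2 e \<zero>\<^bsub>Cov e\<^esub> = Long 2 +>\<^bsub>PA\<^esub> \<zero>\<^bsub>PA\<^esub>"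
   unfolding ta.zero q.zero ..
 qed simp
next
 fix g u v assume atom: "g \<in> new e" "u \<in> carrier (kq (head Q e))" "v \<in> carrier (kq (tail Q e))"
 show "\<exists>w\<in>Long 1. cover_class2 e (cover_atom e g u v) = cl2 w \<and>
  (\<forall>y. length (fst (snd y)) = 1 --> (\<forall>g\<in>new e. fst (snd y) \<noteq> [Inr (e, g)]) --> w y = \<zero>\<^bsub>K\<^esub>)"
  by (rule bexI[OF _ path_atom_long(1)[OF e atom]])
   (use path_atom_long(2)[OF e atom] cover_class_atom[OF cover_class_context e atom] atom(1) in blast)
next
 fix p p' assume p: "p \<in> carrier (Cov e)" "p' \<in> carrier (Cov e)"
  "\<exists>w\<in>Long 1. cover_class2 e p = cl2 w \<and>
  (\<forall>y. length (fst (snd y)) = 1 --> (\<forall>g\<in>new e. fst (snd y) \<noteq> [Inr (e, g)]) --> w y = \<zero>\<^bsub>K\<^esub>)"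
  "\<exists>w\<in>Long 1. cover_class2 e p' = cl2 w \<and>
  (\<forall>y. length (fst (snd y)) = 1 --> (\<forall>g\<in>new e. fst (snd y) \<noteq> [Inr (e, g)]) --> w y = \<zero>\<^bsub>K\<^esub>)"
 obtain w where w: "w \<in> Long 1" "cover_class2 e p = cl2 w"
  "\<And>y. length (fst (snd y)) = 1 ==> \<forall>g\<in>new e. fst (snd y) \<noteq> [Inr (e, g)] ==> w y = \<zero>\<^bsub>K\<^esub>"
  using p(3) by blast
 obtain w' where w': "w' \<in> Long 1" "cover_class2 e p' = cl2 w'"
  "\<And>y. length (fst (snd y)) = 1 ==> \<forall>g\<in>new e. fst (snd y) \<noteq> [Inr (e, g)] ==> w' y = \<zero>\<^bsub>K\<^esub>"
  using p(4) by blast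
 show "\<exists>w\<in>Long 1. cover_class2 e (p \<oplus>\<^bsub>Cov e\<^esub> p') = cl2 w \<and>
  (\<forall>y. length (fst (snd y)) = 1 --> (\<forall>g\<in>new e. fst (snd y) \<noteq> [Inr (e, g)]) --> w y = \<zero>\<^bsub>K\<^esub>)"
 proof (intro bexI[OF _ L.a_closed[OF w(1) w'(1)]] conjI allI impI)
  show "cover_class2 e (p \<oplus>\<^bsub>Cov e\<^esub> p') = cl2 (w \<oplus>\<^bsub>PA\<^esub> w')"
   unfolding ta.add[OF p(1,2)] w(2) w'(2)
   by (rule q.hom_add[symmetric, OF AQ.long_part_closed[OF w(1)] AQ.long_part_closed[OF w'(1)]])
  show "(w \<oplus>\<^bsub>PA\<^esub> w') y = \<zero>\<^bsub>K\<^esub>"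
   if "length (fst (snd y)) = 1" "\<forall>g\<in>new e. fst (snd y) \<noteq> [Inr (e, g)]" for y
   using w(3)[OF that] w'(3)[OF that] by simp
 qed
qed

text \<open>This is where minimality of the cover enters. Suppose that a kernel element \<open>r\<close> has a lift with nonzero coefficient
 at a new arrow \<open>g\<close>. Subtracting multiples of \<open>r\<close>, every element of the cover can be moved into the subbimodule of
 elements whose coefficient at \<open>g\<close> vanishes. As the kernel is superfluous, this subbimodule is the whole cover; but
 it does not contain the generator of the summand \<open>g\<close>.\<close>

lemma cover_kernel_long:
 assumes r: "r \<in> carrier (Cov e)" "cmap e r = \<zero>\<^bsub>M e\<^esub>"
  and x: "x \<in> carrier PA" "cover_class2 e r = cl2 x"
 shows "x \<in> Long 2"
proof -
 obtain w where w: "w \<in> Long 1" "cover_class2 e r = cl2 w"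
  "\<And>y. length (fst (snd y)) = 1 ==> \<forall>g\<in>new e. fst (snd y) \<noteq> [Inr (e, g)] ==> w y = \<zero>\<^bsub>K\<^esub>"
  using long_representative[OF r(1)] by blast
 have xw: "cl2 x = cl2 w" using x(2) w(2) by (rule trans[OF sym])
 have x1: "x \<in> Long 1" by (rule long_part_coset(1)[OF w(1) x(1) xw])
 interpret cm: linear_map K "Cov e" "M e" "cmap e" by (rule linear_cover_map[OF e])
 have "x y = \<zero>\<^bsub>K\<^esub>" if y: "length (fst (snd y)) = 1" for y
 proof (cases "\<forall>g\<in>new e. fst (snd y) \<noteq> [Inr (e, g)]")
  case True
  show ?thesis unfolding long_part_coset(2)[OF w(1) x(1) xw y] by (rule w(3)[OF y True])
 next
  case False
  then obtain g where g: "g \<in> new e" "fst (snd y) = [Inr (e, g)]" by blast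
  show ?thesis
  proof (rule ccontr)
   assume xy: "x y \<noteq> \<zero>\<^bsub>K\<^esub>"
   have "y \<in> qpaths AQ" by (rule AQ.support_path[OF x(1) xy])
   then have yeq: "y = (head AQ (Inr (e, g)), [Inr (e, g)], tail AQ (Inr (e, g)))"
    using g(2) by (cases y) auto
   have xyK: "x y \<in> carrier K" by (rule AQ.coefficient_closed[OF x(1)])
   have "carrier (Cov e) \<subseteq> vanishing y <+>\<^bsub>Cov e\<^esub> a_kernel (Cov e) (M e) (cmap e)"
   proof
    fix p assume p: "p \<in> carrier (Cov e)"
    obtain z where z: "z \<in> Long 1" "cover_class2 e p = cl2 z"
     using long_representative[OF p] by blast
    note zc = AQ.long_part_closed[OF z(1)]
    have zy: "z y \<in> carrier K" by (rule AQ.coefficient_closed[OF zc])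
    \<comment> \<open>With this scalar, \<open>p - c r\<close> has coefficient zero at \<open>y\<close>.\<close>
    define c where "c = z y \<otimes>\<^bsub>K\<^esub> inv\<^bsub>K\<^esub> (x y)"
    have ix: "inv\<^bsub>K\<^esub> (x y) \<in> carrier K" "inv\<^bsub>K\<^esub> (x y) \<otimes>\<^bsub>K\<^esub> x y = \<one>\<^bsub>K\<^esub>"
     using xyK xy base.field_Units by (auto intro: base.Units_l_inv)
    have c: "c \<in> carrier K" unfolding c_def using zy ix(1) by simp
    have cx: "c \<otimes>\<^bsub>K\<^esub> x y = z y" unfolding c_def using zy ix xyK by (simp add: base.m_assoc)
    let ?s = "c \<odot>\<^bsub>Cov e\<^esub> r"
    have s: "?s \<in> carrier (Cov e)" by (rule module.smult_closed[OF D.P.vec.module_axioms c r(1)])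
    have sx: "c \<odot>\<^bsub>PA\<^esub> x \<in> carrier PA" by (rule module.smult_closed[OF AQ.kQ.vec.module_axioms c x(1)])
    have d: "p \<ominus>\<^bsub>Cov e\<^esub> ?s \<in> vanishing y"
    proof (rule vanishingI[of _ "z \<ominus>\<^bsub>PA\<^esub> c \<odot>\<^bsub>PA\<^esub> x"])
     show "p \<ominus>\<^bsub>Cov e\<^esub> ?s \<in> carrier (Cov e)" using p s by simp
     have "c \<odot>\<^bsub>PA\<^esub> x \<in> Long 1" by (rule L.smult_closed[OF c x1])
     then have "\<ominus>\<^bsub>PA\<^esub> (c \<odot>\<^bsub>PA\<^esub> x) \<in> Long 1" by (rule L.a_inv_closed)
     then show "z \<ominus>\<^bsub>PA\<^esub> c \<odot>\<^bsub>PA\<^esub> x \<in> Long 1" unfolding a_minus_def by (rule L.a_closed[OF z(1)])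
     show "cover_class2 e (p \<ominus>\<^bsub>Cov e\<^esub> ?s) = cl2 (z \<ominus>\<^bsub>PA\<^esub> c \<odot>\<^bsub>PA\<^esub> x)"
      unfolding ta.minus[OF p s] ta.smult[OF c r(1)] z(2) x(2) q.minus[OF zc sx] q.smult[OF c x(1)] ..
     have "z = (z \<ominus>\<^bsub>PA\<^esub> c \<odot>\<^bsub>PA\<^esub> x) \<oplus>\<^bsub>PA\<^esub> c \<odot>\<^bsub>PA\<^esub> x"
      using zc sx by (simp add: a_minus_def AQ.kQ.alg.a_assoc AQ.kQ.alg.l_neg del: path_algebra_simps)
     then have "z y = (z \<ominus>\<^bsub>PA\<^esub> c \<odot>\<^bsub>PA\<^esub> x) y \<oplus>\<^bsub>K\<^esub> z y"
      using cx by (metis path_algebra_simps(3,4))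
     then show "(z \<ominus>\<^bsub>PA\<^esub> c \<odot>\<^bsub>PA\<^esub> x) y = \<zero>\<^bsub>K\<^esub>"
      using base.add.r_cancel_one'[OF zy AQ.coefficient_closed[OF AQ.kQ.alg.minus_closed[OF zc sx]]] by blast
    qed
    have "cmap e ?s = \<zero>\<^bsub>M e\<^esub>"
     unfolding cm.smult[OF c r(1)] r(2) by (rule module.smult_r_null[OF module_M[OF e] c])
    then have k: "?s \<in> a_kernel (Cov e) (M e) (cmap e)" using s by (simp add: a_kernel_def')
    have "p = (p \<ominus>\<^bsub>Cov e\<^esub> ?s) \<oplus>\<^bsub>Cov e\<^esub> ?s"
     using p s by (simp add: a_minus_def D.P.vec.M.a_assoc D.P.vec.M.l_neg)
    then show "p \<in> vanishing y <+>\<^bsub>Cov e\<^esub> a_kernel (Cov e) (M e) (cmap e)"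
     unfolding set_add_def' using d k by blast
   qed
   moreover have "vanishing y <+>\<^bsub>Cov e\<^esub> a_kernel (Cov e) (M e) (cmap e) \<subseteq> carrier (Cov e)"
    unfolding set_add_def' a_kernel_def' vanishing_def by auto
   ultimately have "vanishing y = carrier (Cov e)"
    using cover_projective[OF e] vanishing_subbimodule[OF y] unfolding projective_cover_def by blast
   note n = new_vertices[OF e g(1)]
   let ?arr = "path_arrow K AQ (Inr (e, g))"
   have ap: "?arr \<in> carrier PA" by (rule new_arrow_closed[OF e g(1)])
   have "cover_atom e g (vh e g) (vt e g) \<in> vanishing y"
    unfolding \<open>vanishing y = _\<close> by (rule cover_atom_lact(2)[OF e g(1) n n(1)])
   then obtain z where z: "z \<in> Long 1" "cover_class2 e (cover_atom e g (vh e g) (vt e g)) = cl2 z" "z y = \<zero>\<^bsub>K\<^esub>"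
    by (rule vanishingE)
   have "cl2 ?arr = cl2 z"
    using z(2) unfolding cover_class_atom[OF cover_class_context e g(1) n] vertex_mult_path_atom[OF e g(1)] .
   then have "?arr y = z y" by (rule long_part_coset(2)[OF z(1) ap _ y])
   then show False using z(3) base.one_not_zero unfolding yeq path_arrow_def by simp
  qed
 qed
 then have "2 \<le> length (fst (snd y))" if "x y \<noteq> \<zero>\<^bsub>K\<^esub>" for y
 proof -
  have "1 \<le> length (fst (snd y))" using x1 that unfolding AQ.long_part_def by blast
  moreover have "length (fst (snd y)) \<noteq> 1" using \<open>\<And>y. length (fst (snd y)) = 1 ==> x y = \<zero>\<^bsub>K\<^esub>\<close> that by blast
  ultimately show ?thesis by simp
 qed
 then show ?thesis using x(1) unfolding AQ.long_part_def by blast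
qed

end

lemma relations_long:
 assumes l: "kernel_lifts K Q A M qt I \<psi> C l"
 shows "Idl\<^bsub>PA\<^esub> (assembled_relations K Q M I C l) \<subseteq> Long 2"
proof (rule AQ.kQ.alg.genideal_minimal[OF AQ.long_part_ideal])
 show "assembled_relations K Q M I C l \<subseteq> Long 2"
 proof
  fix x assume "x \<in> assembled_relations K Q M I C l"
  then show "x \<in> Long 2"
  proof (rule Rels_cases[OF l])
   fix i u assume "i \<in> verts Q" "u \<in> I i" "x = emb i u"
   then show ?thesis
    by (intro subsetD[OF vertex_relations_long]) (auto simp: vertex_relations_def)
  next
   fix e r assume *: "e \<in> arcs Q" "r \<in> carrier (Cov e)" "cmap e r = \<zero>\<^bsub>M e\<^esub>" "x = l e r"
   have lift: "lifts_cover_element K Q A qt I \<psi> C e r (l e r)" by (rule lift_kernel[OF l *(1-3)])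
   have c: "l e r \<in> carrier PA" by (rule lifts_cover_elementE[OF lift])
   show ?thesis unfolding *(4)
    by (rule cover_kernel_long[OF *(1-3) c cover_class_lift[OF cover_class_context *(1) lift]])
  qed
 qed
qed

text \<open>Forgetting the arrows of the quivers at the vertices gives a path of \<open>Q\<close>; its length counts the new arrows.\<close>

lemma project_path: "(j, p, i) \<in> qpaths AQ ==>
  (fst j, concat (map (case_sum (\<lambda>_. []) (\<lambda>z. [fst z])) p), fst i) \<in> qpaths Q"
proof (induction p arbitrary: j)
 case Nil
 then show ?case by (auto simp: AQ_simps)
next
 case (Cons a p)
 then have a: "a \<in> arcs AQ" "head AQ a = j" and IH: "(fst (tail AQ a), concat (map (case_sum (\<lambda>_. []) (\<lambda>z. [fst z])) p), fst i) \<in> qpaths Q"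
  by auto
 show ?case
 proof (cases a)
  case (Inl z)
  then show ?thesis using a IH by (cases z) (auto simp: AQ_simps)
 next
  case (Inr z)
  then show ?thesis using a IH by (cases z) (auto simp: AQ_simps)
 qed
qed

lemma few_new_arrows:
 assumes Q: "acyclic_quiver Q" and p: "(j, p, i) \<in> qpaths AQ"
 shows "length (filter (\<lambda>a. \<not> isl a) p) < card (verts Q)"
proof -
 have "length (filter (\<lambda>a. \<not> isl a) p) = length (concat (map (case_sum (\<lambda>_. []) (\<lambda>z. [fst z])) p))"
  by (induction p) (auto split: sum.splits)
 then show ?thesis using acyclic_qpath_length[OF Q project_path[OF p]] by simp
qed

lemma vertex_path:
 assumes "(j, p, i) \<in> qpaths AQ" "list_all isl p"
 shows "\<exists>k\<in>verts Q. \<exists>x\<in>qpaths (qt k). embed_path k x = (j, p, i)"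
 using assms
proof (induction p arbitrary: j)
 case Nil
 then have j: "fst j \<in> verts Q" "snd j \<in> verts (qt (fst j))" "j = i" by (auto simp: AQ_simps)
 interpret q: finite_quiver K "qt (fst j)" by (rule qt_finite[OF j(1)])
 show ?case
 proof (rule bexI[OF _ j(1)], rule bexI[of _ "(snd j, [], snd j)"])
  show "embed_path (fst j) (snd j, [], snd j) = (j, [], i)" by (simp add: embed_path_def j(3)[symmetric])
  show "(snd j, [], snd j) \<in> qpaths (qt (fst j))" using j(2) by simp
 qed
next
 case (Cons a p)
 then have a: "a \<in> arcs AQ" "head AQ a = j" "isl a" and p: "(tail AQ a, p, i) \<in> qpaths AQ" "list_all isl p"
  by auto
 obtain k x where x: "k \<in> verts Q" "x \<in> qpaths (qt k)" "embed_path k x = (tail AQ a, p, i)"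
  using Cons.IH[OF p] by blast
 obtain h b where ab: "a = Inl (h, b)" using a(3) by (cases a) auto
 have b: "h \<in> verts Q" "b \<in> arcs (qt h)" using a(1) ab by (auto simp: AQ_simps)
 obtain t r s where xd: "x = (t, r, s)" by (cases x)
 have ev: "k = h" "t = tail (qt h) b" "p = map (\<lambda>b. Inl (h, b)) r" "i = (h, s)"
  using x(3) ab xd by (auto simp: embed_path_def AQ_simps)
 interpret q: finite_quiver K "qt h" by (rule qt_finite[OF b(1)])
 show ?case
  by (rule bexI[OF _ b(1)], rule bexI[of _ "(head (qt h) b, b # r, s)"])
   (use ev x(2) xd b a(2) ab in "auto simp: embed_path_def AQ_simps")
qed

text \<open>A path of the assembled quiver has fewer than \<open>card (verts Q)\<close> new arrows, because \<open>Q\<close> is acyclic. So a long path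
 contains a long infix inside the quiver at a single vertex \<open>h\<close>, and there long paths lie in \<open>I h\<close>.\<close>

lemma long_paths_in_relations:
 assumes Q: "acyclic_quiver Q" and l: "kernel_lifts K Q A M qt I \<psi> C l"
 shows "\<exists>m\<ge>2. Long m \<subseteq> Idl\<^bsub>PA\<^esub> (assembled_relations K Q M I C l)"
proof -
 let ?R = "Idl\<^bsub>PA\<^esub> (assembled_relations K Q M I C l)"
 interpret R: ideal ?R PA by (rule AQ.kQ.alg.genideal_ideal[OF Rels_subset[OF l]])
 have "\<exists>n. finite_quiver.long_part K (qt i) n \<subseteq> I i" if i: "i \<in> verts Q" for i
 proof -
  interpret q: finite_quiver K "qt i" by (rule qt_finite[OF i])
  show ?thesis using presentation[OF i] unfolding presents_def q.admissible_iff by blast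
 qed
 then obtain n where n: "\<And>i. i \<in> verts Q ==> finite_quiver.long_part K (qt i) (n i) \<subseteq> I i" by metis
 define m where "m = Suc (\<Sum>i\<in>verts Q. n i)"
 have nm: "n i \<le> m" if "i \<in> verts Q" for i
  using member_le_sum[of i "verts Q" n] that by (simp add: m_def)
 \<comment> \<open>The summand \<open>2\<close> only ensures that the exponent is at least two.\<close>
 let ?N = "(card (verts Q) + 1) * m + 2"
 have "Long ?N \<subseteq> ?R"
 proof (rule AQ.long_part_subset[OF AQ.kQ.ideal_submodule[OF R.ideal_axioms]])
  fix x assume x: "x \<in> qpaths AQ" "?N \<le> length (fst (snd x))"
  obtain j p i where xd: "x = (j, p, i)" by (cases x)
  have f: "length (filter (\<lambda>a. \<not> isl a) p) < card (verts Q)" using few_new_arrows[OF Q] x(1) xd by simp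
  have "(length (filter (\<lambda>a. \<not> isl a) p) + 1) * m \<le> (card (verts Q) + 1) * m"
   using f by (intro mult_right_mono) auto
  also have "... \<le> length p" using x(2) xd by simp
  finally have "(length (filter (\<lambda>a. \<not> isl a) p) + 1) * m \<le> length p" .
  then obtain us vs ws where p: "p = us @ vs @ ws" "length vs = m" "list_all isl vs"
   by (rule infix_of_few_exceptions) (simp add: m_def)
  obtain k where k: "(j, us, k) \<in> qpaths AQ" "(k, vs @ ws, i) \<in> qpaths AQ"
   "single K x = single K (j, us, k) \<otimes>\<^bsub>PA\<^esub> single K (k, vs @ ws, i)"
   using x(1) unfolding xd p(1) by (rule AQ.single_append)
  obtain k' where k': "(k, vs, k') \<in> qpaths AQ" "(k', ws, i) \<in> qpaths AQ"
   "single K (k, vs @ ws, i) = single K (k, vs, k') \<otimes>\<^bsub>PA\<^esub> single K (k', ws, i)"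
   using k(2) by (rule AQ.single_append)
  obtain h y where y: "h \<in> verts Q" "y \<in> qpaths (qt h)" "embed_path h y = (k, vs, k')"
   using vertex_path[OF k'(1) p(3)] by blast
  interpret q: finite_quiver K "qt h" by (rule qt_finite[OF y(1)])
  have ly: "length (fst (snd y)) = m" using y(3) p(2) by (cases y) (auto simp: embed_path_def)
  have "single K y \<in> I h"
   by (rule subsetD[OF n[OF y(1)] q.single_long[OF y(2)]]) (use nm[OF y(1)] ly in simp)
  then have "emb h (single K y) \<in> ?R"
   by (intro subsetD[OF AQ.kQ.alg.genideal_self[OF Rels_subset[OF l]]])
    (use y(1) in "auto simp: assembled_relations_def vertex_relations_def")
  then have v: "single K (k, vs, k') \<in> ?R" unfolding emb_single y(3) .
  show "single K x \<in> ?R" unfolding k(3) k'(3)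
   by (rule R.I_l_closed[OF R.I_r_closed[OF v AQ.single_path[OF k'(2)]] AQ.single_path[OF k(1)]])
 qed
 then show ?thesis by (intro exI[of _ ?N]) simp
qed

theorem assembled_relations_admissible:
 assumes "acyclic_quiver Q" "kernel_lifts K Q A M qt I \<psi> C l"
 shows "admissible K AQ (Idl\<^bsub>PA\<^esub> (assembled_relations K Q M I C l))"
 unfolding AQ.admissible_iff
 using AQ.kQ.alg.genideal_ideal[OF Rels_subset[OF assms(2)]] relations_long[OF assms(2)]
  long_paths_in_relations[OF assms] by blast

end

section \<open>The double of a species\<close>

lemma transport_simps:
 "carrier (transport h h' M) = h ` carrier M" "zero (transport h h' M) = h \<zero>\<^bsub>M\<^esub>"
 "add (transport h h' M) = (\<lambda>x y. h (h' x \<oplus>\<^bsub>M\<^esub> h' y))" "smult (transport h h' M) = (\<lambda>c x. h (c \<odot>\<^bsub>M\<^esub> h' x))"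
 "lact (transport h h' M) = (\<lambda>b x. h (lact M b (h' x)))" "ract (transport h h' M) = (\<lambda>x a. h (ract M (h' x) a))"
 by (simp_all add: transport_def)

lemma bimodule_transport:
 assumes M: "bimodule K B A M" and inv: "\<And>x. x \<in> carrier M ==> h' (h x) = x"
 shows "bimodule K B A (transport h h' M)"
proof -
 interpret M: bimodule K B A M by (rule M)
 have "abelian_group (transport h h' M)"
 proof (rule abelian_groupI)
  fix x assume "x \<in> carrier (transport h h' M)"
  then obtain a where a: "a \<in> carrier M" "x = h a" by (auto simp: transport_simps)
  show "\<exists>y\<in>carrier (transport h h' M). y \<oplus>\<^bsub>transport h h' M\<^esub> x = \<zero>\<^bsub>transport h h' M\<^esub>"
   by (rule bexI[of _ "h (\<ominus>\<^bsub>M\<^esub> a)"]) (use a in "auto simp: transport_simps inv M.vec.M.l_neg")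
 qed (auto simp: transport_simps inv M.vec.M.a_ac)
 then have "Module.module K (transport h h' M)"
  by (intro moduleI M.left.base.is_cring)
   (auto simp: transport_simps inv M.vec.smult_l_distr M.vec.smult_r_distr M.vec.smult_assoc1)
 then show ?thesis
  by (intro bimodule.intro bimodule_axioms.intro M.left.assoc_algebra_axioms M.right.assoc_algebra_axioms)
   (auto simp: transport_simps inv M.lact_closed M.ract_closed M.lact_add_left M.lact_add_right
    M.ract_add_left M.ract_add_right M.lact_mult M.ract_mult M.lact_one M.ract_one M.lact_ract M.lact_smult M.ract_smult)
qed

context bimodule
begin

text \<open>The ground field acts through the multiples of the unit of \<open>A\<close>.\<close>

lemma linear_over_ground:
 assumes f: "f \<in> right_hom A M (regular_bimodule A)" and c: "c \<in> carrier K" and x: "x \<in> carrier M"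
 shows "f (c \<odot>\<^bsub>M\<^esub> x) = c \<odot>\<^bsub>A\<^esub> f x"
proof -
 have one: "\<one>\<^bsub>A\<^esub> \<in> carrier A" by (rule right.alg.one_closed)
 have fx: "f x \<in> carrier A" using f x by (auto simp: right_hom_def regular_bimodule_def module.defs bimodule.defs)
 have "c \<odot>\<^bsub>M\<^esub> x = ract M x (c \<odot>\<^bsub>A\<^esub> \<one>\<^bsub>A\<^esub>)"
  using ract_smult[OF c one x] ract_one[OF x] by simp
 then have "f (c \<odot>\<^bsub>M\<^esub> x) = f x \<otimes>\<^bsub>A\<^esub> (c \<odot>\<^bsub>A\<^esub> \<one>\<^bsub>A\<^esub>)"
  using f x module.smult_closed[OF right.vec.module_axioms c one]
  by (simp add: right_hom_def regular_bimodule_def module.defs bimodule.defs)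
 also have "... = c \<odot>\<^bsub>A\<^esub> f x"
  using right.smult_mult_right[OF c fx one] right.alg.r_one[OF fx] by simp
 finally show ?thesis .
qed

lemma right_dual_carrier:
 "f \<in> carrier (right_dual A M) \<longleftrightarrow> f \<in> extensional (carrier M) \<and> (\<forall>x\<in>carrier M. f x \<in> carrier A) \<and>
   (\<forall>x\<in>carrier M. \<forall>y\<in>carrier M. f (x \<oplus>\<^bsub>M\<^esub> y) = f x \<oplus>\<^bsub>A\<^esub> f y) \<and>
   (\<forall>a\<in>carrier A. \<forall>x\<in>carrier M. f (ract M x a) = f x \<otimes>\<^bsub>A\<^esub> a)"
 by (auto simp: right_dual_def right_hom_def regular_bimodule_def module.defs bimodule.defs)

lemma right_dual_simps:
 "zero (right_dual A M) = (\<lambda>x\<in>carrier M. \<zero>\<^bsub>A\<^esub>)"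
 "add (right_dual A M) = (\<lambda>f g. \<lambda>x\<in>carrier M. f x \<oplus>\<^bsub>A\<^esub> g x)"
 "smult (right_dual A M) = (\<lambda>c f. \<lambda>x\<in>carrier M. c \<odot>\<^bsub>A\<^esub> f x)"
 "lact (right_dual A M) = (\<lambda>a f. \<lambda>x\<in>carrier M. a \<otimes>\<^bsub>A\<^esub> f x)"
 "ract (right_dual A M) = (\<lambda>f b. \<lambda>x\<in>carrier M. f (lact M b x))"
 by (simp_all add: right_dual_def)

lemma right_dual_smult:
 assumes "f \<in> carrier (right_dual A M)" "c \<in> carrier K" "x \<in> carrier M"
 shows "f (c \<odot>\<^bsub>M\<^esub> x) = c \<odot>\<^bsub>A\<^esub> f x"
 using assms by (intro linear_over_ground) (auto simp: right_dual_def)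

lemma bimodule_right_dual: "bimodule K A B (right_dual A M)"
proof -
 let ?D = "right_dual A M"
 note c = vec.M.a_closed vec.smult_closed ract_closed lact_closed
 note ra = right.alg.a_closed right.alg.m_closed right.alg.zero_closed right.alg.a_inv_closed right.alg.one_closed
  module.smult_closed[OF right.vec.module_axioms]
 note sm = module.smult_l_distr[OF right.vec.module_axioms] module.smult_r_distr[OF right.vec.module_axioms]
  module.smult_assoc1[OF right.vec.module_axioms] module.smult_one[OF right.vec.module_axioms]
 have val: "f x \<in> carrier A" if "f \<in> carrier ?D" "x \<in> carrier M" for f x
  using that by (simp add: right_dual_carrier)
 have addv: "f (x \<oplus>\<^bsub>M\<^esub> y) = f x \<oplus>\<^bsub>A\<^esub> f y" if "f \<in> carrier ?D" "x \<in> carrier M" "y \<in> carrier M" for f x y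
  using that by (simp add: right_dual_carrier)
 have ext: "f = g" if "f \<in> extensional (carrier M)" "g \<in> extensional (carrier M)" "\<And>x. x \<in> carrier M ==> f x = g x" for f g
  using that by (rule extensionalityI)
 have exD: "f \<in> extensional (carrier M)" if "f \<in> carrier ?D" for f using that by (simp add: right_dual_carrier)
 have add_in: "f \<oplus>\<^bsub>?D\<^esub> g \<in> carrier ?D" if "f \<in> carrier ?D" "g \<in> carrier ?D" for f g
  using that by (auto simp: right_dual_carrier right_dual_simps c ra right.alg.l_distr right.alg.a_ac)
 have zero_in: "\<zero>\<^bsub>?D\<^esub> \<in> carrier ?D" by (auto simp: right_dual_carrier right_dual_simps c)
 have smult_in: "k \<odot>\<^bsub>?D\<^esub> f \<in> carrier ?D" if "k \<in> carrier K" "f \<in> carrier ?D" for k f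
  using that by (auto simp: right_dual_carrier right_dual_simps c ra sm right.smult_mult_left)
 have lact_in: "lact ?D a f \<in> carrier ?D" if "a \<in> carrier A" "f \<in> carrier ?D" for a f
  using that by (auto simp: right_dual_carrier right_dual_simps c ra right.alg.r_distr right.alg.m_assoc)
 have ract_in: "ract ?D f b \<in> carrier ?D" if "b \<in> carrier B" "f \<in> carrier ?D" for b f
  using that by (auto simp: right_dual_carrier right_dual_simps c ra lact_add_right lact_ract[symmetric])
 have grp: "abelian_group ?D"
 proof (rule abelian_groupI)
  fix f assume f: "f \<in> carrier ?D"
  show "\<exists>g\<in>carrier ?D. g \<oplus>\<^bsub>?D\<^esub> f = \<zero>\<^bsub>?D\<^esub>"
  proof (rule bexI[of _ "\<lambda>x\<in>carrier M. \<ominus>\<^bsub>A\<^esub> f x"])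
   show "(\<lambda>x\<in>carrier M. \<ominus>\<^bsub>A\<^esub> f x) \<oplus>\<^bsub>?D\<^esub> f = \<zero>\<^bsub>?D\<^esub>"
    unfolding right_dual_simps by (rule restrict_ext) (use f in "simp add: val right.alg.l_neg")
   show "(\<lambda>x\<in>carrier M. \<ominus>\<^bsub>A\<^esub> f x) \<in> carrier ?D"
    using f by (auto simp: right_dual_carrier c ra right.alg.minus_add right.alg.l_minus)
  qed
 next
  fix f g k assume f: "f \<in> carrier ?D" and g: "g \<in> carrier ?D" and k: "k \<in> carrier ?D"
  show "f \<oplus>\<^bsub>?D\<^esub> g \<oplus>\<^bsub>?D\<^esub> k = f \<oplus>\<^bsub>?D\<^esub> (g \<oplus>\<^bsub>?D\<^esub> k)"
   unfolding right_dual_simps by (rule restrict_ext) (use f g k in "simp add: val right.alg.a_assoc")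
 next
  fix f g assume f: "f \<in> carrier ?D" and g: "g \<in> carrier ?D"
  show "f \<oplus>\<^bsub>?D\<^esub> g = g \<oplus>\<^bsub>?D\<^esub> f"
   unfolding right_dual_simps by (rule restrict_ext) (use f g in "simp add: val right.alg.a_comm")
 next
  fix f assume f: "f \<in> carrier ?D"
  show "\<zero>\<^bsub>?D\<^esub> \<oplus>\<^bsub>?D\<^esub> f = f"
   by (rule ext[OF exD[OF add_in[OF zero_in f]] exD[OF f]]) (use f in "simp add: right_dual_simps val")
 qed (rule add_in zero_in; assumption?)+
 have mod: "Module.module K ?D"
 proof (rule moduleI[OF left.base.is_cring grp smult_in])
  fix k l f assume kl: "k \<in> carrier K" "l \<in> carrier K" "f \<in> carrier ?D"
  show "(k \<oplus>\<^bsub>K\<^esub> l) \<odot>\<^bsub>?D\<^esub> f = k \<odot>\<^bsub>?D\<^esub> f \<oplus>\<^bsub>?D\<^esub> l \<odot>\<^bsub>?D\<^esub> f"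
   unfolding right_dual_simps by (rule restrict_ext) (use kl in "simp add: val sm")
  show "(k \<otimes>\<^bsub>K\<^esub> l) \<odot>\<^bsub>?D\<^esub> f = k \<odot>\<^bsub>?D\<^esub> (l \<odot>\<^bsub>?D\<^esub> f)"
   unfolding right_dual_simps by (rule restrict_ext) (use kl in "simp add: val sm")
 next
  fix k f g assume kf: "k \<in> carrier K" "f \<in> carrier ?D" "g \<in> carrier ?D"
  show "k \<odot>\<^bsub>?D\<^esub> (f \<oplus>\<^bsub>?D\<^esub> g) = k \<odot>\<^bsub>?D\<^esub> f \<oplus>\<^bsub>?D\<^esub> k \<odot>\<^bsub>?D\<^esub> g"
   unfolding right_dual_simps by (rule restrict_ext) (use kf in "simp add: val sm")
 next
  fix f assume f: "f \<in> carrier ?D"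
  show "\<one>\<^bsub>K\<^esub> \<odot>\<^bsub>?D\<^esub> f = f"
   by (rule ext[OF exD[OF smult_in[OF left.base.one_closed f]] exD[OF f]]) (use f in "simp add: right_dual_simps val sm")
 qed
 show ?thesis
 proof (intro bimodule.intro bimodule_axioms.intro left.assoc_algebra_axioms right.assoc_algebra_axioms mod lact_in ract_in)
  fix a f assume "a \<in> carrier A" "f \<in> carrier ?D"
  note af = this
  fix a' assume a': "a' \<in> carrier A"
  show "lact ?D (a \<oplus>\<^bsub>A\<^esub> a') f = lact ?D a f \<oplus>\<^bsub>?D\<^esub> lact ?D a' f"
   unfolding right_dual_simps by (rule restrict_ext) (use af a' in "simp add: val right.alg.l_distr")
  show "lact ?D (a \<otimes>\<^bsub>A\<^esub> a') f = lact ?D a (lact ?D a' f)"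
   unfolding right_dual_simps by (rule restrict_ext) (use af a' in "simp add: val right.alg.m_assoc")
 next
  fix a f g assume af: "a \<in> carrier A" "f \<in> carrier ?D" "g \<in> carrier ?D"
  show "lact ?D a (f \<oplus>\<^bsub>?D\<^esub> g) = lact ?D a f \<oplus>\<^bsub>?D\<^esub> lact ?D a g"
   unfolding right_dual_simps by (rule restrict_ext) (use af in "simp add: val right.alg.r_distr")
 next
  fix b f g assume bf: "b \<in> carrier B" "f \<in> carrier ?D" "g \<in> carrier ?D"
  show "ract ?D (f \<oplus>\<^bsub>?D\<^esub> g) b = ract ?D f b \<oplus>\<^bsub>?D\<^esub> ract ?D g b"
   unfolding right_dual_simps by (rule restrict_ext) (use bf in "simp add: lact_closed")
 next
  fix b b' f assume bf: "b \<in> carrier B" "b' \<in> carrier B" "f \<in> carrier ?D"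
  show "ract ?D f (b \<oplus>\<^bsub>B\<^esub> b') = ract ?D f b \<oplus>\<^bsub>?D\<^esub> ract ?D f b'"
   unfolding right_dual_simps by (rule restrict_ext) (use bf in "simp add: lact_closed lact_add_left addv")
  show "ract ?D f (b \<otimes>\<^bsub>B\<^esub> b') = ract ?D (ract ?D f b) b'"
   unfolding right_dual_simps by (rule restrict_ext) (use bf in "simp add: lact_closed lact_mult")
 next
  fix f assume f: "f \<in> carrier ?D"
  show "lact ?D \<one>\<^bsub>A\<^esub> f = f"
   by (rule ext[OF exD[OF lact_in[OF right.alg.one_closed f]] exD[OF f]]) (use f in "simp add: right_dual_simps val")
  show "ract ?D f \<one>\<^bsub>B\<^esub> = f"
   by (rule ext[OF exD[OF ract_in[OF left.alg.one_closed f]] exD[OF f]]) (use f in "simp add: right_dual_simps lact_one")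
 next
  fix a b f assume ab: "a \<in> carrier A" "b \<in> carrier B" "f \<in> carrier ?D"
  show "ract ?D (lact ?D a f) b = lact ?D a (ract ?D f b)"
   unfolding right_dual_simps by (rule restrict_ext) (use ab in "simp add: lact_closed")
 next
  fix k a f assume ka: "k \<in> carrier K" "a \<in> carrier A" "f \<in> carrier ?D"
  show "lact ?D (k \<odot>\<^bsub>A\<^esub> a) f = k \<odot>\<^bsub>?D\<^esub> lact ?D a f"
   unfolding right_dual_simps by (rule restrict_ext) (use ka in "simp add: val right.smult_mult_left")
 next
  fix k b f assume kb: "k \<in> carrier K" "b \<in> carrier B" "f \<in> carrier ?D"
  show "ract ?D f (k \<odot>\<^bsub>B\<^esub> b) = k \<odot>\<^bsub>?D\<^esub> ract ?D f b"
   unfolding right_dual_simps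
   by (rule restrict_ext) (use kb in "simp add: lact_closed lact_smult right_dual_smult")
 qed
qed

end

lemma (in species) species_double: "species K (double_quiver Q) A (double_bimodule Q A M)"
proof (intro species.intro species_axioms.intro base.field_axioms)
 show "fin_digraph (double_quiver Q)"
  by unfold_locales (auto simp: double_quiver_def)
 show "assoc_algebra K (A i)" if "i \<in> verts (double_quiver Q)" for i
  using algebra_at that by (simp add: double_quiver_def)
 fix d assume b: "d \<in> arcs (double_quiver Q)"
 show "bimodule K (A (head (double_quiver Q) d)) (A (tail (double_quiver Q) d)) (double_bimodule Q A M d)"
 proof (cases d)
  case (Inl e)
  then have "e \<in> arcs Q" using b by (auto simp: double_quiver_def)
  from bimodule_transport[OF bimodule_at[OF this], of projl Inl] Inl show ?thesis
   by (simp add: double_quiver_def double_bimodule_def)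
 next
  case (Inr e)
  then have "e \<in> arcs Q" using b by (auto simp: double_quiver_def)
  from bimodule_transport[OF bimodule.bimodule_right_dual[OF bimodule_at[OF this]], of projr Inr] Inr show ?thesis
   by (simp add: double_quiver_def double_bimodule_def)
 qed
qed

section \<open>Presentations of tensor algebras and preprojective algebras\<close>

theorem proposition3:
  fixes K :: "'k ring"
    and Q :: "('v, 'e) pre_digraph"
    and A :: "'v \<Rightarrow> ('k, 'a) module"
    and M :: "'e \<Rightarrow> ('a, 'k, 'm) bimodule"
    and qt :: "'v \<Rightarrow> ('w, 'b) pre_digraph"
    and I :: "'v \<Rightarrow> (('w, 'b) qpath \<Rightarrow> 'k) set"
    and \<psi> :: "'v \<Rightarrow> (('w, 'b) qpath \<Rightarrow> 'k) set \<Rightarrow> 'a"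
  assumes "pro_species K Q A M"
    and "acyclic_quiver Q"
    and "\<And>i. i \<in> verts Q \<Longrightarrow> presents K (A i) (qt i) (I i) (\<psi> i)"
  shows
    "(\<forall>(C :: 'e \<Rightarrow> ('a, 'k, 'w, 'g, 'p, 'm) cover) l.
        (\<forall>\<alpha>\<in>arcs Q. decomposed_cover K Q A M qt I \<psi> \<alpha> (C \<alpha>)) \<and>
        kernel_lifts K Q A M qt I \<psi> C l \<longrightarrow>
        (let kQ = path_algebra K (assembled_quiver Q qt C);
             R = Idl\<^bsub>kQ\<^esub> (assembled_relations K Q M I C l)
         in alg_isomorphic K (tensor_algebra K Q A M) (quot kQ R) \<and>
            admissible K (assembled_quiver Q qt C) R)) \<and>
     (\<forall>\<phi> cas (C :: 'e + 'e \<Rightarrow> ('a, 'k, 'w, 'h, 'q, 'm + ('m \<Rightarrow> 'a)) cover) l c.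
        (let DQ = double_quiver Q; DM = double_bimodule Q A M;
             kQ = path_algebra K (assembled_quiver DQ qt C);
             R = Idl\<^bsub>kQ\<^esub> (assembled_relations K DQ DM I C l \<union> {c})
         in dualising_isos Q A M \<phi> \<and>
            (\<forall>\<beta>\<in>arcs DQ. cas \<beta> \<in> casimir_elements K Q A M \<phi> \<beta>) \<and>
            (\<forall>\<beta>\<in>arcs DQ. decomposed_cover K DQ A DM qt I \<psi> \<beta> (C \<beta>)) \<and>
            kernel_lifts K DQ A DM qt I \<psi> C l \<and>
            c \<in> carrier kQ \<and>
            canonical_map K DQ A DM qt I \<psi> C c = preprojective_relation K Q A M cas \<longrightarrow>
            alg_isomorphic K (preprojective_algebra K Q A M cas) (quot kQ R)))"
proof -
 interpret pro_species K Q A M by (rule assms(1))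
 interpret species K Q A M
  by (intro species.intro species_axioms.intro base.field_axioms fin_digraph_axioms algebras bimodules)
 show ?thesis
  unfolding Let_def
 proof (intro conjI allI impI)
  fix C :: "'e => ('a, 'k, 'w, 'g, 'p, 'm) cover" and l
  assume a: "(\<forall>e\<in>arcs Q. decomposed_cover K Q A M qt I \<psi> e (C e)) \<and> kernel_lifts K Q A M qt I \<psi> C l"
  interpret presented_species K Q A M qt I \<psi> C
   by (intro presented_species.intro presented_species_axioms.intro species_axioms assms(3)) (use a in auto)
  have l: "kernel_lifts K Q A M qt I \<psi> C l" using a by (rule conjunct2)
  show "alg_isomorphic K (tensor_algebra K Q A M)
    (quot (path_algebra K (assembled_quiver Q qt C)) (Idl\<^bsub>path_algebra K (assembled_quiver Q qt C)\<^esub> (assembled_relations K Q M I C l)))"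
   by (rule tensor_algebra_presentation[OF l])
  show "admissible K (assembled_quiver Q qt C) (Idl\<^bsub>path_algebra K (assembled_quiver Q qt C)\<^esub> (assembled_relations K Q M I C l))"
   by (rule assembled_relations_admissible[OF assms(2) l])
 next
  fix \<phi> cas and C :: "'e + 'e => ('a, 'k, 'w, 'h, 'q, 'm + ('m => 'a)) cover" and l c
  let ?DQ = "double_quiver Q" and ?DM = "double_bimodule Q A M"
  assume a: "dualising_isos Q A M \<phi> \<and>
      (\<forall>d\<in>arcs ?DQ. cas d \<in> casimir_elements K Q A M \<phi> d) \<and>
      (\<forall>d\<in>arcs ?DQ. decomposed_cover K ?DQ A ?DM qt I \<psi> d (C d)) \<and>
      kernel_lifts K ?DQ A ?DM qt I \<psi> C l \<and>
      c \<in> carrier (path_algebra K (assembled_quiver ?DQ qt C)) \<and>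
      canonical_map K ?DQ A ?DM qt I \<psi> C c = preprojective_relation K Q A M cas"
  have cov: "\<And>d. d \<in> arcs ?DQ ==> decomposed_cover K ?DQ A ?DM qt I \<psi> d (C d)"
   and l: "kernel_lifts K ?DQ A ?DM qt I \<psi> C l" and c: "c \<in> carrier (path_algebra K (assembled_quiver ?DQ qt C))"
   and rel: "canonical_map K ?DQ A ?DM qt I \<psi> C c = preprojective_relation K Q A M cas"
   using a by blast+
  have D: "presented_species K ?DQ A ?DM qt I \<psi> C"
  proof (intro presented_species.intro presented_species_axioms.intro species_double cov)
   show "presents K (A i) (qt i) (I i) (\<psi> i)" if "i \<in> verts ?DQ" for i
    using assms(3) that by (simp add: double_quiver_def)
  qed
  have "alg_isomorphic K (quot (tensor_algebra K ?DQ A ?DM) (Idl\<^bsub>tensor_algebra K ?DQ A ?DM\<^esub> {preprojective_relation K Q A M cas}))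
   (quot (path_algebra K (assembled_quiver ?DQ qt C))
    (Idl\<^bsub>path_algebra K (assembled_quiver ?DQ qt C)\<^esub> (assembled_relations K ?DQ ?DM I C l \<union> {c})))"
   unfolding rel[symmetric] by (rule presented_species.tensor_quotient_presentation[OF D l c])
  then show "alg_isomorphic K (preprojective_algebra K Q A M cas)
   (quot (path_algebra K (assembled_quiver ?DQ qt C))
    (Idl\<^bsub>path_algebra K (assembled_quiver ?DQ qt C)\<^esub> (assembled_relations K ?DQ ?DM I C l \<union> {c})))"
   unfolding preprojective_algebra_def double_tensor_algebra_def Let_def .
 qed
qed

end
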